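(* Let $B$ be a finite Blaschke product with $n$ zeros (not necessarily distinct), $B(z)=\prod_{j=1}^{n}\frac{z-\alpha_j}{1-\overline{\alpha_j}z}$, $\alpha_j\in\mathbb{D}$, $\alpha_1=0$. Let $M$ be a closed subspace of $H^p$, $0<p\leq\infty$, $p\neq2$, such that $M$ is invariant under the Banach algebra generated by $B$. Then there exist $B$-inner functions $J_1,\ldots,J_r$, $r\leq n$, such that $$M=J_1H^p(B)\oplus\cdots\oplus J_rH^p(B).$$ When $0<p<1$, the right-hand side is to be read as being dense in $M$, i.e. its closure in the $H^p$ metric is all of $M$.
   Context: $\mathbb{D}$ is the open unit disk, $\mathbb{T}$ the unit circle, $m$ normalized Lebesgue measure on $\mathbb{T}$. For $0<p<\infty$, $H^p$ is the closure of the analytic polynomials in $L^p(\mathbb{T},m)$, with the norm $\|f\|_p=(\int|f|^p\,dm)^{1/p}$ if $p\ge1$ and the metric $d(f,g)=\int|f-g|^p\,dm$ if $0<p<1$. $H^\infty$ is the Banach algebra of bounded analytic functions on $\mathbb{D}$, identified with their boundary functions, under the essential supremum norm. "Closed subspace of $H^p$" means closed in this norm or metric. The Banach algebra generated by $B$ is the closed subalgebra of $H^\infty$ generated by $B$. A closed subspace $M$ of $H^p$ is invariant under a subalgebra $\mathcal{A}$ of $H^\infty$ if $fg\in M$ for all $f\in\mathcal{A}$ and all $g\in M$. $H^p(B)=\{f\circ B: f\in H^p\}$; for $p=2$ this is the closed linear span of $\{B^m:m=0,1,2,\ldots\}$ in $H^2$. Let $B_0=1$, $B_j(z)=\prod_{i=1}^{j}\frac{z-\alpha_i}{1-\overline{\alpha_i}z}$,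 and $e_{j0}(z)=(1-|\alpha_{j+1}|^2)^{1/2}(1-\overline{\alpha_{j+1}}z)^{-1}B_j(z)$ for $0\le j\le n-1$. Every $\psi\in H^2$ can be written uniquely as $\psi=\sum_{j=0}^{n-1}e_{j0}\psi_j$ with $\psi_j\in H^2(B)$. A function $\psi\in H^\infty$ is called $B$-inner if $\sum_{j=0}^{n-1}|\psi_j|^2=1$ a.e. on $\mathbb{T}$. The symbol $\oplus$ denotes a direct sum of subspaces.
   Formalization: For p = ∞, "closed subspace" is taken to mean weak-star closed in H^∞ rather than closed in the essential supremum norm, since with norm-closedness the claim fails (B = z, M the disk algebra). *)

theory Defs
  imports "HOL-Probability.Probability" "HOL-Computational_Algebra.Polynomial"
begin

text \<open>
  Elements of the spaces below are representatives, i.e. Borel functions on \<^typ>\<open>complex\<close> of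
  which only the values on the unit circle matter, up to null sets of \<open>circle_measure\<close>. A subspace
  of \<open>hardy p\<close> that is closed in the sense of \<open>closed_in_hardy\<close> is automatically saturated under
  almost everywhere equality.
\<close>

definition circle_measure :: "complex measure" where
  "circle_measure = distr (uniform_measure lborel {0..2 * pi}) borel cis"


subsection \<open>Hardy spaces\<close>

definition Lp :: "ennreal \<Rightarrow> (complex \<Rightarrow> complex) set" where
  "Lp p = {f \<in> borel_measurable circle_measure.
     if p = \<infinity> then (\<exists>C. AE z in circle_measure. cmod (f z) \<le> C)
     else integrable circle_measure (\<lambda>z. cmod (f z) powr enn2real p)}"

text \<open>The essential supremum norm, the \<open>p\<close>-norm, or (for \<open>p < 1\<close>) the metric without the root.\<close>

definition lp_dist :: "ennreal \<Rightarrow> (complex \<Rightarrow> complex) \<Rightarrow> (complex \<Rightarrow> complex) \<Rightarrow> real" where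
  "lp_dist p f g =
    (if p = \<infinity> then real_of_ereal (esssup circle_measure (\<lambda>z. ereal (cmod (f z - g z))))
     else if 1 \<le> p then
       (LINT z|circle_measure. cmod (f z - g z) powr enn2real p) powr (1 / enn2real p)
     else (LINT z|circle_measure. cmod (f z - g z) powr enn2real p))"

definition lp_closure :: "ennreal \<Rightarrow> (complex \<Rightarrow> complex) set \<Rightarrow> (complex \<Rightarrow> complex) set" where
  "lp_closure p S = {f \<in> Lp p. \<forall>\<epsilon>>0. \<exists>g\<in>S. lp_dist p f g < \<epsilon>}"

text \<open>\<open>H\<^sup>\<infinity>\<close>: the (radial) boundary functions of bounded analytic functions on the disk.\<close>

definition Hinf :: "(complex \<Rightarrow> complex) set" where
  "Hinf = {f \<in> borel_measurable circle_measure.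
     \<exists>F. F holomorphic_on ball 0 1 \<and> bounded (F ` ball 0 1) \<and>
       (AE z in circle_measure. ((\<lambda>t. F (of_real t * z)) \<longlongrightarrow> f z) (at_left 1))}"

definition hardy :: "ennreal \<Rightarrow> (complex \<Rightarrow> complex) set" where
  "hardy p = (if p = \<infinity> then Hinf else lp_closure p (range poly))"

definition csubspace :: "(complex \<Rightarrow> complex) set \<Rightarrow> bool" where
  "csubspace M \<longleftrightarrow> (\<lambda>_. 0) \<in> M \<and> (\<forall>f\<in>M. \<forall>g\<in>M. (\<lambda>z. f z + g z) \<in> M) \<and>
     (\<forall>c. \<forall>f\<in>M. (\<lambda>z. c * f z) \<in> M)"

text \<open>Closure in the topology of \<open>L\<^sup>\<infinity>\<close> as the dual of \<open>L\<^sup>1\<close>.\<close>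

definition weak_star_closure :: "(complex \<Rightarrow> complex) set \<Rightarrow> (complex \<Rightarrow> complex) set" where
  "weak_star_closure S = {f \<in> Lp \<infinity>. \<forall>G \<epsilon>. finite G \<and> G \<subseteq> Lp 1 \<and> \<epsilon> > 0 \<longrightarrow>
     (\<exists>h\<in>S. \<forall>g\<in>G. cmod (LINT z|circle_measure. (f z - h z) * g z) < \<epsilon>)}"

text \<open>
  For \<open>p < \<infinity>\<close> closedness refers to the norm or metric. For \<open>p = \<infinity>\<close> it refers to the weak-star
  topology, as usual for invariant subspaces of \<open>H\<^sup>\<infinity>\<close>: for the norm topology the disk algebra is a
  closed subspace invariant under multiplication by \<open>z\<close> which is not of the form \<open>J H\<^sup>\<infinity>\<close>, so a
  Beurling-type description is false there.
\<close>

definition closed_in_hardy :: "ennreal \<Rightarrow> (complex \<Rightarrow> complex) set \<Rightarrow> bool" where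
  "closed_in_hardy p M \<longleftrightarrow>
     hardy p \<inter> (if p = \<infinity> then weak_star_closure M else lp_closure p M) \<subseteq> M"


subsection \<open>Banach algebras in \<open>H\<^sup>\<infinity>\<close>\<close>

text \<open>Here closedness is in the norm. Subalgebras need not contain the constants.\<close>

definition closed_subalgebra :: "(complex \<Rightarrow> complex) set \<Rightarrow> bool" where
  "closed_subalgebra A \<longleftrightarrow> A \<subseteq> Hinf \<and> csubspace A \<and>
     (\<forall>f\<in>A. \<forall>g\<in>A. (\<lambda>z. f z * g z) \<in> A) \<and> Hinf \<inter> lp_closure \<infinity> A \<subseteq> A"

definition banach_algebra_gen :: "(complex \<Rightarrow> complex) \<Rightarrow> (complex \<Rightarrow> complex) set" where
  "banach_algebra_gen b = closed_subalgebra hull {b}"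

definition invariant_under ::
    "(complex \<Rightarrow> complex) set \<Rightarrow> (complex \<Rightarrow> complex) set \<Rightarrow> bool" where
  "invariant_under A M \<longleftrightarrow> (\<forall>f\<in>A. \<forall>g\<in>M. (\<lambda>z. f z * g z) \<in> M)"


subsection \<open>Finite Blaschke products and \<open>B\<close>-inner functions\<close>

definition blaschke :: "(nat \<Rightarrow> complex) \<Rightarrow> nat \<Rightarrow> complex \<Rightarrow> complex" where
  "blaschke \<alpha> j z = (\<Prod>i=1..j. (z - \<alpha> i) / (1 - cnj (\<alpha> i) * z))"

definition e0 :: "(nat \<Rightarrow> complex) \<Rightarrow> nat \<Rightarrow> complex \<Rightarrow> complex" where
  "e0 \<alpha> j z = of_real ((1 - (cmod (\<alpha> (j + 1)))\<^sup>2) powr (1 / 2))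
     / (1 - cnj (\<alpha> (j + 1)) * z) * blaschke \<alpha> j z"

definition hardy_comp :: "ennreal \<Rightarrow> (complex \<Rightarrow> complex) \<Rightarrow> (complex \<Rightarrow> complex) set" where
  "hardy_comp p b = {f \<circ> b | f. f \<in> hardy p}"

text \<open>The coefficients \<open>c j\<close> are those of the (unique) expansion of \<open>\<psi>\<close> in \<open>H\<^sup>2\<close>.\<close>

definition B_inner :: "(nat \<Rightarrow> complex) \<Rightarrow> nat \<Rightarrow> (complex \<Rightarrow> complex) \<Rightarrow> bool" where
  "B_inner \<alpha> n \<psi> \<longleftrightarrow> \<psi> \<in> Hinf \<and>
     (\<exists>c. (\<forall>j<n. c j \<in> hardy_comp 2 (blaschke \<alpha> n)) \<and>
       (AE z in circle_measure. \<psi> z = (\<Sum>j<n. e0 \<alpha> j z * c j z)) \<and>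
       (AE z in circle_measure. (\<Sum>j<n. (cmod (c j z))\<^sup>2) = 1))"


subsection \<open>Direct sums of subspaces\<close>

definition mult_space ::
    "(complex \<Rightarrow> complex) \<Rightarrow> (complex \<Rightarrow> complex) set \<Rightarrow> (complex \<Rightarrow> complex) set" where
  "mult_space J S = {(\<lambda>z. J z * g z) | g. g \<in> S}"

definition sum_space :: "nat \<Rightarrow> (nat \<Rightarrow> (complex \<Rightarrow> complex) set) \<Rightarrow> (complex \<Rightarrow> complex) set" where
  "sum_space r S = {h \<in> borel_measurable circle_measure.
     \<exists>g. (\<forall>i\<in>{1..r}. g i \<in> S i) \<and> (AE z in circle_measure. h z = (\<Sum>i=1..r. g i z))}"

definition independent_spaces :: "nat \<Rightarrow> (nat \<Rightarrow> (complex \<Rightarrow> complex) set) \<Rightarrow> bool" where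
  "independent_spaces r S \<longleftrightarrow>
     (\<forall>g. (\<forall>i\<in>{1..r}. g i \<in> S i) \<and> (AE z in circle_measure. (\<Sum>i=1..r. g i z) = 0) \<longrightarrow>
       (\<forall>i\<in>{1..r}. AE z in circle_measure. g i z = 0))"

end

theory Submission
  imports Defs "HOL-Complex_Analysis.Complex_Analysis"
begin

text \<open>
  Write \<open>T c = (\<Sum>j<n. e0 \<alpha> j * c j \<circ> B)\<close>. Since \<open>B\<close> preserves the measure of the circle and the
  functions \<open>e0 \<alpha> j * B ^ k\<close> are orthonormal and complete, \<open>T\<close> is an isometry of the \<open>n\<close>-fold sum of
  \<open>L\<^sup>2\<close> onto \<open>L\<^sup>2\<close>, and it is compatible with weights of the form \<open>u \<circ> B\<close>. Let \<open>K\<close> be the set of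
  bounded elements of \<open>M\<close>, and \<open>M2\<close> its closure in \<open>L\<^sup>2\<close>. The wandering subspace of \<open>M2\<close> under
  multiplication by \<open>B\<close> has an orthonormal basis \<open>J\<close> whose coefficient vectors are orthonormal at almost
  every point of the circle; so there are at most \<open>n\<close> of them, they are bounded, \<open>B\<close>-inner and belong to
  \<open>K\<close>, and the coefficients of \<open>f \<in> K\<close> with respect to \<open>J\<close> are pointwise inner products of coefficient
  vectors.

  An element \<open>f\<close> of \<open>M\<close> is a limit of elements \<open>(\<Phi> \<circ> B) * f\<close> of \<open>K\<close>, with bounded analytic \<open>\<Phi>\<close> obtained
  from a weighted least squares problem as in Szego's theorem. For bounded \<open>T c\<close> the weighted isometry
  bounds the \<open>L\<^sup>q\<close> size of \<open>c\<close> by that of \<open>T c\<close> for every \<open>q > 0\<close>, so the representation on \<open>K\<close> passes to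
  the limit. Hence \<open>M\<close> equals the sum also for \<open>p < 1\<close>.
\<close>

subsection \<open>Functions with integrable powers\<close>

text \<open>Multiplication by functions of B is the only freedom inside M, so every truncation is
  carried out with multipliers \<open>\<Phi> (B z)\<close>. A majorant F is therefore expanded as
  \<open>T d\<close> first; since |T d|^2 is at most a constant times \<open>sq d (B z)\<close>, it
  is dominated by a function of B z, and the prediction problem is solved for the weight
  \<open>sq d\<close>. The multipliers turn L^q convergence, with a majorant along a subsequence,
  into bounded pointwise convergence, the one kind of limit that all topologies in question share;
  \<open>bounded_invariant\<close> records just this closure property and so covers p = \<infinity>
  too. For q < 1 Fourier coefficients are not continuous in L^q, so the analyticity of a bounded
  limit is obtained in this way as well. Bounded analytic functions are handled through vanishing
  Fourier coefficients, while \<open>Hinf\<close> asks for radial limits; the bridge is Fatou's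
  theorem, the main purpose of the Poisson kernel and the maximal inequality. Measure identities for
  B come from moments: a positive measure on the circle is determined by its integrals against
  z^k.\<close>

definition lq :: "real \<Rightarrow> 'a measure \<Rightarrow> ('a \<Rightarrow> complex) set" where
  "lq q M = {f \<in> borel_measurable M. integrable M (\<lambda>z. cmod (f z) powr q)}"

text \<open>No root is taken at any exponent, so that one function serves norms (q >= 1) and metrics
  (q < 1) alike; the price is the factor \<open>2 powr q\<close> in its triangle inequality.\<close>

definition lint :: "real \<Rightarrow> 'a measure \<Rightarrow> ('a \<Rightarrow> complex) \<Rightarrow> real" where
  "lint q M f = (LINT z|M. cmod (f z) powr q)"

lemma lqD [measurable_dest]: "f \<in> lq q M \<Longrightarrow> f \<in> borel_measurable M"
  by (simp add: lq_def)

lemma measurable_cnj [measurable]: "f \<in> borel_measurable M \<Longrightarrow> (\<lambda>z. cnj (f z)) \<in> borel_measurable M"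
  by (rule borel_measurable_continuous_on[OF continuous_on_cnj[OF continuous_on_id]])

lemma lq_integrable: "f \<in> lq q M \<Longrightarrow> integrable M (\<lambda>z. cmod (f z) powr q)"
  by (simp add: lq_def)

lemma lint_nonneg [simp]: "0 \<le> lint q M f"
  by (simp add: lint_def)

text \<open>A sum is at most twice its larger term. The bound is crude but uniform in q > 0, on both
  sides of q = 1.\<close>

lemma powr_add_le:
  fixes a b q :: real
  assumes "0 < q" "0 \<le> a" "0 \<le> b"
  shows "(a + b) powr q \<le> 2 powr q * (a powr q + b powr q)"
proof -
  have "(a + b) powr q \<le> (2 * max a b) powr q"
    using assms by (intro powr_mono2) auto
  also have "\<dots> = 2 powr q * max a b powr q"
    using assms by (simp add: powr_mult)
  also have "max a b powr q \<le> a powr q + b powr q"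
    using assms by (auto simp: max_def)
  finally show ?thesis by simp
qed

lemma lq_bound:
  assumes "f \<in> borel_measurable M" "integrable M G" "AE z in M. cmod (f z) powr q \<le> G z"
  shows "f \<in> lq q M"
proof -
  have "integrable M (\<lambda>z. cmod (f z) powr q)"
    by (rule Bochner_Integration.integrable_bound[OF assms(2)]) (use assms in auto)
  then show ?thesis using assms by (simp add: lq_def)
qed

lemma lq_add:
  assumes "0 < q" "f \<in> lq q M" "g \<in> lq q M"
  shows "(\<lambda>z. f z + g z) \<in> lq q M"
    and "lint q M (\<lambda>z. f z + g z) \<le> 2 powr q * (lint q M f + lint q M g)"
proof -
  have *: "cmod (f z + g z) powr q \<le> 2 powr q * (cmod (f z) powr q + cmod (g z) powr q)" for z
  proof -
    have "cmod (f z + g z) powr q \<le> (cmod (f z) + cmod (g z)) powr q"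
      using assms norm_triangle_ineq by (intro powr_mono2) auto
    also have "\<dots> \<le> 2 powr q * (cmod (f z) powr q + cmod (g z) powr q)"
      using assms by (intro powr_add_le) auto
    finally show ?thesis .
  qed
  have i: "integrable M (\<lambda>z. 2 powr q * (cmod (f z) powr q + cmod (g z) powr q))"
    using assms by (auto simp: lq_def)
  show 1: "(\<lambda>z. f z + g z) \<in> lq q M"
    using assms i * by (intro lq_bound[OF _ i]) (auto intro: borel_measurable_add dest: lqD)
  have "lint q M (\<lambda>z. f z + g z) \<le> (LINT z|M. 2 powr q * (cmod (f z) powr q + cmod (g z) powr q))"
    unfolding lint_def using 1 i * by (intro integral_mono) (auto dest: lq_integrable)
  also have "\<dots> = 2 powr q * (lint q M f + lint q M g)"
    using assms unfolding lint_def by (subst integral_mult_right_zero, subst Bochner_Integration.integral_add) (auto dest: lq_integrable)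
  finally show "lint q M (\<lambda>z. f z + g z) \<le> 2 powr q * (lint q M f + lint q M g)" .
qed

lemma lq_cmult:
  assumes "f \<in> lq q M"
  shows "(\<lambda>z. c * f z) \<in> lq q M" "lint q M (\<lambda>z. c * f z) = cmod c powr q * lint q M f"
  using assms by (auto simp: lq_def lint_def norm_mult powr_mult)

lemma lq_minus:
  assumes "f \<in> lq q M"
  shows "(\<lambda>z. - f z) \<in> lq q M" "lint q M (\<lambda>z. - f z) = lint q M f"
  using assms by (auto simp: lq_def lint_def)

lemma lq_cnj:
  assumes "f \<in> lq q M"
  shows "(\<lambda>z. cnj (f z)) \<in> lq q M" "lint q M (\<lambda>z. cnj (f z)) = lint q M f"
  using assms by (auto simp: lq_def lint_def)

lemma lq_diff:
  assumes "0 < q" "f \<in> lq q M" "g \<in> lq q M"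
  shows "(\<lambda>z. f z - g z) \<in> lq q M"
    and "lint q M (\<lambda>z. f z - g z) \<le> 2 powr q * (lint q M f + lint q M g)"
  using lq_add[OF assms(1,2) lq_minus(1)[OF assms(3)]] lq_minus[OF assms(3)] by auto

lemma lint_diff_triangle:
  assumes "0 < q" "f \<in> lq q M" "g \<in> lq q M" "h \<in> lq q M"
  shows "lint q M (\<lambda>z. f z - h z) \<le> 2 powr q * (lint q M (\<lambda>z. f z - g z) + lint q M (\<lambda>z. g z - h z))"
  using lq_add(2)[OF assms(1) lq_diff(1)[OF assms(1,2,3)] lq_diff(1)[OF assms(1,3,4)]] by simp

lemma lint_commute: "lint q M (\<lambda>z. f z - g z) = lint q M (\<lambda>z. g z - f z)"
  by (simp add: lint_def norm_minus_commute)

lemma lint_eq_0_iff: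
  assumes "f \<in> lq q M"
  shows "lint q M f = 0 \<longleftrightarrow> (AE z in M. f z = 0)"
  unfolding lint_def
  by (subst integral_nonneg_eq_0_iff_AE) (use assms in \<open>auto dest: lq_integrable\<close>)

lemma lq_sum:
  assumes "0 < q" "\<And>i. i \<in> I \<Longrightarrow> f i \<in> lq q M"
  shows "(\<lambda>z. \<Sum>i\<in>I. f i z) \<in> lq q M"
  using assms(2)
proof (induction I rule: infinite_finite_induct)
  case (insert i I)
  then show ?case by (auto intro!: lq_add[OF assms(1)])
qed (auto simp: lq_def)

lemma lq_mult_bounded:
  assumes "0 < q" "f \<in> lq q M" "g \<in> borel_measurable M" "AE z in M. cmod (g z) \<le> C"
  shows "(\<lambda>z. g z * f z) \<in> lq q M" "lint q M (\<lambda>z. g z * f z) \<le> \<bar>C\<bar> powr q * lint q M f"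
proof -
  have *: "AE z in M. cmod (g z * f z) powr q \<le> \<bar>C\<bar> powr q * cmod (f z) powr q"
    using assms(4)
  proof eventually_elim
    case (elim z)
    have "cmod (g z * f z) powr q = cmod (g z) powr q * cmod (f z) powr q"
      by (simp add: norm_mult powr_mult)
    also have "cmod (g z) powr q \<le> \<bar>C\<bar> powr q"
      using elim assms(1) by (intro powr_mono2) auto
    finally show ?case by (simp add: mult_right_mono)
  qed
  have i: "integrable M (\<lambda>z. \<bar>C\<bar> powr q * cmod (f z) powr q)"
    using assms by (auto simp: lq_def)
  have m: "(\<lambda>z. g z * f z) \<in> borel_measurable M"
    using assms by (auto dest: lqD)
  show 1: "(\<lambda>z. g z * f z) \<in> lq q M"
    by (rule lq_bound[OF m i *])
  have "lint q M (\<lambda>z. g z * f z) \<le> (LINT z|M. \<bar>C\<bar> powr q * cmod (f z) powr q)"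
    unfolding lint_def using 1 i * by (intro integral_mono_AE) (auto dest: lq_integrable)
  then show "lint q M (\<lambda>z. g z * f z) \<le> \<bar>C\<bar> powr q * lint q M f"
    by (simp add: lint_def)
qed

lemma lq_dominated_convergence:
  assumes q: "0 < q" and [measurable]: "f \<in> borel_measurable M" "\<And>k. s k \<in> borel_measurable M"
    and F: "integrable M (\<lambda>z. F z powr q)"
    and bd: "\<And>k. AE z in M. cmod (s k z) \<le> F z"
    and lim: "AE z in M. (\<lambda>k. s k z) \<longlonglongrightarrow> f z"
  shows "f \<in> lq q M" "\<And>k. s k \<in> lq q M" "(\<lambda>k. lint q M (\<lambda>z. s k z - f z)) \<longlonglongrightarrow> 0"
proof -
  have bd': "AE z in M. \<forall>k. cmod (s k z) \<le> F z" using bd by (simp add: AE_all_countable)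
  have fF: "AE z in M. cmod (f z) \<le> F z"
    using bd' lim 
  proof eventually_elim
    case (elim z)
    show ?case by (rule LIMSEQ_le_const2[OF tendsto_norm[OF elim(2)]]) (use elim(1) in auto)
  qed
  show "f \<in> lq q M"
    by (rule lq_bound[OF _ F]) (use fF q in \<open>auto intro!: powr_mono2\<close>)
  show "s k \<in> lq q M" for k
    by (rule lq_bound[OF _ F]) (use bd[of k] q in \<open>auto intro!: powr_mono2\<close>)
  have "(\<lambda>k. LINT z|M. cmod (s k z - f z) powr q) \<longlonglongrightarrow> (LINT z|M. 0)"
  proof (rule integral_dominated_convergence[where w = "\<lambda>z. 2 powr q * F z powr q"])
    show "integrable M (\<lambda>z. 2 powr q * F z powr q)" using F by simp
    show "AE z in M. (\<lambda>k. cmod (s k z - f z) powr q) \<longlonglongrightarrow> 0"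
      using lim
    proof eventually_elim
      case (elim z)
      have "(\<lambda>k. cmod (s k z - f z)) \<longlonglongrightarrow> 0"
        using elim by (simp add: LIM_zero_iff tendsto_norm_zero)
      then have "(\<lambda>k. cmod (s k z - f z) powr q) \<longlonglongrightarrow> 0 powr q"
        using q by (intro tendsto_powr') auto
      then show ?case by simp
    qed
    show "AE z in M. norm (cmod (s k z - f z) powr q) \<le> 2 powr q * F z powr q" for k
      using bd[of k] fF
    proof eventually_elim
      case (elim z)
      have "cmod (s k z - f z) \<le> 2 * F z" using norm_triangle_ineq4[of "s k z" "f z"] elim by linarith
      then have "cmod (s k z - f z) powr q \<le> (2 * F z) powr q" using q by (intro powr_mono2) auto
      also have "\<dots> = 2 powr q * F z powr q" by (simp add: powr_mult)
      finally show ?case by simp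
    qed
  qed auto
  then show "(\<lambda>k. lint q M (\<lambda>z. s k z - f z)) \<longlonglongrightarrow> 0" by (simp add: lint_def)
qed

text \<open>At the assumed rate the weighted increments \<open>g k\<close>, which carry the factor
  \<open>2 powr (real k * q)\<close>, have integrals at most 2^-k, so their sum G is integrable.
  Hence |s (Suc k) - s k| <= 2^-k G^(1/q) almost everywhere, a geometric bound that yields the
  pointwise limit and the majorant F together, for every q > 0.\<close>

lemma lint_fast_convergence:
  assumes q: "0 < q" and s: "\<And>k. s k \<in> lq q M"
    and fast: "\<And>k. lint q M (\<lambda>z. s (Suc k) z - s k z) \<le> (1 / 2) powr (real k * (q + 1))"
  obtains f F where "f \<in> lq q M" "F \<in> borel_measurable M" "integrable M (\<lambda>z. F z powr q)" "\<And>z. 0 \<le> F z"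
    "AE z in M. (\<lambda>k. s k z) \<longlonglongrightarrow> f z" "\<And>k. AE z in M. cmod (s k z) \<le> F z"
proof -
  have sm[measurable]: "s k \<in> borel_measurable M" for k using s by (auto dest: lqD)
  define d where "d k z = cmod (s (Suc k) z - s k z)" for k z
  have dm[measurable]: "d k \<in> borel_measurable M" for k unfolding d_def by measurable
  have d0: "0 \<le> d k z" for k z by (simp add: d_def)
  define g where "g k z = 2 powr (real k * q) * d k z powr q" for k z
  have gm[measurable]: "g k \<in> borel_measurable M" for k unfolding g_def by measurable
  have g0: "0 \<le> g k z" for k z by (simp add: g_def)
  have di: "integrable M (\<lambda>z. d k z powr q)" for k
    unfolding d_def by (intro lq_integrable lq_diff q s)
  have gi: "integrable M (g k)" for k
    unfolding g_def by (intro integrable_mult_right di)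
  have gle: "(LINT z|M. norm (g k z)) \<le> (1/2) ^ k" for k
  proof -
    have "(LINT z|M. norm (g k z)) = 2 powr (real k * q) * lint q M (\<lambda>z. s (Suc k) z - s k z)"
      by (simp add: g0 g_def lint_def d_def)
    also have "\<dots> \<le> 2 powr (real k * q) * (1 / 2) powr (real k * (q + 1))"
      by (intro mult_left_mono fast) auto
    also have "\<dots> = (1/2) powr real k"
      by (simp add: powr_divide powr_minus_divide[symmetric] powr_add[symmetric] algebra_simps divide_simps)
    finally show ?thesis by (simp add: powr_realpow)
  qed
  have sumint: "summable (\<lambda>k. LINT z|M. norm (g k z))"
    by (rule summable_comparison_test'[of "\<lambda>k. (1/2)^k" 0]) (use gle in auto)
  have "(\<integral>\<^sup>+z. (\<Sum>k. ennreal (g k z)) \<partial>M) = (\<Sum>k. \<integral>\<^sup>+z. ennreal (g k z) \<partial>M)"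
    by (rule nn_integral_suminf) auto
  also have "\<dots> = (\<Sum>k. ennreal (LINT z|M. norm (g k z)))"
    by (intro suminf_cong, subst nn_integral_eq_integral) (use gi g0 in auto)
  also have "\<dots> = ennreal (\<Sum>k. LINT z|M. norm (g k z))"
    by (rule suminf_ennreal2) (use sumint in auto)
  finally have "(\<integral>\<^sup>+z. (\<Sum>k. ennreal (g k z)) \<partial>M) \<noteq> \<infinity>" by simp
  then have "AE z in M. (\<Sum>k. ennreal (g k z)) \<noteq> \<infinity>"
    by (intro nn_integral_noteq_infinite) auto
  then have gs: "AE z in M. summable (\<lambda>k. g k z)"
    by eventually_elim (use g0 in \<open>auto intro: summable_suminf_not_top\<close>)
  define G where "G z = (\<Sum>k. g k z)" for z
  have [measurable]: "G \<in> borel_measurable M" unfolding G_def by measurable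
  have gs': "AE z in M. summable (\<lambda>k. norm (g k z))" using gs g0 by simp
  have Gi: "integrable M G" unfolding G_def
    by (rule integrable_suminf[OF gi gs' sumint])
  \<comment> \<open>The factor 2 is the sum of the geometric series that bounds the
    increments.\<close>
  define F where "F z = cmod (s 0 z) + 2 * \<bar>G z\<bar> powr (1/q)" for z
  have Fm: "F \<in> borel_measurable M" unfolding F_def by measurable
  have F0: "0 \<le> F z" for z by (simp add: F_def)
  have Fi: "integrable M (\<lambda>z. F z powr q)"
  proof (rule Bochner_Integration.integrable_bound)
    show "integrable M (\<lambda>z. 2 powr q * (cmod (s 0 z) powr q + 2 powr q * \<bar>G z\<bar>))"
      using Gi lq_integrable[OF s] by auto
    have "F z powr q \<le> 2 powr q * (cmod (s 0 z) powr q + 2 powr q * \<bar>G z\<bar>)" for z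
      using powr_add_le[OF q, of "cmod (s 0 z)" "2 * \<bar>G z\<bar> powr (1/q)"] q
      by (simp add: F_def powr_mult powr_powr)
    then show "AE z in M. norm (F z powr q) \<le> norm (2 powr q * (cmod (s 0 z) powr q + 2 powr q * \<bar>G z\<bar>))"
      by (auto intro!: AE_I2)
  qed (use Fm in auto)
  have ds: "AE z in M. \<forall>k. d k z \<le> (1/2)^k * \<bar>G z\<bar> powr (1/q)"
    using gs
  proof eventually_elim
    case (elim z)
    show ?case
    proof
      fix k
      have "g k z \<le> G z" unfolding G_def
        using sum_le_suminf[OF elim, of "{k}"] g0 by simp
      then have "(g k z) powr (1/q) \<le> \<bar>G z\<bar> powr (1/q)" using q g0 by (intro powr_mono2) auto
      moreover have "(g k z) powr (1/q) = 2 ^ k * d k z"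
        using q d0 unfolding g_def by (simp add: powr_mult powr_powr powr_realpow)
      ultimately show "d k z \<le> (1/2)^k * \<bar>G z\<bar> powr (1/q)"
        by (simp add: field_simps)
    qed
  qed
  have tele: "s k z = s 0 z + (\<Sum>i<k. s (Suc i) z - s i z)" for k z
    by (induction k) auto
  have le: "AE z in M. \<forall>k. cmod (s k z) \<le> F z"
    using ds
  proof eventually_elim
    case (elim z)
    show ?case
    proof
      fix k
      have "cmod (s k z) \<le> cmod (s 0 z) + cmod (\<Sum>i<k. s (Suc i) z - s i z)"
        using norm_triangle_ineq[of "s 0 z" "\<Sum>i<k. s (Suc i) z - s i z"] by (subst tele)
      also have "cmod (\<Sum>i<k. s (Suc i) z - s i z) \<le> (\<Sum>i<k. d i z)"
        unfolding d_def by (rule norm_sum)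
      also have "\<dots> \<le> (\<Sum>i<k. (1/2)^i * \<bar>G z\<bar> powr (1/q))"
        using elim by (intro sum_mono) auto
      also have "\<dots> = (\<Sum>i<k. (1/2::real)^i) * \<bar>G z\<bar> powr (1/q)" by (simp add: sum_distrib_right)
      also have "(\<Sum>i<k. (1/2::real)^i) \<le> 2" by (subst sum_gp_strict) (simp add: field_simps)
      finally show "cmod (s k z) \<le> F z" unfolding F_def by (simp add: mult_right_mono)
    qed
  qed
  have conv: "AE z in M. convergent (\<lambda>k. s k z)"
    using ds
  proof eventually_elim
    case (elim z)
    have "summable (\<lambda>k. (1/2)^k * \<bar>G z\<bar> powr (1/q))" by (intro summable_mult2 summable_geometric) auto
    then have "summable (\<lambda>k. s (Suc k) z - s k z)"
      by (rule summable_comparison_test'[where N = 0]) (use elim in \<open>auto simp: d_def\<close>)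
    then have "convergent (\<lambda>k. \<Sum>i<k. s (Suc i) z - s i z)" by (simp add: summable_iff_convergent)
    then have "convergent (\<lambda>k. s 0 z + (\<Sum>i<k. s (Suc i) z - s i z))"
      by (intro convergent_add convergent_const)
    then show ?case by (subst tele[abs_def])
  qed
  define f where "f z = lim (\<lambda>k. s k z)" for z
  have fm: "f \<in> borel_measurable M" unfolding f_def by measurable
  have lim: "AE z in M. (\<lambda>k. s k z) \<longlonglongrightarrow> f z"
    using conv by eventually_elim (simp add: f_def convergent_LIMSEQ_iff)
  have le': "AE z in M. cmod (s k z) \<le> F z" for k using le by (auto simp: AE_all_countable)
  show thesis
    by (rule that[OF _ Fm Fi F0 lim le']) (rule lq_dominated_convergence[OF q fm sm Fi le' lim])
qed

text \<open>Completeness of L^q. Besides the limit it delivers a majorant of a subsequence, because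
  such a majorant is the input of \<open>multipliers\<close>.\<close>

lemma lq_Cauchy_dominated_subseq:
  assumes q: "0 < q" and s: "\<And>k. s k \<in> lq q M"
    and C: "\<And>e. e > 0 \<Longrightarrow> \<exists>N. \<forall>k\<ge>N. \<forall>l\<ge>N. lint q M (\<lambda>z. s k z - s l z) < e"
  obtains f F r where "strict_mono (r :: nat \<Rightarrow> nat)" "f \<in> lq q M" "F \<in> borel_measurable M"
    "integrable M (\<lambda>z. F z powr q)" "\<And>z. 0 \<le> F z"
    "AE z in M. (\<lambda>k. s (r k) z) \<longlonglongrightarrow> f z" "\<And>k. AE z in M. cmod (s (r k) z) \<le> F z"
    "(\<lambda>k. lint q M (\<lambda>z. s k z - f z)) \<longlonglongrightarrow> 0"
proof -
  have "\<forall>j. \<exists>N. \<forall>k\<ge>N. \<forall>l\<ge>N. lint q M (\<lambda>z. s k z - s l z) < (1 / 2) powr (real j * (q + 1))"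
    by (intro allI C) auto
  then obtain N where N: "\<And>j k l. k \<ge> N j \<Longrightarrow> l \<ge> N j \<Longrightarrow> lint q M (\<lambda>z. s k z - s l z) < (1 / 2) powr (real j * (q + 1))"
    by metis
  define r where "r = rec_nat (N 0) (\<lambda>j m. max (Suc m) (N (Suc j)))"
  have rS: "r (Suc j) = max (Suc (r j)) (N (Suc j))" for j by (simp add: r_def)
  have rN: "r j \<ge> N j" for j by (cases j) (auto simp: r_def)
  have sr: "strict_mono r" by (rule strict_monoI_Suc) (simp add: rS)
  have fast: "lint q M (\<lambda>z. s (r (Suc k)) z - s (r k) z) \<le> (1 / 2) powr (real k * (q + 1))" for k
    
  proof -
    have "N k \<le> r (Suc k)" using rN[of k] unfolding rS by simp
    from N[OF this rN] show ?thesis by simp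
  qed
  obtain f F where fF: "f \<in> lq q M" "F \<in> borel_measurable M" "integrable M (\<lambda>z. F z powr q)" "\<And>z. 0 \<le> F z"
    "AE z in M. (\<lambda>k. s (r k) z) \<longlonglongrightarrow> f z" "\<And>k. AE z in M. cmod (s (r k) z) \<le> F z"
    by (rule lint_fast_convergence[of q "\<lambda>k. s (r k)", OF q s fast]) (rule that)
  have conv: "(\<lambda>k. lint q M (\<lambda>z. s (r k) z - f z)) \<longlonglongrightarrow> 0"
    by (rule lq_dominated_convergence(3)[OF q _ _ fF(3) fF(6) fF(5)]) (use fF s in \<open>auto dest: lqD\<close>)
  have "(\<lambda>k. lint q M (\<lambda>z. s k z - f z)) \<longlonglongrightarrow> 0"
  proof (rule LIMSEQ_I)
    fix e :: real assume e: "0 < e"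
    \<comment> \<open>Two errors \<open>e'\<close>, multiplied by the factor \<open>2 powr q\<close>
      of the triangle inequality, give e / 2, which is strictly below e.\<close>
    define e' where "e' = e / (4 * 2 powr q)"
    have e': "e' > 0" using e by (simp add: e'_def)
    from C[OF e'] obtain K where K: "\<And>k l. k \<ge> K \<Longrightarrow> l \<ge> K \<Longrightarrow> lint q M (\<lambda>z. s k z - s l z) < e'" by blast
    from LIMSEQ_D[OF conv e'] obtain L where L: "\<And>k. k \<ge> L \<Longrightarrow> lint q M (\<lambda>z. s (r k) z - f z) < e'" by auto
    define j where "j = max K L"
    have rj: "r j \<ge> K" using seq_suble[OF sr, of j] by (simp add: j_def)
    have "norm (lint q M (\<lambda>z. s k z - f z) - 0) < e" if k: "k \<ge> K" for k
    proof -
      have "lint q M (\<lambda>z. s k z - f z) \<le> 2 powr q * (lint q M (\<lambda>z. s k z - s (r j) z) + lint q M (\<lambda>z. s (r j) z - f z))"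
        by (rule lint_diff_triangle[OF q s s fF(1)])
      also have "\<dots> \<le> 2 powr q * (e' + e')"
        using K[OF k rj] L[of j] by (intro mult_left_mono add_mono) (auto simp: j_def)
      also have "\<dots> < e" using e by (simp add: e'_def field_simps)
      finally show ?thesis by simp
    qed
    then show "\<exists>no. \<forall>n\<ge>no. norm (lint q M (\<lambda>z. s n z - f z) - 0) < e" by blast
  qed
  then show thesis using that[OF sr fF] by blast
qed

lemma lq_convergent_Cauchy:
  assumes q: "0 < q" and s: "\<And>k. s k \<in> lq q M" and f: "f \<in> lq q M"
    and conv: "(\<lambda>k. lint q M (\<lambda>z. s k z - f z)) \<longlonglongrightarrow> 0" and e: "e > 0"
  shows "\<exists>N. \<forall>k\<ge>N. \<forall>l\<ge>N. lint q M (\<lambda>z. s k z - s l z) < e"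
proof -
  define e' where "e' = e / (4 * 2 powr q)"
  have e': "e' > 0" using e by (simp add: e'_def)
  from LIMSEQ_D[OF conv e'] obtain N where N: "\<And>k. k \<ge> N \<Longrightarrow> lint q M (\<lambda>z. s k z - f z) < e'" by auto
  have "lint q M (\<lambda>z. s k z - s l z) < e" if "k \<ge> N" "l \<ge> N" for k l
  proof -
    have "lint q M (\<lambda>z. s k z - s l z) \<le> 2 powr q * (lint q M (\<lambda>z. s k z - f z) + lint q M (\<lambda>z. f z - s l z))"
      by (rule lint_diff_triangle[OF q s f s])
    also have "\<dots> \<le> 2 powr q * (e' + e')"
      using N[OF that(1)] N[OF that(2)] lint_commute[of q M f "s l"] by (intro mult_left_mono add_mono) auto
    also have "\<dots> < e" using e by (simp add: e'_def field_simps)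
    finally show ?thesis .
  qed
  then show ?thesis by blast
qed

text \<open>Completeness supplies a pointwise limit along a subsequence; by uniqueness of limits in
  L^q it agrees with f almost everywhere, so the majorant found there serves for f.\<close>

lemma lq_convergent_dominated_subseq:
  assumes q: "0 < q" and s: "\<And>k. s k \<in> lq q M" and f: "f \<in> lq q M"
    and conv: "(\<lambda>k. lint q M (\<lambda>z. s k z - f z)) \<longlonglongrightarrow> 0"
  obtains F r where "strict_mono (r :: nat \<Rightarrow> nat)" "F \<in> borel_measurable M"
    "integrable M (\<lambda>z. F z powr q)" "\<And>z. 0 \<le> F z"
    "AE z in M. (\<lambda>k. s (r k) z) \<longlonglongrightarrow> f z" "\<And>k. AE z in M. cmod (s (r k) z) \<le> F z"
proof -
  obtain g F r where *: "strict_mono (r :: nat \<Rightarrow> nat)" "g \<in> lq q M" "F \<in> borel_measurable M"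
    "integrable M (\<lambda>z. F z powr q)" "\<And>z. 0 \<le> F z"
    "AE z in M. (\<lambda>k. s (r k) z) \<longlonglongrightarrow> g z" "\<And>k. AE z in M. cmod (s (r k) z) \<le> F z"
    "(\<lambda>k. lint q M (\<lambda>z. s k z - g z)) \<longlonglongrightarrow> 0"
    by (rule lq_Cauchy_dominated_subseq[OF q s lq_convergent_Cauchy[OF q s f conv]], assumption) (rule that)
  have "(\<lambda>k. 2 powr q * (lint q M (\<lambda>z. f z - s k z) + lint q M (\<lambda>z. s k z - g z))) \<longlonglongrightarrow> 2 powr q * (0 + 0)"
    using conv *(8) unfolding lint_commute[of q M f] by (intro tendsto_intros)
  then have "lint q M (\<lambda>z. f z - g z) \<le> 2 powr q * (0 + 0)"
    by (rule LIMSEQ_le_const) (use lint_diff_triangle[OF q f s *(2)] in blast)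
  then have "lint q M (\<lambda>z. f z - g z) = 0" using lint_nonneg[of q M "\<lambda>z. f z - g z"] by simp
  then have "AE z in M. f z - g z = 0" using lint_eq_0_iff[OF lq_diff(1)[OF q f *(2)]] by simp
  with *(6) have ae: "AE z in M. (\<lambda>k. s (r k) z) \<longlonglongrightarrow> f z" by eventually_elim simp
  show thesis by (rule that[OF *(1,3,4,5) ae *(7)])
qed

section \<open>The Hilbert space L^2: inner products and projections\<close>

lemma lq2_iff: "f \<in> lq 2 M \<longleftrightarrow> f \<in> borel_measurable M \<and> integrable M (\<lambda>z. (cmod (f z))\<^sup>2)"
  by (simp add: lq_def powr_numeral)

lemma lint2_eq: "lint 2 M f = (LINT z|M. (cmod (f z))\<^sup>2)"
  by (simp add: lint_def powr_numeral)

lemma lq2_mult_integrable: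
  assumes "f \<in> lq 2 M" "g \<in> lq 2 M"
  shows "integrable M (\<lambda>z. f z * g z)"
proof (rule Bochner_Integration.integrable_bound)
  show "integrable M (\<lambda>z. (cmod (f z))\<^sup>2 + (cmod (g z))\<^sup>2)"
    using assms by (auto simp: lq2_iff)
  show "(\<lambda>z. f z * g z) \<in> borel_measurable M" using assms by (auto simp: lq2_iff)
  have "norm (a * b) \<le> norm ((cmod a)\<^sup>2 + (cmod b)\<^sup>2)" for a b :: complex
  proof -
    have "2 * (cmod a * cmod b) \<le> (cmod a)\<^sup>2 + (cmod b)\<^sup>2"
      using sum_squares_bound[of "cmod a" "cmod b"] by (simp add: mult.assoc)
    moreover have "0 \<le> cmod a * cmod b" by simp
    ultimately have "cmod a * cmod b \<le> (cmod a)\<^sup>2 + (cmod b)\<^sup>2" by linarith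
    then show ?thesis by (simp add: norm_mult)
  qed
  then show "AE z in M. norm (f z * g z) \<le> norm ((cmod (f z))\<^sup>2 + (cmod (g z))\<^sup>2)" by simp
qed

lemma lq2_cnj_mult_integrable:
  assumes "f \<in> lq 2 M" "g \<in> lq 2 M"
  shows "integrable M (\<lambda>z. f z * cnj (g z))"
  using lq2_mult_integrable[OF assms(1) lq_cnj(1)[OF assms(2)]] .

lemma lq2_integral_mult_diff:
  assumes "f \<in> lq 2 M" "g \<in> lq 2 M" "h \<in> lq 2 M"
  shows "(LINT z|M. (f z - g z) * h z) = (LINT z|M. f z * h z) - (LINT z|M. g z * h z)"
  unfolding left_diff_distrib by (intro Bochner_Integration.integral_diff lq2_mult_integrable assms)

lemma lq2_tendsto_mult:
  assumes s: "\<And>k. s k \<in> lq 2 M" and f: "f \<in> lq 2 M" and g: "g \<in> lq 2 M"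
    and conv: "(\<lambda>k. lint 2 M (\<lambda>z. s k z - f z)) \<longlonglongrightarrow> 0"
  shows "(\<lambda>k. LINT z|M. s k z * g z) \<longlonglongrightarrow> (LINT z|M. f z * g z)"
proof -
  have d: "(\<lambda>z. s k z - f z) \<in> lq 2 M" for k by (intro lq_diff s f) simp
  have "\<exists>N. \<forall>k\<ge>N. cmod ((LINT z|M. s k z * g z) - (LINT z|M. f z * g z)) < e" if e: "e > 0" for e
  proof -
    define G where "G = lint 2 M g"
    have G0: "G \<ge> 0" by (simp add: G_def)
    \<comment> \<open>The weight in 2 a b <= a^2 / t + t b^2, chosen so that the contribution of g
      stays below e; 1 is added because G may be 0.\<close>
    define t where "t = e / (G + 1)"
    have t: "t > 0" using e G0 by (simp add: t_def)
    from LIMSEQ_D[OF conv, of "e * t"] e t obtain N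
      where N: "\<And>k. k \<ge> N \<Longrightarrow> lint 2 M (\<lambda>z. s k z - f z) < e * t" by auto
    have "cmod ((LINT z|M. s k z * g z) - (LINT z|M. f z * g z)) < e" if k: "k \<ge> N" for k
    proof -
      have "(LINT z|M. s k z * g z) - (LINT z|M. f z * g z) = (LINT z|M. (s k z - f z) * g z)"
        by (rule lq2_integral_mult_diff[OF s f g, symmetric])
      also have "cmod \<dots> \<le> (LINT z|M. cmod ((s k z - f z) * g z))" by simp
      also have "\<dots> \<le> (LINT z|M. ((cmod (s k z - f z))\<^sup>2 / t + t * (cmod (g z))\<^sup>2) / 2)"
      proof (rule integral_mono)
        show "integrable M (\<lambda>z. cmod ((s k z - f z) * g z))"
          by (intro integrable_norm lq2_mult_integrable d g)
        show "integrable M (\<lambda>z. ((cmod (s k z - f z))\<^sup>2 / t + t * (cmod (g z))\<^sup>2) / 2)"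
          using d[of k] g by (auto simp: lq2_iff)
        fix z
        define a b where "a = cmod (s k z - f z)" and "b = cmod (g z)"
        have "0 \<le> (a - t * b)\<^sup>2" by simp
        then have "2 * a * b * t \<le> a\<^sup>2 + t * b\<^sup>2 * t" by (simp add: power2_eq_square algebra_simps)
        then have "a * b \<le> (a\<^sup>2 / t + t * b\<^sup>2) / 2" using t by (simp add: field_simps)
        then show "cmod ((s k z - f z) * g z) \<le> ((cmod (s k z - f z))\<^sup>2 / t + t * (cmod (g z))\<^sup>2) / 2"
          by (simp add: norm_mult a_def b_def)
      qed
      also have "\<dots> = (lint 2 M (\<lambda>z. s k z - f z) / t + t * G) / 2"
        unfolding G_def lint2_eq using d[of k] g
        by (subst integral_divide_zero, subst Bochner_Integration.integral_add) (auto simp: lq2_iff)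
      also have "\<dots> < e"
      proof -
        have "lint 2 M (\<lambda>z. s k z - f z) / t < e" using N[OF k] t by (simp add: field_simps)
        moreover have "t * G \<le> e" using e G0 by (simp add: t_def field_simps)
        ultimately show ?thesis by simp
      qed
      finally show ?thesis .
    qed
    then show ?thesis by blast
  qed
  then show ?thesis by (intro LIMSEQ_I) auto
qed

text \<open>S need not be closed, so the nearest point g is only a limit of elements of S, and the
  approximating sequence is returned with it. A minimizing sequence is Cauchy by the parallelogram
  law; g gives orthogonality because no step along h can bring the distance below its
  infimum.\<close>

lemma lq2_projection:
  assumes SL: "S \<subseteq> lq 2 M" and S: "csubspace S" and f: "f \<in> lq 2 M"
  obtains s g where "\<And>k. s k \<in> S" "g \<in> lq 2 M" "(\<lambda>k. lint 2 M (\<lambda>z. s k z - g z)) \<longlonglongrightarrow> 0"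
    "\<And>h. h \<in> S \<Longrightarrow> (LINT z|M. (f z - g z) * cnj (h z)) = 0"
proof -
  define A where "A = (\<lambda>h. lint 2 M (\<lambda>z. f z - h z)) ` S"
  define d where "d = Inf A"
  have Sadd: "(\<lambda>z. u z + v z) \<in> S" if "u \<in> S" "v \<in> S" for u v
    using S that by (auto simp: csubspace_def)
  have Scm: "(\<lambda>z. c * u z) \<in> S" if "u \<in> S" for u c
    using S that by (auto simp: csubspace_def)
  have "A \<noteq> {}" using S by (auto simp: A_def csubspace_def)
  have bb: "bdd_below A" by (auto simp: A_def intro!: bdd_belowI[of _ 0])
  have dle: "d \<le> lint 2 M (\<lambda>z. f z - h z)" if "h \<in> S" for h
    unfolding d_def A_def by (rule cInf_lower) (use that bb in \<open>auto simp: A_def\<close>)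
  have "\<exists>h\<in>S. lint 2 M (\<lambda>z. f z - h z) < d + 1 / real (Suc k)" for k
    using cInf_lessD[OF \<open>A \<noteq> {}\<close>, of "d + 1 / real (Suc k)"] unfolding d_def[symmetric] by (auto simp: A_def)
  then obtain s where sS: "\<And>k. s k \<in> S" and sd: "\<And>k. lint 2 M (\<lambda>z. f z - s k z) < d + 1 / real (Suc k)"
    by metis
  have sL: "s k \<in> lq 2 M" for k using sS SL by auto
  have Fs: "(\<lambda>z. f z - s k z) \<in> lq 2 M" for k by (intro lq_diff f sL) simp
  have par: "lint 2 M (\<lambda>z. s k z - s l z) \<le> 2 * (1 / real (Suc k)) + 2 * (1 / real (Suc l))" for k l
  proof -
    define m where "m z = (1/2) * s k z + (1/2) * s l z" for z
    have mS: "m \<in> S" unfolding m_def by (intro Sadd Scm sS)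
    have mL: "(\<lambda>z. f z - m z) \<in> lq 2 M" by (intro lq_diff f) (use mS SL in auto)
    have pl: "(cmod (b - c))\<^sup>2 + 4 * (cmod (a - ((1/2) * b + (1/2) * c)))\<^sup>2 = 2 * (cmod (a - b))\<^sup>2 + 2 * (cmod (a - c))\<^sup>2" for a b c
      by (simp only: cmod_power2) (simp add: power2_eq_square algebra_simps)
    have "lint 2 M (\<lambda>z. s k z - s l z) + 4 * lint 2 M (\<lambda>z. f z - m z)
        = (LINT z|M. (cmod (s k z - s l z))\<^sup>2 + 4 * (cmod (f z - m z))\<^sup>2)"
      unfolding lint2_eq using mL lq_diff(1)[OF _ sL[of k] sL[of l]]
      by (subst Bochner_Integration.integral_add) (auto simp: lq2_iff)
    also have "\<dots> = 2 * lint 2 M (\<lambda>z. f z - s k z) + 2 * lint 2 M (\<lambda>z. f z - s l z)"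
      unfolding lint2_eq m_def pl using Fs[of k] Fs[of l]
      by (subst Bochner_Integration.integral_add) (auto simp: lq2_iff)
    finally show ?thesis using dle[OF mS] sd[of k] sd[of l] by linarith
  qed
  have C: "\<exists>N. \<forall>k\<ge>N. \<forall>l\<ge>N. lint 2 M (\<lambda>z. s k z - s l z) < e" if e: "e > 0" for e
  proof -
    obtain N where N: "1 / real (Suc N) < e / 4"
      using reals_Archimedean[of "e/4"] e unfolding inverse_eq_divide by auto
    have "lint 2 M (\<lambda>z. s k z - s l z) < e" if "k \<ge> N" "l \<ge> N" for k l
    proof -
      have "1 / real (Suc k) \<le> 1 / real (Suc N)" "1 / real (Suc l) \<le> 1 / real (Suc N)"
        using that by (intro frac_le; simp)+
      then show ?thesis using par[of k l] N by linarith
    qed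
    then show ?thesis by blast
  qed
  obtain g where gL: "g \<in> lq 2 M" and conv: "(\<lambda>k. lint 2 M (\<lambda>z. s k z - g z)) \<longlonglongrightarrow> 0"
    by (rule lq_Cauchy_dominated_subseq[of 2 s M, OF _ sL C]) auto
  have orth: "(LINT z|M. (f z - g z) * cnj (h z)) = 0" if h: "h \<in> S" for h
  proof -
    have hL: "h \<in> lq 2 M" using h SL by auto
    define N where "N = lint 2 M h"
    have N0: "N \<ge> 0" by (simp add: N_def)
    define I where "I k = (LINT z|M. (f z - s k z) * cnj (h z))" for k
    have Ile: "(cmod (I k))\<^sup>2 \<le> (N + 1) * (1 / real (Suc k))" for k
    proof -
      have Hi: "integrable M (\<lambda>z. (f z - s k z) * cnj (h z))" by (rule lq2_cnj_mult_integrable[OF Fs hL])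
      define t where "t = 1 / (N + 1)"
      have t: "t > 0" "t * N \<le> 1" using N0 by (auto simp: t_def field_simps)
      define c where "c = of_real t * I k"
      define u where "u z = Re (cnj c * ((f z - s k z) * cnj (h z)))" for z
      have u: "integrable M u" "integral\<^sup>L M u = Re (cnj c * I k)"
        unfolding u_def I_def using integrable_Re[OF integrable_mult_right[OF Hi, of "cnj c"]]
          integral_Re[OF integrable_mult_right[OF Hi, of "cnj c"]] by (simp_all del: times_complex.sel)
      have "d \<le> lint 2 M (\<lambda>z. f z - (s k z + c * h z))" by (intro dle Sadd Scm sS h)
      also have "\<dots> = (LINT z|M. (cmod (f z - s k z))\<^sup>2 - 2 * u z + (cmod c)\<^sup>2 * (cmod (h z))\<^sup>2)"
      proof -
        have "(cmod (a - (b + c * u)))\<^sup>2 = (cmod (a - b))\<^sup>2 - 2 * Re (cnj c * ((a - b) * cnj u)) + (cmod c)\<^sup>2 * (cmod u)\<^sup>2" for a b u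
          by (simp only: cmod_power2) (simp add: power2_eq_square algebra_simps)
        then show ?thesis unfolding lint2_eq u_def by presburger
      qed
      also have "\<dots> = lint 2 M (\<lambda>z. f z - s k z) - 2 * integral\<^sup>L M u + (cmod c)\<^sup>2 * N"
        unfolding lint2_eq N_def using Fs[of k] hL u(1) by (simp add: lq2_iff)
      also note u(2)
      also have "Re (cnj c * I k) = t * (cmod (I k))\<^sup>2"
        by (simp add: c_def cmod_power2) (simp add: power2_eq_square algebra_simps)
      also have "(cmod c)\<^sup>2 = t\<^sup>2 * (cmod (I k))\<^sup>2" by (simp add: c_def norm_mult power_mult_distrib)
      finally have "d \<le> lint 2 M (\<lambda>z. f z - s k z) - 2 * (t * (cmod (I k))\<^sup>2) + t\<^sup>2 * (cmod (I k))\<^sup>2 * N" .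
      moreover have "t\<^sup>2 * (cmod (I k))\<^sup>2 * N \<le> t * (cmod (I k))\<^sup>2"
        using mult_right_mono[OF t(2), of "t * (cmod (I k))\<^sup>2"] t(1) by (simp add: power2_eq_square algebra_simps)
      ultimately have "t * (cmod (I k))\<^sup>2 \<le> 1 / real (Suc k)" using sd[of k] by linarith
      then show ?thesis using N0 by (simp add: t_def field_simps)
    qed
    have "(\<lambda>k. (N + 1) * (1 / real (Suc k))) \<longlonglongrightarrow> (N + 1) * 0"
      by (intro tendsto_mult tendsto_const LIMSEQ_inverse_real_of_nat[unfolded inverse_eq_divide])
    then have "(\<lambda>k. (N + 1) * (1 / real (Suc k))) \<longlonglongrightarrow> 0" by (simp only: mult_zero_right)
    then have "(\<lambda>k. (cmod (I k))\<^sup>2) \<longlonglongrightarrow> 0"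
      by (rule tendsto_sandwich[OF _ _ tendsto_const, rotated 2]) (use Ile in auto)
    then have "(\<lambda>k. sqrt ((cmod (I k))\<^sup>2)) \<longlonglongrightarrow> sqrt 0" by (rule tendsto_real_sqrt)
    then have I0: "I \<longlonglongrightarrow> 0" by (simp add: tendsto_norm_zero_iff)
    have Ieq: "I k = (LINT z|M. f z * cnj (h z)) - (LINT z|M. s k z * cnj (h z))" for k
      unfolding I_def by (rule lq2_integral_mult_diff[OF f sL lq_cnj(1)[OF hL]])
    have "I \<longlonglongrightarrow> (LINT z|M. f z * cnj (h z)) - (LINT z|M. g z * cnj (h z))"
      unfolding Ieq[abs_def] by (intro tendsto_intros lq2_tendsto_mult sL gL lq_cnj hL conv)
    then have "(LINT z|M. f z * cnj (h z)) - (LINT z|M. g z * cnj (h z)) = 0"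
      using I0 LIMSEQ_unique by blast
    then show ?thesis
      using lq2_integral_mult_diff[OF f gL lq_cnj(1)[OF hL]] by simp
  qed
  show thesis by (rule that[OF sS gL conv orth])
qed

subsection \<open>The circle\<close>

abbreviation "cm \<equiv> circle_measure"

lemma sets_cm [simp, measurable_cong]: "sets cm = sets borel"
  by (simp add: circle_measure_def)

lemma space_cm [simp]: "space cm = UNIV"
  by (simp add: circle_measure_def)

lemma measurable_cis [measurable]: "cis \<in> borel_measurable borel"
  by (intro borel_measurable_continuous_onI continuous_on_cis continuous_on_id)

lemma prob_space_cm: "prob_space cm"
proof -
  have "prob_space (uniform_measure lborel {0..2 * pi})"
    by (rule prob_space_uniform_measure) auto
  then show ?thesis
    unfolding circle_measure_def by (rule prob_space.prob_space_distr) simp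
qed

interpretation cm: prob_space cm by (rule prob_space_cm)

lemma AE_cm_circle: "AE z in cm. cmod z = 1"
  unfolding circle_measure_def by (subst AE_distr_iff) auto

lemma integral_cm_power: "(LINT z|cm. z ^ k) = (if k = 0 then 1 else 0)"
proof (cases "k = 0")
  case True
  then show ?thesis by (simp add: cm.prob_space[simplified])
next
  case False
  define F where "F t = cis (real k * t) / (\<i> * of_nat k)" for t
  have "(LINT z|cm. z ^ k) = (LINT t|uniform_measure lborel {0..2*pi}. cis (real k * t))"
    unfolding circle_measure_def by (subst integral_distr) (auto simp: Complex.DeMoivre)
  also have "\<dots> = (LINT t|lborel. (indicator {0..2*pi} t / (2 * pi)) *\<^sub>R cis (real k * t))"
  proof -
    have "uniform_measure lborel {0..2*pi} = density lborel (\<lambda>t. ennreal (indicator {0..2*pi} t / (2 * pi)))"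
      unfolding uniform_measure_def
      by (intro density_cong) (auto simp: divide_ennreal[symmetric] ennreal_indicator)
    then show ?thesis by (simp only:) (subst integral_density, auto)
  qed
  also have "\<dots> = (1 / (2 * pi)) *\<^sub>R (LINT t|lborel. indicator {0..2*pi} t *\<^sub>R cis (real k * t))"
    by (simp flip: integral_scaleR_right)
  also have "(LINT t|lborel. indicator {0..2*pi} t *\<^sub>R cis (real k * t)) = F (2*pi) - F 0"
  proof (rule integral_FTC_Icc)
    fix t
    have "((\<lambda>t. cis (real k * t)) has_vector_derivative \<i> * of_nat k * cis (real k * t)) (at t)"
      unfolding cis_conv_exp
      by (rule has_vector_derivative_real_field derivative_eq_intros refl | simp)+
    then have "(F has_vector_derivative \<i> * of_nat k * cis (real k * t) / (\<i> * of_nat k)) (at t)"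
      unfolding F_def by (rule has_vector_derivative_divide)
    then show "(F has_vector_derivative cis (real k * t)) (at t within {0..2*pi})"
      using False by (simp add: has_vector_derivative_at_within)
  qed (auto intro!: continuous_intros)
  also have "F (2*pi) = F 0"
    using cis_multiple_2pi[of "real k"] by (simp add: F_def mult.commute mult.left_commute Ints_of_nat)
  finally show ?thesis using False by simp
qed

lemma cm_integrable_bounded:
  assumes "f \<in> borel_measurable cm" "AE z in cm. cmod (f z) \<le> C"
  shows "integrable cm f"
  using cm.integrable_const_bound[of f C] assms by auto

subsection \<open>Determination by moments\<close>

lemma cnj_mult_circle: "cmod z = 1 \<Longrightarrow> z * cnj z = 1" "cmod z = 1 \<Longrightarrow> cnj z * z = 1"
  by (simp_all add: complex_norm_square[symmetric] mult.commute)

text \<open>On the circle Re z = (1 + z^2) / 2 * cnj z and Im z = (z^2 - 1) / (2 i) * cnj z, so real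
  polynomials in the coordinates become trigonometric polynomials, with all negative powers
  collected in one factor \<open>cnj z ^ N\<close>. Stone-Weierstrass speaks about the former,
  moments about the latter.\<close>

lemma circle_trig_poly:
  assumes "real_polynomial_function g"
  shows "\<exists>N q. \<forall>z. cmod z = 1 \<longrightarrow> complex_of_real (g z) = poly q z * cnj z ^ N"
  using assms
proof induction
  case (linear f)
  then interpret bounded_linear f .
  define q where "q = smult (of_real (f 1) / 2) [:1, 0, 1:] + smult (of_real (f \<i>) / (2 * \<i>)) [:-1, 0, 1:]"
  have "complex_of_real (f z) = poly q z * cnj z ^ 1" if "cmod z = 1" for z
  proof -
    have "f z = f (Re z *\<^sub>R 1 + Im z *\<^sub>R \<i>)"
      by (rule arg_cong[where f = f]) (simp add: complex_eq_iff)
    also have "\<dots> = Re z * f 1 + Im z * f \<i>" by (simp only: add scaleR real_scaleR_def)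
    finally have e: "complex_of_real (f z) = of_real (Re z) * of_real (f 1) + of_real (Im z) * of_real (f \<i>)" by simp
    have 1: "complex_of_real (Re z) = (1 + z * z) / 2 * cnj z"
      using cnj_mult_circle[OF that] complex_add_cnj[of z] by (simp add: field_simps)
    have 2: "complex_of_real (Im z) = (z * z - 1) / (2 * \<i>) * cnj z"
      using cnj_mult_circle[OF that] complex_diff_cnj[of z] by (simp add: field_simps)
    show ?thesis unfolding e 1 2 by (simp add: q_def algebra_simps add_divide_distrib diff_divide_distrib)
  qed
  then show ?case by blast
next
  case (const c)
  have "complex_of_real c = poly [:of_real c:] z * cnj z ^ 0" for z by simp
  then show ?case by blast
next
  case (add f g)
  then obtain N q N' q' where *: "\<And>z. cmod z = 1 \<Longrightarrow> complex_of_real (f z) = poly q z * cnj z ^ N"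
     "\<And>z. cmod z = 1 \<Longrightarrow> complex_of_real (g z) = poly q' z * cnj z ^ N'" by metis
  have "complex_of_real (f z + g z) = poly (q * monom 1 N' + q' * monom 1 N) z * cnj z ^ (N + N')" if "cmod z = 1" for z
  proof -
    have "z ^ N' * cnj z ^ N' = 1" "z ^ N * cnj z ^ N = 1"
      using cnj_mult_circle[OF that] by (simp_all flip: power_mult_distrib)
    then have "poly q z * cnj z ^ N * (z ^ N' * cnj z ^ N') + poly q' z * cnj z ^ N' * (z ^ N * cnj z ^ N)
       = poly q z * cnj z ^ N + poly q' z * cnj z ^ N'" by simp
    then show ?thesis using *[OF that] by (simp add: poly_monom power_add algebra_simps)
  qed
  then show ?case by blast
next
  case (mult f g)
  then obtain N q N' q' where *: "\<And>z. cmod z = 1 \<Longrightarrow> complex_of_real (f z) = poly q z * cnj z ^ N"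
     "\<And>z. cmod z = 1 \<Longrightarrow> complex_of_real (g z) = poly q' z * cnj z ^ N'" by metis
  have "complex_of_real (f z * g z) = poly (q * q') z * cnj z ^ (N + N')" if "cmod z = 1" for z
    using *[OF that] by (simp add: power_add algebra_simps)
  then show ?case by blast
qed

text \<open>Moments of negative index are conjugates of those of positive index since the measures
  are positive. So M and N agree on trigonometric polynomials, by Stone-Weierstrass on continuous
  functions, and in the limit on closed sets, which form an intersection-stable generator.\<close>

lemma circle_measure_eqI_moments:
  fixes M N :: "complex measure"
  assumes "finite_measure M" "finite_measure N" and sets[simp, measurable_cong]: "sets M = sets borel" "sets N = sets borel"
    and circle: "AE z in M. cmod z = 1" "AE z in N. cmod z = 1"
    and mom: "\<And>k. (LINT z|M. z ^ k) = (LINT z|N. z ^ k)"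
  shows "M = N"
proof -
  interpret M: finite_measure M by fact
  interpret N: finite_measure N by fact
  have sp: "space M = UNIV" "space N = UNIV"
    using sets_eq_imp_space_eq[OF sets(1)] sets_eq_imp_space_eq[OF sets(2)] by auto
  have gen: "integrable K (\<lambda>z. z ^ i * cnj z ^ j) \<and>
     (LINT z|K. z ^ i * cnj z ^ j) = (if j \<le> i then LINT z|K. z ^ (i - j) else cnj (LINT z|K. z ^ (j - i)))"
    if K: "finite_measure K" "sets K = sets borel" "AE z in K. cmod z = 1" for K i j
  proof
    note [measurable_cong] = K(2)
    have "AE z in K. norm (z ^ i * cnj z ^ j) \<le> 1"
      using K(3) by eventually_elim (simp add: norm_mult norm_power)
    then show "integrable K (\<lambda>z. z ^ i * cnj z ^ j)"
      by (intro finite_measure.integrable_const_bound[OF K(1)]) (auto simp: measurable_completion)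
    show "(LINT z|K. z ^ i * cnj z ^ j) = (if j \<le> i then LINT z|K. z ^ (i - j) else cnj (LINT z|K. z ^ (j - i)))"
    proof (cases "j \<le> i")
      case True
      have "AE z in K. z ^ i * cnj z ^ j = z ^ (i - j)"
        using K(3)
      proof eventually_elim
        case (elim z)
        have "z ^ j * cnj z ^ j = 1" using cnj_mult_circle[OF elim] by (simp flip: power_mult_distrib)
        then show ?case using True power_add[of z "i - j" j] by (simp add: mult.assoc)
      qed
      then have "(LINT z|K. z ^ i * cnj z ^ j) = (LINT z|K. z ^ (i - j))"
        by (intro integral_cong_AE) auto
      then show ?thesis using True by simp
    next
      case False
      have "AE z in K. z ^ i * cnj z ^ j = cnj (z ^ (j - i))"
        using K(3)
      proof eventually_elim
        case (elim z)
        have "z ^ i * cnj z ^ i = 1" using cnj_mult_circle[OF elim] by (simp flip: power_mult_distrib)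
        then show ?case using False power_add[of "cnj z" i "j - i"] by (simp add: mult.assoc[symmetric])
      qed
      then have "(LINT z|K. z ^ i * cnj z ^ j) = (LINT z|K. cnj (z ^ (j - i)))"
        by (intro integral_cong_AE) auto
      also have "\<dots> = cnj (LINT z|K. z ^ (j - i))" by (rule Bochner_Integration.integral_cnj)
      finally show ?thesis using False by simp
    qed
  qed
  have pm: "(LINT z|M. z ^ i * cnj z ^ j) = (LINT z|N. z ^ i * cnj z ^ j)" for i j
    using gen[OF assms(1) sets(1) circle(1), of i j] gen[OF assms(2) sets(2) circle(2), of i j] mom by simp
  have poly: "(LINT z|M. poly q z * cnj z ^ j) = (LINT z|N. poly q z * cnj z ^ j)" for q j
  proof -
    have "(LINT z|K. poly q z * cnj z ^ j) = (\<Sum>i\<le>degree q. coeff q i * (LINT z|K. z ^ i * cnj z ^ j))"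
      if K: "finite_measure K" "sets K = sets borel" "AE z in K. cmod z = 1" for K
    proof -
      have "(LINT z|K. poly q z * cnj z ^ j) = (LINT z|K. (\<Sum>i\<le>degree q. coeff q i * (z ^ i * cnj z ^ j)))"
        by (simp add: poly_altdef sum_distrib_right mult.assoc)
      also have "\<dots> = (\<Sum>i\<le>degree q. coeff q i * (LINT z|K. z ^ i * cnj z ^ j))"
        using gen[OF K] by (subst Bochner_Integration.integral_sum) auto
      finally show ?thesis .
    qed
    from this[OF assms(1) sets(1) circle(1)] this[OF assms(2) sets(2) circle(2)] show ?thesis
      by (simp add: pm)
  qed
  have rpf: "(LINT z|M. g z) = (LINT z|N. g z)" if g: "real_polynomial_function g" for g
  proof -
    obtain n q where q: "\<And>z. cmod z = 1 \<Longrightarrow> complex_of_real (g z) = poly q z * cnj z ^ n"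
      using circle_trig_poly[OF g] by blast
    have gm: "g \<in> borel_measurable borel"
      by (intro borel_measurable_continuous_onI) (use g in \<open>simp add: continuous_on_polymonial_function real_polynomial_function_eq\<close>)
    have "of_real (LINT z|K. g z) = (LINT z|K. poly q z * cnj z ^ n)"
      if K: "sets K = sets borel" "AE z in K. cmod z = 1" for K
    proof -
      note [measurable_cong] = K(1)
      have [measurable]: "g \<in> borel_measurable K" using gm by simp
      have [measurable]: "(\<lambda>z. poly q z) \<in> borel_measurable K"
        using borel_measurable_continuous_onI[of "poly q"] by (simp add: continuous_intros)
      have "of_real (LINT z|K. g z) = (LINT z|K. complex_of_real (g z))" by simp
      also have "\<dots> = (LINT z|K. poly q z * cnj z ^ n)"
        by (rule integral_cong_AE) (use K(2) q in auto)
      finally show ?thesis .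
    qed
    from this[OF sets(1) circle(1)] this[OF sets(2) circle(2)] poly[of q n]
    have "complex_of_real (LINT z|M. g z) = of_real (LINT z|N. g z)" by simp
    then show ?thesis by (simp only: of_real_eq_iff)
  qed
  have cont: "(LINT z|M. f z) = (LINT z|N. f z)" if f: "continuous_on UNIV f" for f :: "complex \<Rightarrow> real"
  proof (rule ccontr)
    assume ne: "(LINT z|M. f z) \<noteq> (LINT z|N. f z)"
    define d where "d = \<bar>(LINT z|M. f z) - (LINT z|N. f z)\<bar>"
    define m where "m = measure M UNIV + measure N UNIV"
    define e where "e = d / (m + 1)"
    have m0: "m \<ge> 0" by (simp add: m_def)
    have e: "e > 0" using ne m0 by (simp add: e_def d_def)
    obtain g where g: "real_polynomial_function g" "\<And>z. z \<in> sphere 0 1 \<Longrightarrow> \<bar>f z - g z\<bar> < e"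
      using Stone_Weierstrass_real_polynomial_function[of "sphere 0 1" f e] e continuous_on_subset[OF f] by (metis compact_sphere top_greatest)
    have gc: "continuous_on UNIV g"
      using g(1) by (simp add: continuous_on_polymonial_function real_polynomial_function_eq)
    have est: "\<bar>(LINT z|K. f z) - (LINT z|K. g z)\<bar> \<le> e * measure K UNIV"
      if K: "finite_measure K" "sets K = sets borel" "AE z in K. cmod z = 1" "space K = UNIV" for K
    proof -
      note [measurable_cong] = K(2)
      have i: "integrable K h" if h: "continuous_on UNIV h" for h :: "complex \<Rightarrow> real"
      proof -
        have "compact (h ` sphere 0 1)"
          by (rule compact_continuous_image) (use continuous_on_subset[OF h] in auto)
        from bounded_iff[THEN iffD1, OF compact_imp_bounded[OF this]]
        obtain C where "\<forall>y\<in>h ` sphere 0 1. norm y \<le> C" ..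
        then have C: "norm (h z) \<le> C" if "cmod z = 1" for z using that by (auto simp del: real_norm_def)
        have [measurable]: "h \<in> borel_measurable K"
          using borel_measurable_continuous_onI[OF h] by simp
        show ?thesis
          by (rule finite_measure.integrable_const_bound[OF K(1), of _ C]) (use K(3) C in auto)
      qed
      have "(LINT z|K. f z) - (LINT z|K. g z) = (LINT z|K. f z - g z)"
        by (rule Bochner_Integration.integral_diff[symmetric]) (use i f gc in auto)
      also have "\<bar>\<dots>\<bar> \<le> (LINT z|K. \<bar>f z - g z\<bar>)" by (rule integral_abs_bound)
      also have "\<dots> \<le> (LINT z|K. e)"
      proof (rule integral_mono_AE)
        show "AE z in K. \<bar>f z - g z\<bar> \<le> e" using K(3) by eventually_elim (use g(2) in \<open>auto intro: less_imp_le\<close>)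
        show "integrable K (\<lambda>z. \<bar>f z - g z\<bar>)" using i f gc by auto
        show "integrable K (\<lambda>z. e)" using K(1) by (simp add: finite_measure.integrable_const)
      qed
      also have "\<dots> = e * measure K UNIV" using K(4) by simp
      finally show ?thesis .
    qed
    have "d \<le> e * m"
      using est[OF assms(1) sets(1) circle(1) sp(1)] est[OF assms(2) sets(2) circle(2) sp(2)] rpf[OF g(1)]
      unfolding d_def m_def by (simp add: algebra_simps)
    also have "\<dots> < d" using ne m0 by (simp add: e_def d_def field_simps)
    finally show False by simp
  qed
  have closed: "emeasure M F = emeasure N F" if F: "closed F" for F
  proof (cases "F = {}")
    case False
    \<comment> \<open>Continuous tent functions that decrease to the indicator of the closed set
      F.\<close>
    define h where "h k z = max 0 (1 - real k * infdist z F)" for k z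
    have hc: "continuous_on UNIV (h k)" for k unfolding h_def by (intro continuous_intros)
    have lim: "(\<lambda>k. h k z) \<longlonglongrightarrow> indicator F z" for z
    proof (cases "z \<in> F")
      case True
      then show ?thesis using False by (simp add: h_def)
    next
      case nF: False
      then have d: "infdist z F > 0"
        using F False by (metis in_closed_iff_infdist_zero infdist_nonneg less_eq_real_def)
      obtain n where n: "real n * infdist z F > 1" using reals_Archimedean3[OF d] by blast
      have "\<forall>k\<ge>n. h k z = 0"
      proof (intro allI impI)
        fix k assume "k \<ge> n"
        then have "real n * infdist z F \<le> real k * infdist z F" using d by (intro mult_right_mono) auto
        then show "h k z = 0" using n by (simp add: h_def)
      qed
      then have "eventually (\<lambda>k. h k z = indicator F z) sequentially"
        using nF by (auto simp: eventually_sequentially)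
      then show ?thesis by (rule tendsto_eventually)
    qed
    have "(\<lambda>k. LINT z|K. h k z) \<longlonglongrightarrow> measure K F" if K: "finite_measure K" "sets K = sets borel" "space K = UNIV" for K
    proof -
      note [measurable_cong] = K(2)
      have [measurable]: "h k \<in> borel_measurable K" for k
        using borel_measurable_continuous_onI[OF hc] by simp
      have [measurable]: "F \<in> sets K" using F K(2) by auto
      have "(\<lambda>k. LINT z|K. h k z) \<longlonglongrightarrow> (LINT z|K. indicator F z)"
      proof (rule integral_dominated_convergence[where w = "\<lambda>_. 1"])
        show "integrable K (\<lambda>_. 1::real)" using K(1) by (simp add: finite_measure.integrable_const)
        show "AE z in K. norm (h k z) \<le> 1" for k
          by (auto simp: h_def max_def not_le infdist_nonneg intro!: AE_I2 mult_nonneg_nonneg)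
      qed (use lim in auto)
      then show ?thesis using K(3) by simp
    qed
    from this[OF assms(1) sets(1) sp(1)] this[OF assms(2) sets(2) sp(2)] cont[OF hc]
    have "measure M F = measure N F" using LIMSEQ_unique by fastforce
    then show ?thesis by (simp add: M.emeasure_eq_measure N.emeasure_eq_measure)
  qed simp
  show "M = N"
  proof (rule measure_eqI_generator_eq[where E = "Collect closed" and \<Omega> = UNIV and A = "\<lambda>_. UNIV"])
    show "Int_stable (Collect closed)" by (auto simp: Int_stable_def)
    show "sets M = sigma_sets UNIV (Collect closed)" "sets N = sigma_sets UNIV (Collect closed)"
      by (simp_all add: borel_eq_closed)
  qed (use closed in auto)
qed

text \<open>The positive and the negative part of g are densities of two finite measures with equal
  moments, so the parts agree almost everywhere; as they are never positive at the same point, both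
  vanish.\<close>

lemma real_fourier_unique:
  fixes g :: "complex \<Rightarrow> real"
  assumes g: "integrable cm g" and z: "\<And>k. (LINT z|cm. of_real (g z) * z ^ k) = 0"
  shows "AE z in cm. g z = 0"
proof -
  have [measurable]: "g \<in> borel_measurable cm" using g by auto
  define P where "P = density cm (\<lambda>z. ennreal (max 0 (g z)))"
  define Q where "Q = density cm (\<lambda>z. ennreal (max 0 (- g z)))"
  have fin: "finite_measure (density cm (\<lambda>z. ennreal (max 0 (h z))))" if "integrable cm h" for h
  proof -
    have "integrable cm (\<lambda>z. max 0 (h z))" using that by auto
    then have "(\<integral>\<^sup>+z. ennreal (max 0 (h z)) \<partial>cm) = ennreal (LINT z|cm. max 0 (h z))"
      by (intro nn_integral_eq_integral) auto
    then show ?thesis using that by (intro finite_measureI) (simp add: emeasure_density)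
  qed
  have int: "(LINT z|density cm (\<lambda>z. ennreal (max 0 (h z))). z ^ k) = (LINT z|cm. of_real (max 0 (h z)) * z ^ k)"
    if [measurable]: "h \<in> borel_measurable cm" for h k
    by (subst integral_density) (auto simp: scaleR_conv_of_real)
  have i: "integrable cm (\<lambda>z. complex_of_real (max 0 (h z)) * z ^ k)" if "integrable cm h" for h k
  proof (rule Bochner_Integration.integrable_bound[of _ h])
    have [measurable]: "h \<in> borel_measurable cm" using that by auto
    show "(\<lambda>z. complex_of_real (max 0 (h z)) * z ^ k) \<in> borel_measurable cm" by measurable
    show "AE z in cm. norm (complex_of_real (max 0 (h z)) * z ^ k) \<le> norm (h z)"
      using AE_cm_circle by eventually_elim (auto simp: norm_mult norm_power)
  qed fact
  have "P = Q"
  proof (rule circle_measure_eqI_moments)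
    show "finite_measure P" "finite_measure Q" unfolding P_def Q_def using fin[of g] fin[of "\<lambda>z. - g z"] g by blast+
    show "AE z in P. cmod z = 1" "AE z in Q. cmod z = 1"
      unfolding P_def Q_def using AE_cm_circle by (subst AE_density; auto)+
    show "(LINT z|P. z ^ k) = (LINT z|Q. z ^ k)" for k
    proof -
      have "(LINT z|P. z ^ k) - (LINT z|Q. z ^ k) = (LINT z|cm. of_real (max 0 (g z)) * z ^ k - of_real (max 0 (- g z)) * z ^ k)"
        unfolding P_def Q_def using g by (subst (1 2) int) (auto simp: Bochner_Integration.integral_diff[OF i i])
      also have "\<dots> = (LINT z|cm. of_real (g z) * z ^ k)"
        by (intro Bochner_Integration.integral_cong refl) (auto simp: max_def)
      finally show ?thesis using z by simp
    qed
  qed (simp_all add: P_def Q_def)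
  then have "AE z in cm. ennreal (max 0 (g z)) = ennreal (max 0 (- g z))"
    unfolding P_def Q_def by (subst (asm) cm.density_unique_iff) auto
  then show ?thesis by eventually_elim (auto simp: max_def split: if_splits)
qed

text \<open>Real and imaginary part are (f + cnj f) / 2 and (f - cnj f) / (2 i). The moments of cnj
  f are conjugates of the moments of f of negative index, so the two assumptions together feed
  \<open>real_fourier_unique\<close>.\<close>

lemma fourier_unique:
  assumes f: "integrable cm f" and z: "\<And>k. (LINT z|cm. f z * z ^ k) = 0" "\<And>k. (LINT z|cm. f z * cnj (z ^ k)) = 0"
  shows "AE z in cm. f z = 0"
proof -
  have i: "integrable cm (\<lambda>z. f z * z ^ k)" for k
  proof (rule Bochner_Integration.integrable_bound[OF f])
    have [measurable]: "f \<in> borel_measurable cm" using f by auto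
    show "(\<lambda>z. f z * z ^ k) \<in> borel_measurable cm" by measurable
    show "AE z in cm. norm (f z * z ^ k) \<le> norm (f z)"
      using AE_cm_circle by eventually_elim (auto simp: norm_mult norm_power)
  qed
  have i': "integrable cm (\<lambda>z. cnj (f z) * z ^ k)" for k
  proof (rule Bochner_Integration.integrable_bound[OF f])
    have [measurable]: "f \<in> borel_measurable cm" using f by auto
    show "(\<lambda>z. cnj (f z) * z ^ k) \<in> borel_measurable cm" by measurable
    show "AE z in cm. norm (cnj (f z) * z ^ k) \<le> norm (f z)"
      using AE_cm_circle by eventually_elim (auto simp: norm_mult norm_power)
  qed
  have z': "(LINT z|cm. cnj (f z) * z ^ k) = 0" for k
    using z(2)[of k] Bochner_Integration.integral_cnj[of cm "\<lambda>z. f z * cnj (z ^ k)"] by simp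
  have "AE z in cm. Re (f z) = 0"
  proof (rule real_fourier_unique)
    show "(LINT z|cm. of_real (Re (f z)) * z ^ k) = 0" for k
    proof -
      have "(LINT z|cm. of_real (Re (f z)) * z ^ k) = (LINT z|cm. (f z * z ^ k + cnj (f z) * z ^ k) / 2)"
        by (intro Bochner_Integration.integral_cong refl)
           (simp add: distrib_right[symmetric] complex_add_cnj)
      then show ?thesis using z(1) z' i[of k] i'[of k] by simp
    qed
  qed (use f in auto)
  moreover have "AE z in cm. Im (f z) = 0"
  proof (rule real_fourier_unique)
    show "(LINT z|cm. of_real (Im (f z)) * z ^ k) = 0" for k
    proof -
      have "(LINT z|cm. of_real (Im (f z)) * z ^ k) = (LINT z|cm. (f z * z ^ k - cnj (f z) * z ^ k) / (2 * \<i>))"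
      proof (intro Bochner_Integration.integral_cong refl)
        fix z
        have "f z * z ^ k - cnj (f z) * z ^ k = (2 * \<i>) * (of_real (Im (f z)) * z ^ k)"
          unfolding left_diff_distrib[symmetric] complex_diff_cnj by simp
        then show "of_real (Im (f z)) * z ^ k = (f z * z ^ k - cnj (f z) * z ^ k) / (2 * \<i>)"
          by (simp only:) simp
      qed
      then show ?thesis using z(1) z' i[of k] i'[of k] by simp
    qed
  qed (use f in auto)
  ultimately show ?thesis by eventually_elim (simp add: complex_eq_iff)
qed

section \<open>Closures in L^q, described by sequences\<close>

definition lq_closure :: "real \<Rightarrow> 'a measure \<Rightarrow> ('a \<Rightarrow> complex) set \<Rightarrow> ('a \<Rightarrow> complex) set" where
  "lq_closure q M S = {f \<in> lq q M. \<exists>s. (\<forall>k. s k \<in> S) \<and> (\<lambda>k. lint q M (\<lambda>z. s k z - f z)) \<longlonglongrightarrow> 0}"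

lemma LIMSEQ_0_le:
  fixes a b :: "nat \<Rightarrow> real"
  assumes "b \<longlonglongrightarrow> 0" "\<And>k. 0 \<le> a k" "\<And>k. a k \<le> b k"
  shows "a \<longlonglongrightarrow> 0"
  by (rule tendsto_sandwich[OF _ _ tendsto_const assms(1)]) (use assms in auto)

lemma lq_closure_lq: "f \<in> lq_closure q M S \<Longrightarrow> f \<in> lq q M"
  by (simp add: lq_closure_def)

lemma lq_closureI:
  assumes "f \<in> lq q M" "\<And>k. s k \<in> S" "(\<lambda>k. lint q M (\<lambda>z. s k z - f z)) \<longlonglongrightarrow> 0"
  shows "f \<in> lq_closure q M S"
  using assms by (auto simp: lq_closure_def)

lemma lq_closureE:
  assumes "f \<in> lq_closure q M S"
  obtains s where "\<And>k. s k \<in> S" "(\<lambda>k. lint q M (\<lambda>z. s k z - f z)) \<longlonglongrightarrow> 0"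
  using assms by (auto simp: lq_closure_def)

lemma lq_closure_eps:
  assumes "f \<in> lq q M" "\<And>e. e > 0 \<Longrightarrow> \<exists>g\<in>S. lint q M (\<lambda>z. g z - f z) < e"
  shows "f \<in> lq_closure q M S"
proof -
  have "\<exists>g\<in>S. lint q M (\<lambda>z. g z - f z) < 1 / real (Suc k)" for k by (rule assms(2)) simp
  then obtain s where s: "\<And>k. s k \<in> S" "\<And>k. lint q M (\<lambda>z. s k z - f z) < 1 / real (Suc k)" by metis
  have "(\<lambda>k. lint q M (\<lambda>z. s k z - f z)) \<longlonglongrightarrow> 0"
    by (rule LIMSEQ_0_le[OF LIMSEQ_inverse_real_of_nat[unfolded inverse_eq_divide]])
       (use s(2) in \<open>auto intro!: less_imp_le\<close>)
  then show ?thesis using assms(1) s(1) by (auto intro: lq_closureI)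
qed

lemma lq_closure_eps_ex:
  assumes "f \<in> lq_closure q M S" "e > 0"
  shows "\<exists>g\<in>S. lint q M (\<lambda>z. g z - f z) < e"
proof -
  obtain s where s: "\<And>k. s k \<in> S" "(\<lambda>k. lint q M (\<lambda>z. s k z - f z)) \<longlonglongrightarrow> 0"
    by (rule lq_closureE[OF assms(1)]) (rule that)
  from LIMSEQ_D[OF s(2) assms(2)] s(1) show ?thesis by fastforce
qed

lemma lq_closure_superset: "S \<subseteq> lq q M \<Longrightarrow> S \<subseteq> lq_closure q M S"
  by (auto intro!: lq_closureI[where s = "\<lambda>_. f" for f] simp: lint_def)

lemma lq_closure_closed:
  assumes q: "0 < q" and S: "S \<subseteq> lq q M" and f: "f \<in> lq q M"
    and t: "\<And>k. t k \<in> lq_closure q M S" "(\<lambda>k. lint q M (\<lambda>z. t k z - f z)) \<longlonglongrightarrow> 0"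
  shows "f \<in> lq_closure q M S"
proof (rule lq_closure_eps[OF f])
  fix e :: real assume e: "e > 0"
  define e' where "e' = e / (4 * 2 powr q)"
  have e': "e' > 0" using e by (simp add: e'_def)
  from LIMSEQ_D[OF t(2) e'] obtain k where k: "lint q M (\<lambda>z. t k z - f z) < e'" by auto
  obtain g where g: "g \<in> S" "lint q M (\<lambda>z. g z - t k z) < e'"
    using lq_closure_eps_ex[OF t(1) e'] by blast
  have "lint q M (\<lambda>z. g z - f z) \<le> 2 powr q * (lint q M (\<lambda>z. g z - t k z) + lint q M (\<lambda>z. t k z - f z))"
    by (rule lint_diff_triangle[OF q _ _ f]) (use g(1) S lq_closure_lq[OF t(1)] in auto)
  also have "\<dots> \<le> 2 powr q * (e' + e')" using g k by (intro mult_left_mono) auto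
  also have "\<dots> < e" using e by (simp add: e'_def field_simps)
  finally show "\<exists>g\<in>S. lint q M (\<lambda>z. g z - f z) < e" using g(1) by blast
qed

lemma lint_cong_AE:
  assumes "AE z in M. f z = g z" "f \<in> borel_measurable M" "g \<in> borel_measurable M"
  shows "lint q M f = lint q M g"
  unfolding lint_def by (rule integral_cong_AE) (use assms in auto)

lemma lq_cong_AE:
  assumes "f \<in> lq q M" "AE z in M. f z = g z" "g \<in> borel_measurable M"
  shows "g \<in> lq q M"
  by (rule lq_bound[OF assms(3) lq_integrable[OF assms(1)]]) (use assms(2) in auto)

lemma lq_closure_cong_AE:
  assumes f: "f \<in> lq_closure q M S" and S: "S \<subseteq> lq q M" and g: "AE z in M. f z = g z" "g \<in> borel_measurable M"
  shows "g \<in> lq_closure q M S"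
proof -
  obtain s where s: "\<And>k. s k \<in> S" "(\<lambda>k. lint q M (\<lambda>z. s k z - f z)) \<longlonglongrightarrow> 0"
    by (rule lq_closureE[OF f]) (rule that)
  have fm: "f \<in> borel_measurable M" using lq_closure_lq[OF f] by (rule lqD)
  have sm: "s k \<in> borel_measurable M" for k using s(1) S by (auto dest: lqD)
  have "lint q M (\<lambda>z. s k z - f z) = lint q M (\<lambda>z. s k z - g z)" for k
    by (rule lint_cong_AE) (use g fm sm in auto)
  then show ?thesis using s lq_cong_AE[OF lq_closure_lq[OF f] g] by (auto intro: lq_closureI)
qed

lemma lq_closure_csubspace:
  assumes q: "0 < q" and S: "S \<subseteq> lq q M" "csubspace S"
  shows "csubspace (lq_closure q M S)"
  unfolding csubspace_def
proof (intro conjI ballI allI)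
  show "(\<lambda>_. 0) \<in> lq_closure q M S"
    using lq_closure_superset[OF S(1)] S(2) by (auto simp: csubspace_def)
next
  fix f g assume f: "f \<in> lq_closure q M S" and g: "g \<in> lq_closure q M S"
  obtain s where s: "\<And>k. s k \<in> S" "(\<lambda>k. lint q M (\<lambda>z. s k z - f z)) \<longlonglongrightarrow> 0"
    by (rule lq_closureE[OF f]) (rule that)
  obtain t where t: "\<And>k. t k \<in> S" "(\<lambda>k. lint q M (\<lambda>z. t k z - g z)) \<longlonglongrightarrow> 0"
    by (rule lq_closureE[OF g]) (rule that)
  show "(\<lambda>z. f z + g z) \<in> lq_closure q M S"
  proof (rule lq_closureI[where s = "\<lambda>k z. s k z + t k z"])
    show "(\<lambda>z. f z + g z) \<in> lq q M" by (intro lq_add(1) q lq_closure_lq[OF f] lq_closure_lq[OF g])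
    show "(\<lambda>z. s k z + t k z) \<in> S" for k using S(2) s(1) t(1) by (auto simp: csubspace_def)
    have le: "lint q M (\<lambda>z. s k z + t k z - (f z + g z)) \<le> 2 powr q * (lint q M (\<lambda>z. s k z - f z) + lint q M (\<lambda>z. t k z - g z))" for k
      using lq_add(2)[OF q lq_diff(1)[OF q _ lq_closure_lq[OF f]] lq_diff(1)[OF q _ lq_closure_lq[OF g]], of "s k" "t k"] s(1) t(1) S(1)
      by (auto simp: algebra_simps subset_iff)
    have "(\<lambda>k. 2 powr q * (lint q M (\<lambda>z. s k z - f z) + lint q M (\<lambda>z. t k z - g z))) \<longlonglongrightarrow> 2 powr q * (0 + 0)"
      by (intro tendsto_intros s t)
    then have "(\<lambda>k. 2 powr q * (lint q M (\<lambda>z. s k z - f z) + lint q M (\<lambda>z. t k z - g z))) \<longlonglongrightarrow> 0" by simp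
    then show "(\<lambda>k. lint q M (\<lambda>z. s k z + t k z - (f z + g z))) \<longlonglongrightarrow> 0"
      by (rule LIMSEQ_0_le) (use le in auto)
  qed
next
  fix c f assume f: "f \<in> lq_closure q M S"
  obtain s where s: "\<And>k. s k \<in> S" "(\<lambda>k. lint q M (\<lambda>z. s k z - f z)) \<longlonglongrightarrow> 0"
    by (rule lq_closureE[OF f]) (rule that)
  show "(\<lambda>z. c * f z) \<in> lq_closure q M S"
  proof (rule lq_closureI[where s = "\<lambda>k z. c * s k z"])
    show "(\<lambda>z. c * f z) \<in> lq q M" by (intro lq_cmult(1) lq_closure_lq[OF f])
    show "(\<lambda>z. c * s k z) \<in> S" for k using S(2) s(1) by (auto simp: csubspace_def)
    have "lint q M (\<lambda>z. c * s k z - c * f z) = cmod c powr q * lint q M (\<lambda>z. s k z - f z)" for k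
      using lq_cmult(2)[OF lq_diff(1)[OF q _ lq_closure_lq[OF f]], of "s k" c] s(1) S(1)
      by (auto simp: algebra_simps subset_iff)
    moreover have "(\<lambda>k. cmod c powr q * lint q M (\<lambda>z. s k z - f z)) \<longlonglongrightarrow> cmod c powr q * 0"
      by (intro tendsto_intros s)
    ultimately show "(\<lambda>k. lint q M (\<lambda>z. c * s k z - c * f z)) \<longlonglongrightarrow> 0" by simp
  qed
qed

subsection \<open>Hardy spaces\<close>

abbreviation H2 :: "(complex \<Rightarrow> complex) set" where "H2 \<equiv> lq_closure 2 cm (range poly)"

lemma measurable_poly [measurable]: "poly p \<in> borel_measurable cm" for p :: "complex poly"
  using borel_measurable_continuous_onI[of "poly p"] by (simp add: continuous_intros)

lemma lq_cm_bounded: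
  assumes "f \<in> borel_measurable cm" "AE z in cm. cmod (f z) \<le> C" "0 < q"
  shows "f \<in> lq q cm"
  by (rule lq_bound[OF assms(1), of "\<lambda>_. C powr q"]) (use assms in \<open>auto intro!: powr_mono2\<close>)

lemma lq2_cm_integrable: "f \<in> lq 2 cm \<Longrightarrow> integrable cm f"
proof -
  assume f: "f \<in> lq 2 cm"
  have "(\<lambda>_. 1) \<in> lq 2 cm" by (rule lq_cm_bounded[of _ 1]) simp_all
  from lq2_mult_integrable[OF f this] show ?thesis by simp
qed

lemma poly_circle_bounded: "\<exists>C. \<forall>z. cmod z = 1 \<longrightarrow> cmod (poly p z) \<le> C" for p :: "complex poly"
proof -
  have "cmod (poly p z) \<le> (\<Sum>i\<le>degree p. cmod (coeff p i))" if "cmod z = 1" for z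
    unfolding poly_altdef by (rule order_trans[OF norm_sum]) (simp add: norm_mult norm_power that)
  then show ?thesis by blast
qed

lemma range_poly_lq: "0 < q \<Longrightarrow> range poly \<subseteq> lq q cm"
proof safe
  fix p :: "complex poly" assume q: "0 < q"
  obtain C where "\<forall>z. cmod z = 1 \<longrightarrow> cmod (poly p z) \<le> C" using poly_circle_bounded by blast
  then have "AE z in cm. cmod (poly p z) \<le> C" using AE_cm_circle by auto
  then show "poly p \<in> lq q cm" using q by (intro lq_cm_bounded) auto
qed

lemma csubspace_range_poly: "csubspace (range (poly :: complex poly \<Rightarrow> _))"
  unfolding csubspace_def
proof safe
  show "(\<lambda>_. 0) \<in> range (poly :: complex poly \<Rightarrow> _)" by (rule range_eqI[of _ _ 0]) auto
  show "(\<lambda>z. poly p z + poly q z) \<in> range poly" for p q :: "complex poly" by (rule range_eqI[of _ _ "p + q"]) auto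
  show "(\<lambda>z. c * poly p z) \<in> range poly" for p :: "complex poly" and c by (rule range_eqI[of _ _ "smult c p"]) auto
qed

lemma integral_poly_power: "(LINT z|cm. poly p z * z ^ Suc k) = 0" for p :: "complex poly"
proof -
  have i: "integrable cm (\<lambda>z. z ^ m)" for m :: nat
    by (rule cm_integrable_bounded[of _ 1]) (use AE_cm_circle in \<open>auto simp: norm_power\<close>)
  have "(LINT z|cm. poly p z * z ^ Suc k) = (LINT z|cm. (\<Sum>i\<le>degree p. coeff p i * z ^ (i + Suc k)))"
    by (simp add: poly_altdef sum_distrib_right sum_distrib_left power_add mult_ac)
  also have "\<dots> = (\<Sum>i\<le>degree p. coeff p i * (LINT z|cm. z ^ (i + Suc k)))"
    by (subst Bochner_Integration.integral_sum) (auto intro!: integrable_mult_right i simp del: power_Suc add_Suc_right)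
  also have "\<dots> = 0" by (simp add: integral_cm_power del: power_Suc)
  finally show ?thesis .
qed

lemma power_lq: "0 < q \<Longrightarrow> (\<lambda>z. z ^ k) \<in> lq q cm"
  by (rule lq_cm_bounded[of _ 1]) (use AE_cm_circle in \<open>auto simp: norm_power\<close>)

lemma H2_power:
  assumes "f \<in> H2"
  shows "(LINT z|cm. f z * z ^ Suc k) = 0"
proof -
  obtain s where s: "\<And>k. s k \<in> range poly" "(\<lambda>k. lint 2 cm (\<lambda>z. s k z - f z)) \<longlonglongrightarrow> 0"
    by (rule lq_closureE[OF assms]) (rule that)
  have "(\<lambda>j. LINT z|cm. s j z * z ^ Suc k) \<longlonglongrightarrow> (LINT z|cm. f z * z ^ Suc k)"
    by (rule lq2_tendsto_mult[OF _ lq_closure_lq[OF assms] power_lq s(2)]) (use s(1) range_poly_lq[of 2] in auto)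
  moreover have "(LINT z|cm. s j z * z ^ Suc k) = 0" for j
  proof -
    obtain p where "s j = poly p" using s(1)[of j] by auto
    then show ?thesis using integral_poly_power by simp
  qed
  ultimately show ?thesis by (simp only: LIMSEQ_const_iff)
qed

text \<open>The integral against z^(k+1) is the Fourier coefficient of index -(k+1). If g is the
  projection of f onto the polynomials, then f - g loses all coefficients of index >= 0 by
  orthogonality, and the negative ones by assumption and \<open>H2_power\<close>.\<close>

lemma H2I:
  assumes f: "f \<in> lq 2 cm" and z: "\<And>k. (LINT z|cm. f z * z ^ Suc k) = 0"
  shows "f \<in> H2"
proof -
  obtain s g where s: "\<And>k. s k \<in> range poly" and g: "g \<in> lq 2 cm" and c: "(\<lambda>k. lint 2 cm (\<lambda>z. s k z - g z)) \<longlonglongrightarrow> 0"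
    and o: "\<And>h. h \<in> range poly \<Longrightarrow> (LINT z|cm. (f z - g z) * cnj (h z)) = 0"
    by (rule lq2_projection[OF range_poly_lq csubspace_range_poly f]) (simp, rule that)
  have gH: "g \<in> H2" by (rule lq_closureI[OF g s c])
  have d: "(\<lambda>z. f z - g z) \<in> lq 2 cm" by (intro lq_diff f g) simp
  have n: "(LINT z|cm. (f z - g z) * cnj (z ^ k)) = 0" for k
    using o[of "poly (monom 1 k)"] by (simp add: poly_monom)
  have "AE z in cm. f z - g z = 0"
  proof (rule fourier_unique[OF lq2_cm_integrable[OF d] _ n])
    show "(LINT z|cm. (f z - g z) * z ^ k) = 0" for k
    proof (cases k)
      case 0
      then show ?thesis using n[of 0] by simp
    next
      case (Suc m)
      then show ?thesis using lq2_integral_mult_diff[OF f g power_lq[of 2 k]] z[of m] H2_power[OF gH, of m] by simp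
    qed
  qed
  then have ae: "AE z in cm. g z = f z" by eventually_elim simp
  show ?thesis by (rule lq_closure_cong_AE[OF gH range_poly_lq ae]) (use f in \<open>auto dest: lqD\<close>)
qed

lemma H2_lq: "f \<in> H2 \<Longrightarrow> f \<in> lq 2 cm"
  by (rule lq_closure_lq)

lemma csubspace_H2: "csubspace H2"
  by (intro lq_closure_csubspace range_poly_lq csubspace_range_poly) auto

text \<open>By Fatou's theorem this is \<open>Hinf\<close>, but products and limits are easier to handle in terms of Fourier
  coefficients.\<close>

definition hb :: "(complex \<Rightarrow> complex) set" where
  "hb = {f \<in> borel_measurable cm. (\<exists>C. AE z in cm. cmod (f z) \<le> C) \<and> (\<forall>k. (LINT z|cm. f z * z ^ Suc k) = 0)}"

lemma hb_measurable [measurable_dest]: "f \<in> hb \<Longrightarrow> f \<in> borel_measurable cm"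
  by (simp add: hb_def)

lemma hb_H2: "f \<in> hb \<Longrightarrow> f \<in> H2"
  by (rule H2I) (auto simp: hb_def intro: lq_cm_bounded simp del: power_Suc)

lemma hb_iff: "f \<in> hb \<longleftrightarrow> f \<in> H2 \<and> (\<exists>C. AE z in cm. cmod (f z) \<le> C)"
proof
  assume "f \<in> hb"
  then show "f \<in> H2 \<and> (\<exists>C. AE z in cm. cmod (f z) \<le> C)" using hb_H2 by (simp add: hb_def del: power_Suc)
next
  assume f: "f \<in> H2 \<and> (\<exists>C. AE z in cm. cmod (f z) \<le> C)"
  then show "f \<in> hb"
    using lqD[OF H2_lq] H2_power unfolding hb_def by (intro CollectI conjI allI) blast+
qed

text \<open>Only f is approximated by polynomials while g stays fixed; for a polynomial factor the
  integral is a finite combination of Fourier coefficients of g of negative index.\<close>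

lemma H2_mult_hb:
  assumes f: "f \<in> H2" and g: "g \<in> hb"
  shows "(\<lambda>z. g z * f z) \<in> H2"
proof (rule H2I)
  obtain C where C: "AE z in cm. cmod (g z) \<le> C" using g by (auto simp: hb_def)
  have gm: "g \<in> borel_measurable cm" using g by (rule hb_measurable)
  show 1: "(\<lambda>z. g z * f z) \<in> lq 2 cm" by (rule lq_mult_bounded[OF _ H2_lq[OF f] gm C]) simp
  fix k
  obtain s where s: "\<And>k. s k \<in> range poly" "(\<lambda>k. lint 2 cm (\<lambda>z. s k z - f z)) \<longlonglongrightarrow> 0"
    by (rule lq_closureE[OF f]) (rule that)
  have h: "(\<lambda>z. g z * z ^ Suc k) \<in> lq 2 cm" by (rule lq_mult_bounded[OF _ power_lq gm C]) simp_all
  have "(\<lambda>j. LINT z|cm. s j z * (g z * z ^ Suc k)) \<longlonglongrightarrow> (LINT z|cm. f z * (g z * z ^ Suc k))"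
    by (rule lq2_tendsto_mult[OF _ H2_lq[OF f] h s(2)]) (use s(1) range_poly_lq[of 2] in auto)
  moreover have "(LINT z|cm. s j z * (g z * z ^ Suc k)) = 0" for j
  proof -
    obtain p where p: "s j = poly p" using s(1)[of j] by auto
    have gi: "integrable cm (\<lambda>z. g z * z ^ m)" for m
      using lq2_cm_integrable[OF lq_mult_bounded(1)[OF _ power_lq gm C]] by simp
    have "(LINT z|cm. s j z * (g z * z ^ Suc k)) = (LINT z|cm. (\<Sum>i\<le>degree p. coeff p i * (g z * z ^ Suc (i + k))))"
      by (simp add: p poly_altdef sum_distrib_right sum_distrib_left power_add mult_ac)
    also have "\<dots> = (\<Sum>i\<le>degree p. coeff p i * (LINT z|cm. g z * z ^ Suc (i + k)))"
      by (subst Bochner_Integration.integral_sum) (auto intro!: integrable_mult_right gi simp del: power_Suc)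
    also have "\<dots> = 0" using g by (simp add: hb_def del: power_Suc)
    finally show ?thesis .
  qed
  ultimately have "(LINT z|cm. f z * (g z * z ^ Suc k)) = 0"
    by (simp only: LIMSEQ_const_iff)
  then show "(LINT z|cm. g z * f z * z ^ Suc k) = 0" by (simp only: mult_ac)
qed

lemma hb_mult:
  assumes f: "f \<in> hb" and g: "g \<in> hb"
  shows "(\<lambda>z. g z * f z) \<in> hb"
proof -
  obtain C D where "AE z in cm. cmod (g z) \<le> C" "AE z in cm. cmod (f z) \<le> D" using f g by (auto simp: hb_def)
  then have "AE z in cm. cmod (g z * f z) \<le> \<bar>C\<bar> * \<bar>D\<bar>"
    by eventually_elim (auto simp: norm_mult intro!: mult_mono)
  then show ?thesis using H2_mult_hb[OF hb_H2[OF f] g] by (auto simp: hb_iff)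
qed

lemma hb_add: assumes "f \<in> hb" "g \<in> hb" shows "(\<lambda>z. f z + g z) \<in> hb"
proof -
  obtain C D where "AE z in cm. cmod (f z) \<le> C" "AE z in cm. cmod (g z) \<le> D" using assms by (auto simp: hb_def)
  then have "AE z in cm. cmod (f z + g z) \<le> C + D"
    by eventually_elim (rule order_trans[OF norm_triangle_ineq add_mono])
  then show ?thesis using csubspace_H2 assms by (auto simp: hb_iff csubspace_def)
qed

lemma hb_cmult: assumes "f \<in> hb" shows "(\<lambda>z. c * f z) \<in> hb"
proof -
  obtain C where "AE z in cm. cmod (f z) \<le> C" using assms by (auto simp: hb_def)
  then have "AE z in cm. cmod (c * f z) \<le> cmod c * C"
    by eventually_elim (simp add: norm_mult mult_left_mono)
  then show ?thesis using csubspace_H2 assms by (auto simp: hb_iff csubspace_def)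
qed

lemma hb_poly: "poly p \<in> hb"
proof -
  obtain C where "\<forall>z. cmod z = 1 \<longrightarrow> cmod (poly p z) \<le> C" using poly_circle_bounded by blast
  then have "AE z in cm. cmod (poly p z) \<le> C" using AE_cm_circle by auto
  then show ?thesis using lq_closure_superset[OF range_poly_lq[of 2]] by (auto simp: hb_iff)
qed

lemma hb_const: "(\<lambda>z. c) \<in> hb"
proof -
  have "poly [:c:] = (\<lambda>z. c)" by auto
  then show ?thesis using hb_poly[of "[:c:]"] by simp
qed

lemma hb_id: "(\<lambda>z. z) \<in> hb"
proof -
  have "poly [:0, 1:] = (\<lambda>z::complex. z)" by auto
  then show ?thesis using hb_poly[of "[:0, 1:]"] by simp
qed

lemma hb_power: "f \<in> hb \<Longrightarrow> (\<lambda>z. f z ^ k) \<in> hb"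
  by (induction k) (auto intro: hb_const hb_mult)

lemma hb_sum: "(\<And>i. i \<in> I \<Longrightarrow> f i \<in> hb) \<Longrightarrow> (\<lambda>z. \<Sum>i\<in>I. f i z) \<in> hb"
  by (induction I rule: infinite_finite_induct) (auto intro: hb_const hb_add)

lemma hb_prod: "(\<And>i. i \<in> I \<Longrightarrow> f i \<in> hb) \<Longrightarrow> (\<lambda>z. \<Prod>i\<in>I. f i z) \<in> hb"
  by (induction I rule: infinite_finite_induct) (auto intro: hb_const hb_mult)

lemma hb_cong_AE:
  assumes "f \<in> hb" "AE z in cm. f z = g z" "g \<in> borel_measurable cm"
  shows "g \<in> hb"
proof -
  obtain C where "AE z in cm. cmod (f z) \<le> C" using assms by (auto simp: hb_def)
  then have "AE z in cm. cmod (g z) \<le> C" using assms(2) by eventually_elim simp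
  moreover have "g \<in> H2" by (rule lq_closure_cong_AE[OF hb_H2 range_poly_lq]) (use assms in auto)
  ultimately show ?thesis by (auto simp: hb_iff)
qed

lemma hb_lq: "f \<in> hb \<Longrightarrow> 0 < q \<Longrightarrow> f \<in> lq q cm"
  by (auto simp: hb_def intro: lq_cm_bounded)

lemma hb_integrable: "f \<in> hb \<Longrightarrow> integrable cm f"
  by (auto simp: hb_def intro: cm_integrable_bounded)

lemma H2_mean_id: "f \<in> H2 \<Longrightarrow> (LINT z|cm. z * f z) = 0"
  using H2_power[of f 0] by (simp add: mult.commute)

lemma bounded_convergence_lq:
  assumes q: "0 < q" and m: "f \<in> borel_measurable cm" "\<And>k. s k \<in> borel_measurable cm"
    and bd: "\<And>k. AE z in cm. cmod (s k z) \<le> C"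
    and lim: "AE z in cm. (\<lambda>k. s k z) \<longlonglongrightarrow> f z"
  shows "f \<in> lq q cm" "\<And>k. s k \<in> lq q cm" "(\<lambda>k. lint q cm (\<lambda>z. s k z - f z)) \<longlonglongrightarrow> 0"
    "AE z in cm. cmod (f z) \<le> C"
proof -
  have i: "integrable cm (\<lambda>z. C powr q)" by simp
  note * = lq_dominated_convergence[OF q m(1) m(2) i bd lim]
  show "f \<in> lq q cm" "\<And>k. s k \<in> lq q cm" "(\<lambda>k. lint q cm (\<lambda>z. s k z - f z)) \<longlonglongrightarrow> 0" using * by auto
  have "AE z in cm. \<forall>k. cmod (s k z) \<le> C" using bd by (simp add: AE_all_countable)
  with lim show "AE z in cm. cmod (f z) \<le> C"
  proof eventually_elim
    case (elim z)
    show ?case by (rule LIMSEQ_le_const2[OF tendsto_norm[OF elim(1)]]) (use elim(2) in auto)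
  qed
qed

text \<open>On a probability space bounded pointwise convergence implies convergence in L^2, where
  H^2 is closed.\<close>

lemma hb_bounded_limit:
  assumes s: "\<And>k. s k \<in> hb" and bd: "\<And>k. AE z in cm. cmod (s k z) \<le> C"
    and f: "f \<in> borel_measurable cm" and lim: "AE z in cm. (\<lambda>k. s k z) \<longlonglongrightarrow> f z"
  shows "f \<in> hb"
proof -
  note * = bounded_convergence_lq[where q = 2, OF _ f hb_measurable[OF s] bd lim, simplified]
  have "f \<in> H2"
    by (rule lq_closure_closed[OF _ range_poly_lq *(1) hb_H2[OF s] *(3)]) simp_all
  then show ?thesis using *(4) by (auto simp: hb_iff)
qed

text \<open>The moments A k of 1 / (1 - a z) satisfy A k = a A (k + 1), with 1 added for k = 0.
  Iterating gives A (k + 1) = a^m A (k + 1 + m), which tends to 0 because the moments are bounded;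
  hence also A 0 = 1.\<close>

lemma hb_geometric:
  assumes a: "cmod a < 1"
  shows "(\<lambda>z. 1 / (1 - a * z)) \<in> hb" "(LINT z|cm. 1 / (1 - a * z)) = 1"
    "\<And>z. cmod z = 1 \<Longrightarrow> 1 - a * z \<noteq> 0"
proof -
  show nz: "1 - a * z \<noteq> 0" if "cmod z = 1" for z
  proof
    assume "1 - a * z = 0"
    then have "cmod (a * z) = 1" by (metis eq_iff_diff_eq_0 norm_one)
    then show False using a that by (simp add: norm_mult)
  qed
  define g where "g z = 1 / (1 - a * z)" for z
  define C where "C = 1 / (1 - cmod a)"
  have gm[measurable]: "g \<in> borel_measurable cm" unfolding g_def by measurable
  have bd: "AE z in cm. cmod (g z) \<le> C"
    using AE_cm_circle
  proof eventually_elim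
    case (elim z)
    have "1 - cmod a \<le> cmod (1 - a * z)"
      using norm_triangle_ineq2[of 1 "a * z"] elim by (simp add: norm_mult)
    then show ?case using a by (simp add: g_def C_def norm_divide frac_le)
  qed
  have gi: "integrable cm (\<lambda>z. g z * z ^ k)" for k
    using lq2_cm_integrable[OF lq_mult_bounded(1)[OF _ power_lq gm bd]] by simp
  define A where "A k = (LINT z|cm. g z * z ^ k)" for k
  have rec: "A k = (if k = 0 then 1 else 0) + a * A (Suc k)" for k
  proof -
    have "A k - a * A (Suc k) = (LINT z|cm. g z * z ^ k - a * (g z * z ^ Suc k))"
      unfolding A_def using gi[of k] gi[of "Suc k"] by (simp del: power_Suc)
    also have "\<dots> = (LINT z|cm. z ^ k)"
      by (rule integral_cong_AE) (use AE_cm_circle nz in \<open>auto simp: g_def field_simps\<close>)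
    finally show ?thesis by (simp add: integral_cm_power algebra_simps)
  qed
  have Ab: "cmod (A k) \<le> C" for k
  proof -
    have "cmod (A k) \<le> (LINT z|cm. cmod (g z * z ^ k))" unfolding A_def by simp
    also have "\<dots> \<le> (LINT z|cm. C)"
    proof (rule integral_mono_AE)
      show "AE z in cm. cmod (g z * z ^ k) \<le> C"
        using bd AE_cm_circle by eventually_elim (simp add: norm_mult norm_power)
    qed (use gi in auto)
    also have "\<dots> = C" using cm.prob_space by simp
    finally show ?thesis .
  qed
  have pow: "A (Suc k) = a ^ m * A (Suc k + m)" for k m
  proof (induction m)
    case (Suc m)
    have "A (Suc k + m) = a * A (Suc k + Suc m)" using rec[of "Suc k + m"] by simp
    with Suc show ?case by simp
  qed simp
  have A0: "A (Suc k) = 0" for k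
  proof -
    have "(\<lambda>m. cmod a ^ m * C) \<longlonglongrightarrow> 0 * C" using a by (intro tendsto_intros LIMSEQ_power_zero) simp
    then have "cmod (A (Suc k)) \<le> 0 * C"
    proof (rule LIMSEQ_le_const)
      have "cmod (A (Suc k)) \<le> cmod a ^ m * C" for m
        by (subst pow[of k m]) (simp add: norm_mult norm_power mult_left_mono Ab)
      then show "\<exists>N. \<forall>m\<ge>N. cmod (A (Suc k)) \<le> cmod a ^ m * C" by blast
    qed
    then show ?thesis by simp
  qed
  have "g \<in> hb" unfolding hb_def using gm bd A0 by (auto simp: A_def simp del: power_Suc)
  then show "(\<lambda>z. 1 / (1 - a * z)) \<in> hb" by (simp add: g_def[abs_def])
  show "(LINT z|cm. 1 / (1 - a * z)) = 1" using rec[of 0] A0[of 0] by (simp add: A_def g_def)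
qed

subsection \<open>The spaces of the definitions\<close>

lemma enn2real_pos_finite: "0 < p \<Longrightarrow> p \<noteq> \<infinity> \<Longrightarrow> 0 < enn2real p"
  by (simp add: enn2real_positive_iff less_top[symmetric])

lemma Lp_eq_lq: "p \<noteq> \<infinity> \<Longrightarrow> Lp p = lq (enn2real p) cm"
  by (simp add: Lp_def lq_def)

lemma lp_dist_less_iff:
  assumes "0 < p" "p \<noteq> \<infinity>" "e > 0"
  shows "lp_dist p f g < (if 1 \<le> p then e powr (1 / enn2real p) else e) \<longleftrightarrow> lint (enn2real p) cm (\<lambda>z. g z - f z) < e"
proof -
  have q: "0 < enn2real p" using assms enn2real_pos_finite by blast
  have c: "lint (enn2real p) cm (\<lambda>z. g z - f z) = (LINT z|cm. cmod (f z - g z) powr enn2real p)"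
    by (simp add: lint_def norm_minus_commute)
  have n: "0 \<le> (LINT z|cm. cmod (f z - g z) powr enn2real p)" by simp
  have "x powr (1 / enn2real p) < e powr (1 / enn2real p) \<longleftrightarrow> x < e" if "0 \<le> x" for x :: real
    using q that assms(3) by (metis powr_less_mono2 powr_mono2 less_eq_real_def not_less zero_less_divide_1_iff)
  then show ?thesis using assms n unfolding c lp_dist_def by auto
qed

lemma lp_closure_eq:
  assumes p: "0 < p" "p \<noteq> \<infinity>"
  shows "lp_closure p S = lq_closure (enn2real p) cm S"
proof -
  \<comment> \<open>\<open>h\<close> translates a bound on the integral into the corresponding bound
    on \<open>lp_dist\<close>. It maps the positive reals onto themselves, so both notions of
    closeness have the same balls.\<close>
  define h where "h e = (if 1 \<le> p then e powr (1 / enn2real p) else e)" for e :: real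
  have q: "0 < enn2real p" using p enn2real_pos_finite by blast
  have hpos: "h e > 0" if "e > 0" for e using that by (simp add: h_def)
  have hsurj: "\<exists>e>0. h e = d" if "d > 0" for d
    using that q by (intro exI[of _ "if 1 \<le> p then d powr enn2real p else d"]) (auto simp: h_def powr_powr)
  show ?thesis
  proof (intro set_eqI iffI)
    fix f assume f: "f \<in> lp_closure p S"
    show "f \<in> lq_closure (enn2real p) cm S"
    proof (rule lq_closure_eps)
      show "f \<in> lq (enn2real p) cm" using f p by (simp add: lp_closure_def Lp_eq_lq)
      fix e :: real assume e: "e > 0"
      obtain g where "g \<in> S" "lp_dist p f g < h e" using f hpos[OF e] by (auto simp: lp_closure_def)
      then show "\<exists>g\<in>S. lint (enn2real p) cm (\<lambda>z. g z - f z) < e"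
        using lp_dist_less_iff[OF p e, of f g] by (auto simp: h_def)
    qed
  next
    fix f assume f: "f \<in> lq_closure (enn2real p) cm S"
    have "\<exists>g\<in>S. lp_dist p f g < d" if d: "d > 0" for d
    proof -
      obtain e where e: "e > 0" "h e = d" using hsurj[OF d] by blast
      obtain g where "g \<in> S" "lint (enn2real p) cm (\<lambda>z. g z - f z) < e" using lq_closure_eps_ex[OF f e(1)] by blast
      then show ?thesis using lp_dist_less_iff[OF p e(1), of f g] e(2) by (auto simp: h_def)
    qed
    then show "f \<in> lp_closure p S" using lq_closure_lq[OF f] p by (simp add: lp_closure_def Lp_eq_lq)
  qed
qed

lemma hardy_eq: "0 < p \<Longrightarrow> p \<noteq> \<infinity> \<Longrightarrow> hardy p = lq_closure (enn2real p) cm (range poly)"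
  by (simp add: hardy_def lp_closure_eq)

lemma hardy_2: "hardy 2 = H2"
  by (subst hardy_eq) auto

subsection \<open>The Poisson kernel\<close>

text \<open>On the circle |1 - a cnj \<zeta>| = |\<zeta> - a|, so this is the usual Poisson kernel.
  In this form it splits directly into an antianalytic and an analytic function of \<zeta>, see
  \<open>pk_eq\<close>.\<close>

definition pk :: "complex \<Rightarrow> complex \<Rightarrow> real" where
  "pk a \<zeta> = (1 - (cmod a)\<^sup>2) / (cmod (1 - a * cnj \<zeta>))\<^sup>2"

definition pois :: "(complex \<Rightarrow> real) \<Rightarrow> complex \<Rightarrow> real" where
  "pois g a = (LINT \<zeta>|cm. g \<zeta> * pk a \<zeta>)"

text \<open>The bound holds at every point of the circle, not just almost everywhere: the maximal
  inequality compares functions at individual points, and \<open>pois\<close> keeps this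
  property.\<close>

definition cb :: "real \<Rightarrow> (complex \<Rightarrow> real) \<Rightarrow> bool" where
  "cb C g \<longleftrightarrow> g \<in> borel_measurable cm \<and> (\<forall>z. cmod z = 1 \<longrightarrow> \<bar>g z\<bar> \<le> C)"

lemma measurable_pk [measurable]:
  assumes [measurable]: "f \<in> borel_measurable M" "g \<in> borel_measurable M"
  shows "(\<lambda>x. pk (f x) (g x)) \<in> borel_measurable M"
  unfolding pk_def by measurable

lemma pk_denom:
  assumes "cmod a < 1" "cmod \<zeta> = 1"
  shows "1 - cmod a \<le> cmod (1 - a * cnj \<zeta>)" "1 - a * cnj \<zeta> \<noteq> 0" "1 - cnj a * \<zeta> \<noteq> 0"
proof -
  show 1: "1 - cmod a \<le> cmod (1 - a * cnj \<zeta>)"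
    using norm_triangle_ineq2[of 1 "a * cnj \<zeta>"] assms by (simp add: norm_mult)
  then show 2: "1 - a * cnj \<zeta> \<noteq> 0" using assms by auto
  have "1 - cnj a * \<zeta> = cnj (1 - a * cnj \<zeta>)" by simp
  then show "1 - cnj a * \<zeta> \<noteq> 0" using 2 by (metis complex_cnj_zero_iff)
qed

lemma pk_nonneg: "cmod a < 1 \<Longrightarrow> 0 \<le> pk a \<zeta>"
  by (auto simp: pk_def power_le_one intro!: divide_nonneg_nonneg)

lemma pk_le:
  assumes "cmod a < 1" "cmod \<zeta> = 1"
  shows "pk a \<zeta> \<le> 1 / (1 - cmod a)\<^sup>2"
  unfolding pk_def using pk_denom[OF assms] assms by (intro frac_le power_mono) auto

lemma pk_eq:
  assumes "cmod a < 1" "cmod \<zeta> = 1"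
  shows "complex_of_real (pk a \<zeta>) = 1 / (1 - a * cnj \<zeta>) + cnj a * \<zeta> / (1 - cnj a * \<zeta>)"
proof -
  note d = pk_denom[OF assms]
  have n: "complex_of_real ((cmod (1 - a * cnj \<zeta>))\<^sup>2) = (1 - a * cnj \<zeta>) * (1 - cnj a * \<zeta>)"
    by (subst complex_norm_square) simp
  have "a * cnj \<zeta> * (cnj a * \<zeta>) = (a * cnj a) * (\<zeta> * cnj \<zeta>)" by (simp add: mult_ac)
  also have "\<dots> = complex_of_real ((cmod a)\<^sup>2)"
    using cnj_mult_circle[OF assms(2)] by (simp only: complex_norm_square) simp
  finally have m: "complex_of_real (1 - (cmod a)\<^sup>2) = (1 - cnj a * \<zeta>) + cnj a * \<zeta> * (1 - a * cnj \<zeta>)"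
    by (simp add: algebra_simps)
  show ?thesis
    unfolding pk_def of_real_divide n m using d by (simp add: divide_simps)
qed

lemma pk_Re:
  assumes "cmod a < 1" "cmod \<zeta> = 1"
  shows "pk a \<zeta> = 2 * Re (1 / (1 - a * cnj \<zeta>)) - 1"
proof -
  note d = pk_denom[OF assms]
  define X where "X = 1 / (1 - a * cnj \<zeta>)"
  have "cnj a * \<zeta> / (1 - cnj a * \<zeta>) = cnj X - 1"
    using d by (simp add: X_def divide_simps)
  then have "complex_of_real (pk a \<zeta>) = X + (cnj X - 1)"
    unfolding pk_eq[OF assms] by (simp add: X_def)
  then have "Re (complex_of_real (pk a \<zeta>)) = Re (X + (cnj X - 1))" by simp
  then have "pk a \<zeta> = 2 * Re X - 1" by simp
  then show ?thesis unfolding X_def .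
qed

lemma pk_swap:
  assumes "cmod z = 1" "cmod \<zeta> = 1"
  shows "pk (of_real r * z) \<zeta> = pk (of_real r * \<zeta>) z"
proof -
  have "cmod (1 - of_real r * z * cnj \<zeta>) = cmod (cnj (1 - of_real r * z * cnj \<zeta>))" by (rule complex_mod_cnj[symmetric])
  also have "cnj (1 - of_real r * z * cnj \<zeta>) = 1 - of_real r * \<zeta> * cnj z" by simp
  finally show ?thesis unfolding pk_def using assms by (simp add: norm_mult)
qed

lemma integral_cnj_geometric:
  assumes "cmod a < 1"
  shows "integrable cm (\<lambda>\<zeta>. 1 / (1 - a * cnj \<zeta>))" "(LINT \<zeta>|cm. 1 / (1 - a * cnj \<zeta>)) = 1"
proof -
  have e: "(\<lambda>\<zeta>. 1 / (1 - a * cnj \<zeta>)) = (\<lambda>\<zeta>. cnj (1 / (1 - cnj a * \<zeta>)))" by auto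
  have a: "cmod (cnj a) < 1" using assms by simp
  show "integrable cm (\<lambda>\<zeta>. 1 / (1 - a * cnj \<zeta>))"
    unfolding e using hb_integrable[OF hb_geometric(1)[OF a]] by (rule integrable_cnj)
  show "(LINT \<zeta>|cm. 1 / (1 - a * cnj \<zeta>)) = 1"
    unfolding e Bochner_Integration.integral_cnj hb_geometric(2)[OF a] by simp
qed

lemma cb_measurable: "cb C g \<Longrightarrow> g \<in> borel_measurable cm"
  by (simp add: cb_def)

lemma cb_integrable: "cb C g \<Longrightarrow> integrable cm g"
  by (rule cm.integrable_const_bound[of _ C]) (use AE_cm_circle in \<open>auto simp: cb_def\<close>)

lemma cb_mult: "cb C f \<Longrightarrow> cb D g \<Longrightarrow> cb (\<bar>C\<bar> * \<bar>D\<bar>) (\<lambda>z. f z * g z)"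
  unfolding cb_def by (force simp: abs_mult intro!: mult_mono)

lemma cb_pk: "cmod a < 1 \<Longrightarrow> cb (1 / (1 - cmod a)\<^sup>2) (pk a)"
  unfolding cb_def
proof (intro conjI allI impI)
  show "pk a \<in> borel_measurable cm" by measurable
  show "\<bar>pk a z\<bar> \<le> 1 / (1 - cmod a)\<^sup>2" if "cmod a < 1" "cmod z = 1" for z
    using pk_le[OF that] pk_nonneg[OF that(1), of z] by simp
qed

lemma integral_pk:
  assumes "cmod a < 1"
  shows "(LINT \<zeta>|cm. pk a \<zeta>) = 1"
proof -
  note g = integral_cnj_geometric[OF assms]
  define u where "u \<zeta> = Re (1 / (1 - a * cnj \<zeta>))" for \<zeta>
  have u: "integrable cm u" "(LINT \<zeta>|cm. u \<zeta>) = 1"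
    unfolding u_def using integrable_Re[OF g(1)] integral_Re[OF g(1)] g(2) by auto
  have "(LINT \<zeta>|cm. pk a \<zeta>) = (LINT \<zeta>|cm. 2 * u \<zeta> - 1)"
    by (rule integral_cong_AE) (use AE_cm_circle pk_Re[OF assms] u(1) in \<open>auto simp: u_def\<close>)
  also have "\<dots> = 1" using u cm.prob_space by simp
  finally show ?thesis .
qed

text \<open>Partial fractions: on the circle the product of the two kernels is 1 / (1 - v w) times a
  sum of an analytic and an antianalytic function of known mean, plus \<eta> times a function in
  \<open>hb\<close>, whose mean is 0. In effect the Poisson integral reproduces an analytic function
  at w.\<close>

lemma pk_geometric:
  assumes w: "cmod w < 1" and v: "cmod v < 1"
  shows "(LINT \<eta>|cm. of_real (pk w \<eta>) * (1 / (1 - v * \<eta>))) = 1 / (1 - v * w)"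
proof -
  define h where "h \<eta> = 1 / (1 - v * \<eta>)" for \<eta>
  define k where "k \<eta> = cnj w * (1 / (1 - cnj w * \<eta>) * h \<eta>)" for \<eta>
  have w': "cmod (cnj w) < 1" using w by simp
  have h: "h \<in> hb" unfolding h_def[abs_def] by (rule hb_geometric(1)[OF v])
  have k: "k \<in> hb" unfolding k_def[abs_def] by (intro hb_cmult hb_mult h hb_geometric(1)[OF w'])
  have vw: "1 - v * w \<noteq> 0"
  proof
    assume "1 - v * w = 0"
    then have "cmod (v * w) = 1" by (metis eq_iff_diff_eq_0 norm_one)
    moreover have "cmod (v * w) < 1" using mult_strict_mono'[OF v w] by (simp add: norm_mult)
    ultimately show False by simp
  qed
  have eq: "of_real (pk w \<eta>) * h \<eta> = (h \<eta> + (1 / (1 - w * cnj \<eta>) - 1)) / (1 - v * w) + \<eta> * k \<eta>"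
    if e: "cmod \<eta> = 1" for \<eta>
  proof -
    define c where "c = cnj \<eta>"
    have ce: "\<eta> * c = 1" "c * \<eta> = 1" using cnj_mult_circle[OF e] by (auto simp: c_def)
    have d: "1 - v * \<eta> \<noteq> 0" using hb_geometric(3)[OF v e] .
    have d2: "1 - w * c \<noteq> 0" using pk_denom(2)[OF w e] by (simp add: c_def)
    have "(1 - w * c) + ((1 - v * \<eta>) - (1 - w * c) * (1 - v * \<eta>)) = 1 - v * w * (\<eta> * c)" by (simp add: algebra_simps)
    then have x: "(1 - w * c) + ((1 - v * \<eta>) - (1 - w * c) * (1 - v * \<eta>)) = 1 - v * w" using ce by simp
    have "(1 / (1 - v * \<eta>) + (1 / (1 - w * c) - 1)) = ((1 - w * c) + ((1 - v * \<eta>) - (1 - w * c) * (1 - v * \<eta>))) / ((1 - w * c) * (1 - v * \<eta>))"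
    proof -
      have "A \<noteq> 0 \<Longrightarrow> D \<noteq> 0 \<Longrightarrow> 1 / D + (1 / A - 1) = (A + (D - A * D)) / (A * D)" for A D :: complex
        by (simp add: field_simps)
      from this[OF d2 d] show ?thesis .
    qed
    then have "1 / (1 - w * c) * (1 / (1 - v * \<eta>)) = (1 / (1 - v * \<eta>) + (1 / (1 - w * c) - 1)) / (1 - v * w)"
      unfolding x using vw by simp
    then show ?thesis
      unfolding pk_eq[OF w e] by (simp add: h_def k_def c_def algebra_simps)
  qed
  have "(LINT \<eta>|cm. of_real (pk w \<eta>) * h \<eta>) = (LINT \<eta>|cm. (h \<eta> + (1 / (1 - w * cnj \<eta>) - 1)) / (1 - v * w) + \<eta> * k \<eta>)"
    by (rule integral_cong_AE) (use AE_cm_circle eq h k in \<open>auto dest!: hb_measurable\<close>)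
  also have "\<dots> = (LINT \<eta>|cm. (h \<eta> + (1 / (1 - w * cnj \<eta>) - 1)) / (1 - v * w)) + (LINT \<eta>|cm. \<eta> * k \<eta>)"
  proof (rule Bochner_Integration.integral_add)
    show "integrable cm (\<lambda>\<eta>. (h \<eta> + (1 / (1 - w * cnj \<eta>) - 1)) / (1 - v * w))"
      using hb_integrable[OF h] integral_cnj_geometric(1)[OF w] by simp
    show "integrable cm (\<lambda>\<eta>. \<eta> * k \<eta>)" by (rule hb_integrable[OF hb_mult[OF k hb_id]])
  qed
  also have "(LINT \<eta>|cm. \<eta> * k \<eta>) = 0" by (rule H2_mean_id[OF hb_H2[OF k]])
  also have "(LINT \<eta>|cm. (h \<eta> + (1 / (1 - w * cnj \<eta>) - 1)) / (1 - v * w)) = (LINT \<eta>|cm. h \<eta> + (1 / (1 - w * cnj \<eta>) - 1)) / (1 - v * w)"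
    by simp
  also have "(LINT \<eta>|cm. h \<eta> + (1 / (1 - w * cnj \<eta>) - 1)) = 1"
  proof -
    have "(LINT \<eta>|cm. h \<eta>) = 1" unfolding h_def by (rule hb_geometric(2)[OF v])
    then show ?thesis using hb_integrable[OF h] integral_cnj_geometric[OF w] cm.prob_space by simp
  qed
  finally show ?thesis by (simp add: h_def)
qed

text \<open>By \<open>pk_Re\<close> the first kernel is, as a function of \<eta>, twice the real
  part of 1 / (1 - v \<eta>) minus 1, and \<open>pk_geometric\<close> evaluates its Poisson
  integral. Consequently dilation by \<rho>^k is the k-th power of a single operator, the form in
  which an ergodic argument applies.\<close>

lemma pk_semigroup:
  assumes z: "cmod z = 1" "cmod \<zeta> = 1" and r: "0 \<le> r" "r < 1" and s: "0 \<le> s" "s < 1"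
  shows "(LINT \<eta>|cm. pk (of_real s * \<eta>) \<zeta> * pk (of_real r * z) \<eta>) = pk (of_real (r * s) * z) \<zeta>"
proof -
  define w where "w = of_real r * z"
  define v where "v = of_real s * cnj \<zeta>"
  have w: "cmod w < 1" using z r by (simp add: w_def norm_mult)
  have v: "cmod v < 1" using z s by (simp add: v_def norm_mult)
  have rs: "cmod (of_real (r * s) * z) < 1"
    using z r s mult_strict_mono'[of r 1 s 1] by (simp add: norm_mult)
  have h: "integrable cm (\<lambda>\<eta>. of_real (pk w \<eta>) * (1 / (1 - v * \<eta>)))"
  proof (rule Bochner_Integration.integrable_bound)
    show "integrable cm (\<lambda>\<eta>. (1 / (1 - cmod w)\<^sup>2) *\<^sub>R (1 / (1 - v * \<eta>)))"
      by (intro integrable_scaleR_right hb_integrable hb_geometric v)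
    show "AE \<eta> in cm. norm (of_real (pk w \<eta>) * (1 / (1 - v * \<eta>))) \<le> norm ((1 / (1 - cmod w)\<^sup>2) *\<^sub>R (1 / (1 - v * \<eta>)))"
      using AE_cm_circle
    proof eventually_elim
      case (elim \<eta>)
      have "\<bar>pk w \<eta>\<bar> \<le> 1 / (1 - cmod w)\<^sup>2" using pk_le[OF w elim] pk_nonneg[OF w, of \<eta>] by simp
      then show ?case by (simp only: norm_mult norm_scaleR norm_of_real abs_divide abs_power2 abs_one) (rule mult_right_mono, simp_all)
    qed
  qed measurable
  have "(LINT \<eta>|cm. pk (of_real s * \<eta>) \<zeta> * pk w \<eta>) = (LINT \<eta>|cm. 2 * Re (of_real (pk w \<eta>) * (1 / (1 - v * \<eta>))) - pk w \<eta>)"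
  proof (rule integral_cong_AE)
    show "AE \<eta> in cm. pk (of_real s * \<eta>) \<zeta> * pk w \<eta> = 2 * Re (of_real (pk w \<eta>) * (1 / (1 - v * \<eta>))) - pk w \<eta>"
      using AE_cm_circle
    proof eventually_elim
      case (elim \<eta>)
      have "cmod (of_real s * \<eta>) < 1" using elim s by (simp add: norm_mult)
      from pk_Re[OF this z(2)] have "pk (of_real s * \<eta>) \<zeta> = 2 * Re (1 / (1 - v * \<eta>)) - 1" by (simp add: v_def mult_ac)
      then show ?case by (simp only: Re_complex_of_real times_complex.sel Im_complex_of_real) (simp add: algebra_simps)
    qed
  qed measurable
  also have "\<dots> = 2 * (LINT \<eta>|cm. Re (of_real (pk w \<eta>) * (1 / (1 - v * \<eta>)))) - (LINT \<eta>|cm. pk w \<eta>)"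
    using integrable_Re[OF h] cb_integrable[OF cb_pk[OF w]]
    by (subst Bochner_Integration.integral_diff) (auto simp del: times_complex.sel)
  also have "(LINT \<eta>|cm. Re (of_real (pk w \<eta>) * (1 / (1 - v * \<eta>)))) = Re (1 / (1 - v * w))"
    using integral_Re[OF h] pk_geometric[OF w v] by simp
  also have "2 * Re (1 / (1 - v * w)) - (LINT \<eta>|cm. pk w \<eta>) = pk (of_real (r * s) * z) \<zeta>"
    using pk_Re[OF rs z(2)] integral_pk[OF w] by (simp add: v_def w_def mult_ac)
  finally show ?thesis by (simp add: w_def)
qed

lemma cm_Fubini:
  fixes f :: "complex \<Rightarrow> complex \<Rightarrow> real"
  assumes [measurable]: "case_prod f \<in> borel_measurable (cm \<Otimes>\<^sub>M cm)"
    and bd: "\<And>x y. cmod x = 1 \<Longrightarrow> cmod y = 1 \<Longrightarrow> \<bar>f x y\<bar> \<le> C"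
  shows "(LINT y|cm. LINT x|cm. f x y) = (LINT x|cm. LINT y|cm. f x y)"
proof -
  interpret P: pair_prob_space cm cm ..
  have "AE p in cm \<Otimes>\<^sub>M cm. cmod (fst p) = 1 \<and> cmod (snd p) = 1"
  proof (rule P.AE_pair_measure)
    show "AE x in cm. AE y in cm. cmod (fst (x, y)) = 1 \<and> cmod (snd (x, y)) = 1"
      using AE_cm_circle by simp
  qed measurable
  then have "AE p in cm \<Otimes>\<^sub>M cm. norm (case_prod f p) \<le> C"
    by eventually_elim (use bd in \<open>auto split: prod.splits\<close>)
  then have "integrable (cm \<Otimes>\<^sub>M cm) (case_prod f)"
    by (intro P.integrable_const_bound[where B = C]) auto
  then show ?thesis by (rule P.Fubini_integral)
qed

lemma measurable_pois [measurable]: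
  assumes [measurable]: "g \<in> borel_measurable cm" "f \<in> borel_measurable cm"
  shows "(\<lambda>z. pois g (f z)) \<in> borel_measurable cm"
  unfolding pois_def by measurable

lemma pois_integrable: "cb C g \<Longrightarrow> cmod a < 1 \<Longrightarrow> integrable cm (\<lambda>\<zeta>. g \<zeta> * pk a \<zeta>)"
  using cb_integrable[OF cb_mult[OF _ cb_pk]] .

lemma pois_mono:
  assumes "cb C f" "cb D g" "cmod a < 1" "\<And>z. cmod z = 1 \<Longrightarrow> f z \<le> g z"
  shows "pois f a \<le> pois g a"
  unfolding pois_def
proof (rule integral_mono_AE)
  show "AE z in cm. f z * pk a z \<le> g z * pk a z"
    using AE_cm_circle by eventually_elim (use assms pk_nonneg in \<open>auto intro!: mult_right_mono\<close>)
qed (use assms pois_integrable in auto)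

lemma pois_const: "cmod a < 1 \<Longrightarrow> pois (\<lambda>_. c) a = c"
  by (simp add: pois_def integral_pk)

lemma pois_add: "cb C f \<Longrightarrow> cb D g \<Longrightarrow> cmod a < 1 \<Longrightarrow> pois (\<lambda>z. f z + g z) a = pois f a + pois g a"
  unfolding pois_def using pois_integrable by (simp add: distrib_right)

lemma pois_cong:
  assumes [measurable]: "f \<in> borel_measurable cm" "g \<in> borel_measurable cm"
    and "\<And>z. cmod z = 1 \<Longrightarrow> f z = g z"
  shows "pois f a = pois g a"
  unfolding pois_def by (rule integral_cong_AE) (use AE_cm_circle assms(3) in auto)

lemma cb_const: "cb \<bar>c\<bar> (\<lambda>_. c)" by (simp add: cb_def)

lemma cb_add: "cb C f \<Longrightarrow> cb D g \<Longrightarrow> cb (C + D) (\<lambda>z. f z + g z)"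
  unfolding cb_def by force

lemma pois_abs_le:
  assumes "cb C g" "cmod a < 1"
  shows "\<bar>pois g a\<bar> \<le> C"
proof -
  have 1: "g z \<le> C" "- C \<le> g z" if "cmod z = 1" for z using assms(1) that by (auto simp: cb_def abs_le_iff)
  have "pois g a \<le> pois (\<lambda>_. C) a" by (rule pois_mono[OF assms(1) cb_const assms(2) 1(1)])
  moreover have "pois (\<lambda>_. - C) a \<le> pois g a" by (rule pois_mono[OF cb_const assms(1,2) 1(2)])
  ultimately show ?thesis using pois_const[OF assms(2)] by simp
qed

lemma cmod_of_real_circle: "0 \<le> r \<Longrightarrow> r < 1 \<Longrightarrow> cmod z = 1 \<Longrightarrow> cmod (of_real r * z) < 1"
  by (simp add: norm_mult)

lemma cb_pois:
  assumes g: "cb C g" and r: "0 \<le> r" "r < 1"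
  shows "cb C (\<lambda>z. pois g (of_real r * z))"
proof -
  have [measurable]: "g \<in> borel_measurable cm" using g by (rule cb_measurable)
  show ?thesis unfolding cb_def using pois_abs_le[OF g cmod_of_real_circle[OF r]] by auto
qed

lemma pois_semigroup:
  assumes g: "cb C g" and z: "cmod z = 1" and r: "0 \<le> r" "r < 1" and s: "0 \<le> s" "s < 1"
  shows "pois (\<lambda>\<eta>. pois g (of_real s * \<eta>)) (of_real r * z) = pois g (of_real (r * s) * z)"
proof -
  have [measurable]: "g \<in> borel_measurable cm" using g by (rule cb_measurable)
  define f where "f \<zeta> \<eta> = g \<zeta> * (pk (of_real s * \<eta>) \<zeta> * pk (of_real r * z) \<eta>)" for \<zeta> \<eta>
  have "(LINT \<eta>|cm. LINT \<zeta>|cm. f \<zeta> \<eta>) = (LINT \<zeta>|cm. LINT \<eta>|cm. f \<zeta> \<eta>)"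
  proof (rule cm_Fubini)
    show "case_prod f \<in> borel_measurable (cm \<Otimes>\<^sub>M cm)" unfolding f_def by measurable
    fix x y :: complex assume x: "cmod x = 1" and y: "cmod y = 1"
    have "\<bar>g x\<bar> \<le> C" using g x by (simp add: cb_def)
    moreover have "\<bar>pk (of_real s * y) x\<bar> \<le> 1 / (1 - s)\<^sup>2"
      using pk_le[OF cmod_of_real_circle[OF s y] x] pk_nonneg[OF cmod_of_real_circle[OF s y], of x] y s by (simp add: norm_mult)
    moreover have "\<bar>pk (of_real r * z) y\<bar> \<le> 1 / (1 - r)\<^sup>2"
      using pk_le[OF cmod_of_real_circle[OF r z] y] pk_nonneg[OF cmod_of_real_circle[OF r z], of y] z r by (simp add: norm_mult)
    ultimately show "\<bar>f x y\<bar> \<le> C * (1 / (1 - s)\<^sup>2 * (1 / (1 - r)\<^sup>2))"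
      unfolding f_def abs_mult by (intro mult_mono) auto
  qed
  moreover have "(LINT \<eta>|cm. LINT \<zeta>|cm. f \<zeta> \<eta>) = pois (\<lambda>\<eta>. pois g (of_real s * \<eta>)) (of_real r * z)"
    unfolding f_def pois_def by (simp add: mult.assoc[symmetric])
  moreover have "(LINT \<zeta>|cm. LINT \<eta>|cm. f \<zeta> \<eta>) = (LINT \<zeta>|cm. g \<zeta> * pk (of_real (r * s) * z) \<zeta>)"
  proof (rule integral_cong_AE)
    show "AE \<zeta> in cm. (LINT \<eta>|cm. f \<zeta> \<eta>) = g \<zeta> * pk (of_real (r * s) * z) \<zeta>"
      using AE_cm_circle
    proof eventually_elim
      case (elim \<zeta>)
      show ?case unfolding f_def using pk_semigroup[OF z elim r s] by simp
    qed
  qed (unfold f_def, measurable)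
  ultimately show ?thesis by (simp add: pois_def)
qed

text \<open>By \<open>pk_swap\<close> the kernel has mass 1 in its first variable as well, so Fubini
  gives the equality. Garsia's argument rests on it.\<close>

lemma integral_pois:
  assumes g: "cb C g" and r: "0 \<le> r" "r < 1"
  shows "(LINT z|cm. pois g (of_real r * z)) = (LINT z|cm. g z)"
proof -
  have [measurable]: "g \<in> borel_measurable cm" using g by (rule cb_measurable)
  define f where "f \<zeta> z = g \<zeta> * pk (of_real r * z) \<zeta>" for \<zeta> z
  have "(LINT z|cm. LINT \<zeta>|cm. f \<zeta> z) = (LINT \<zeta>|cm. LINT z|cm. f \<zeta> z)"
  proof (rule cm_Fubini)
    show "case_prod f \<in> borel_measurable (cm \<Otimes>\<^sub>M cm)" unfolding f_def by measurable
    fix x y :: complex assume x: "cmod x = 1" and y: "cmod y = 1"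
    have "\<bar>g x\<bar> \<le> C" using g x by (simp add: cb_def)
    moreover have "\<bar>pk (of_real r * y) x\<bar> \<le> 1 / (1 - r)\<^sup>2"
      using pk_le[OF cmod_of_real_circle[OF r y] x] pk_nonneg[OF cmod_of_real_circle[OF r y], of x] y r by (simp add: norm_mult)
    ultimately show "\<bar>f x y\<bar> \<le> C * (1 / (1 - r)\<^sup>2)"
      unfolding f_def abs_mult by (intro mult_mono) auto
  qed
  moreover have "(LINT \<zeta>|cm. LINT z|cm. f \<zeta> z) = (LINT \<zeta>|cm. g \<zeta>)"
  proof (rule integral_cong_AE)
    show "AE \<zeta> in cm. (LINT z|cm. f \<zeta> z) = g \<zeta>"
      using AE_cm_circle
    proof eventually_elim
      case (elim \<zeta>)
      have "(LINT z|cm. pk (of_real r * z) \<zeta>) = (LINT z|cm. pk (of_real r * \<zeta>) z)"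
        by (rule integral_cong_AE) (use AE_cm_circle pk_swap[OF _ elim] in auto)
      then show ?case unfolding f_def using integral_pk[OF cmod_of_real_circle[OF r elim]] by simp
    qed
  qed (unfold f_def, measurable)
  ultimately show ?thesis by (simp add: pois_def f_def)
qed

subsection \<open>The maximal inequality\<close>

text \<open>(1 - y^k) / k is (1 - y) times the mean of the first k powers of y, and these powers
  decrease.\<close>

lemma poisson_ratio_power:
  fixes y :: real
  assumes "0 \<le> y" "y < 1" "k \<le> K"
  shows "real k * (1 - y ^ K) \<le> real K * (1 - y ^ k)"
  using assms(3)
proof (induction K rule: dec_induct)
  case (step K)
  have "real k * y ^ K = (\<Sum>i<k. y ^ K)" by simp
  also have "\<dots> \<le> (\<Sum>i<k. y ^ i)"
    using assms step by (intro sum_mono power_decreasing) auto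
  finally have "(1 - y) * (real k * y ^ K) \<le> 1 - y ^ k"
    using assms by (subst one_diff_power_eq) (auto intro!: mult_left_mono)
  moreover have "real k * (1 - y ^ Suc K) = real k * (1 - y ^ K) + (1 - y) * (real k * y ^ K)"
    by (simp add: algebra_simps)
  ultimately show ?case using step by (simp add: algebra_simps)
qed simp

text \<open>With u = z cnj \<zeta>, |1 - s u| <= |1 - r u| + (s - r) <= 3 |1 - r u|, because s - r
  is below 1 - r <= |1 - r u|. Squaring gives the 9; c compares the numerators.\<close>

lemma pk_compare:
  assumes z: "cmod z = 1" "cmod \<zeta> = 1" and rs: "0 \<le> r" "r \<le> s" "s < 1" and c: "0 \<le> c" "c * (1 - r\<^sup>2) \<le> 1 - s\<^sup>2"
  shows "c / 9 * pk (of_real r * z) \<zeta> \<le> pk (of_real s * z) \<zeta>"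
proof -
  define u where "u = z * cnj \<zeta>"
  have u: "cmod u = 1" using z by (simp add: u_def norm_mult)
  have e: "pk (of_real t * z) \<zeta> = (1 - t\<^sup>2) / (cmod (1 - of_real t * u))\<^sup>2" if "0 \<le> t" for t
    using z that by (simp add: pk_def u_def norm_mult mult_ac)
  define A B where "A = cmod (1 - of_real r * u)" and "B = cmod (1 - of_real s * u)"
  have A1: "1 - r \<le> A"
    using norm_triangle_ineq2[of 1 "of_real r * u"] u rs by (simp add: A_def norm_mult)
  have B1: "1 - s \<le> B"
    using norm_triangle_ineq2[of 1 "of_real s * u"] u rs by (simp add: B_def norm_mult)
  have "1 - of_real s * u = (1 - of_real r * u) - of_real (s - r) * u" by (simp add: algebra_simps)
  then have "B \<le> A + cmod (of_real (s - r) * u)" unfolding A_def B_def by (metis norm_triangle_ineq4)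
  also have "cmod (of_real (s - r) * u) = s - r" using u rs by (simp only: norm_mult norm_of_real) simp
  finally have BA: "B \<le> 3 * A" using A1 rs by linarith
  have "0 < A" "0 < B" using A1 B1 rs by auto
  have r1: "r\<^sup>2 \<le> 1" using rs by (simp add: power_le_one)
  have "c / 9 * ((1 - r\<^sup>2) / A\<^sup>2) = c * (1 - r\<^sup>2) / (3 * A)\<^sup>2" by (simp add: power_mult_distrib)
  also have "\<dots> \<le> c * (1 - r\<^sup>2) / B\<^sup>2"
    using BA \<open>0 < B\<close> \<open>0 < A\<close> c r1 by (intro divide_left_mono power_mono mult_nonneg_nonneg) auto
  also have "\<dots> \<le> (1 - s\<^sup>2) / B\<^sup>2" using c by (intro divide_right_mono) auto
  finally show ?thesis using e[of r] e[of s] rs by (simp add: A_def B_def)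
qed

lemma pois_compare:
  assumes g: "cb C g" "\<And>z. cmod z = 1 \<Longrightarrow> 0 \<le> g z"
    and z: "cmod z = 1" and rs: "0 \<le> r" "r \<le> s" "s < 1" and c: "0 \<le> c" "c * (1 - r\<^sup>2) \<le> 1 - s\<^sup>2"
  shows "c / 9 * pois g (of_real r * z) \<le> pois g (of_real s * z)"
proof -
  have rr: "cmod (of_real r * z) < 1" and ss: "cmod (of_real s * z) < 1"
    using cmod_of_real_circle[of r z] cmod_of_real_circle[of s z] rs z by auto
  have "c / 9 * pois g (of_real r * z) = (LINT \<zeta>|cm. c / 9 * (g \<zeta> * pk (of_real r * z) \<zeta>))"
    by (simp add: pois_def)
  also have "\<dots> \<le> (LINT \<zeta>|cm. g \<zeta> * pk (of_real s * z) \<zeta>)"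
  proof (rule integral_mono_AE)
    show "AE \<zeta> in cm. c / 9 * (g \<zeta> * pk (of_real r * z) \<zeta>) \<le> g \<zeta> * pk (of_real s * z) \<zeta>"
      using AE_cm_circle
    proof eventually_elim
      case (elim \<zeta>)
      show ?case using mult_left_mono[OF pk_compare[OF z elim rs c] g(2)[OF elim]] by (simp add: mult_ac)
    qed
  qed (intro integrable_mult_right pois_integrable[OF g(1)] rr ss)+
  finally show ?thesis by (simp add: pois_def)
qed

text \<open>Garsia's proof of the maximal ergodic inequality, for the Poisson operator.\<close>

context
  fixes \<rho> :: real and h :: "complex \<Rightarrow> real" and C :: real
  assumes \<rho>: "0 \<le> \<rho>" "\<rho> < 1" and h: "cb C h"
begin

text \<open>With P the Poisson operator of radius \<rho>, \<open>esum k\<close> is h + P h + ... +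
  P^(k-1) h, built by applying P to the whole previous sum, as the maximal argument
  requires.\<close>

fun esum :: "nat \<Rightarrow> complex \<Rightarrow> real" where
  "esum 0 = (\<lambda>z. 0)"
| "esum (Suc k) = (\<lambda>z. h z + pois (esum k) (of_real \<rho> * z))"

fun emax :: "nat \<Rightarrow> complex \<Rightarrow> real" where
  "emax 0 = (\<lambda>z. 0)"
| "emax (Suc k) = (\<lambda>z. max (emax k z) (esum (Suc k) z))"

declare esum.simps(2) [simp del]

lemma cb_esum: "\<exists>D. cb D (esum k)"
proof (induction k)
  case 0
  show ?case using cb_const[of 0] by auto
next
  case (Suc k)
  then obtain D where "cb D (esum k)" by blast
  from cb_add[OF h cb_pois[OF this \<rho>]] show ?case unfolding esum.simps by blast
qed

lemma cb_emax: "\<exists>D. cb D (emax k)"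
proof (induction k)
  case 0
  show ?case using cb_const[of 0] by auto
next
  case (Suc k)
  then obtain D where D: "cb D (emax k)" by blast
  obtain E where E: "cb E (esum (Suc k))" using cb_esum by blast
  have "cb (max D E) (emax (Suc k))" unfolding cb_def
  proof (intro conjI allI impI)
    have [measurable]: "emax k \<in> borel_measurable cm" "esum (Suc k) \<in> borel_measurable cm"
      using D E by (auto simp: cb_def)
    show "emax (Suc k) \<in> borel_measurable cm" unfolding emax.simps by measurable
    show "\<bar>emax (Suc k) z\<bar> \<le> max D E" if "cmod z = 1" for z
    proof -
      have "\<bar>emax k z\<bar> \<le> D" "\<bar>esum (Suc k) z\<bar> \<le> E" using D E that by (auto simp: cb_def)
      then show ?thesis unfolding emax.simps by linarith
    qed
  qed
  then show ?case by blast
qed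

lemma emax_nonneg: "0 \<le> emax K z"
  by (induction K) auto

lemma esum_le_emax: "k \<le> K \<Longrightarrow> esum k z \<le> emax K z"
proof (induction K)
  case (Suc K)
  then show ?case by (cases "k = Suc K") auto
qed simp

lemma emax_pos: "emax K z > 0 \<Longrightarrow> \<exists>k<K. emax K z = esum (Suc k) z"
proof (induction K)
  case (Suc K)
  show ?case
  proof (cases "emax K z \<ge> esum (Suc K) z")
    case True
    then have "emax (Suc K) z = emax K z" by simp
    with Suc show ?thesis using less_SucI by metis
  next
    case False
    then have "emax (Suc K) z = esum (Suc K) z" by simp
    then show ?thesis by blast
  qed
qed simp

text \<open>Where \<open>emax K\<close> is positive it equals some \<open>esum (Suc k)\<close> with
  k < K, that is h plus the Poisson integral of \<open>esum k\<close>, and so is at most h plus the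
  Poisson integral of \<open>emax K\<close>; elsewhere it is 0 and that Poisson integral is
  nonnegative. On integration \<open>emax K\<close> cancels, since the operator preserves
  integrals.\<close>

lemma maximal_ergodic: "0 \<le> (LINT z|cm. indicator {z. emax K z > 0} z * h z)"
proof -
  obtain D where D: "cb D (emax K)" using cb_emax by blast
  have [measurable]: "emax K \<in> borel_measurable cm" "h \<in> borel_measurable cm"
    using D h by (auto simp: cb_def)
  have iT: "cb D (\<lambda>z. pois (emax K) (of_real \<rho> * z))" by (rule cb_pois[OF D \<rho>])
  have "0 = (LINT z|cm. emax K z - pois (emax K) (of_real \<rho> * z))"
    using integral_pois[OF D \<rho>] cb_integrable[OF D] cb_integrable[OF iT] by simp
  also have "\<dots> \<le> (LINT z|cm. indicator {z. emax K z > 0} z * h z)"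
  proof (rule integral_mono_AE)
    show "integrable cm (\<lambda>z. emax K z - pois (emax K) (of_real \<rho> * z))"
      using cb_integrable[OF D] cb_integrable[OF iT] by simp
    show "integrable cm (\<lambda>z. indicator {z. emax K z > 0} z * h z)"
      by (rule Bochner_Integration.integrable_bound[OF cb_integrable[OF h]]) (auto split: split_indicator)
    show "AE z in cm. emax K z - pois (emax K) (of_real \<rho> * z) \<le> indicator {z. emax K z > 0} z * h z"
      using AE_cm_circle
    proof eventually_elim
      case (elim z)
      have rz: "cmod (of_real \<rho> * z) < 1" by (rule cmod_of_real_circle[OF \<rho> elim])
      show ?case
      proof (cases "emax K z > 0")
        case True
        then obtain k where k: "k < K" "emax K z = esum (Suc k) z" using emax_pos by blast
        obtain E where E: "cb E (esum k)" using cb_esum by blast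
        have "pois (esum k) (of_real \<rho> * z) \<le> pois (emax K) (of_real \<rho> * z)"
          by (rule pois_mono[OF E D rz]) (use k esum_le_emax in auto)
        then show ?thesis using k True by (simp add: esum.simps)
      next
        case False
        then have "emax K z = 0" using emax_nonneg[of K z] by simp
        moreover have "0 \<le> pois (emax K) (of_real \<rho> * z)"
          using pois_mono[OF cb_const D rz, of 0] emax_nonneg pois_const[OF rz, of 0] by simp
        ultimately show ?thesis by simp
      qed
    qed
  qed
  finally show ?thesis .
qed

end

text \<open>The semigroup law turns powers of the Poisson operator into dilations. Since h already
  contains one application of it, the radii in the sum start at \<rho>, which is below 1.\<close>

lemma esum_pois:
  assumes \<rho>: "0 \<le> \<rho>" "\<rho> < 1" and g: "cb C g" and z: "cmod z = 1"
  shows "esum \<rho> (\<lambda>z. pois g (of_real \<rho> * z) - c) k z = (\<Sum>i=1..k. pois g (of_real (\<rho> ^ i) * z)) - real k * c"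
  using z
proof (induction k arbitrary: z)
  case (Suc k)
  note z1 = Suc.prems
  have h: "cb (C + \<bar>c\<bar>) (\<lambda>z. pois g (of_real \<rho> * z) - c)"
    using cb_add[OF cb_pois[OF g \<rho>] cb_const[of "- c"]] by simp
  have rz: "cmod (of_real \<rho> * z) < 1" by (rule cmod_of_real_circle[OF \<rho> Suc.prems])
  have r: "0 \<le> \<rho> ^ i" "\<rho> ^ Suc i < 1" for i
    using \<rho> power_Suc_le_self[of \<rho> i] by (auto simp del: power_Suc)
  have c: "cb C (\<lambda>z. pois g (of_real (\<rho> ^ i) * z))" if "1 \<le> i" for i
    using that r[of "i - 1"] r[of i] by (intro cb_pois[OF g]) auto
  have cs: "\<exists>D. cb D (\<lambda>z. \<Sum>i=1..k. pois g (of_real (\<rho> ^ i) * z))" for k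
  proof (induction k)
    case 0
    show ?case using cb_const[of 0] by auto
  next
    case (Suc k)
    then obtain D where "cb D (\<lambda>z. \<Sum>i=1..k. pois g (of_real (\<rho> ^ i) * z))" by blast
    from cb_add[OF this c[of "Suc k"]] show ?case by auto
  qed
  have sum: "pois (\<lambda>z. \<Sum>i=1..k. pois g (of_real (\<rho> ^ i) * z)) (of_real \<rho> * z) = (\<Sum>i=1..k. pois g (of_real (\<rho> ^ Suc i) * z))" for k
  proof (induction k)
    case 0
    show ?case using pois_const[OF rz, of 0] by simp
  next
    case (Suc k)
    obtain D where D: "cb D (\<lambda>z. \<Sum>i=1..k. pois g (of_real (\<rho> ^ i) * z))" using cs by blast
    have "pois (\<lambda>\<eta>. pois g (of_real (\<rho> ^ Suc k) * \<eta>)) (of_real \<rho> * z) = pois g (of_real (\<rho> * \<rho> ^ Suc k) * z)"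
      by (rule pois_semigroup[OF g z1 \<rho>]) (use r[of k] r[of "Suc k"] in auto)
    with pois_add[OF D c[of "Suc k"] rz] Suc.IH show ?case by (simp del: of_real_power of_real_mult power_Suc add: power_Suc[symmetric])
  qed
  obtain D where D: "cb D (\<lambda>z. \<Sum>i=1..k. pois g (of_real (\<rho> ^ i) * z))" using cs by blast
  have "pois (esum \<rho> (\<lambda>z. pois g (of_real \<rho> * z) - c) k) (of_real \<rho> * z)
      = pois (\<lambda>z. (\<Sum>i=1..k. pois g (of_real (\<rho> ^ i) * z)) + - (real k * c)) (of_real \<rho> * z)"
  proof (rule pois_cong)
    show "esum \<rho> (\<lambda>z. pois g (of_real \<rho> * z) - c) k \<in> borel_measurable cm"
      using cb_esum[OF \<rho> h] cb_measurable by blast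
    have [measurable]: "(\<lambda>z. \<Sum>i=1..k. pois g (of_real (\<rho> ^ i) * z)) \<in> borel_measurable cm" using D by (rule cb_measurable)
    show "(\<lambda>x. (\<Sum>i=1..k. pois g (of_real (\<rho> ^ i) * x)) + - (real k * c)) \<in> borel_measurable cm"
      by measurable
  qed (simp add: Suc.IH)
  also have "\<dots> = (\<Sum>i=1..k. pois g (of_real (\<rho> ^ Suc i) * z)) - real k * c"
    unfolding pois_add[OF D cb_const rz] sum pois_const[OF rz] by simp
  finally have "esum \<rho> (\<lambda>z. pois g (of_real \<rho> * z) - c) (Suc k) z
     = pois g (of_real (\<rho> ^ Suc 0) * z) + (\<Sum>i=1..k. pois g (of_real (\<rho> ^ Suc i) * z)) - real (Suc k) * c"
    unfolding esum.simps(2)[OF \<rho> h] by (simp add: algebra_simps)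
  also have "pois g (of_real (\<rho> ^ Suc 0) * z) + (\<Sum>i=1..k. pois g (of_real (\<rho> ^ Suc i) * z)) = (\<Sum>i=1..Suc k. pois g (of_real (\<rho> ^ i) * z))"
    using sum.atLeast_Suc_atMost[of 1 "Suc k" "\<lambda>i. pois g (of_real (\<rho> ^ i) * z)"]
      sum.shift_bounds_cl_Suc_ivl[of "\<lambda>i. pois g (of_real (\<rho> ^ i) * z)" 1 k] by simp
  finally show ?case .
next
  case 0
  have h: "cb (C + \<bar>c\<bar>) (\<lambda>z. pois g (of_real \<rho> * z) - c)"
    using cb_add[OF cb_pois[OF g \<rho>] cb_const[of "- c"]] by simp
  show ?case by (simp add: esum.simps(1)[OF \<rho> h])
qed

text \<open>If the value P at radius \<rho>^N exceeds 18 c, then by comparison the value at \<rho>^i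
  is at least i / (9 N) P for 1 <= i <= N. These bounds add up to (N + 1) / 18 P > N c, so an
  ergodic sum is positive at z, and \<open>maximal_ergodic\<close> bounds the measure of the set of
  such points.\<close>

lemma poisson_maximal_step:
  assumes g: "cb C g" "\<And>z. cmod z = 1 \<Longrightarrow> 0 \<le> g z" and \<rho>: "0 \<le> \<rho>" "\<rho> < 1" and c: "0 < c"
  shows "measure cm {z. cmod z = 1 \<and> (\<exists>K. pois g (of_real (\<rho> ^ Suc K) * z) > 18 * c)} \<le> (LINT z|cm. g z) / c"
proof -
  have [measurable]: "g \<in> borel_measurable cm" using g by (simp add: cb_def)
  define h where "h z = pois g (of_real \<rho> * z) - c" for z
  have h: "cb (C + \<bar>c\<bar>) h" unfolding h_def
    using cb_add[OF cb_pois[OF g(1) \<rho>] cb_const[of "- c"]] by simp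
  have mE: "emax \<rho> h K \<in> borel_measurable cm" for K using cb_emax[OF \<rho> h, of K] by (auto simp: cb_def)
  note [measurable] = mE
  define E where "E K = {z. emax \<rho> h K z > 0}" for K
  have Em[measurable]: "E K \<in> sets cm" for K
    unfolding E_def using measurable_sets_borel[of "emax \<rho> h K"] by measurable
  have iT: "cb C (\<lambda>z. pois g (of_real \<rho> * z))" by (rule cb_pois[OF g(1) \<rho>])
  have T0: "0 \<le> pois g (of_real r * z)" if "cmod z = 1" "0 \<le> r" "r < 1" for z r
    using pois_mono[OF cb_const g(1) cmod_of_real_circle[OF that(2,3,1)], of 0] g(2) pois_const[OF cmod_of_real_circle[OF that(2,3,1)], of 0] by simp
  have mono: "E K \<subseteq> E (Suc K)" for K unfolding E_def by (auto simp: emax.simps(2)[OF \<rho> h] less_max_iff_disj)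
  have Ele: "measure cm (E K) \<le> (LINT z|cm. g z) / c" for K
  proof -
    have i1: "integrable cm (\<lambda>z. indicator (E K) z * pois g (of_real \<rho> * z))"
      by (rule Bochner_Integration.integrable_bound[OF cb_integrable[OF iT]]) (auto split: split_indicator)
    have i2: "integrable cm (\<lambda>z. indicator (E K) z * c)"
      by (rule cm.integrable_const_bound[of _ c]) (use c in \<open>auto split: split_indicator\<close>)
    have "0 \<le> (LINT z|cm. indicator (E K) z * h z)"
      unfolding E_def by (rule maximal_ergodic[OF \<rho> h])
    also have "\<dots> = (LINT z|cm. indicator (E K) z * pois g (of_real \<rho> * z)) - (LINT z|cm. indicator (E K) z * c)"
      unfolding h_def right_diff_distrib by (rule Bochner_Integration.integral_diff[OF i1 i2])
    also have "(LINT z|cm. indicator (E K) z * pois g (of_real \<rho> * z)) \<le> (LINT z|cm. pois g (of_real \<rho> * z))"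
    proof (rule integral_mono_AE[OF i1 cb_integrable[OF iT]])
      show "AE z in cm. indicator (E K) z * pois g (of_real \<rho> * z) \<le> pois g (of_real \<rho> * z)"
        using AE_cm_circle by eventually_elim (use T0[OF _ \<rho>] in \<open>auto split: split_indicator\<close>)
    qed
    also have "(LINT z|cm. pois g (of_real \<rho> * z)) = (LINT z|cm. g z)" by (rule integral_pois[OF g(1) \<rho>])
    also have "(LINT z|cm. indicator (E K) z * c) = measure cm (E K) * c" by simp
    finally show ?thesis using c by (simp add: field_simps)
  qed
  have "(\<lambda>K. measure cm (E K)) \<longlonglongrightarrow> measure cm (\<Union>K. E K)"
    by (rule cm.finite_Lim_measure_incseq) (use mono Em in \<open>auto intro!: incseq_SucI\<close>)
  then have U: "measure cm (\<Union>K. E K) \<le> (LINT z|cm. g z) / c"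
    by (rule LIMSEQ_le_const2) (use Ele in auto)
  have "{z. cmod z = 1 \<and> (\<exists>K. pois g (of_real (\<rho> ^ Suc K) * z) > 18 * c)} \<subseteq> (\<Union>K. E K)"
  proof clarify
    fix z K assume z: "cmod z = 1" and gt: "18 * c < pois g (of_real (\<rho> ^ Suc K) * z)"
    define N where "N = Suc K"
    define P where "P = pois g (of_real (\<rho> ^ N) * z)"
    have le: "real i / (9 * real N) * P \<le> pois g (of_real (\<rho> ^ i) * z)" if i: "i \<in> {1..N}" for i
    proof -
      have "\<rho> ^ i \<le> \<rho>" using i \<rho> power_decreasing[of 1 i \<rho>] by simp
      then have lt: "\<rho> ^ i < 1" using \<rho> by simp
      have y: "0 \<le> \<rho>\<^sup>2" "\<rho>\<^sup>2 < 1" using \<rho> by (auto simp: power_less_one_iff)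
      have "real i * (1 - (\<rho>\<^sup>2) ^ N) \<le> real N * (1 - (\<rho>\<^sup>2) ^ i)"
        by (rule poisson_ratio_power[OF y]) (use i in auto)
      then have "real i / real N * (1 - (\<rho> ^ N)\<^sup>2) \<le> 1 - (\<rho> ^ i)\<^sup>2"
        by (simp add: N_def field_simps power_mult[symmetric] del: of_nat_Suc power_Suc)
      from pois_compare[OF g z _ _ lt _ this] have "real i / real N / 9 * P \<le> pois g (of_real (\<rho> ^ i) * z)"
        unfolding P_def using \<rho> i by (simp add: power_decreasing del: of_real_power)
      then show ?thesis by (simp add: mult.commute)
    qed
    have gauss: "(\<Sum>i=1..N. real i) = real N * (real N + 1) / 2" for N by (induction N) (auto simp: field_simps)
    have P: "P > 18 * c" using gt by (simp add: P_def N_def)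
    have "real N * c < (real N + 1) / 18 * P"
    proof -
      have "real N * c < (real N + 1) * c" using c by simp
      also have "\<dots> \<le> (real N + 1) / 18 * P" using mult_left_mono[of c "P / 18" "real N + 1"] P by simp
      finally show ?thesis .
    qed
    also have "\<dots> = (\<Sum>i=1..N. real i / (9 * real N) * P)"
      unfolding sum_distrib_right[symmetric] sum_divide_distrib[symmetric] gauss by (simp add: N_def field_simps del: of_nat_Suc)
    also have "\<dots> \<le> (\<Sum>i=1..N. pois g (of_real (\<rho> ^ i) * z))" by (rule sum_mono[OF le])
    finally have "0 < esum \<rho> h N z"
      unfolding h_def esum_pois[OF \<rho> g(1) z] by simp
    also have "\<dots> \<le> emax \<rho> h N z" by (rule esum_le_emax[OF \<rho> h]) simp
    finally show "z \<in> (\<Union>K. E K)" unfolding E_def by blast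
  qed
  then have "measure cm {z. cmod z = 1 \<and> (\<exists>K. pois g (of_real (\<rho> ^ Suc K) * z) > 18 * c)} \<le> measure cm (\<Union>K. E K)"
    by (rule cm.finite_measure_mono) measurable
  with U show ?thesis by linarith
qed

text \<open>The radii used are exp (- N / 2^l); as \<open>\<rho> l\<close> is the square of
  \<open>\<rho> (Suc l)\<close>, the exceptional sets increase with l. An arbitrary r is compared
  with such a radius s satisfying r <= s and s^2 <= r, which costs the factor 2 * 9; hence 324 = 18
  * 18.\<close>

lemma poisson_maximal:
  assumes g: "cb C g" "\<And>z. cmod z = 1 \<Longrightarrow> 0 \<le> g z" and c: "0 < c"
  obtains A where "A \<in> sets cm" "measure cm A \<le> (LINT z|cm. g z) / c"
    "\<And>z r. cmod z = 1 \<Longrightarrow> 0 < r \<Longrightarrow> r < 1 \<Longrightarrow> pois g (of_real r * z) > 324 * c \<Longrightarrow> z \<in> A"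
proof
  have [measurable]: "g \<in> borel_measurable cm" using g by (simp add: cb_def)
  define \<rho> :: "nat \<Rightarrow> real" where "\<rho> l = exp (- (1 / 2 ^ l))" for l
  have \<rho>: "0 \<le> \<rho> l" "\<rho> l < 1" for l by (auto simp: \<rho>_def)
  define A where "A l = {z. cmod z = 1 \<and> (\<exists>K. pois g (of_real (\<rho> l ^ Suc K) * z) > 18 * c)}" for l
  have Am[measurable]: "A l \<in> sets cm" for l unfolding A_def by measurable
  have sq: "\<rho> l = \<rho> (Suc l) ^ 2" for l
    by (simp add: \<rho>_def exp_of_nat_mult[symmetric])
  have mono: "A l \<subseteq> A (Suc l)" for l
  proof
    fix z assume "z \<in> A l"
    then obtain K where K: "cmod z = 1" "pois g (of_real (\<rho> l ^ Suc K) * z) > 18 * c" by (auto simp: A_def)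
    have "\<rho> l ^ Suc K = \<rho> (Suc l) ^ Suc (2 * K + 1)" by (simp add: sq[of l] power_mult[symmetric] del: power_Suc) 
    then have "pois g (of_real (\<rho> (Suc l) ^ Suc (2 * K + 1)) * z) > 18 * c" using K(2) by simp
    then show "z \<in> A (Suc l)" using K(1) unfolding A_def by blast
  qed
  show "(\<Union>l. A l) \<in> sets cm" by measurable
  have "(\<lambda>l. measure cm (A l)) \<longlonglongrightarrow> measure cm (\<Union>l. A l)"
    by (rule cm.finite_Lim_measure_incseq) (use mono Am in \<open>auto intro!: incseq_SucI\<close>)
  then show "measure cm (\<Union>l. A l) \<le> (LINT z|cm. g z) / c"
    by (rule LIMSEQ_le_const2) (use poisson_maximal_step[OF g \<rho> c] in \<open>auto simp: A_def\<close>)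
  fix z r assume z: "cmod z = 1" and r: "0 < (r::real)" "r < 1" and gt: "pois g (of_real r * z) > 324 * c"
  define t where "t = - ln r"
  have t: "t > 0" using r by (simp add: t_def)
  have "(\<lambda>l. (1/2::real) ^ l) \<longlonglongrightarrow> 0" by (rule LIMSEQ_power_zero) simp
  from order_tendstoD(2)[OF this, of "t/2"] t obtain l where l: "(1/2) ^ l < t / 2"
    by (auto simp: eventually_sequentially)
  \<comment> \<open>N / 2^l is the largest such fraction not above t = - ln r. Since t 2^l exceeds
    2, it is also at least t / 2, whence s^2 <= r <= s.\<close>
  define N where "N = nat \<lfloor>t * 2 ^ l\<rfloor>"
  have two: "1 / 2 ^ l < t / 2" using l by (simp add: power_one_over)
  have big: "t * 2 ^ l > 2" using two by (simp add: field_simps)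
  have N: "real N \<le> t * 2 ^ l" "t * 2 ^ l < real N + 1" using big by (auto simp: N_def) 
  have N1: "N \<ge> 1" using N big by linarith
  then obtain K where K: "N = Suc K" by (cases N) auto
  define s where "s = \<rho> l ^ N"
  have s_eq: "s = exp (- (real N / 2 ^ l))" by (simp add: s_def \<rho>_def exp_of_nat_mult[symmetric])
  have u: "real N / 2 ^ l \<le> t" "t / 2 \<le> real N / 2 ^ l" "0 < real N / 2 ^ l"
    using N big N1 by (auto simp: field_simps)
  have rt: "r = exp (- t)" using r by (simp add: t_def)
  have rs: "r \<le> s" unfolding s_eq rt using u by simp
  have s1: "s < 1" unfolding s_eq using u by simp
  have "s\<^sup>2 = exp (- (2 * (real N / 2 ^ l)))" unfolding s_eq by (simp add: exp_double[symmetric] power2_eq_square exp_add[symmetric])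
  also have "\<dots> \<le> exp (- t)" unfolding exp_le_cancel_iff using u by linarith
  also have "exp (- t) = r" using rt by simp
  finally have "s\<^sup>2 \<le> r" .
  moreover have "1 - r\<^sup>2 \<le> 2 * (1 - r)"
    using zero_le_power2[of "1 - r"] by (simp add: power2_eq_square algebra_simps)
  ultimately have "1 / 2 * (1 - r\<^sup>2) \<le> 1 - s\<^sup>2" by simp
  from pois_compare[OF g z _ rs s1 _ this] have "1 / 2 / 9 * pois g (of_real r * z) \<le> pois g (of_real s * z)"
    using r by simp
  then have "pois g (of_real s * z) > 18 * c" using gt by linarith
  then have "z \<in> A l" using z unfolding A_def s_def K by blast
  then show "z \<in> (\<Union>l. A l)" by blast
qed

subsection \<open>Boundary values of bounded analytic functions\<close>

text \<open>Cauchy's integral: on the circle d\<zeta> / (2 pi i (\<zeta> - w)) is the normalized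
  measure times 1 / (1 - w cnj \<zeta>).\<close>

definition cauchy :: "(complex \<Rightarrow> complex) \<Rightarrow> complex \<Rightarrow> complex" where
  "cauchy f w = (LINT \<zeta>|cm. f \<zeta> * (1 / (1 - w * cnj \<zeta>)))"

lemma cauchy_kernel_bound:
  assumes "cmod w < 1" "cmod \<zeta> = 1"
  shows "cmod (1 / (1 - w * cnj \<zeta>)) \<le> 1 / (1 - cmod w)"
  using pk_denom[OF assms] assms by (simp add: norm_divide frac_le)

lemma hb_mult_bounded_integrable:
  assumes "f \<in> hb" "g \<in> borel_measurable cm" "AE z in cm. cmod (g z) \<le> C"
  shows "integrable cm (\<lambda>z. f z * g z)"
proof -
  obtain D where D: "AE z in cm. cmod (f z) \<le> D" using assms by (auto simp: hb_def)
  have [measurable]: "f \<in> borel_measurable cm" using assms(1) by (rule hb_measurable)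
  have "AE z in cm. cmod (f z * g z) \<le> \<bar>D\<bar> * \<bar>C\<bar>"
    using D assms(3) by eventually_elim (auto simp: norm_mult intro!: mult_mono)
  then show ?thesis using assms(2) by (intro cm_integrable_bounded) auto
qed

lemma cauchy_integrable:
  assumes "f \<in> hb" "cmod w < 1"
  shows "integrable cm (\<lambda>\<zeta>. f \<zeta> * (1 / (1 - w * cnj \<zeta>)))"
  by (rule hb_mult_bounded_integrable[OF assms(1), of _ "1 / (1 - cmod w)"])
     (use AE_cm_circle cauchy_kernel_bound[OF assms(2)] in auto)

text \<open>Horner's scheme: for the polynomial a + z q the mean of \<zeta> q(\<zeta>) drops out,
  which leaves a plus w times the Cauchy integral of q.\<close>

lemma cauchy_poly: "cmod w < 1 \<Longrightarrow> cauchy (poly p) w = poly p w"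
proof (induction p)
  case 0
  then show ?case by (simp add: cauchy_def)
next
  case (pCons a q)
  note w = pCons.prems
  have i: "integrable cm (\<lambda>\<zeta>. poly q \<zeta> * (1 / (1 - w * cnj \<zeta>)))" by (rule cauchy_integrable[OF hb_poly w])
  have iq: "integrable cm (\<lambda>\<zeta>. \<zeta> * poly q \<zeta>)" by (rule hb_integrable[OF hb_mult[OF hb_poly hb_id]])
  note g = integral_cnj_geometric[OF w]
  have "cauchy (poly (pCons a q)) w = (LINT \<zeta>|cm. a * (1 / (1 - w * cnj \<zeta>)) + (\<zeta> * poly q \<zeta> + w * (poly q \<zeta> * (1 / (1 - w * cnj \<zeta>)))))"
    unfolding cauchy_def
  proof (rule integral_cong_AE)
    show "AE \<zeta> in cm. poly (pCons a q) \<zeta> * (1 / (1 - w * cnj \<zeta>)) = a * (1 / (1 - w * cnj \<zeta>)) + (\<zeta> * poly q \<zeta> + w * (poly q \<zeta> * (1 / (1 - w * cnj \<zeta>))))"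
      using AE_cm_circle
    proof eventually_elim
      case (elim \<zeta>)
      define D where "D = 1 - w * cnj \<zeta>"
      have D: "D \<noteq> 0" using pk_denom(2)[OF w elim] by (simp add: D_def)
      have "\<zeta> * poly q \<zeta> * D = \<zeta> * poly q \<zeta> - w * poly q \<zeta> * (\<zeta> * cnj \<zeta>)" by (simp add: D_def algebra_simps)
      then have "\<zeta> * poly q \<zeta> * D + w * poly q \<zeta> = \<zeta> * poly q \<zeta>" using cnj_mult_circle[OF elim] by simp
      then have "\<zeta> * poly q \<zeta> / D = \<zeta> * poly q \<zeta> + w * poly q \<zeta> / D" using D by (simp add: field_simps)
      then show ?case by (simp add: D_def[symmetric] add_divide_distrib)
    qed
  qed measurable
  also have "\<dots> = a + (0 + w * cauchy (poly q) w)"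
  proof -
    define k where "k \<zeta> = 1 / (1 - w * cnj \<zeta>)" for \<zeta>
    show ?thesis
      unfolding cauchy_def k_def[symmetric]
      using i[folded k_def] iq g[folded k_def] H2_mean_id[OF hb_H2[OF hb_poly[of q]]] by simp
  qed
  finally have *: "cauchy (poly (pCons a q)) w = a + (0 + w * cauchy (poly q) w)" .
  show ?case unfolding * pCons.IH[OF w] by simp
qed

text \<open>The kernels differ by cnj w \<zeta> / (1 - cnj w \<zeta>), whose product with f is
  \<zeta> times a function in \<open>hb\<close> and has mean 0. The Cauchy form is holomorphic in w,
  the Poisson form has a positive kernel and yields bounds.\<close>

lemma cauchy_eq_poisson:
  assumes f: "f \<in> hb" and w: "cmod w < 1"
  shows "cauchy f w = (LINT \<zeta>|cm. f \<zeta> * of_real (pk w \<zeta>))" "integrable cm (\<lambda>\<zeta>. f \<zeta> * of_real (pk w \<zeta>))"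
proof -
  have w': "cmod (cnj w) < 1" using w by simp
  define k where "k \<zeta> = cnj w * (1 / (1 - cnj w * \<zeta>) * f \<zeta>)" for \<zeta>
  have k: "k \<in> hb" unfolding k_def[abs_def] by (intro hb_cmult hb_mult f hb_geometric(1)[OF w'])
  have [measurable]: "f \<in> borel_measurable cm" "k \<in> borel_measurable cm" using f k by (auto dest: hb_measurable)
  have ik: "integrable cm (\<lambda>\<zeta>. \<zeta> * k \<zeta>)" by (rule hb_integrable[OF hb_mult[OF k hb_id]])
  show i: "integrable cm (\<lambda>\<zeta>. f \<zeta> * of_real (pk w \<zeta>))"
  proof (rule hb_mult_bounded_integrable[OF f, of _ "1 / (1 - cmod w)\<^sup>2"])
    show "AE z in cm. cmod (of_real (pk w z)) \<le> 1 / (1 - cmod w)\<^sup>2"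
      using AE_cm_circle by eventually_elim (use pk_le[OF w] pk_nonneg[OF w] in auto)
  qed measurable
  have "(LINT \<zeta>|cm. f \<zeta> * of_real (pk w \<zeta>)) = (LINT \<zeta>|cm. f \<zeta> * (1 / (1 - w * cnj \<zeta>)) + \<zeta> * k \<zeta>)"
  proof (rule integral_cong_AE)
    show "AE \<zeta> in cm. f \<zeta> * of_real (pk w \<zeta>) = f \<zeta> * (1 / (1 - w * cnj \<zeta>)) + \<zeta> * k \<zeta>"
      using AE_cm_circle by eventually_elim (simp add: pk_eq[OF w] k_def algebra_simps)
  qed measurable
  also have "\<dots> = cauchy f w"
    using cauchy_integrable[OF f w] ik H2_mean_id[OF hb_H2[OF k]] by (simp add: cauchy_def)
  finally show "cauchy f w = (LINT \<zeta>|cm. f \<zeta> * of_real (pk w \<zeta>))" by simp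
qed

lemma cauchy_bound:
  assumes f: "f \<in> hb" and w: "cmod w < 1" and C: "AE z in cm. cmod (f z) \<le> C"
  shows "cmod (cauchy f w) \<le> C"
proof -
  note i = cauchy_eq_poisson(2)[OF f w]
  have "cmod (cauchy f w) \<le> (LINT \<zeta>|cm. cmod (f \<zeta> * of_real (pk w \<zeta>)))"
    unfolding cauchy_eq_poisson(1)[OF f w] by (rule integral_norm_bound)
  also have "\<dots> \<le> (LINT \<zeta>|cm. C * pk w \<zeta>)"
  proof (rule integral_mono_AE[OF integrable_norm[OF i]])
    show "integrable cm (\<lambda>\<zeta>. C * pk w \<zeta>)" using cb_integrable[OF cb_pk[OF w]] by simp
    show "AE \<zeta> in cm. cmod (f \<zeta> * of_real (pk w \<zeta>)) \<le> C * pk w \<zeta>"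
      using C by eventually_elim (use pk_nonneg[OF w] in \<open>auto simp: norm_mult intro!: mult_right_mono\<close>)
  qed
  also have "\<dots> = C" using integral_pk[OF w] by simp
  finally show ?thesis .
qed

text \<open>The finite geometric sum leaves a remainder with the factor (w cnj \<zeta>)^N, of
  modulus |w|^N. From the power series, holomorphy of \<open>cauchy f\<close> is immediate.\<close>

lemma cauchy_sums:
  assumes f: "f \<in> hb" and w: "cmod w < 1"
  shows "(\<lambda>n. (LINT \<zeta>|cm. f \<zeta> * cnj \<zeta> ^ n) * w ^ n) sums cauchy f w"
proof -
  obtain C where C: "AE z in cm. cmod (f z) \<le> C" using f by (auto simp: hb_def)
  have [measurable]: "f \<in> borel_measurable cm" using f by (rule hb_measurable)
  have i: "integrable cm (\<lambda>\<zeta>. f \<zeta> * cnj \<zeta> ^ n)" for n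
    by (rule hb_mult_bounded_integrable[OF f, of _ 1]) (use AE_cm_circle in \<open>auto simp: norm_power\<close>)
  have part: "cmod ((\<Sum>n<N. (LINT \<zeta>|cm. f \<zeta> * cnj \<zeta> ^ n) * w ^ n) - cauchy f w) \<le> cmod w ^ N * (\<bar>C\<bar> / (1 - cmod w))" for N
  proof -
    define R where "R \<zeta> = f \<zeta> * ((w * cnj \<zeta>) ^ N * (1 / (1 - w * cnj \<zeta>)))" for \<zeta>
    have Rb: "AE \<zeta> in cm. cmod (R \<zeta>) \<le> cmod w ^ N * (\<bar>C\<bar> / (1 - cmod w))"
      using C AE_cm_circle
    proof eventually_elim
      case (elim \<zeta>)
      have "cmod (R \<zeta>) = cmod (f \<zeta>) * (cmod w ^ N * cmod (1 / (1 - w * cnj \<zeta>)))"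
        unfolding R_def norm_mult norm_power using elim by simp
      also have "\<dots> \<le> \<bar>C\<bar> * (cmod w ^ N * (1 / (1 - cmod w)))"
        using elim cauchy_kernel_bound[OF w elim(2)] by (intro mult_mono) auto
      finally show ?case by (simp add: mult_ac)
    qed
    have Ri: "integrable cm R"
      by (rule cm_integrable_bounded[OF _ Rb]) (simp add: R_def[abs_def])
    have "(\<Sum>n<N. (LINT \<zeta>|cm. f \<zeta> * cnj \<zeta> ^ n) * w ^ n) = (LINT \<zeta>|cm. (\<Sum>n<N. f \<zeta> * cnj \<zeta> ^ n * w ^ n))"
      using i by (subst Bochner_Integration.integral_sum) auto
    also have "\<dots> = (LINT \<zeta>|cm. f \<zeta> * (1 / (1 - w * cnj \<zeta>)) - R \<zeta>)"
    proof (rule integral_cong_AE)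
      show "AE \<zeta> in cm. (\<Sum>n<N. f \<zeta> * cnj \<zeta> ^ n * w ^ n) = f \<zeta> * (1 / (1 - w * cnj \<zeta>)) - R \<zeta>"
        using AE_cm_circle
      proof eventually_elim
        case (elim \<zeta>)
        define u where "u = w * cnj \<zeta>"
        have u: "1 - u \<noteq> 0" using pk_denom(2)[OF w elim] by (simp add: u_def)
        have "(\<Sum>n<N. f \<zeta> * cnj \<zeta> ^ n * w ^ n) = f \<zeta> * (\<Sum>n<N. u ^ n)"
          by (simp add: sum_distrib_left u_def power_mult_distrib mult_ac)
        also have "(\<Sum>n<N. u ^ n) = 1 / (1 - u) - u ^ N * (1 / (1 - u))"
          using one_diff_power_eq[of u N] u by (simp add: field_simps)
        finally show ?case by (simp add: R_def u_def right_diff_distrib)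
      qed
    qed (simp_all add: R_def)
    also have "\<dots> = cauchy f w - (LINT \<zeta>|cm. R \<zeta>)"
      unfolding cauchy_def by (rule Bochner_Integration.integral_diff[OF cauchy_integrable[OF f w] Ri])
    finally have "cmod ((\<Sum>n<N. (LINT \<zeta>|cm. f \<zeta> * cnj \<zeta> ^ n) * w ^ n) - cauchy f w) = cmod (LINT \<zeta>|cm. R \<zeta>)"
      by simp
    also have "\<dots> \<le> (LINT \<zeta>|cm. cmod (R \<zeta>))" by (rule integral_norm_bound)
    also have "\<dots> \<le> (LINT \<zeta>|cm. cmod w ^ N * (\<bar>C\<bar> / (1 - cmod w)))"
      by (rule integral_mono_AE[OF integrable_norm[OF Ri] _ Rb]) simp
    also have "\<dots> = cmod w ^ N * (\<bar>C\<bar> / (1 - cmod w))" using cm.prob_space by simp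
    finally show ?thesis .
  qed
  have "(\<lambda>N. cmod w ^ N * (\<bar>C\<bar> / (1 - cmod w))) \<longlonglongrightarrow> 0 * (\<bar>C\<bar> / (1 - cmod w))"
    using w by (intro tendsto_intros LIMSEQ_power_zero) simp
  then have "(\<lambda>N. cmod w ^ N * (\<bar>C\<bar> / (1 - cmod w))) \<longlonglongrightarrow> 0" by simp
  then have "(\<lambda>N. cmod ((\<Sum>n<N. (LINT \<zeta>|cm. f \<zeta> * cnj \<zeta> ^ n) * w ^ n) - cauchy f w)) \<longlonglongrightarrow> 0"
    by (rule LIMSEQ_0_le) (use part in auto)
  then show ?thesis unfolding sums_def by (simp add: tendsto_norm_zero_iff LIM_zero_iff)
qed

lemma cauchy_holomorphic: "f \<in> hb \<Longrightarrow> cauchy f holomorphic_on ball 0 1"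
  by (rule power_series_holomorphic[where a = "\<lambda>n. LINT \<zeta>|cm. f \<zeta> * cnj \<zeta> ^ n"])
     (use cauchy_sums in auto)

lemma hb_L1_approx:
  assumes f: "f \<in> hb" and e: "e > 0"
  shows "\<exists>p. (LINT z|cm. cmod (f z - poly p z)) \<le> e"
proof -
  obtain g where "g \<in> range poly" "lint 2 cm (\<lambda>z. g z - f z) < e\<^sup>2"
    using lq_closure_eps_ex[OF hb_H2[OF f], of "e\<^sup>2"] e by auto
  then obtain p where p: "lint 2 cm (\<lambda>z. poly p z - f z) < e\<^sup>2" by auto
  have d: "(\<lambda>z. f z - poly p z) \<in> lq 2 cm" by (intro lq_diff hb_lq f hb_poly) auto
  have "(LINT z|cm. cmod (f z - poly p z)) \<le> (LINT z|cm. (e + (cmod (f z - poly p z))\<^sup>2 / e) / 2)"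
  proof (rule integral_mono)
    show "integrable cm (\<lambda>z. cmod (f z - poly p z))" by (intro integrable_norm lq2_cm_integrable d)
    show "integrable cm (\<lambda>z. (e + (cmod (f z - poly p z))\<^sup>2 / e) / 2)" using d by (auto simp: lq2_iff)
    fix z
    define x where "x = cmod (f z - poly p z)"
    have "0 \<le> (x - e)\<^sup>2" by simp
    then have "2 * x * e \<le> e * e + x\<^sup>2" by (simp add: power2_eq_square algebra_simps)
    then show "cmod (f z - poly p z) \<le> (e + (cmod (f z - poly p z))\<^sup>2 / e) / 2"
      using e by (simp add: x_def[symmetric] field_simps)
  qed
  also have "\<dots> = (e + lint 2 cm (\<lambda>z. f z - poly p z) / e) / 2"
    using d cm.prob_space by (simp add: lint2_eq lq2_iff)
  also have "\<dots> \<le> e" using p e lint_commute[of 2 cm f "poly p"] by (simp add: field_simps power2_eq_square)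
  finally show ?thesis by blast
qed

text \<open>For polynomials the limit is clear. Take approximants p_j with L^1 error at most 4^-j.
  Outside a set of measure 2^-j the maximal inequality bounds the Poisson integrals of |f - p_j| by
  324 * 2^-j, and Markov's inequality bounds |f - p_j| itself by 2^-j in the same sense. By
  Borel-Cantelli almost every point lies in only finitely many exceptional sets. The 326 is 324 + 1
  + 1.\<close>

theorem Fatou_radial_limit:
  assumes f: "f \<in> hb" and C: "\<And>z. cmod z = 1 \<Longrightarrow> cmod (f z) \<le> C"
  shows "AE z in cm. ((\<lambda>t. cauchy f (of_real t * z)) \<longlongrightarrow> f z) (at_left 1)"
proof -
  have [measurable]: "f \<in> borel_measurable cm" using f by (rule hb_measurable)
  define \<l> where "\<l> j = (1/2::real) ^ j" for j :: nat
  have l0: "\<l> j > 0" for j by (simp add: \<l>_def)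
  have "\<exists>p. (LINT z|cm. cmod (f z - poly p z)) \<le> \<l> j * \<l> j" for j
    by (rule hb_L1_approx[OF f]) (simp add: \<l>_def)
  then obtain p where p: "\<And>j. (LINT z|cm. cmod (f z - poly (p j) z)) \<le> \<l> j * \<l> j" by metis
  define g where "g j z = cmod (f z - poly (p j) z)" for j z
  have gm[measurable]: "g j \<in> borel_measurable cm" for j unfolding g_def by measurable
  have "\<exists>D. cb D (g j)" for j
  proof -
    obtain D where D: "\<And>z. cmod z = 1 \<Longrightarrow> cmod (poly (p j) z) \<le> D" using poly_circle_bounded by blast
    have "cb (C + D) (g j)" unfolding cb_def
    proof (intro conjI allI impI gm)
      fix z :: complex assume "cmod z = 1"
      with C[OF this] D[OF this] norm_triangle_ineq4[of "f z" "poly (p j) z"]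
      show "\<bar>g j z\<bar> \<le> C + D" by (simp add: g_def)
    qed
    then show ?thesis ..
  qed
  then obtain D where D: "\<And>j. cb (D j) (g j)" by metis
  have "\<exists>A. A \<in> sets cm \<and> measure cm A \<le> (LINT z|cm. g j z) / \<l> j \<and>
    (\<forall>z r. cmod z = 1 \<longrightarrow> 0 < r \<longrightarrow> r < 1 \<longrightarrow> pois (g j) (of_real r * z) > 324 * \<l> j \<longrightarrow> z \<in> A)" for j
    by (rule poisson_maximal[OF D _ l0, of j j]) (auto simp: g_def)
  then obtain A where A: "\<And>j. A j \<in> sets cm" "\<And>j. measure cm (A j) \<le> (LINT z|cm. g j z) / \<l> j"
    "\<And>j z r. cmod z = 1 \<Longrightarrow> 0 < r \<Longrightarrow> r < 1 \<Longrightarrow> z \<notin> A j \<Longrightarrow> pois (g j) (of_real r * z) \<le> 324 * \<l> j"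
    by (metis not_less)
  note [measurable] = A(1)
  have gi: "integrable cm (g j)" for j by (rule cb_integrable[OF D])
  have gl: "(LINT z|cm. g j z) / \<l> j \<le> \<l> j" for j using p[of j] l0[of j] by (simp add: g_def field_simps)
  define W where "W j = {z. g j z \<ge> \<l> j}" for j
  have Wm[measurable]: "W j \<in> sets cm" for j unfolding W_def by measurable
  have Wle: "measure cm (W j) \<le> \<l> j" for j
  proof -
    have "measure cm {z \<in> space cm. g j z \<ge> \<l> j} \<le> (LINT z|cm. g j z) / \<l> j"
      by (rule integral_Markov_inequality_measure[OF gi, where A = "{}"]) (auto simp: l0 g_def)
    then show ?thesis using gl[of j] by (simp add: W_def)
  qed
  have "AE z in cm. eventually (\<lambda>j. z \<in> space cm - (A j \<union> W j)) sequentially"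
  proof (rule borel_cantelli_AE1)
    show "summable (\<lambda>j. measure cm (A j \<union> W j))"
    proof (rule summable_comparison_test'[of "\<lambda>j. 2 * \<l> j" 0])
      show "summable (\<lambda>j. 2 * \<l> j)" unfolding \<l>_def by (intro summable_mult summable_geometric) simp
      fix j
      have "measure cm (A j \<union> W j) \<le> measure cm (A j) + measure cm (W j)"
        by (rule measure_Un_le) (use A(1) Wm in auto)
      then show "norm (measure cm (A j \<union> W j)) \<le> 2 * \<l> j" using A(2)[of j] gl[of j] Wle[of j] by simp
    qed
  qed (simp_all add: cm.emeasure_eq_measure sets.Un[OF A(1) Wm, simplified])
  with AE_cm_circle show ?thesis
  proof eventually_elim
    case (elim z)
    then obtain J where J: "\<And>j. j \<ge> J \<Longrightarrow> z \<notin> A j \<and> z \<notin> W j" by (auto simp: eventually_sequentially)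
    show ?case
    proof (rule tendstoI)
      fix e :: real assume e: "e > 0"
      have "\<l> \<longlonglongrightarrow> 0" unfolding \<l>_def by (rule LIMSEQ_power_zero) simp
      from order_tendstoD(2)[OF this, of "e / 326"] e obtain J' where J': "\<And>j. j \<ge> J' \<Longrightarrow> \<l> j < e / 326"
        by (auto simp: eventually_sequentially)
      define j where "j = max J J'"
      have j: "z \<notin> A j" "z \<notin> W j" "\<l> j < e / 326" using J[of j] J'[of j] by (auto simp: j_def)
      have "((\<lambda>t. poly (p j) (of_real t * z)) \<longlongrightarrow> poly (p j) (of_real 1 * z)) (at_left (1::real))"
        by (intro tendsto_intros)
      then have "eventually (\<lambda>t. dist (poly (p j) (of_real t * z)) (poly (p j) z) < \<l> j) (at_left (1::real))"
        using tendstoD[OF _ l0[of j]] by fastforce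
      moreover have "eventually (\<lambda>t. t \<in> {0<..<1}) (at_left (1::real))"
        by (rule eventually_at_left_real) simp
      ultimately show "eventually (\<lambda>t. dist (cauchy f (of_real t * z)) (f z) < e) (at_left 1)"
      proof eventually_elim
        fix t assume 1: "dist (poly (p j) (of_real t * z)) (poly (p j) z) < \<l> j" and t: "t \<in> {0<..<(1::real)}"
        define w where "w = of_real t * z"
        have w: "cmod w < 1" using t elim by (simp add: w_def norm_mult)
        have "cauchy f w - poly (p j) w = (LINT \<zeta>|cm. f \<zeta> * of_real (pk w \<zeta>) - poly (p j) \<zeta> * of_real (pk w \<zeta>))"
          using cauchy_eq_poisson[OF f w] cauchy_eq_poisson[OF hb_poly[of "p j"] w] cauchy_poly[OF w, of "p j"] by simp
        also have "cmod \<dots> \<le> (LINT \<zeta>|cm. cmod (f \<zeta> * of_real (pk w \<zeta>) - poly (p j) \<zeta> * of_real (pk w \<zeta>)))"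
          by (rule integral_norm_bound)
        also have "\<dots> = pois (g j) w"
          unfolding pois_def g_def left_diff_distrib[symmetric] norm_mult using pk_nonneg[OF w] by simp
        also have "\<dots> \<le> 324 * \<l> j" unfolding w_def using A(3)[OF _ _ _ j(1)] elim t by auto
        finally have 2: "cmod (cauchy f w - poly (p j) w) \<le> 324 * \<l> j" .
        have 3: "cmod (f z - poly (p j) z) < \<l> j" using j(2) by (simp add: W_def g_def)
        have "dist (cauchy f w) (f z) \<le> dist (cauchy f w) (poly (p j) w) + (dist (poly (p j) w) (poly (p j) z) + dist (poly (p j) z) (f z))"
          using dist_triangle[of "cauchy f w" "f z" "poly (p j) w"] dist_triangle[of "poly (p j) w" "f z" "poly (p j) z"] by linarith
        also have "\<dots> < 326 * \<l> j" using 1 2 3 by (simp add: w_def dist_norm norm_minus_commute)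
        finally show "dist (cauchy f (of_real t * z)) (f z) < e" using j(3) by (simp add: w_def)
      qed
    qed
  qed
qed

lemma hb_Hinf: assumes f: "f \<in> hb" shows "f \<in> Hinf"
proof -
  have [measurable]: "f \<in> borel_measurable cm" using f by (rule hb_measurable)
  obtain C0 where C0: "AE z in cm. cmod (f z) \<le> C0" using f by (auto simp: hb_def)
  define C where "C = \<bar>C0\<bar>"
  have C: "AE z in cm. cmod (f z) \<le> C" using C0 by eventually_elim (simp add: C_def)
  \<comment> \<open>The Fatou theorem above asks for a bound at every point of the circle, so f is
    first changed on a null set.\<close>
  define g where "g z = (if cmod (f z) \<le> C then f z else 0)" for z
  have gm[measurable]: "g \<in> borel_measurable cm" unfolding g_def[abs_def] by measurable
  have fg: "AE z in cm. f z = g z" using C by eventually_elim (simp add: g_def)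
  have g: "g \<in> hb" by (rule hb_cong_AE[OF f fg gm])
  have gC: "cmod (g z) \<le> C" for z by (simp add: g_def C_def)
  have "bounded (cauchy g ` ball 0 1)"
    using cauchy_bound[OF g] gC by (auto simp: bounded_iff intro!: exI[of _ C])
  moreover have "AE z in cm. ((\<lambda>t. cauchy g (of_real t * z)) \<longlongrightarrow> f z) (at_left 1)"
    using Fatou_radial_limit[OF g gC] fg by eventually_elim simp
  ultimately show ?thesis unfolding Hinf_def using cauchy_holomorphic[OF g] by auto
qed

lemma holomorphic_dilate_poly:
  assumes F: "F holomorphic_on ball 0 1" and r: "0 < r" "r < 1" and e: "e > 0"
  shows "\<exists>q. \<forall>z. cmod z = 1 \<longrightarrow> cmod (F (of_real r * z) - poly q z) < e"
proof -
  define a where "a n = (deriv ^^ n) F 0 / fact n" for n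
  have sums: "(\<lambda>n. a n * w ^ n) sums F w" if "cmod w < 1" for w
    using holomorphic_power_series[OF F, of w] that by (simp add: a_def)
  \<comment> \<open>A radius strictly between r and 1: convergence of the series at \<rho> yields
    absolute convergence at r.\<close>
  define \<rho> where "\<rho> = (r + 1) / 2"
  have "summable (\<lambda>n. a n * (of_real \<rho>) ^ n)"
    using sums[of "of_real \<rho>"] r by (auto simp: \<rho>_def sums_iff simp del: of_real_add of_real_divide)
  then have abs: "summable (\<lambda>n. norm (a n * (of_real r) ^ n))"
    by (rule powser_insidea) (use r in \<open>simp add: \<rho>_def del: of_real_add of_real_divide\<close>)
  then obtain N where N: "norm (\<Sum>i. norm (a (i + N) * (of_real r) ^ (i + N))) < e"
    using suminf_exist_split[OF e] by blast
  have abs': "summable (\<lambda>i. norm (a (i + N) * (of_real r) ^ (i + N)))"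
    by (rule summable_ignore_initial_segment[OF abs])
  define q where "q = (\<Sum>n<N. monom (a n * of_real r ^ n) n)"
  have "cmod (F (of_real r * z) - poly q z) < e" if z: "cmod z = 1" for z
  proof -
    define w where "w = of_real r * z"
    have w: "cmod w < 1" using z r by (simp add: w_def norm_mult)
    have pq: "poly q z = (\<Sum>n<N. a n * w ^ n)"
      by (simp add: q_def poly_sum poly_monom w_def power_mult_distrib mult_ac)
    have nw: "norm (a n * w ^ n) = norm (a n * (of_real r) ^ n)" for n
      using z by (simp add: w_def norm_mult norm_power)
    have "F w = (\<Sum>n. a n * w ^ n)" using sums[OF w] by (simp add: sums_iff)
    also have "\<dots> = (\<Sum>n. a (n + N) * w ^ (n + N)) + (\<Sum>n<N. a n * w ^ n)"
      by (rule suminf_split_initial_segment) (use sums[OF w] in \<open>simp add: sums_iff\<close>)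
    finally have "cmod (F w - poly q z) = cmod (\<Sum>n. a (n + N) * w ^ (n + N))" by (simp add: pq)
    also have "\<dots> \<le> (\<Sum>n. norm (a (n + N) * w ^ (n + N)))"
      by (rule summable_norm) (unfold nw, rule abs')
    also have "\<dots> < e" unfolding nw using N by simp
    finally show ?thesis by (simp add: w_def)
  qed
  then show ?thesis by blast
qed

text \<open>Dilates of the holomorphic function are approximated uniformly on the circle by
  polynomials while the radius tends to 1. Such bounded pointwise approximation is what extends
  invariance under B to all multipliers \<open>\<Phi> (B z)\<close> with \<Phi> in
  \<open>hb\<close>.\<close>

lemma Hinf_poly_approx:
  assumes "f \<in> Hinf"
  obtains q C where "\<And>k z. cmod z = 1 \<Longrightarrow> cmod (poly (q k) z) \<le> C"
    "AE z in cm. (\<lambda>k. poly (q k) z) \<longlonglongrightarrow> f z"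
proof -
  obtain F where F: "F holomorphic_on ball 0 1" "bounded (F ` ball 0 1)"
    and lim: "AE z in cm. ((\<lambda>t. F (of_real t * z)) \<longlongrightarrow> f z) (at_left 1)"
    using assms by (auto simp: Hinf_def)
  from F(2) obtain B where "\<forall>x\<in>F ` ball 0 1. cmod x \<le> B" unfolding bounded_iff ..
  then have B: "cmod (F w) \<le> B" if "cmod w < 1" for w using that by simp
  define r where "r k = 1 - 1 / real (k + 2)" for k :: nat
  have r: "0 < r k" "r k < 1" for k by (auto simp: r_def)
  have "\<exists>q. \<forall>z. cmod z = 1 \<longrightarrow> cmod (F (of_real (r k) * z) - poly q z) < 1 / real (Suc k)" for k
    by (rule holomorphic_dilate_poly[OF F(1) r]) simp
  then obtain q where q: "\<And>k z. cmod z = 1 \<Longrightarrow> cmod (F (of_real (r k) * z) - poly (q k) z) < 1 / real (Suc k)"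
    by metis
  have rlim: "filterlim r (at_left 1) sequentially"
  proof (rule tendsto_imp_filterlim_at_left)
    have "(\<lambda>k. 1 - 1 / real (k + 2)) \<longlonglongrightarrow> 1 - 0"
      by (intro tendsto_diff tendsto_const LIMSEQ_ignore_initial_segment[OF lim_1_over_n])
    then show "r \<longlonglongrightarrow> 1" by (simp add: r_def[abs_def])
  qed (use r in auto)
  show thesis
  proof (rule that)
    fix k and z :: complex assume z: "cmod z = 1"
    have "cmod (poly (q k) z) \<le> cmod (F (of_real (r k) * z)) + cmod (F (of_real (r k) * z) - poly (q k) z)"
      using norm_triangle_ineq4[of "F (of_real (r k) * z)" "F (of_real (r k) * z) - poly (q k) z"] by simp
    also have "\<dots> \<le> B + 1"
    proof (rule add_mono)
      show "cmod (F (of_real (r k) * z)) \<le> B" by (rule B) (use r[of k] z in \<open>simp add: norm_mult\<close>)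
      have "1 / real (Suc k) \<le> 1" by simp
      then show "cmod (F (of_real (r k) * z) - poly (q k) z) \<le> 1" using q[OF z, of k] by linarith
    qed
    finally show "cmod (poly (q k) z) \<le> B + 1" .
  next
    show "AE z in cm. (\<lambda>k. poly (q k) z) \<longlonglongrightarrow> f z"
      using lim AE_cm_circle
    proof eventually_elim
      case (elim z)
      have 1: "(\<lambda>k. F (of_real (r k) * z)) \<longlonglongrightarrow> f z" by (rule filterlim_compose[OF elim(1) rlim])
      have "(\<lambda>k. cmod (F (of_real (r k) * z) - poly (q k) z)) \<longlonglongrightarrow> 0"
        by (rule LIMSEQ_0_le[OF LIMSEQ_inverse_real_of_nat[unfolded inverse_eq_divide]])
           (use q[OF elim(2)] in \<open>auto intro: less_imp_le\<close>)
      then have "(\<lambda>k. F (of_real (r k) * z) - poly (q k) z) \<longlonglongrightarrow> 0" by (simp add: tendsto_norm_zero_iff)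
      from tendsto_diff[OF 1 this] show ?case by simp
    qed
  qed
qed

lemma Hinf_eq_hb: "Hinf = hb"
proof (intro equalityI subsetI)
  fix f assume f: "f \<in> Hinf"
  then obtain q C where q: "\<And>k z. cmod z = 1 \<Longrightarrow> cmod (poly (q k) z) \<le> C"
    "AE z in cm. (\<lambda>k. poly (q k) z) \<longlonglongrightarrow> f z" by (rule Hinf_poly_approx) blast
  show "f \<in> hb"
  proof (rule hb_bounded_limit[OF hb_poly _ _ q(2)])
    show "AE z in cm. cmod (poly (q k) z) \<le> C" for k using AE_cm_circle by eventually_elim (rule q(1))
    show "f \<in> borel_measurable cm" using f by (simp add: Hinf_def)
  qed
qed (rule hb_Hinf)

subsection \<open>Finite Blaschke products\<close>

text \<open>Adding |C| makes \<phi> a nonnegative density. The image under V of the measure with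
  this density has the moments of d + |C| times \<open>cm\<close>, so it is that measure, and the
  integral formula passes from powers to all functions g.\<close>

lemma integral_compose_of_moments:
  fixes \<phi> :: "complex \<Rightarrow> real" and g :: "complex \<Rightarrow> complex"
  assumes [measurable]: "\<phi> \<in> borel_measurable cm" "V \<in> borel_measurable cm"
    and C: "AE z in cm. \<bar>\<phi> z\<bar> \<le> C" and V: "AE z in cm. cmod (V z) = 1"
    and one: "\<And>k. (LINT z|cm. V z ^ k) = (if k = 0 then 1 else 0)"
    and mom: "\<And>k. (LINT z|cm. of_real (\<phi> z) * V z ^ k) = (if k = 0 then of_real d else 0)"
    and g: "g \<in> borel_measurable cm"
  shows "(LINT z|cm. of_real (\<phi> z + \<bar>C\<bar>) * g (V z)) = of_real (d + \<bar>C\<bar>) * (LINT z|cm. g z)"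
    and "integrable cm g \<Longrightarrow> integrable cm (\<lambda>z. of_real (\<phi> z + \<bar>C\<bar>) * g (V z))"
proof -
  \<comment> \<open>It equals \<phi> + |C| almost everywhere; the maximum makes it nonnegative at
    every point.\<close>
  define \<psi> where "\<psi> z = max 0 (\<phi> z + \<bar>C\<bar>)" for z
  have [measurable]: "\<psi> \<in> borel_measurable cm" unfolding \<psi>_def[abs_def] by measurable
  have \<psi>0: "0 \<le> \<psi> z" for z by (simp add: \<psi>_def)
  have \<psi>eq: "AE z in cm. \<psi> z = \<phi> z + \<bar>C\<bar>" using C by eventually_elim (auto simp: \<psi>_def)
  have ip: "integrable cm (\<lambda>z. V z ^ k)" for k
    by (rule cm_integrable_bounded[of _ 1]) (use V in \<open>auto simp: norm_power\<close>)
  have ip2: "integrable cm (\<lambda>z. of_real (\<phi> z) * V z ^ k)" for k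
    by (rule cm_integrable_bounded[of _ C]) (use V C in \<open>auto simp: norm_power norm_mult\<close>)
  have mom': "(LINT z|cm. of_real (\<psi> z) * V z ^ k) = (if k = 0 then of_real (d + \<bar>C\<bar>) else 0)" for k
  proof -
    have "(LINT z|cm. of_real (\<psi> z) * V z ^ k) = (LINT z|cm. of_real (\<phi> z) * V z ^ k + of_real \<bar>C\<bar> * V z ^ k)"
      by (rule integral_cong_AE) (use \<psi>eq in \<open>auto simp: algebra_simps\<close>)
    also have "\<dots> = (LINT z|cm. of_real (\<phi> z) * V z ^ k) + of_real \<bar>C\<bar> * (LINT z|cm. V z ^ k)"
      using ip ip2 by simp
    finally show ?thesis using mom one by simp
  qed
  have "complex_of_real (LINT z|cm. \<psi> z) = of_real (d + \<bar>C\<bar>)" using mom'[of 0] by simp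
  then have tot: "(LINT z|cm. \<psi> z) = d + \<bar>C\<bar>" by (simp only: of_real_eq_iff)
  then have dC: "0 \<le> d + \<bar>C\<bar>" using \<psi>0 by (metis Bochner_Integration.integral_nonneg)
  have \<psi>i: "integrable cm \<psi>"
    by (rule cm.integrable_const_bound[of _ "\<bar>C\<bar> + \<bar>C\<bar>"]) (use C in \<open>auto simp: \<psi>_def\<close>)
  define N where "N = distr (density cm (\<lambda>z. ennreal (\<psi> z))) borel V"
  define K where "K = density cm (\<lambda>_. ennreal (d + \<bar>C\<bar>))"
  have intN: "(LINT z|N. h z) = (LINT z|cm. of_real (\<psi> z) * h (V z))" if [measurable]: "h \<in> borel_measurable borel" for h :: "complex \<Rightarrow> complex"
    unfolding N_def using \<psi>0
    by (subst integral_distr, measurable, subst integral_density) (auto simp: scaleR_conv_of_real)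
  have intK: "(LINT z|K. h z) = of_real (d + \<bar>C\<bar>) * (LINT z|cm. h z)" if [measurable]: "h \<in> borel_measurable borel" for h :: "complex \<Rightarrow> complex"
    unfolding K_def using dC by (subst integral_density) (auto simp: scaleR_conv_of_real simp del: of_real_add)
  have "N = K"
  proof (rule circle_measure_eqI_moments)
    have "emeasure (density cm (\<lambda>z. ennreal (\<psi> z))) UNIV = ennreal (LINT z|cm. \<psi> z)"
      using \<psi>i \<psi>0 by (simp add: emeasure_density nn_integral_eq_integral)
    then have "finite_measure (density cm (\<lambda>z. ennreal (\<psi> z)))" by (intro finite_measureI) simp
    then show "finite_measure N" unfolding N_def by (rule finite_measure.finite_measure_distr) simp
    show "finite_measure K" unfolding K_def by (rule finite_measureI) (simp add: emeasure_density ennreal_mult_eq_top_iff cm.emeasure_eq_measure)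
    show "AE z in N. cmod z = 1" unfolding N_def
      by (subst AE_distr_iff, measurable, subst AE_density) (use V in auto)
    show "AE z in K. cmod z = 1" unfolding K_def
      by (subst AE_density) (use AE_cm_circle in auto)
    show "(LINT z|N. z ^ k) = (LINT z|K. z ^ k)" for k
      using intN[of "\<lambda>z. z ^ k"] intK[of "\<lambda>z. z ^ k"] mom'[of k] by (simp add: integral_cm_power)
  qed (simp_all add: N_def K_def)
  have gb: "g \<in> borel_measurable borel" using g by simp
  have [measurable]: "(\<lambda>z. g (V z)) \<in> borel_measurable cm" by (rule measurable_compose[OF _ gb]) simp
  have "(LINT z|cm. of_real (\<phi> z + \<bar>C\<bar>) * g (V z)) = (LINT z|cm. of_real (\<psi> z) * g (V z))"
    by (rule integral_cong_AE) (use \<psi>eq gb in auto)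
  also have "\<dots> = of_real (d + \<bar>C\<bar>) * (LINT z|cm. g z)"
    using intN[OF gb] intK[OF gb] \<open>N = K\<close> by simp
  finally show "(LINT z|cm. of_real (\<phi> z + \<bar>C\<bar>) * g (V z)) = of_real (d + \<bar>C\<bar>) * (LINT z|cm. g z)" .
  assume gi: "integrable cm g"
  have "integrable K g"
    unfolding K_def using gi dC gb by (subst integrable_density) auto
  then have "integrable N g" using \<open>N = K\<close> by simp
  then have "integrable cm (\<lambda>z. of_real (\<psi> z) * g (V z))"
    unfolding N_def using \<psi>0 gb
    by (subst (asm) integrable_distr_eq, simp, simp, subst (asm) integrable_density) (auto simp: scaleR_conv_of_real)
  then show "integrable cm (\<lambda>z. of_real (\<phi> z + \<bar>C\<bar>) * g (V z))"
    by (rule integrable_cong_AE_imp) (use \<psi>eq gb in auto)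
qed

lemma circle_factor:
  assumes "cmod a < 1" "cmod z = 1"
  shows "cmod ((z - a) / (1 - cnj a * z)) = 1" "z - a \<noteq> 0" "1 - cnj a * z \<noteq> 0" "(1 / (1 - a * cnj z)) * (z - a) = z"
proof -
  show n: "1 - cnj a * z \<noteq> 0" using pk_denom(3)[OF assms] .
  have "z * (1 - a * cnj z) = z - a * (z * cnj z)" by (simp add: algebra_simps)
  then have e: "z - a = z * (1 - a * cnj z)" using cnj_mult_circle[OF assms(2)] by simp
  have "cmod (1 - a * cnj z) = cmod (cnj (1 - a * cnj z))" by (rule complex_mod_cnj[symmetric])
  then have "cmod (z - a) = cmod (1 - cnj a * z)" unfolding e using assms by (simp add: norm_mult)
  then show "cmod ((z - a) / (1 - cnj a * z)) = 1" using n by (simp add: norm_divide)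
  show "z - a \<noteq> 0" using assms by auto
  show "(1 / (1 - a * cnj z)) * (z - a) = z" unfolding e using pk_denom(2)[OF assms] by simp
qed

text \<open>The assumption says that the Cauchy integral of f vanishes at a. For the Cauchy kernel,
  K (z - a) = z on the circle, so the moment l + 1 of K f is that of f, which is 0 in H^2, plus a
  times the moment l of K f. All of them vanish by induction, and the moments of g are combinations
  of them.\<close>

lemma H2_divide:
  assumes f: "f \<in> H2" and a: "cmod a < 1" and 0: "(LINT z|cm. f z * (1 / (1 - a * cnj z))) = 0"
  obtains g where "g \<in> H2" "\<And>z. cmod z = 1 \<Longrightarrow> f z = (z - a) / (1 - cnj a * z) * g z"
proof
  define K where "K z = 1 / (1 - a * cnj z)" for z
  define g where "g z = (1 - cnj a * z) / (z - a) * f z" for z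
  have [measurable]: "f \<in> borel_measurable cm" using H2_lq[OF f] by (rule lqD)
  show fg: "f z = (z - a) / (1 - cnj a * z) * g z" if z: "cmod z = 1" for z
    using circle_factor(2,3)[OF a z] by (simp add: g_def)
  have Kb: "AE z in cm. cmod (K z) \<le> 1 / (1 - cmod a)"
    using AE_cm_circle by eventually_elim (unfold K_def, rule cauchy_kernel_bound[OF a])
  have Km[measurable]: "K \<in> borel_measurable cm" unfolding K_def[abs_def] by measurable
  have fK: "(\<lambda>z. K z * f z) \<in> lq 2 cm" by (rule lq_mult_bounded[OF _ H2_lq[OF f] Km Kb]) simp
  have i: "integrable cm (\<lambda>z. K z * f z * z ^ l)" for l
    using lq2_mult_integrable[OF fK power_lq[of 2 l]] by simp
  have fi: "integrable cm (\<lambda>z. f z * z ^ l)" for l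
    using lq2_mult_integrable[OF H2_lq[OF f] power_lq[of 2 l]] by simp
  have I: "(LINT z|cm. K z * f z * z ^ l) = 0" for l
  proof (induction l)
    case 0
    show ?case using \<open>(LINT z|cm. f z * (1 / (1 - a * cnj z))) = 0\<close> by (simp add: K_def mult.commute)
  next
    case (Suc l)
    have "(LINT z|cm. K z * f z * z ^ Suc l) = (LINT z|cm. f z * z ^ Suc l + a * (K z * f z * z ^ l))"
    proof (rule integral_cong_AE)
      show "AE z in cm. K z * f z * z ^ Suc l = f z * z ^ Suc l + a * (K z * f z * z ^ l)"
        using AE_cm_circle
      proof eventually_elim
        case (elim z)
        have "K z * (z - a) = z" unfolding K_def by (rule circle_factor(4)[OF a elim])
        then have "K z * z = z + a * K z" by (simp add: algebra_simps)
        then have "(K z * z) * (f z * z ^ l) = (z + a * K z) * (f z * z ^ l)" by simp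
        then show ?case by (simp add: algebra_simps)
      qed
    qed measurable
    also have "\<dots> = (LINT z|cm. f z * z ^ Suc l) + a * (LINT z|cm. K z * f z * z ^ l)"
      using i[of l] fi[of "Suc l"] by (simp del: power_Suc)
    finally show ?case using Suc H2_power[OF f, of l] by (simp del: power_Suc)
  qed
  show "g \<in> H2"
  proof (rule H2I)
    have gb: "AE z in cm. cmod ((1 - cnj a * z) / (z - a)) \<le> 1"
      using AE_cm_circle
    proof eventually_elim
      case (elim z)
      have "cmod ((1 - cnj a * z) / (z - a)) = inverse (cmod ((z - a) / (1 - cnj a * z)))"
        by (simp add: norm_divide)
      then show ?case using circle_factor(1)[OF a elim] by simp
    qed
    show "g \<in> lq 2 cm" unfolding g_def[abs_def]
      by (rule lq_mult_bounded[OF _ H2_lq[OF f] _ gb]) simp_all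
    fix k
    have "(LINT z|cm. g z * z ^ Suc k) = (LINT z|cm. K z * f z * z ^ k - cnj a * (K z * f z * z ^ Suc k))"
    proof (rule integral_cong_AE)
      show "AE z in cm. g z * z ^ Suc k = K z * f z * z ^ k - cnj a * (K z * f z * z ^ Suc k)"
        using AE_cm_circle
      proof eventually_elim
        case (elim z)
        have "z / (z - a) = K z" using circle_factor(4)[OF a elim] circle_factor(2)[OF a elim] by (simp add: K_def field_simps)
        moreover have "g z * z = (1 - cnj a * z) * (z / (z - a) * f z)" by (simp add: g_def)
        ultimately have "g z * z = (1 - cnj a * z) * (K z * f z)" by simp
        then have "(g z * z) * z ^ k = (1 - cnj a * z) * (K z * f z) * z ^ k" by simp
        then show ?case by (simp add: algebra_simps)
      qed
    qed (simp_all add: g_def[abs_def])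
    also have "\<dots> = 0" using i[of k] i[of "Suc k"] I[of k] I[of "Suc k"] by (simp del: power_Suc)
    finally show "(LINT z|cm. g z * z ^ Suc k) = 0" .
  qed
qed

locale blaschke_product =
  fixes \<alpha> :: "nat \<Rightarrow> complex" and n :: nat
  assumes n: "1 \<le> n" and disc: "\<And>j. j \<in> {1..n} \<Longrightarrow> cmod (\<alpha> j) < 1" and zero: "\<alpha> 1 = 0"
begin

abbreviation "B \<equiv> blaschke \<alpha> n"

definition T :: "(nat \<Rightarrow> complex \<Rightarrow> complex) \<Rightarrow> complex \<Rightarrow> complex" where
  "T c z = (\<Sum>j<n. e0 \<alpha> j z * c j (B z))"

lemma measurable_blaschke [measurable]: "blaschke \<alpha> j \<in> borel_measurable cm"
  unfolding blaschke_def[abs_def] by measurable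

lemma measurable_blaschke_compose: "f \<in> borel_measurable cm \<Longrightarrow> (\<lambda>z. f (B z)) \<in> borel_measurable cm"
  using measurable_compose[OF measurable_blaschke, of f borel n] by simp

lemma blaschke_part_circle:
  "I \<subseteq> {1..n} \<Longrightarrow> cmod z = 1 \<Longrightarrow> cmod (\<Prod>i\<in>I. (z - \<alpha> i) / (1 - cnj (\<alpha> i) * z)) = 1"
  unfolding prod_norm[symmetric] using circle_factor(1) disc by (intro prod.neutral) blast

lemma blaschke_part_hb:
  assumes "I \<subseteq> {1..n}"
  shows "(\<lambda>z. \<Prod>i\<in>I. (z - \<alpha> i) / (1 - cnj (\<alpha> i) * z)) \<in> hb"
proof (rule hb_prod)
  fix i assume "i \<in> I"
  then have a: "cmod (cnj (\<alpha> i)) < 1" using assms disc by auto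
  have p: "poly [:- \<alpha> i, 1:] = (\<lambda>z. z - \<alpha> i)" by auto
  have "(\<lambda>z. z - \<alpha> i) \<in> hb" using hb_poly[of "[:- \<alpha> i, 1:]"] unfolding p .
  from hb_mult[OF hb_geometric(1)[OF a] this] show "(\<lambda>z. (z - \<alpha> i) / (1 - cnj (\<alpha> i) * z)) \<in> hb" by simp
qed

lemma blaschke_circle: "j \<le> n \<Longrightarrow> cmod z = 1 \<Longrightarrow> cmod (blaschke \<alpha> j z) = 1"
  unfolding blaschke_def by (rule blaschke_part_circle) auto

lemma blaschke_hb: "j \<le> n \<Longrightarrow> blaschke \<alpha> j \<in> hb"
  unfolding blaschke_def[abs_def] by (rule blaschke_part_hb) auto

lemma blaschke_split:
  assumes "i < m"
  shows "blaschke \<alpha> m z = blaschke \<alpha> i z * ((z - \<alpha> (Suc i)) / (1 - cnj (\<alpha> (Suc i)) * z))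
    * (\<Prod>l\<in>{Suc (Suc i)..m}. (z - \<alpha> l) / (1 - cnj (\<alpha> l) * z))"
proof -
  have "{1..m} = insert (Suc i) {1..i} \<union> {Suc (Suc i)..m}" using assms by auto
  then show ?thesis unfolding blaschke_def by (simp add: prod.union_disjoint mult_ac)
qed

lemma e0_hb: assumes "j < n" shows "e0 \<alpha> j \<in> hb"
proof -
  have a: "cmod (cnj (\<alpha> (j + 1))) < 1" using disc assms by auto
  have "(\<lambda>z. blaschke \<alpha> j z * (of_real ((1 - (cmod (\<alpha> (j + 1)))\<^sup>2) powr (1 / 2)) * (1 / (1 - cnj (\<alpha> (j + 1)) * z)))) \<in> hb"
    using assms by (intro hb_mult hb_cmult hb_geometric(1)[OF a] blaschke_hb) simp
  then show ?thesis unfolding e0_def[abs_def] by (simp add: mult_ac)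
qed

lemma measurable_e0 [measurable]: "e0 \<alpha> j \<in> borel_measurable cm"
  unfolding e0_def[abs_def] by measurable

lemma e0_0: "e0 \<alpha> 0 z = 1"
  by (simp add: e0_def zero[simplified] blaschke_def)

text \<open>The zero \<alpha> 1 = 0 enters here: B is z times a function b in \<open>hb\<close>,
  unimodular on the circle, so B^k is divisible by z^k. This links divisibility by B to Fourier
  coefficients.\<close>

lemma blaschke_zero: obtains b where "b \<in> hb" "\<And>z. B z = z * b z" "\<And>z. cmod z = 1 \<Longrightarrow> cmod (b z) = 1"
proof
  define b where "b z = (\<Prod>i\<in>{2..n}. (z - \<alpha> i) / (1 - cnj (\<alpha> i) * z))" for z
  show "b \<in> hb" unfolding b_def[abs_def] by (rule blaschke_part_hb) auto
  show "cmod (b z) = 1" if "cmod z = 1" for z unfolding b_def by (rule blaschke_part_circle[OF _ that]) auto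
  have "{1..n} = insert 1 {2..n}" using n by auto
  then show "B z = z * b z" for z unfolding blaschke_def b_def by (simp add: zero[simplified])
qed

lemma e0_cnj:
  assumes j: "j < n" and z: "cmod z = 1"
  shows "cnj (e0 \<alpha> j z) = of_real ((1 - (cmod (\<alpha> (j + 1)))\<^sup>2) powr (1 / 2)) * (1 / (1 - \<alpha> (j + 1) * cnj z)) * cnj (blaschke \<alpha> j z)"
  by (simp add: e0_def)

lemma e0_const_pos: "j < n \<Longrightarrow> 0 < (1 - (cmod (\<alpha> (j + 1)))\<^sup>2) powr (1 / 2)"
proof -
  assume "j < n"
  then have "(cmod (\<alpha> (j + 1)))\<^sup>2 < 1"
    using disc[of "j + 1"] power_strict_mono[of "cmod (\<alpha> (j + 1))" 1 2] by simp
  then show ?thesis by simp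
qed

text \<open>On the circle the conjugated kernel of \<open>e0 \<alpha> i\<close> times the factor z -
  \<alpha> (i + 1) of the Blaschke product is z, and the first i factors cancel against their
  conjugates. What remains is z times an analytic function, hence of mean 0 against everything in
  \<open>hb\<close>.\<close>

lemma cnj_e0_blaschke:
  assumes i: "i < m" "m \<le> n"
  obtains h where "h \<in> hb" "\<And>z. cmod z = 1 \<Longrightarrow> cnj (e0 \<alpha> i z) * blaschke \<alpha> m z = z * h z"
proof
  define c where "c = complex_of_real ((1 - (cmod (\<alpha> (i + 1)))\<^sup>2) powr (1 / 2))"
  define R where "R z = (\<Prod>l\<in>{Suc (Suc i)..m}. (z - \<alpha> l) / (1 - cnj (\<alpha> l) * z))" for z
  define h where "h z = c * (1 / (1 - cnj (\<alpha> (i + 1)) * z) * R z)" for z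
  have a: "cmod (\<alpha> (i + 1)) < 1" using disc i by auto
  then have a': "cmod (cnj (\<alpha> (i + 1))) < 1" by simp
  have R: "R \<in> hb" unfolding R_def[abs_def] using i by (intro blaschke_part_hb) auto
  show "h \<in> hb" unfolding h_def[abs_def] by (intro hb_cmult hb_mult R hb_geometric(1)[OF a'])
  fix z :: complex assume z: "cmod z = 1"
  define K where "K = 1 / (1 - \<alpha> (i + 1) * cnj z)"
  define G where "G = 1 - cnj (\<alpha> (i + 1)) * z"
  have "cnj (blaschke \<alpha> i z) * blaschke \<alpha> i z = 1" using cnj_mult_circle(2)[OF blaschke_circle[OF _ z]] i by simp
  moreover have "K * (z - \<alpha> (i + 1)) = z" unfolding K_def by (rule circle_factor(4)[OF a z])
  moreover have "cnj (e0 \<alpha> i z) * blaschke \<alpha> m z = c * (cnj (blaschke \<alpha> i z) * blaschke \<alpha> i z) * (K * (z - \<alpha> (i + 1))) / G * R z"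
    using e0_cnj[of i z] i z unfolding blaschke_split[OF i(1)] R_def[symmetric] c_def K_def G_def by simp
  ultimately show "cnj (e0 \<alpha> i z) * blaschke \<alpha> m z = z * h z" by (simp add: h_def G_def)
qed

text \<open>For k > 0, and for k = 0 with i < j, the integrand is z times a function in
  \<open>hb\<close> by \<open>cnj_e0_blaschke\<close>; the case j < i with k = 0 is its conjugate.
  For k = 0 and i = j it is the Poisson kernel at \<alpha> (j + 1), of mass 1, which explains the
  normalizing root in \<open>e0\<close>.\<close>

lemma e0_orth:
  assumes "i < n" "j < n"
  shows "(LINT z|cm. e0 \<alpha> j z * cnj (e0 \<alpha> i z) * B z ^ k) = (if k = 0 \<and> i = j then 1 else 0)"
proof (cases k)
  case (Suc m)
  obtain h where h: "h \<in> hb" "\<And>z. cmod z = 1 \<Longrightarrow> cnj (e0 \<alpha> i z) * B z = z * h z"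
    by (rule cnj_e0_blaschke[OF assms(1) order_refl]) blast
  define g where "g z = h z * (e0 \<alpha> j z * B z ^ m)" for z
  have g: "g \<in> hb" unfolding g_def[abs_def] by (intro hb_mult h hb_power blaschke_hb e0_hb assms order_refl)
  have [measurable]: "g \<in> borel_measurable cm" using g by (rule hb_measurable)
  have "(LINT z|cm. e0 \<alpha> j z * cnj (e0 \<alpha> i z) * B z ^ k) = (LINT z|cm. z * g z)"
  proof (rule integral_cong_AE)
    show "AE z in cm. e0 \<alpha> j z * cnj (e0 \<alpha> i z) * B z ^ k = z * g z"
      using AE_cm_circle
    proof eventually_elim
      case (elim z)
      have "e0 \<alpha> j z * cnj (e0 \<alpha> i z) * B z ^ k = (cnj (e0 \<alpha> i z) * B z) * (e0 \<alpha> j z * B z ^ m)"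
        by (simp add: Suc mult_ac)
      then show ?case unfolding h(2)[OF elim] by (simp add: g_def mult_ac)
    qed
  qed measurable
  then show ?thesis using H2_mean_id[OF hb_H2[OF g]] Suc by simp
next
  case 0
  have lt: "(LINT z|cm. e0 \<alpha> j z * cnj (e0 \<alpha> i z)) = 0" if ij: "i < j" "j < n" for i j
  proof -
    obtain h where h: "h \<in> hb" "\<And>z. cmod z = 1 \<Longrightarrow> cnj (e0 \<alpha> i z) * blaschke \<alpha> j z = z * h z"
      by (rule cnj_e0_blaschke[OF ij(1)]) (use ij in auto)
    have a: "cmod (cnj (\<alpha> (j + 1))) < 1" using disc ij by auto
    define c where "c = complex_of_real ((1 - (cmod (\<alpha> (j + 1)))\<^sup>2) powr (1 / 2))"
    define g where "g z = c * (1 / (1 - cnj (\<alpha> (j + 1)) * z) * h z)" for z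
    have g: "g \<in> hb" unfolding g_def[abs_def] by (intro hb_cmult hb_mult h hb_geometric(1)[OF a])
    have [measurable]: "g \<in> borel_measurable cm" using g by (rule hb_measurable)
    have "(LINT z|cm. e0 \<alpha> j z * cnj (e0 \<alpha> i z)) = (LINT z|cm. z * g z)"
    proof (rule integral_cong_AE)
      show "AE z in cm. e0 \<alpha> j z * cnj (e0 \<alpha> i z) = z * g z"
        using AE_cm_circle
      proof eventually_elim
        case (elim z)
        have "e0 \<alpha> j z * cnj (e0 \<alpha> i z) = c / (1 - cnj (\<alpha> (j + 1)) * z) * (cnj (e0 \<alpha> i z) * blaschke \<alpha> j z)"
          by (subst e0_def) (simp add: c_def)
        then show ?case unfolding h(2)[OF elim] by (simp add: g_def)
      qed
    qed measurable
    then show ?thesis using H2_mean_id[OF hb_H2[OF g]] by simp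
  qed
  show ?thesis
  proof (cases "i = j")
    case True
    have a: "cmod (\<alpha> (j + 1)) < 1" using disc assms by auto
    have "(LINT z|cm. e0 \<alpha> j z * cnj (e0 \<alpha> j z)) = (LINT z|cm. complex_of_real (pk (\<alpha> (j + 1)) z))"
    proof (rule integral_cong_AE)
      show "AE z in cm. e0 \<alpha> j z * cnj (e0 \<alpha> j z) = of_real (pk (\<alpha> (j + 1)) z)"
        using AE_cm_circle
      proof eventually_elim
        case (elim z)
        have "cmod (1 - cnj (\<alpha> (j + 1)) * z) = cmod (cnj (1 - cnj (\<alpha> (j + 1)) * z))" by (rule complex_mod_cnj[symmetric])
        then have m: "cmod (1 - cnj (\<alpha> (j + 1)) * z) = cmod (1 - \<alpha> (j + 1) * cnj z)" by simp
        have p: "(1 - (cmod (\<alpha> (j + 1)))\<^sup>2) \<ge> 0" using a by (simp add: power_le_one)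
        have "e0 \<alpha> j z * cnj (e0 \<alpha> j z) = of_real ((cmod (e0 \<alpha> j z))\<^sup>2)" by (rule complex_norm_square[symmetric])
        also have "cmod (e0 \<alpha> j z) = (1 - (cmod (\<alpha> (j + 1)))\<^sup>2) powr (1 / 2) / cmod (1 - \<alpha> (j + 1) * cnj z)"
          unfolding e0_def norm_mult norm_divide m using blaschke_circle[OF _ elim, of j] assms by simp
        also have "\<dots>\<^sup>2 = pk (\<alpha> (j + 1)) z"
          using p by (simp add: power_divide pk_def powr_half_sqrt)
        finally show ?case .
      qed
    qed measurable
    also have "\<dots> = 1" using integral_pk[OF a] by simp
    finally show ?thesis using True 0 by simp
  next
    case False
    then consider "i < j" | "j < i" by linarith
    then show ?thesis
    proof cases
      case 1
      then show ?thesis using lt[OF 1 assms(2)] 0 by simp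
    next
      case 2
      have "(LINT z|cm. e0 \<alpha> j z * cnj (e0 \<alpha> i z)) = (LINT z|cm. cnj (e0 \<alpha> i z * cnj (e0 \<alpha> j z)))"
        by (simp add: mult.commute)
      also have "\<dots> = cnj (LINT z|cm. e0 \<alpha> i z * cnj (e0 \<alpha> j z))" by (rule Bochner_Integration.integral_cnj)
      finally show ?thesis using lt[OF 2 assms(1)] 0 2 by simp
    qed
  qed
qed

text \<open>\<open>e0_orth\<close> says that B has, under the weight
  \<open>e0 \<alpha> j * cnj (e0 \<alpha> i)\<close>, the moments of \<open>cm\<close> under the
  constant weight 1 or 0. Applying \<open>integral_compose_of_moments\<close> to the real and the
  imaginary part of the weight extends this from powers to all integrable g.\<close>

lemma integral_e0_compose:
  assumes ij: "i < n" "j < n" and g: "integrable cm g"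
  shows "integrable cm (\<lambda>z. e0 \<alpha> j z * cnj (e0 \<alpha> i z) * g (B z))"
    "(LINT z|cm. e0 \<alpha> j z * cnj (e0 \<alpha> i z) * g (B z)) = (if i = j then LINT z|cm. g z else 0)"
proof -
  define E where "E z = e0 \<alpha> j z * cnj (e0 \<alpha> i z)" for z
  have Em[measurable]: "E \<in> borel_measurable cm" unfolding E_def[abs_def] by measurable
  have gm: "g \<in> borel_measurable cm" using g by auto
  have gB[measurable]: "(\<lambda>z. g (B z)) \<in> borel_measurable cm" by (rule measurable_blaschke_compose[OF gm])
  obtain C1 C2 where "AE z in cm. cmod (e0 \<alpha> j z) \<le> C1" "AE z in cm. cmod (e0 \<alpha> i z) \<le> C2"
    using e0_hb[OF ij(1)] e0_hb[OF ij(2)] by (auto simp: hb_def)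
  then have E: "AE z in cm. cmod (E z) \<le> \<bar>C1\<bar> * \<bar>C2\<bar>"
    by eventually_elim (auto simp: E_def norm_mult intro!: mult_mono)
  define C where "C = \<bar>C1\<bar> * \<bar>C2\<bar>"
  have EC: "AE z in cm. \<bar>Re (E z)\<bar> \<le> C"
    using E unfolding C_def by eventually_elim (rule order_trans[OF abs_Re_le_cmod])
  have EC': "AE z in cm. \<bar>Im (E z)\<bar> \<le> C"
    using E unfolding C_def by eventually_elim (rule order_trans[OF abs_Im_le_cmod])
  have V: "AE z in cm. cmod (B z) = 1" using AE_cm_circle by eventually_elim (simp add: blaschke_circle)
  have one: "(LINT z|cm. B z ^ k) = (if k = 0 then 1 else 0)" for k
    using e0_orth[of 0 0 k] n by (simp add: e0_0)
  have iE: "integrable cm (\<lambda>z. E z * B z ^ k)" for k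
    by (rule cm_integrable_bounded[of _ C]) (use E V in \<open>auto simp: norm_mult norm_power C_def\<close>)
  have iE': "integrable cm (\<lambda>z. cnj (E z) * B z ^ k)" for k
    by (rule cm_integrable_bounded[of _ C]) (use E V in \<open>auto simp: norm_mult norm_power C_def\<close>)
  have mE: "(LINT z|cm. E z * B z ^ k) = (if k = 0 \<and> i = j then 1 else 0)" for k
    unfolding E_def by (rule e0_orth[OF ij])
  have mE': "(LINT z|cm. cnj (E z) * B z ^ k) = (if k = 0 \<and> i = j then 1 else 0)" for k
    using e0_orth[OF ij(2,1), of k] by (auto simp: E_def mult.commute)
  define d :: real where "d = (if i = j then 1 else 0)"
  have re: "(LINT z|cm. of_real (Re (E z)) * B z ^ k) = (if k = 0 then of_real d else 0)" for k
  proof -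
    have "(LINT z|cm. of_real (Re (E z)) * B z ^ k) = (LINT z|cm. (E z * B z ^ k + cnj (E z) * B z ^ k) / 2)"
      by (intro Bochner_Integration.integral_cong refl) (simp add: distrib_right[symmetric] complex_add_cnj)
    also have "\<dots> = ((LINT z|cm. E z * B z ^ k) + (LINT z|cm. cnj (E z) * B z ^ k)) / 2"
      using iE[of k] iE'[of k] by simp
    finally show ?thesis unfolding mE mE' by (simp add: d_def)
  qed
  have im: "(LINT z|cm. of_real (Im (E z)) * B z ^ k) = (if k = 0 then of_real 0 else 0)" for k
  proof -
    have "(LINT z|cm. of_real (Im (E z)) * B z ^ k) = (LINT z|cm. (E z * B z ^ k - cnj (E z) * B z ^ k) / (2 * \<i>))"
    proof (intro Bochner_Integration.integral_cong refl)
      fix z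
      have "E z * B z ^ k - cnj (E z) * B z ^ k = (2 * \<i>) * (of_real (Im (E z)) * B z ^ k)"
        unfolding left_diff_distrib[symmetric] complex_diff_cnj by simp
      then show "of_real (Im (E z)) * B z ^ k = (E z * B z ^ k - cnj (E z) * B z ^ k) / (2 * \<i>)"
        by (simp only:) simp
    qed
    also have "\<dots> = ((LINT z|cm. E z * B z ^ k) - (LINT z|cm. cnj (E z) * B z ^ k)) / (2 * \<i>)"
      using iE[of k] iE'[of k] by simp
    finally show ?thesis unfolding mE mE' by simp
  qed
  \<comment> \<open>The weight 0 with bound 1 becomes the constant 1 after the shift by the bound.
    This instance says that B preserves the measure, and it removes the shift in the other
    two.\<close>
  have zz: "AE z in cm. \<bar>0::real\<bar> \<le> 1" by simp
  have z0: "(LINT z|cm. of_real 0 * B z ^ k) = (if k = 0 then of_real 0 else 0)" for k by simp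
  have meas: "(\<lambda>z. Re (E z)) \<in> borel_measurable cm" "(\<lambda>z. Im (E z)) \<in> borel_measurable cm" "(\<lambda>z. 0::real) \<in> borel_measurable cm"
    by measurable
  note R = integral_compose_of_moments[OF meas(1) measurable_blaschke EC V one re gm]
  note I = integral_compose_of_moments[OF meas(2) measurable_blaschke EC' V one im gm]
  note Z = integral_compose_of_moments[OF meas(3) measurable_blaschke zz V one z0 gm]
  define G where "G = (LINT z|cm. g z)"
  have gBi: "integrable cm (\<lambda>z. g (B z))" and gBe: "(LINT z|cm. g (B z)) = G"
    using Z g by (simp_all add: G_def)
  have eq: "e0 \<alpha> j z * cnj (e0 \<alpha> i z) * g (B z) = (of_real (Re (E z) + \<bar>C\<bar>) * g (B z) - of_real \<bar>C\<bar> * g (B z))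
     + \<i> * (of_real (Im (E z) + \<bar>C\<bar>) * g (B z) - of_real \<bar>C\<bar> * g (B z))" for z
  proof -
    have "E z = of_real (Re (E z)) + \<i> * of_real (Im (E z))" by (rule complex_eq)
    then have "E z * g (B z) = (of_real (Re (E z)) + \<i> * of_real (Im (E z))) * g (B z)" by simp
    then show ?thesis by (simp add: E_def[symmetric] algebra_simps)
  qed
  have i1: "integrable cm (\<lambda>z. of_real (Re (E z) + \<bar>C\<bar>) * g (B z) - of_real \<bar>C\<bar> * g (B z))"
    and i2: "integrable cm (\<lambda>z. of_real (Im (E z) + \<bar>C\<bar>) * g (B z) - of_real \<bar>C\<bar> * g (B z))"
    using R(2)[OF g] I(2)[OF g] gBi by (intro Bochner_Integration.integrable_diff; simp)+
  show "integrable cm (\<lambda>z. e0 \<alpha> j z * cnj (e0 \<alpha> i z) * g (B z))"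
    unfolding eq using i1 i2 by (intro Bochner_Integration.integrable_add integrable_mult_right)
  have e1: "(LINT z|cm. of_real (Re (E z) + \<bar>C\<bar>) * g (B z) - of_real \<bar>C\<bar> * g (B z)) = of_real d * G"
  proof -
    have "(LINT z|cm. of_real (Re (E z) + \<bar>C\<bar>) * g (B z) - of_real \<bar>C\<bar> * g (B z))
      = (LINT z|cm. of_real (Re (E z) + \<bar>C\<bar>) * g (B z)) - (LINT z|cm. of_real \<bar>C\<bar> * g (B z))"
      by (rule Bochner_Integration.integral_diff[OF R(2)[OF g]]) (use gBi in simp)
    then show ?thesis unfolding R(1) using gBe by (simp add: G_def algebra_simps)
  qed
  have e2: "(LINT z|cm. of_real (Im (E z) + \<bar>C\<bar>) * g (B z) - of_real \<bar>C\<bar> * g (B z)) = of_real 0 * G"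
  proof -
    have "(LINT z|cm. of_real (Im (E z) + \<bar>C\<bar>) * g (B z) - of_real \<bar>C\<bar> * g (B z))
      = (LINT z|cm. of_real (Im (E z) + \<bar>C\<bar>) * g (B z)) - (LINT z|cm. of_real \<bar>C\<bar> * g (B z))"
      by (rule Bochner_Integration.integral_diff[OF I(2)[OF g]]) (use gBi in simp)
    then show ?thesis unfolding I(1) using gBe by (simp add: G_def algebra_simps)
  qed
  show "(LINT z|cm. e0 \<alpha> j z * cnj (e0 \<alpha> i z) * g (B z)) = (if i = j then LINT z|cm. g z else 0)"
    unfolding eq using i1 i2 e1 e2
    by (subst Bochner_Integration.integral_add) (simp_all add: d_def G_def)
qed

section \<open>B as a measure-preserving map of the circle\<close>

lemma integral_blaschke_compose:
  fixes g :: "complex \<Rightarrow> complex"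
  assumes "integrable cm g"
  shows "integrable cm (\<lambda>z. g (B z))" "(LINT z|cm. g (B z)) = (LINT z|cm. g z)"
proof -
  have n0: "0 < n" using n by simp
  show "integrable cm (\<lambda>z. g (B z))" "(LINT z|cm. g (B z)) = (LINT z|cm. g z)"
    using integral_e0_compose[OF n0 n0 assms] by (simp_all add: e0_0)
qed

lemma distr_blaschke: "distr cm cm B = cm"
proof (rule circle_measure_eqI_moments)
  show "finite_measure (distr cm cm B)" "finite_measure cm"
    by (rule cm.finite_measure_distr, simp) (rule cm.finite_measure_axioms)
  show "AE z in distr cm cm B. cmod z = 1"
    by (subst AE_distr_iff) (use AE_cm_circle blaschke_circle in auto)
  show "(LINT z|distr cm cm B. z ^ k) = (LINT z|cm. z ^ k)" for k
    using e0_orth[of 0 0 k] n by (subst integral_distr) (simp_all add: e0_0 integral_cm_power)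
qed (simp_all add: AE_cm_circle)

lemma AE_blaschke_compose:
  assumes "AE z in cm. P z"
  shows "AE z in cm. P (B z)"
proof -
  have "AE z in distr cm cm B. P z" unfolding distr_blaschke by (rule assms)
  then show ?thesis by (rule AE_distrD[rotated]) simp
qed

lemma lq_blaschke_compose:
  assumes "f \<in> lq q cm"
  shows "(\<lambda>z. f (B z)) \<in> lq q cm" "lint q cm (\<lambda>z. f (B z)) = lint q cm f"
proof -
  have m: "f \<in> borel_measurable cm" and i: "integrable cm (\<lambda>z. complex_of_real (cmod (f z) powr q))"
    using assms by (auto simp: lq_def)
  note c = integral_blaschke_compose[OF i]
  have "integrable cm (\<lambda>z. cmod (f (B z)) powr q)" using integrable_Re[OF c(1)] by simp
  then show "(\<lambda>z. f (B z)) \<in> lq q cm" using measurable_blaschke_compose[OF m] by (simp add: lq_def)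
  have "complex_of_real (LINT z|cm. cmod (f (B z)) powr q) = of_real (LINT z|cm. cmod (f z) powr q)"
    using c(2) by simp
  then show "lint q cm (\<lambda>z. f (B z)) = lint q cm f" unfolding lint_def by (simp only: of_real_eq_iff)
qed

subsection \<open>The expansion in the basis\<close>

definition sq :: "(nat \<Rightarrow> complex \<Rightarrow> complex) \<Rightarrow> complex \<Rightarrow> real" where
  "sq c z = (\<Sum>j<n. (cmod (c j z))\<^sup>2)"

lemma sq_nonneg: "0 \<le> sq c z"
  by (simp add: sq_def sum_nonneg)

lemma sq_ge: "j < n \<Longrightarrow> (cmod (c j z))\<^sup>2 \<le> sq c z"
  unfolding sq_def by (rule member_le_sum) auto

lemma measurable_T [measurable]:
  assumes "\<And>j. j < n \<Longrightarrow> c j \<in> borel_measurable cm"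
  shows "T c \<in> borel_measurable cm"
  unfolding T_def[abs_def]
  by (intro borel_measurable_sum borel_measurable_times measurable_e0 measurable_blaschke_compose assms) simp

text \<open>Since \<open>integral_e0_compose\<close> admits every integrable function of B z, a
  weight \<psi> (B z) can be carried along: T is isometric not only globally, but fibre by fibre
  over B.\<close>

lemma T_inner:
  fixes \<psi> :: "complex \<Rightarrow> complex"
  assumes g: "\<And>j k. j < n \<Longrightarrow> k < n \<Longrightarrow> integrable cm (\<lambda>z. c j z * cnj (d k z) * \<psi> z)"
  shows "integrable cm (\<lambda>z. T c z * cnj (T d z) * \<psi> (B z))"
    "(LINT z|cm. T c z * cnj (T d z) * \<psi> (B z)) = (LINT z|cm. (\<Sum>j<n. c j z * cnj (d j z)) * \<psi> z)"
proof -
  define F where "F j k z = e0 \<alpha> j z * cnj (e0 \<alpha> k z) * (c j (B z) * cnj (d k (B z)) * \<psi> (B z))" for j k z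
  have Fi: "integrable cm (F j k)" and Fe: "(LINT z|cm. F j k z) = (if k = j then LINT z|cm. c j z * cnj (d k z) * \<psi> z else 0)"
    if "j < n" "k < n" for j k
    unfolding F_def[abs_def] using integral_e0_compose[OF that(2,1) g[OF that]] by auto
  have eq: "T c z * cnj (T d z) * \<psi> (B z) = (\<Sum>j<n. \<Sum>k<n. F j k z)" for z
    unfolding T_def cnj_sum unfolding sum_product unfolding sum_distrib_right
    by (intro sum.cong refl) (simp add: F_def)
  show "integrable cm (\<lambda>z. T c z * cnj (T d z) * \<psi> (B z))"
    unfolding eq by (intro Bochner_Integration.integrable_sum Fi) auto
  have "(LINT z|cm. T c z * cnj (T d z) * \<psi> (B z)) = (\<Sum>j<n. LINT z|cm. (\<Sum>k<n. F j k z))"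
    unfolding eq by (rule Bochner_Integration.integral_sum) (auto intro!: Bochner_Integration.integrable_sum Fi)
  also have "\<dots> = (\<Sum>j<n. \<Sum>k<n. LINT z|cm. F j k z)"
    by (intro sum.cong refl Bochner_Integration.integral_sum) (auto intro: Fi)
  also have "\<dots> = (\<Sum>j<n. \<Sum>k<n. (if k = j then LINT z|cm. c j z * cnj (d k z) * \<psi> z else 0))"
    by (intro sum.cong refl) (auto simp: Fe)
  also have "\<dots> = (\<Sum>j<n. LINT z|cm. c j z * cnj (d j z) * \<psi> z)" by (intro sum.cong refl) (simp add: sum.delta)
  also have "\<dots> = (LINT z|cm. (\<Sum>j<n. c j z * cnj (d j z) * \<psi> z))"
    by (rule Bochner_Integration.integral_sum[symmetric]) (auto intro: g)
  finally show "(LINT z|cm. T c z * cnj (T d z) * \<psi> (B z)) = (LINT z|cm. (\<Sum>j<n. c j z * cnj (d j z)) * \<psi> z)"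
    by (simp add: sum_distrib_right)
qed

lemma T_weight:
  assumes c: "\<And>j. j < n \<Longrightarrow> c j \<in> borel_measurable cm" and u: "u \<in> borel_measurable cm"
    and i: "integrable cm (\<lambda>z. sq c z * u z)"
  shows "integrable cm (\<lambda>z. (cmod (T c z))\<^sup>2 * u (B z))"
    "(LINT z|cm. (cmod (T c z))\<^sup>2 * u (B z)) = (LINT z|cm. sq c z * u z)"
proof -
  have gi: "integrable cm (\<lambda>z. c j z * cnj (c k z) * of_real (u z))" if "j < n" "k < n" for j k
  proof (rule Bochner_Integration.integrable_bound[OF i])
    show "(\<lambda>z. c j z * cnj (c k z) * of_real (u z)) \<in> borel_measurable cm" using c[OF that(1)] c[OF that(2)] u by measurable
    have "cmod (c j z * cnj (c k z) * of_real (u z)) \<le> norm (sq c z * u z)" for z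
    proof -
      have s: "2 * (cmod (c j z) * cmod (c k z)) \<le> (cmod (c j z))\<^sup>2 + (cmod (c k z))\<^sup>2"
        using sum_squares_bound[of "cmod (c j z)" "cmod (c k z)"] by (simp add: mult.assoc)
      have "cmod (c j z) * cmod (c k z) \<le> sq c z"
        using s sq_ge[of j c z] sq_ge[of k c z] that by linarith
      then have "cmod (c j z) * cmod (c k z) * \<bar>u z\<bar> \<le> sq c z * \<bar>u z\<bar>" by (intro mult_right_mono) auto
      then show ?thesis using sq_nonneg[of c z] by (simp add: norm_mult abs_mult)
    qed
    then show "AE z in cm. cmod (c j z * cnj (c k z) * of_real (u z)) \<le> norm (sq c z * u z)" by simp
  qed
  have eq: "T c z * cnj (T c z) * of_real (u (B z)) = complex_of_real ((cmod (T c z))\<^sup>2 * u (B z))" for z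
    by (simp add: complex_norm_square[symmetric])
  have eq': "(\<Sum>j<n. c j z * cnj (c j z)) * of_real (u z) = complex_of_real (sq c z * u z)" for z
    by (simp add: sq_def complex_norm_square[symmetric] del: of_real_power)
  note t = T_inner[of c c "\<lambda>z. of_real (u z)", OF gi, unfolded eq eq']
  show "integrable cm (\<lambda>z. (cmod (T c z))\<^sup>2 * u (B z))" using integrable_Re[OF t(1)] by simp
  show "(LINT z|cm. (cmod (T c z))\<^sup>2 * u (B z)) = (LINT z|cm. sq c z * u z)"
    using t(2) by (simp only: integral_complex_of_real of_real_eq_iff)
qed

lemma sq_integrable:
  assumes "\<And>j. j < n \<Longrightarrow> c j \<in> lq 2 cm"
  shows "integrable cm (sq c)" "(LINT z|cm. sq c z) = (\<Sum>j<n. lint 2 cm (c j))"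
proof -
  have "\<And>j. j < n \<Longrightarrow> integrable cm (\<lambda>z. (cmod (c j z))\<^sup>2)" using assms by (simp add: lq2_iff)
  then show "integrable cm (sq c)" "(LINT z|cm. sq c z) = (\<Sum>j<n. lint 2 cm (c j))"
    unfolding sq_def[abs_def] lint2_eq by (auto intro!: Bochner_Integration.integral_sum)
qed

lemma T_isometry:
  assumes c: "\<And>j. j < n \<Longrightarrow> c j \<in> lq 2 cm"
  shows "T c \<in> lq 2 cm" "lint 2 cm (T c) = (\<Sum>j<n. lint 2 cm (c j))"
proof -
  have cm': "\<And>j. j < n \<Longrightarrow> c j \<in> borel_measurable cm" using c by (auto dest: lqD)
  note si = sq_integrable[where c = c, OF c]
  have "integrable cm (\<lambda>z. sq c z * 1)" using si(1) by simp
  note w = T_weight[where c = c and u = "\<lambda>_. 1", OF cm' _ this]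
  show "T c \<in> lq 2 cm" using w(1) measurable_T[where c = c, OF cm'] by (simp add: lq2_iff)
  show "lint 2 cm (T c) = (\<Sum>j<n. lint 2 cm (c j))"
    using w(2) si by (simp add: lint2_eq)
qed

lemma T_add: "T (\<lambda>j z. c j z + d j z) z = T c z + T d z"
  by (simp add: T_def algebra_simps sum.distrib)

lemma T_diff: "T (\<lambda>j z. c j z - d j z) z = T c z - T d z"
  by (simp add: T_def algebra_simps sum_subtractf)

lemma T_mult: "T (\<lambda>j z. g z * c j z) z = g (B z) * T c z"
  by (simp add: T_def sum_distrib_left mult_ac)

text \<open>Cauchy-Schwarz over j: the value of T c at z is controlled by the coefficient vector at
  B z alone. One constant serves this bound and the one on the basis functions.\<close>

lemma T_bound: obtains D where "D > 0" "\<And>c z. cmod z = 1 \<Longrightarrow> (\<forall>j<n. cmod (e0 \<alpha> j z) \<le> D) \<and> (cmod (T c z))\<^sup>2 \<le> D * sq c (B z)"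
proof -
  define K where "K = (\<Sum>j<n. ((1 - (cmod (\<alpha> (j + 1)))\<^sup>2) powr (1 / 2) / (1 - cmod (\<alpha> (j + 1))))\<^sup>2)"
  define L where "L = (\<Sum>j<n. ((1 - (cmod (\<alpha> (j + 1)))\<^sup>2) powr (1 / 2) / (1 - cmod (\<alpha> (j + 1)))))"
  have a: "cmod (\<alpha> (j + 1)) < 1" if "j < n" for j using disc that by auto
  have e: "cmod (e0 \<alpha> j z) \<le> (1 - (cmod (\<alpha> (j + 1)))\<^sup>2) powr (1 / 2) / (1 - cmod (\<alpha> (j + 1)))"
    if "j < n" "cmod z = 1" for j z
  proof -
    have "1 - cmod (\<alpha> (j + 1)) \<le> cmod (1 - cnj (\<alpha> (j + 1)) * z)"
      using norm_triangle_ineq2[of 1 "cnj (\<alpha> (j + 1)) * z"] that by (simp add: norm_mult)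
    then show ?thesis unfolding e0_def norm_mult norm_divide
      using blaschke_circle[of j z] that a[OF that(1)] by (simp add: frac_le)
  qed
  have L: "cmod (e0 \<alpha> j z) \<le> L" if "j < n" "cmod z = 1" for j z
  proof -
    have "(1 - (cmod (\<alpha> (j + 1)))\<^sup>2) powr (1 / 2) / (1 - cmod (\<alpha> (j + 1))) \<le> L"
      unfolding L_def
    proof (rule member_le_sum)
      fix i assume "i \<in> {..<n} - {j}"
      then show "0 \<le> (1 - (cmod (\<alpha> (i + 1)))\<^sup>2) powr (1 / 2) / (1 - cmod (\<alpha> (i + 1)))"
        using a[of i] by (intro divide_nonneg_nonneg) auto
    qed (use that(1) in auto)
    then show ?thesis using e[OF that] by linarith
  qed
  have K0: "K \<ge> 0" by (simp add: K_def sum_nonneg)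
  have L0: "L \<ge> 0" using order_trans[OF norm_ge_zero L[of 0 1]] n by simp
  have "(cmod (T c z))\<^sup>2 \<le> K * sq c (B z)" if z: "cmod z = 1" for c z
  proof -
    have "cmod (T c z) \<le> (\<Sum>j<n. cmod (e0 \<alpha> j z) * cmod (c j (B z)))"
      unfolding T_def by (rule order_trans[OF norm_sum]) (simp add: norm_mult)
    then have "(cmod (T c z))\<^sup>2 \<le> (\<Sum>j<n. cmod (e0 \<alpha> j z) * cmod (c j (B z)))\<^sup>2" by (intro power_mono) auto
    also have "\<dots> \<le> (\<Sum>j<n. (cmod (e0 \<alpha> j z))\<^sup>2) * (\<Sum>j<n. (cmod (c j (B z)))\<^sup>2)"
      by (rule Cauchy_Schwarz_ineq_sum)
    also have "\<dots> \<le> K * sq c (B z)"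
      unfolding K_def sq_def using e[OF _ z] by (intro mult_right_mono sum_mono power_mono) (auto intro: sum_nonneg)
    finally show ?thesis .
  qed
  moreover have "K * sq c w \<le> (K + L + 1) * sq c w" for c w
    using sq_nonneg[of c w] L0 by (intro mult_right_mono) auto
  ultimately have T: "(cmod (T c z))\<^sup>2 \<le> (K + L + 1) * sq c (B z)" if "cmod z = 1" for c z
    using that order_trans by blast
  have L': "cmod (e0 \<alpha> j z) \<le> K + L + 1" if "j < n" "cmod z = 1" for j z
    using L[OF that] K0 by linarith
  show thesis by (rule that[of "K + L + 1"]) (use K0 L0 L' T in auto)
qed

end

lemma lq_limit_unique:
  assumes q: "0 < q" and s: "\<And>k. s k \<in> lq q M" and f: "f \<in> lq q M" and g: "g \<in> lq q M"
    and conv: "(\<lambda>k. lint q M (\<lambda>z. s k z - f z)) \<longlonglongrightarrow> 0" "(\<lambda>k. lint q M (\<lambda>z. s k z - g z)) \<longlonglongrightarrow> 0"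
  shows "AE z in M. f z = g z"
proof -
  have "(\<lambda>k. 2 powr q * (lint q M (\<lambda>z. f z - s k z) + lint q M (\<lambda>z. s k z - g z))) \<longlonglongrightarrow> 2 powr q * (0 + 0)"
    using conv unfolding lint_commute[of q M f] by (intro tendsto_intros)
  then have "lint q M (\<lambda>z. f z - g z) \<le> 2 powr q * (0 + 0)"
    by (rule LIMSEQ_le_const) (use lint_diff_triangle[OF q f s g] in blast)
  then have "lint q M (\<lambda>z. f z - g z) = 0" using lint_nonneg[of q M "\<lambda>z. f z - g z"] by simp
  then have "AE z in M. f z - g z = 0" using lint_eq_0_iff[OF lq_diff(1)[OF q f g]] by simp
  then show ?thesis by eventually_elim simp
qed

lemma lq2_cm_mean_tendsto:
  assumes "\<And>k. s k \<in> lq 2 cm" "f \<in> lq 2 cm" "(\<lambda>k. lint 2 cm (\<lambda>z. s k z - f z)) \<longlonglongrightarrow> 0"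
  shows "(\<lambda>k. LINT z|cm. s k z) \<longlonglongrightarrow> (LINT z|cm. f z)"
  using lq2_tendsto_mult[OF assms(1,2) lq_cm_bounded[of "\<lambda>_. 1" 1 2] assms(3)] by simp

lemma H2_closed:
  assumes "\<And>k. s k \<in> H2" "f \<in> lq 2 cm" "(\<lambda>k. lint 2 cm (\<lambda>z. s k z - f z)) \<longlonglongrightarrow> 0"
  shows "f \<in> H2"
  by (rule lq_closure_closed[OF _ range_poly_lq assms(2,1,3)]) simp_all

lemma csubspace_0: "csubspace S \<Longrightarrow> (\<lambda>_. 0) \<in> S"
  by (simp add: csubspace_def)

lemma csubspace_add: "csubspace S \<Longrightarrow> f \<in> S \<Longrightarrow> g \<in> S \<Longrightarrow> (\<lambda>z. f z + g z) \<in> S"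
  by (simp add: csubspace_def)

lemma csubspace_cmult: "csubspace S \<Longrightarrow> f \<in> S \<Longrightarrow> (\<lambda>z. c * f z) \<in> S"
  by (simp add: csubspace_def)

lemma csubspace_diff: "csubspace S \<Longrightarrow> f \<in> S \<Longrightarrow> g \<in> S \<Longrightarrow> (\<lambda>z. f z - g z) \<in> S"
  using csubspace_add[OF _ _ csubspace_cmult[of S g "-1"], of f] by simp

lemma csubspace_sum:
  assumes "csubspace S" "\<And>i. i \<in> I \<Longrightarrow> f i \<in> S"
  shows "(\<lambda>z. \<Sum>i\<in>I. f i z) \<in> S"
  using assms(2)
  by (induction I rule: infinite_finite_induct) (simp_all add: csubspace_0 csubspace_add assms(1))

context blaschke_product
begin

text \<open>The isometry makes each coefficient sequence Cauchy as soon as \<open>T (c k)\<close>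
  converges, so the range of T is closed.\<close>

lemma T_limit:
  assumes c: "\<And>k j. j < n \<Longrightarrow> c k j \<in> lq 2 cm" and g: "g \<in> lq 2 cm"
    and conv: "(\<lambda>k. lint 2 cm (\<lambda>z. T (c k) z - g z)) \<longlonglongrightarrow> 0"
  obtains d where "\<And>j. j < n \<Longrightarrow> d j \<in> lq 2 cm" "\<And>j. j < n \<Longrightarrow> (\<lambda>k. lint 2 cm (\<lambda>z. c k j z - d j z)) \<longlonglongrightarrow> 0"
    "AE z in cm. g z = T d z"
proof -
  have TL: "T (c k) \<in> lq 2 cm" for k by (rule T_isometry) (rule c)
  have iso: "lint 2 cm (\<lambda>z. T (c k) z - T d z) = (\<Sum>j<n. lint 2 cm (\<lambda>z. c k j z - d j z))"
    if "\<And>j. j < n \<Longrightarrow> d j \<in> lq 2 cm" for k d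
  proof -
    have "lint 2 cm (T (\<lambda>j z. c k j z - d j z)) = (\<Sum>j<n. lint 2 cm (\<lambda>z. c k j z - d j z))"
      by (rule T_isometry(2)) (use c that in \<open>auto intro!: lq_diff\<close>)
    then show ?thesis by (simp add: T_diff[abs_def])
  qed
  have "\<exists>d. d \<in> lq 2 cm \<and> (\<lambda>k. lint 2 cm (\<lambda>z. c k j z - d z)) \<longlonglongrightarrow> 0" if j: "j < n" for j
  proof -
    have "\<exists>N. \<forall>k\<ge>N. \<forall>l\<ge>N. lint 2 cm (\<lambda>z. c k j z - c l j z) < e" if e: "e > 0" for e
    proof -
      obtain N where N: "\<forall>k\<ge>N. \<forall>l\<ge>N. lint 2 cm (\<lambda>z. T (c k) z - T (c l) z) < e"
        using lq_convergent_Cauchy[OF _ TL g conv e] by auto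
      have "lint 2 cm (\<lambda>z. c k j z - c l j z) \<le> lint 2 cm (\<lambda>z. T (c k) z - T (c l) z)" for k l
      proof -
        have "lint 2 cm (\<lambda>z. T (c k) z - T (c l) z) = (\<Sum>j<n. lint 2 cm (\<lambda>z. c k j z - c l j z))"
          by (rule iso) (rule c)
        moreover have "lint 2 cm (\<lambda>z. c k j z - c l j z) \<le> (\<Sum>j<n. lint 2 cm (\<lambda>z. c k j z - c l j z))"
          by (rule member_le_sum) (use j in auto)
        ultimately show ?thesis by simp
      qed
      then show ?thesis using N le_less_trans by blast
    qed
    then show ?thesis by (rule lq_Cauchy_dominated_subseq[of 2 "\<lambda>k. c k j" cm, OF _ c[OF j], rotated]) auto
  qed
  then obtain d where d: "\<And>j. j < n \<Longrightarrow> d j \<in> lq 2 cm" "\<And>j. j < n \<Longrightarrow> (\<lambda>k. lint 2 cm (\<lambda>z. c k j z - d j z)) \<longlonglongrightarrow> 0"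
    by metis
  have "(\<lambda>k. \<Sum>j<n. lint 2 cm (\<lambda>z. c k j z - d j z)) \<longlonglongrightarrow> (\<Sum>j<n. 0)"
    by (intro tendsto_sum d) auto
  moreover have "lint 2 cm (\<lambda>z. T (c k) z - T d z) = (\<Sum>j<n. lint 2 cm (\<lambda>z. c k j z - d j z))" for k
    by (rule iso) (rule d(1))
  ultimately have convd: "(\<lambda>k. lint 2 cm (\<lambda>z. T (c k) z - T d z)) \<longlonglongrightarrow> 0" by simp
  have Td: "T d \<in> lq 2 cm" by (rule T_isometry(1)) (rule d(1))
  have ae: "AE z in cm. g z = T d z" by (rule lq_limit_unique[OF _ TL g Td conv convd]) simp
  show thesis by (rule that[of d, OF d(1) d(2) ae])
qed

text \<open>The space X of coefficients is kept general because two instances are needed, H^2 and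
  L^2. Completeness of the basis is then a matter of showing that f - T d vanishes.\<close>

lemma T_projection:
  assumes X: "X \<subseteq> lq 2 cm" "csubspace X"
    and closed: "\<And>s f. (\<And>k. s k \<in> X) \<Longrightarrow> f \<in> lq 2 cm \<Longrightarrow> (\<lambda>k. lint 2 cm (\<lambda>z. s k z - f z)) \<longlonglongrightarrow> 0 \<Longrightarrow> f \<in> X"
    and f: "f \<in> lq 2 cm"
  shows "\<exists>d. (\<forall>j<n. d j \<in> X) \<and> (\<forall>c. (\<forall>j<n. c j \<in> X) \<longrightarrow> (LINT z|cm. (f z - T d z) * cnj (T c z)) = 0)"
proof -
  define S where "S = {T c | c. \<forall>j<n. c j \<in> X}"
  have SL: "S \<subseteq> lq 2 cm" unfolding S_def using X(1) by (auto intro!: T_isometry(1))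
  have S: "csubspace S"
    unfolding csubspace_def
  proof (intro conjI ballI allI)
    have "(\<lambda>_. 0) = T (\<lambda>_ _. 0)" by (simp add: T_def[abs_def])
    moreover have "(\<lambda>_. 0) \<in> X" using X(2) by (simp add: csubspace_def)
    ultimately show "(\<lambda>_. 0) \<in> S" unfolding S_def by blast
  next
    fix f g assume "f \<in> S" "g \<in> S"
    then obtain c d where *: "f = T c" "g = T d" "\<forall>j<n. c j \<in> X" "\<forall>j<n. d j \<in> X" by (auto simp: S_def)
    have "(\<lambda>z. f z + g z) = T (\<lambda>j z. c j z + d j z)" unfolding * by (simp add: T_add[abs_def])
    moreover have "\<forall>j<n. (\<lambda>z. c j z + d j z) \<in> X" using * X(2) by (simp add: csubspace_def)
    ultimately show "(\<lambda>z. f z + g z) \<in> S" unfolding S_def by blast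
  next
    fix a f assume "f \<in> S"
    then obtain c where *: "f = T c" "\<forall>j<n. c j \<in> X" by (auto simp: S_def)
    have "(\<lambda>z. a * f z) = T (\<lambda>j z. a * c j z)" unfolding * by (rule ext) (simp add: T_mult[of "\<lambda>_. a"])
    moreover have "\<forall>j<n. (\<lambda>z. a * c j z) \<in> X" using * X(2) by (simp add: csubspace_def)
    ultimately show "(\<lambda>z. a * f z) \<in> S" unfolding S_def by blast
  qed
  obtain s g where s: "\<And>k. s k \<in> S" and g: "g \<in> lq 2 cm" and conv: "(\<lambda>k. lint 2 cm (\<lambda>z. s k z - g z)) \<longlonglongrightarrow> 0"
    and o: "\<And>h. h \<in> S \<Longrightarrow> (LINT z|cm. (f z - g z) * cnj (h z)) = 0"
    by (rule lq2_projection[OF SL S f]) (rule that)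
  have "\<forall>k. \<exists>c. s k = T c \<and> (\<forall>j<n. c j \<in> X)" using s by (auto simp: S_def)
  then obtain c where c: "\<And>k. s k = T (c k)" "\<And>k j. j < n \<Longrightarrow> c k j \<in> X" by metis
  have cL: "\<And>k j. j < n \<Longrightarrow> c k j \<in> lq 2 cm" using c(2) X(1) by blast
  obtain d where d: "\<And>j. j < n \<Longrightarrow> d j \<in> lq 2 cm" "\<And>j. j < n \<Longrightarrow> (\<lambda>k. lint 2 cm (\<lambda>z. c k j z - d j z)) \<longlonglongrightarrow> 0"
    "AE z in cm. g z = T d z"
    by (rule T_limit[where c = c, OF cL g conv[unfolded c(1)]]) (assumption, rule that)
  show ?thesis
  proof (intro exI conjI allI impI)
    show "d j \<in> X" if "j < n" for j by (rule closed[OF c(2)[OF that] d(1)[OF that] d(2)[OF that]])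
    fix h assume h: "\<forall>j<n. h j \<in> X"
    then have hS: "T h \<in> S" unfolding S_def by blast
    have "(LINT z|cm. (f z - T d z) * cnj (T h z)) = (LINT z|cm. (f z - g z) * cnj (T h z))"
    proof (rule integral_cong_AE)
      have [measurable]: "f \<in> borel_measurable cm" "g \<in> borel_measurable cm" "T h \<in> borel_measurable cm" "T d \<in> borel_measurable cm"
        using f g hS SL T_isometry(1)[of d, OF d(1)] by (auto dest!: lqD)
      show "(\<lambda>z. (f z - T d z) * cnj (T h z)) \<in> borel_measurable cm" by measurable
      show "(\<lambda>z. (f z - g z) * cnj (T h z)) \<in> borel_measurable cm" by measurable
    qed (use d(3) in auto)
    then show "(LINT z|cm. (f z - T d z) * cnj (T h z)) = 0" using o[OF hS] by simp
  qed
qed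

lemma H2_blaschke_compose:
  assumes f: "f \<in> H2"
  shows "(\<lambda>z. f (B z)) \<in> H2"
proof -
  obtain s where s: "\<And>k. s k \<in> range poly" "(\<lambda>k. lint 2 cm (\<lambda>z. s k z - f z)) \<longlonglongrightarrow> 0"
    by (rule lq_closureE[OF f]) (rule that)
  show ?thesis
  proof (rule H2_closed[where s = "\<lambda>k z. s k (B z)"])
    show "(\<lambda>z. f (B z)) \<in> lq 2 cm" by (rule lq_blaschke_compose[OF H2_lq[OF f]])
    show "(\<lambda>z. s k (B z)) \<in> H2" for k
    proof -
      obtain p where p: "s k = poly p" using s(1)[of k] by auto
      have "(\<lambda>z. poly p (B z)) \<in> hb" unfolding poly_altdef
        by (intro hb_sum hb_cmult hb_power blaschke_hb) simp
      then show ?thesis unfolding p by (rule hb_H2)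
    qed
    have sk: "(\<lambda>z. s k z - f z) \<in> lq 2 cm" for k
      using s(1)[of k] range_poly_lq[of 2] by (intro lq_diff H2_lq[OF f]) auto
    show "(\<lambda>k. lint 2 cm (\<lambda>z. s k (B z) - f (B z))) \<longlonglongrightarrow> 0"
      using s(2) lq_blaschke_compose(2)[OF sk] by simp
  qed
qed

lemma T_H2:
  assumes "\<And>j. j < n \<Longrightarrow> c j \<in> H2"
  shows "T c \<in> H2"
proof -
  have "(\<lambda>z. \<Sum>j<m. e0 \<alpha> j z * c j (B z)) \<in> H2" if "m \<le> n" for m
    using that
  proof (induction m)
    case 0
    show ?case using csubspace_H2 by (simp add: csubspace_def)
  next
    case (Suc m)
    have "(\<lambda>z. e0 \<alpha> m z * c m (B z)) \<in> H2"
      using Suc.prems by (intro H2_mult_hb H2_blaschke_compose assms e0_hb) auto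
    then show ?case using Suc csubspace_H2 by (simp add: csubspace_def)
  qed
  from this[of n] show ?thesis by (simp add: T_def[abs_def])
qed

text \<open>One zero is removed at a time, which also takes care of repeated zeros: orthogonality to
  \<open>e0 \<alpha> m\<close> says that the quotient of f by the first m factors has Cauchy
  integral 0 at \<alpha> (m + 1), the hypothesis of \<open>H2_divide\<close>.\<close>

lemma H2_divide_blaschke:
  assumes f: "f \<in> H2" and o: "\<And>j. j < n \<Longrightarrow> (LINT z|cm. f z * cnj (e0 \<alpha> j z)) = 0"
  obtains g where "g \<in> H2" "\<And>z. cmod z = 1 \<Longrightarrow> f z = B z * g z"
proof -
  have "\<exists>g\<in>H2. \<forall>z. cmod z = 1 \<longrightarrow> f z = blaschke \<alpha> m z * g z" if "m \<le> n" for m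
    using that
  proof (induction m)
    case 0
    show ?case using f by (intro bexI[of _ f]) (simp_all add: blaschke_def)
  next
    case (Suc m)
    then obtain g where g: "g \<in> H2" "\<And>z. cmod z = 1 \<Longrightarrow> f z = blaschke \<alpha> m z * g z" by auto
    have a: "cmod (\<alpha> (m + 1)) < 1" using disc Suc.prems by auto
    define r where "r = (1 - (cmod (\<alpha> (m + 1)))\<^sup>2) powr (1 / 2)"
    have r: "r \<noteq> 0" using e0_const_pos[of m] Suc.prems by (simp add: r_def)
    have [measurable]: "f \<in> borel_measurable cm" "g \<in> borel_measurable cm" using f g(1) by (auto dest!: H2_lq lqD)
    have "(LINT z|cm. f z * cnj (e0 \<alpha> m z)) = (LINT z|cm. of_real r * (g z * (1 / (1 - \<alpha> (m + 1) * cnj z))))"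
    proof (rule integral_cong_AE)
      show "AE z in cm. f z * cnj (e0 \<alpha> m z) = of_real r * (g z * (1 / (1 - \<alpha> (m + 1) * cnj z)))"
        using AE_cm_circle
      proof eventually_elim
        case (elim z)
        have b: "blaschke \<alpha> m z * cnj (blaschke \<alpha> m z) = 1"
          using cnj_mult_circle(1)[OF blaschke_circle[OF _ elim]] Suc.prems by simp
        have "f z * cnj (e0 \<alpha> m z) = of_real r * (g z * (1 / (1 - \<alpha> (m + 1) * cnj z))) * (blaschke \<alpha> m z * cnj (blaschke \<alpha> m z))"
          using e0_cnj[of m z] g(2)[OF elim] Suc.prems elim by (simp add: r_def)
        then show ?case using b by simp
      qed
    qed measurable
    also have "\<dots> = of_real r * (LINT z|cm. g z * (1 / (1 - \<alpha> (m + 1) * cnj z)))"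
      by (rule integral_mult_right_zero)
    finally have "of_real r * (LINT z|cm. g z * (1 / (1 - \<alpha> (m + 1) * cnj z))) = 0"
      using o[of m] Suc.prems by (metis Suc_le_eq)
    then have 0: "(LINT z|cm. g z * (1 / (1 - \<alpha> (m + 1) * cnj z))) = 0" using r by (metis mult_eq_0_iff of_real_eq_0_iff)
    obtain h where h: "h \<in> H2" "\<And>z. cmod z = 1 \<Longrightarrow> g z = (z - \<alpha> (m + 1)) / (1 - cnj (\<alpha> (m + 1)) * z) * h z"
      by (rule H2_divide[OF g(1) a 0]) blast
    have "f z = blaschke \<alpha> (Suc m) z * h z" if z: "cmod z = 1" for z
      unfolding g(2)[OF z] h(2)[OF z] blaschke_split[of m "Suc m" z, OF lessI] by simp
    with h(1) show ?case by blast
  qed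
  from this[of n] that show thesis by blast
qed

text \<open>B^k contains z^k, so f has a zero of every order at the origin: on the circle
  \<open>cnj (z ^ l)\<close> times f is still z times a function in H^2 and has mean 0.\<close>

lemma H2_blaschke_vanish:
  assumes f: "f \<in> H2" and ex: "\<And>k. \<exists>g\<in>H2. AE z in cm. f z = B z ^ k * g z"
  shows "AE z in cm. f z = 0"
proof -
  obtain b where b: "b \<in> hb" "\<And>z. B z = z * b z" "\<And>z. cmod z = 1 \<Longrightarrow> cmod (b z) = 1" by (rule blaschke_zero) (rule that)
  have [measurable]: "f \<in> borel_measurable cm" using f by (auto dest!: H2_lq lqD)
  have c0: "(LINT z|cm. f z * cnj (z ^ l)) = 0" for l
  proof -
    obtain g where g: "g \<in> H2" "AE z in cm. f z = B z ^ Suc l * g z" using ex[of "Suc l"] by blast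
    define h where "h z = b z ^ Suc l * g z" for z
    have h: "h \<in> H2" unfolding h_def[abs_def] by (intro H2_mult_hb g hb_power b)
    have [measurable]: "h \<in> borel_measurable cm" using h by (auto dest!: H2_lq lqD)
    have "(LINT z|cm. f z * cnj (z ^ l)) = (LINT z|cm. z * h z)"
    proof (rule integral_cong_AE)
      show "AE z in cm. f z * cnj (z ^ l) = z * h z"
        using AE_cm_circle g(2)
      proof eventually_elim
        case (elim z)
        have "(z * cnj z) ^ l = 1" using cnj_mult_circle(1)[OF elim(1)] by simp
        moreover have "f z * cnj (z ^ l) = (z * cnj z) ^ l * (z * h z)"
          unfolding elim(2) b(2) h_def by (simp add: power_mult_distrib mult_ac)
        ultimately show ?case by simp
      qed
    qed measurable
    then show ?thesis using H2_mean_id[OF h] by simp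
  qed
  show ?thesis
  proof (rule fourier_unique[OF lq2_cm_integrable[OF H2_lq[OF f]] _ c0])
    show "(LINT z|cm. f z * z ^ k) = 0" for k
      using c0[of 0] H2_power[OF f] by (cases k) (simp_all del: power_Suc)
  qed
qed

text \<open>Orthogonality to the first n basis functions splits off a factor B, and the quotient
  inherits orthogonality to the others with k lowered by 1. So f is divisible by all powers of
  B.\<close>

lemma H2_complete:
  assumes f: "f \<in> H2" and o: "\<And>j k. j < n \<Longrightarrow> (LINT z|cm. f z * cnj (e0 \<alpha> j z * B z ^ k)) = 0"
  shows "AE z in cm. f z = 0"
proof (rule H2_blaschke_vanish[OF f])
  have [measurable]: "f \<in> borel_measurable cm" using f by (auto dest!: H2_lq lqD)
  have ex: "\<exists>g\<in>H2. \<forall>z. cmod z = 1 \<longrightarrow> f z = B z ^ k * g z" for k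
  proof (induction k)
    case 0
    show ?case using f by (intro bexI[of _ f]) simp_all
  next
    case (Suc k)
    then obtain g where g: "g \<in> H2" "\<And>z. cmod z = 1 \<Longrightarrow> f z = B z ^ k * g z" by auto
    have [measurable]: "g \<in> borel_measurable cm" using g(1) by (auto dest!: H2_lq lqD)
    have "(LINT z|cm. g z * cnj (e0 \<alpha> j z)) = 0" if j: "j < n" for j
    proof -
      have "(LINT z|cm. f z * cnj (e0 \<alpha> j z * B z ^ k)) = (LINT z|cm. g z * cnj (e0 \<alpha> j z))"
      proof (rule integral_cong_AE)
        show "AE z in cm. f z * cnj (e0 \<alpha> j z * B z ^ k) = g z * cnj (e0 \<alpha> j z)"
          using AE_cm_circle
        proof eventually_elim
          case (elim z)
          have "(B z * cnj (B z)) ^ k = 1" using cnj_mult_circle(1)[OF blaschke_circle[OF order_refl elim]] by simp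
          moreover have "f z * cnj (e0 \<alpha> j z * B z ^ k) = (B z * cnj (B z)) ^ k * (g z * cnj (e0 \<alpha> j z))"
            using g(2)[OF elim] by (simp add: power_mult_distrib mult_ac)
          ultimately show ?case by simp
        qed
      qed measurable
      then show ?thesis using o[OF j] by simp
    qed
    from H2_divide_blaschke[OF g(1) this] obtain h where h: "h \<in> H2" "\<And>z. cmod z = 1 \<Longrightarrow> g z = B z * h z" by blast
    have "f z = B z ^ Suc k * h z" if "cmod z = 1" for z using g(2)[OF that] h(2)[OF that] by simp
    with h(1) show ?case by blast
  qed
  show "\<exists>g\<in>H2. AE z in cm. f z = B z ^ k * g z" for k
  proof -
    obtain g where "g \<in> H2" "\<forall>z. cmod z = 1 \<longrightarrow> f z = B z ^ k * g z" using ex[of k] by blast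
    moreover from this have "AE z in cm. f z = B z ^ k * g z" using AE_cm_circle by auto
    ultimately show ?thesis by blast
  qed
qed

lemma H2_expansion:
  assumes f: "f \<in> H2"
  obtains d where "\<And>j. j < n \<Longrightarrow> d j \<in> H2" "AE z in cm. f z = T d z"
proof -
  have X: "H2 \<subseteq> lq 2 cm" using H2_lq by blast
  have "\<exists>d. (\<forall>j<n. d j \<in> H2) \<and> (\<forall>c. (\<forall>j<n. c j \<in> H2) \<longrightarrow> (LINT z|cm. (f z - T d z) * cnj (T c z)) = 0)"
  proof (rule T_projection[OF X csubspace_H2 _ H2_lq[OF f]])
    show "g \<in> H2" if "\<And>k. s k \<in> H2" "g \<in> lq 2 cm" "(\<lambda>k. lint 2 cm (\<lambda>z. s k z - g z)) \<longlonglongrightarrow> 0" for s g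
      by (rule H2_closed[OF that])
  qed
  then obtain d where d': "\<forall>j<n. d j \<in> H2"
    and o: "\<forall>c. (\<forall>j<n. c j \<in> H2) \<longrightarrow> (LINT z|cm. (f z - T d z) * cnj (T c z)) = 0"
    by blast
  then have d: "\<And>j. j < n \<Longrightarrow> d j \<in> H2" by blast
  have "AE z in cm. f z - T d z = 0"
  proof (rule H2_complete)
    have "T d \<in> H2" by (rule T_H2) (rule d)
    then show "(\<lambda>z. f z - T d z) \<in> H2" by (rule csubspace_diff[OF csubspace_H2 f])
    fix j k assume j: "j < n"
    define c where "c i = (if i = j then (\<lambda>z::complex. z ^ k) else (\<lambda>z. 0))" for i
    have cH: "c i \<in> H2" for i unfolding c_def using hb_H2[OF hb_power[OF hb_id]] hb_H2[OF hb_const] by simp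
    have "T c z = e0 \<alpha> j z * B z ^ k" for z
    proof -
      have "T c z = (\<Sum>i<n. if i = j then e0 \<alpha> j z * B z ^ k else 0)"
        unfolding T_def by (intro sum.cong) (auto simp: c_def)
      then show ?thesis using j by (simp add: sum.delta)
    qed
    then have Tc: "T c = (\<lambda>z. e0 \<alpha> j z * B z ^ k)" by blast
    show "(LINT z|cm. (f z - T d z) * cnj (e0 \<alpha> j z * B z ^ k)) = 0"
      using o[rule_format, of c] cH unfolding Tc by blast
  qed
  then have ae: "AE z in cm. f z = T d z" by eventually_elim simp
  show thesis by (rule that[of d, OF d ae])
qed

text \<open>The difference u of f and its projection is orthogonal to h times the conjugate of B^m
  for all h in H^2, since such a function is T of the coefficients \<open>cnj z ^ m * c j\<close>.
  With h = z^k, m = 0, and with h = b^k, m = k, where z^k = B^k cnj (b^k) on the circle, all Fourier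
  coefficients of u vanish.\<close>

lemma L2_expansion:
  assumes f: "f \<in> lq 2 cm"
  obtains d where "\<And>j. j < n \<Longrightarrow> d j \<in> lq 2 cm" "AE z in cm. f z = T d z"
proof -
  have sub: "csubspace (lq 2 cm)" unfolding csubspace_def by (auto intro: lq_add lq_cmult lq_cm_bounded[of _ 0])
  have "\<exists>d. (\<forall>j<n. d j \<in> lq 2 cm) \<and> (\<forall>c. (\<forall>j<n. c j \<in> lq 2 cm) \<longrightarrow> (LINT z|cm. (f z - T d z) * cnj (T c z)) = 0)"
    by (rule T_projection[OF order_refl sub _ f])
  then obtain d where d': "\<forall>j<n. d j \<in> lq 2 cm"
    and o: "\<forall>c. (\<forall>j<n. c j \<in> lq 2 cm) \<longrightarrow> (LINT z|cm. (f z - T d z) * cnj (T c z)) = 0"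
    by blast
  then have d: "\<And>j. j < n \<Longrightarrow> d j \<in> lq 2 cm" by blast
  obtain b where b: "b \<in> hb" "\<And>z. B z = z * b z" "\<And>z. cmod z = 1 \<Longrightarrow> cmod (b z) = 1" by (rule blaschke_zero) (rule that)
  define u where "u z = f z - T d z" for z
  have uL: "u \<in> lq 2 cm" unfolding u_def[abs_def] by (intro lq_diff f T_isometry(1)[of d, OF d]) auto
  have [measurable]: "u \<in> borel_measurable cm" using uL by (rule lqD)
  have key: "(LINT z|cm. u z * (B z ^ m * cnj (h z))) = 0" if h: "h \<in> H2" for h m
  proof -
    obtain c where c: "\<And>j. j < n \<Longrightarrow> c j \<in> H2" "AE z in cm. h z = T c z" by (rule H2_expansion[OF h]) (rule that)
    have cL: "(\<lambda>z. cnj z ^ m * c j z) \<in> lq 2 cm" if "j < n" for j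
      by (rule lq_mult_bounded[OF _ H2_lq[OF c(1)[OF that]], of _ 1]) (use AE_cm_circle in \<open>auto simp: norm_power\<close>)
    have [measurable]: "h \<in> borel_measurable cm" using h by (auto dest!: H2_lq lqD)
    have [measurable]: "T (\<lambda>j z. cnj z ^ m * c j z) \<in> borel_measurable cm"
      using T_isometry(1)[of "\<lambda>j z. cnj z ^ m * c j z", OF cL] by (rule lqD)
    have "(LINT z|cm. u z * (B z ^ m * cnj (h z))) = (LINT z|cm. u z * cnj (T (\<lambda>j z. cnj z ^ m * c j z) z))"
    proof (rule integral_cong_AE)
      show "AE z in cm. u z * (B z ^ m * cnj (h z)) = u z * cnj (T (\<lambda>j z. cnj z ^ m * c j z) z)"
        using c(2) by eventually_elim (simp add: T_mult)
    qed measurable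
    also have "\<dots> = 0" unfolding u_def by (rule o[rule_format]) (rule cL)
    finally show ?thesis .
  qed
  have "AE z in cm. u z = 0"
  proof (rule fourier_unique[OF lq2_cm_integrable[OF uL]])
    show "(LINT z|cm. u z * cnj (z ^ k)) = 0" for k
      using key[OF hb_H2[OF hb_power[OF hb_id]], of 0 k] by simp
    show "(LINT z|cm. u z * z ^ k) = 0" for k
    proof -
      have [measurable]: "b \<in> borel_measurable cm" using b(1) by (rule hb_measurable)
      have "(LINT z|cm. u z * z ^ k) = (LINT z|cm. u z * (B z ^ k * cnj (b z ^ k)))"
      proof (rule integral_cong_AE)
        show "AE z in cm. u z * z ^ k = u z * (B z ^ k * cnj (b z ^ k))"
          using AE_cm_circle
        proof eventually_elim
          case (elim z)
          have "(b z * cnj (b z)) ^ k = 1" using cnj_mult_circle(1)[OF b(3)[OF elim]] by simp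
          moreover have "B z ^ k * cnj (b z ^ k) = z ^ k * (b z * cnj (b z)) ^ k"
            unfolding b(2) by (simp add: power_mult_distrib mult_ac)
          ultimately show ?case by simp
        qed
      qed measurable
      then show ?thesis using key[OF hb_H2[OF hb_power[OF b(1)]], of k k] by simp
    qed
  qed
  then have ae: "AE z in cm. f z = T d z" by eventually_elim (simp add: u_def)
  show thesis by (rule that[of d, OF d ae])
qed

end

subsection \<open>Prediction and multipliers\<close>

text \<open>Szego's extremal problem: g is the projection of 1 onto z times the polynomials in L^2
  with weight w, and \<phi> = 1 - g. Since z^(k+1) \<phi> is a limit of z times polynomials, it is
  orthogonal to \<phi>, so |\<phi>|^2 w has no Fourier coefficients besides its mean c. Thus \<phi>
  is a bounded analytic function of modulus sqrt (c / w), close to 1 when the mean of w is close to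
  1.\<close>

lemma prediction:
  fixes w :: "complex \<Rightarrow> real"
  assumes w: "integrable cm w" and w1: "\<And>z. 1 \<le> w z"
  obtains \<phi> c where "\<phi> \<in> hb" "1 \<le> c" "c \<le> (LINT z|cm. w z)" "AE z in cm. (cmod (\<phi> z))\<^sup>2 * w z = c"
    "lint 2 cm (\<lambda>z. \<phi> z - 1) \<le> c - 1"
proof -
  have [measurable]: "w \<in> borel_measurable cm" using w by auto
  have w0: "0 \<le> w z" for z using w1[of z] by linarith
  define M where "M = density cm (\<lambda>z. ennreal (w z))"
  have [simp, measurable_cong]: "sets M = sets borel" by (simp add: M_def)
  have AEM: "(AE z in M. P z)" if "AE z in cm. P z" "Measurable.pred borel P" for P
    unfolding M_def using that by (subst AE_density) auto
  have circM: "AE z in M. cmod z = 1" by (rule AEM[OF AE_cm_circle]) measurable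
  have intM: "(LINT z|M. h z) = (LINT z|cm. of_real (w z) * h z)" if "h \<in> borel_measurable cm" for h :: "complex \<Rightarrow> complex"
    unfolding M_def using w0 that by (subst integral_density) (auto simp: scaleR_conv_of_real)
  have lqM: "h \<in> lq 2 M \<longleftrightarrow> h \<in> borel_measurable cm \<and> integrable cm (\<lambda>z. w z * (cmod (h z))\<^sup>2)" for h
    unfolding lq2_iff M_def using w0 by (auto simp: integrable_density)
  have lintM: "lint 2 M h = (LINT z|cm. w z * (cmod (h z))\<^sup>2)" if "h \<in> borel_measurable cm" for h
    unfolding lint2_eq M_def using w0 that by (subst integral_density) auto
  have down: "h \<in> lq 2 cm" "lint 2 cm h \<le> lint 2 M h" if h: "h \<in> lq 2 M" for h
  proof -
    have hm[measurable]: "h \<in> borel_measurable cm" and hi: "integrable cm (\<lambda>z. w z * (cmod (h z))\<^sup>2)" using h by (auto simp: lqM)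
    have le: "(cmod (h z))\<^sup>2 \<le> w z * (cmod (h z))\<^sup>2" for z using mult_right_mono[OF w1, of "(cmod (h z))\<^sup>2" z] by simp
    have i: "integrable cm (\<lambda>z. (cmod (h z))\<^sup>2)"
      by (rule Bochner_Integration.integrable_bound[OF hi]) (use le w0 in auto)
    then show "h \<in> lq 2 cm" by (simp add: lq2_iff)
    show "lint 2 cm h \<le> lint 2 M h" unfolding lintM[OF hm] unfolding lint2_eq by (rule integral_mono[OF i hi le])
  qed
  have bddM: "h \<in> lq 2 M" if "h \<in> borel_measurable cm" "AE z in cm. cmod (h z) \<le> C" for h C
  proof -
    note [measurable] = that(1)
    have "integrable cm (\<lambda>z. w z * (cmod (h z))\<^sup>2)"
    proof (rule Bochner_Integration.integrable_bound[of _ "\<lambda>z. w z * C\<^sup>2"])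
      show "AE z in cm. norm (w z * (cmod (h z))\<^sup>2) \<le> norm (w z * C\<^sup>2)"
        using that(2) by eventually_elim (use w0 in \<open>auto simp: abs_mult intro!: mult_left_mono power_mono\<close>)
    qed (use w in auto)
    then show ?thesis using that(1) by (simp add: lqM)
  qed
  define S where "S = range (\<lambda>(p :: complex poly) z. z * poly p z)"
  have Shb: "h \<in> hb" if "h \<in> S" for h using that hb_mult[OF hb_poly hb_id] by (auto simp: S_def)
  have SL: "S \<subseteq> lq 2 M" using Shb bddM by (auto simp: hb_def)
  have S: "csubspace S"
    unfolding csubspace_def S_def
  proof safe
    show "(\<lambda>_. 0) \<in> range (\<lambda>(p :: complex poly) z. z * poly p z)" by (rule range_eqI[of _ _ 0]) auto
    show "(\<lambda>z. z * poly p z + z * poly q z) \<in> range (\<lambda>p z. z * poly p z)" for p q :: "complex poly"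
      by (rule range_eqI[of _ _ "p + q"]) (auto simp: algebra_simps)
    show "(\<lambda>z. c * (z * poly p z)) \<in> range (\<lambda>p z. z * poly p z)" for p :: "complex poly" and c
      by (rule range_eqI[of _ _ "smult c p"]) (auto simp: algebra_simps)
  qed
  have oneM: "(\<lambda>_. 1) \<in> lq 2 M" by (rule bddM[of _ 1]) auto
  obtain s g where s: "\<And>k. s k \<in> S" and g: "g \<in> lq 2 M" and conv: "(\<lambda>k. lint 2 M (\<lambda>z. s k z - g z)) \<longlonglongrightarrow> 0"
    and o: "\<And>h. h \<in> S \<Longrightarrow> (LINT z|M. (1 - g z) * cnj (h z)) = 0"
    by (rule lq2_projection[OF SL S oneM]) (rule that)
  define \<phi> where "\<phi> z = 1 - g z" for z
  define t where "t k z = 1 - s k z" for k z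
  have \<phi>M: "\<phi> \<in> lq 2 M" unfolding \<phi>_def[abs_def] by (intro lq_diff oneM g) simp
  have tM: "t k \<in> lq 2 M" for k unfolding t_def[abs_def] using s SL by (intro lq_diff oneM) auto
  have convt: "(\<lambda>k. lint 2 M (\<lambda>z. t k z - \<phi> z)) \<longlonglongrightarrow> 0"
  proof -
    have "lint 2 M (\<lambda>z. t k z - \<phi> z) = lint 2 M (\<lambda>z. s k z - g z)" for k
      unfolding t_def \<phi>_def using lint_commute[of 2 M g "s k"] by simp
    then show ?thesis using conv by simp
  qed
  have convt': "(\<lambda>k. lint 2 cm (\<lambda>z. t k z - \<phi> z)) \<longlonglongrightarrow> 0"
    by (rule LIMSEQ_0_le[OF convt]) (auto intro!: down lq_diff tM \<phi>M)
  have [measurable]: "\<phi> \<in> borel_measurable cm" using \<phi>M by (simp add: lqM)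
  have thb: "t k \<in> hb" for k
    using hb_add[OF hb_const[of 1] hb_cmult[OF Shb[OF s[of k]], of "-1"]] by (simp add: t_def[abs_def])
  have \<phi>H: "\<phi> \<in> H2" by (rule H2_closed[OF hb_H2[OF thb] down(1)[OF \<phi>M] convt'])
  have mean: "(LINT z|cm. \<phi> z) = 1"
  proof -
    have "(\<lambda>k. LINT z|cm. t k z) \<longlonglongrightarrow> (LINT z|cm. \<phi> z)"
      by (rule lq2_cm_mean_tendsto[OF down(1)[OF tM] down(1)[OF \<phi>M] convt'])
    moreover have "(LINT z|cm. t k z) = 1" for k
    proof -
      obtain p where p: "s k = (\<lambda>z. z * poly p z)" using s[of k] by (auto simp: S_def)
      have "(LINT z|cm. s k z) = 0" unfolding p by (rule H2_mean_id[OF hb_H2[OF hb_poly]])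
      then show ?thesis unfolding t_def using hb_integrable[OF Shb[OF s[of k]]] cm.prob_space by simp
    qed
    ultimately show ?thesis by (simp add: LIMSEQ_const_iff)
  qed
  have orth: "(LINT z|M. v z * cnj (\<phi> z)) = 0"
    if h: "\<And>k. h k \<in> S" and v: "v \<in> lq 2 M" and c: "(\<lambda>k. lint 2 M (\<lambda>z. h k z - v z)) \<longlonglongrightarrow> 0" for h v
  proof -
    have "(\<lambda>k. LINT z|M. h k z * cnj (\<phi> z)) \<longlonglongrightarrow> (LINT z|M. v z * cnj (\<phi> z))"
      by (rule lq2_tendsto_mult[OF _ v lq_cnj(1)[OF \<phi>M] c]) (use h SL in auto)
    moreover have "(LINT z|M. h k z * cnj (\<phi> z)) = 0" for k
    proof -
      have "(LINT z|M. h k z * cnj (\<phi> z)) = (LINT z|M. cnj ((1 - g z) * cnj (h k z)))"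
        by (simp add: \<phi>_def mult.commute)
      also have "\<dots> = cnj (LINT z|M. (1 - g z) * cnj (h k z))" by (rule Bochner_Integration.integral_cnj)
      finally show ?thesis using o[OF h[of k]] by simp
    qed
    ultimately show ?thesis by (simp add: LIMSEQ_const_iff)
  qed
  define v where "v z = (cmod (\<phi> z))\<^sup>2 * w z" for z
  have vi: "integrable cm v" using \<phi>M by (simp add: lqM v_def[abs_def] mult.commute)
  define c where "c = (LINT z|cm. v z)"
  have zM: "(\<lambda>z. z ^ k * h z) \<in> lq 2 M" "lint 2 M (\<lambda>z. z ^ k * h z) \<le> lint 2 M h" if "h \<in> lq 2 M" for k h
  proof -
    have zk: "AE z in M. cmod (z ^ k) \<le> 1" using circM by eventually_elim (simp add: norm_power)
    show "(\<lambda>z. z ^ k * h z) \<in> lq 2 M" "lint 2 M (\<lambda>z. z ^ k * h z) \<le> lint 2 M h"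
      using lq_mult_bounded[OF _ that _ zk] by simp_all
  qed
  have orthk: "(LINT z|cm. of_real (v z) * z ^ Suc k) = 0" for k
  proof -
    have "(LINT z|M. z ^ Suc k * \<phi> z * cnj (\<phi> z)) = 0"
    proof (rule orth[where h = "\<lambda>l z. z ^ Suc k * t l z"])
      show "(\<lambda>z. z ^ Suc k * t l z) \<in> S" for l
      proof -
        obtain p where p: "s l = (\<lambda>z. z * poly p z)" using s[of l] by (auto simp: S_def)
        show ?thesis unfolding S_def t_def p
          by (rule range_eqI[of _ _ "monom 1 k * (1 - [:0, 1:] * p)"]) (auto simp: poly_monom algebra_simps)
      qed
      show "(\<lambda>z. z ^ Suc k * \<phi> z) \<in> lq 2 M" by (rule zM[OF \<phi>M])
      have "lint 2 M (\<lambda>z. z ^ Suc k * t l z - z ^ Suc k * \<phi> z) \<le> lint 2 M (\<lambda>z. t l z - \<phi> z)" for l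
        using zM(2)[OF lq_diff(1)[OF _ tM[of l] \<phi>M], of "Suc k"] by (simp add: right_diff_distrib del: power_Suc)
      then show "(\<lambda>l. lint 2 M (\<lambda>z. z ^ Suc k * t l z - z ^ Suc k * \<phi> z)) \<longlonglongrightarrow> 0"
        by (intro LIMSEQ_0_le[OF convt]) auto
    qed
    also have "(LINT z|M. z ^ Suc k * \<phi> z * cnj (\<phi> z)) = (LINT z|cm. of_real (w z) * (z ^ Suc k * \<phi> z * cnj (\<phi> z)))"
      by (rule intM) measurable
    also have "\<dots> = (LINT z|cm. of_real (v z) * z ^ Suc k)"
      by (intro Bochner_Integration.integral_cong refl) (simp add: v_def complex_norm_square mult_ac del: of_real_power)
    finally show ?thesis by simp
  qed
  have "AE z in cm. v z - c = 0"
  proof (rule real_fourier_unique)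
    show "integrable cm (\<lambda>z. v z - c)" using vi by simp
    have i: "integrable cm (\<lambda>z. of_real (v z) * z ^ k)" for k
    proof (rule Bochner_Integration.integrable_bound[OF vi])
      have [measurable]: "v \<in> borel_measurable cm" using vi by auto
      show "(\<lambda>z. complex_of_real (v z) * z ^ k) \<in> borel_measurable cm" by measurable
      show "AE z in cm. norm (complex_of_real (v z) * z ^ k) \<le> norm (v z)"
        using AE_cm_circle by eventually_elim (auto simp: norm_mult norm_power)
    qed
    have i2: "integrable cm (\<lambda>z. z ^ k)" for k using lq2_cm_integrable[OF power_lq[of 2 k]] by simp
    show "(LINT z|cm. of_real (v z - c) * z ^ k) = 0" for k
    proof -
      have "(LINT z|cm. of_real (v z - c) * z ^ k) = (LINT z|cm. of_real (v z) * z ^ k) - of_real c * (LINT z|cm. z ^ k)"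
        using i[of k] i2[of k] by (simp add: left_diff_distrib)
      also have "\<dots> = 0"
        using orthk by (cases k) (simp_all add: integral_cm_power c_def cm.prob_space[simplified] del: power_Suc)
      finally show ?thesis .
    qed
  qed
  then have vc: "AE z in cm. (cmod (\<phi> z))\<^sup>2 * w z = c" by eventually_elim (simp add: v_def)
  have \<phi>2: "\<phi> \<in> lq 2 cm" by (rule down[OF \<phi>M])
  \<comment> \<open>The mean of \<phi> is 1, so the cross term contributes -2 and the squared
    distance to 1 is \<open>lint 2 cm \<phi> - 1\<close>.\<close>
  have "lint 2 cm (\<lambda>z. \<phi> z - 1) = (LINT z|cm. (cmod (\<phi> z))\<^sup>2 - 2 * Re (\<phi> z) + 1)"
    unfolding lint2_eq
    by (intro Bochner_Integration.integral_cong refl) (simp only: cmod_power2, simp add: power2_eq_square algebra_simps)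
  also have "\<dots> = lint 2 cm \<phi> - 2 * (LINT z|cm. Re (\<phi> z)) + 1"
    using \<phi>2 lq2_cm_integrable[OF \<phi>2] cm.prob_space by (simp add: lint2_eq lq2_iff)
  also have "(LINT z|cm. Re (\<phi> z)) = 1" using integral_Re[OF lq2_cm_integrable[OF \<phi>2]] mean by simp
  finally have e1: "lint 2 cm (\<lambda>z. \<phi> z - 1) = lint 2 cm \<phi> - 1" by simp
  have \<phi>c: "lint 2 M \<phi> = c" by (simp add: lintM c_def v_def mult.commute)
  have dc: "lint 2 cm (\<lambda>z. \<phi> z - 1) \<le> c - 1" using e1 down(2)[OF \<phi>M] \<phi>c by simp
  have c1: "1 \<le> c" using dc lint_nonneg[of 2 cm "\<lambda>z. \<phi> z - 1"] by linarith
  \<comment> \<open>Pythagoras in the weighted space: 1 = \<phi> + g with orthogonal summands, so c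
    is the integral of w minus the squared norm of g.\<close>
  have cw: "c \<le> (LINT z|cm. w z)"
  proof -
    have g0: "(LINT z|M. g z * cnj (\<phi> z)) = 0" by (rule orth[OF s g conv])
    have "(\<lambda>z. (cmod (g z))\<^sup>2) = (\<lambda>z. 1 - (cmod (\<phi> z))\<^sup>2 - 2 * Re (g z * cnj (\<phi> z)))"
      by (rule ext) (simp only: cmod_power2 \<phi>_def, simp add: power2_eq_square algebra_simps)
    then have "lint 2 M g = (LINT z|M. 1 - (cmod (\<phi> z))\<^sup>2 - 2 * Re (g z * cnj (\<phi> z)))" unfolding lint2_eq by simp
    also have "\<dots> = (LINT z|M. 1) - lint 2 M \<phi> - 2 * (LINT z|M. Re (g z * cnj (\<phi> z)))"
    proof -
      have 1: "integrable M (\<lambda>z. 1::real)" using oneM by (simp add: lq2_iff)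
      have 2: "integrable M (\<lambda>z. (cmod (\<phi> z))\<^sup>2)" using \<phi>M by (simp add: lq2_iff)
      have 3: "integrable M (\<lambda>z. Re (g z * cnj (\<phi> z)))" by (rule integrable_Re[OF lq2_cnj_mult_integrable[OF g \<phi>M]])
      show ?thesis unfolding lint2_eq
        by (subst Bochner_Integration.integral_diff[OF Bochner_Integration.integrable_diff[OF 1 2] integrable_mult_right[OF 3]],
            subst Bochner_Integration.integral_diff[OF 1 2]) (simp del: times_complex.sel)
    qed
    also have "(LINT z|M. Re (g z * cnj (\<phi> z))) = 0"
      using integral_Re[OF lq2_cnj_mult_integrable[OF g \<phi>M]] g0 by simp
    also have "(LINT z|M. 1::real) = (LINT z|cm. w z)"
      unfolding M_def using w0 by (subst integral_density) auto
    finally show ?thesis using \<phi>c lint_nonneg[of 2 M g] by simp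
  qed
  have "AE z in cm. cmod (\<phi> z) \<le> sqrt c"
    using vc
  proof eventually_elim
    case (elim z)
    have "(cmod (\<phi> z))\<^sup>2 \<le> c" using mult_left_mono[OF w1[of z], of "(cmod (\<phi> z))\<^sup>2"] elim by simp
    then show ?case using real_le_rsqrt by blast
  qed
  then have "\<phi> \<in> hb" using \<phi>H by (auto simp: hb_iff)
  from that[OF this c1 cw vc dc] show thesis .
qed

context blaschke_product
begin

text \<open>The multiplier may depend on B z only, so \<open>F z powr q\<close> is first dominated
  by \<open>D * sq d (B z)\<close> through the expansion of \<open>F z powr (q / 2)\<close>. For the
  weight 1 + sq d / (m + 1), \<open>prediction\<close> bounds |\<phi>|^2 sq d by (m + 1) c, while c
  tends to 1 and forces \<phi> to 1 in L^2, hence pointwise along a subsequence.\<close>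

lemma multipliers:
  fixes F :: "complex \<Rightarrow> real"
  assumes q: "0 < q" and Fm: "F \<in> borel_measurable cm" and Fi: "integrable cm (\<lambda>z. F z powr q)" and F0: "\<And>z. 0 \<le> F z"
  obtains \<Phi> :: "nat \<Rightarrow> complex \<Rightarrow> complex" and A where "\<And>m. \<Phi> m \<in> hb" "\<And>m. AE z in cm. cmod (\<Phi> m z) \<le> A"
    "\<And>m. \<exists>C. AE z in cm. cmod (\<Phi> m (B z)) * F z \<le> C" "AE z in cm. (\<lambda>m. \<Phi> m z) \<longlonglongrightarrow> 1"
proof -
  define f where "f z = complex_of_real (F z powr (q / 2))" for z
  have f2: "(cmod (f z))\<^sup>2 = F z powr q" for z
    by (simp add: f_def power2_eq_square powr_add[symmetric])
  have fL: "f \<in> lq 2 cm" using Fm Fi by (simp add: lq2_iff f2) (simp add: f_def[abs_def])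
  obtain d where d: "\<And>j. j < n \<Longrightarrow> d j \<in> lq 2 cm" "AE z in cm. f z = T d z" by (rule L2_expansion[OF fL]) (rule that)
  obtain D where D: "D > 0" "\<And>c z. cmod z = 1 \<Longrightarrow> (\<forall>j<n. cmod (e0 \<alpha> j z) \<le> D) \<and> (cmod (T c z))\<^sup>2 \<le> D * sq c (B z)"
    by (rule T_bound) (rule that)
  have si: "integrable cm (sq d)" by (rule sq_integrable(1)) (rule d(1))
  define I where "I = (LINT z|cm. sq d z)"
  have I0: "0 \<le> I" unfolding I_def by (rule Bochner_Integration.integral_nonneg) (rule sq_nonneg)
  define w where "w m z = 1 + sq d z / real (Suc m)" for m z
  have wi: "integrable cm (w m)" for m unfolding w_def[abs_def] using si by simp
  have w1: "1 \<le> w m z" for m z using sq_nonneg[of d z] by (simp add: w_def)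
  have wI: "(LINT z|cm. w m z) = 1 + I / real (Suc m)" for m
    unfolding w_def I_def using si cm.prob_space by simp
  define P where "P m p \<longleftrightarrow> fst p \<in> hb \<and> 1 \<le> snd p \<and> snd p \<le> 1 + I / real (Suc m) \<and>
    (AE z in cm. (cmod (fst p z))\<^sup>2 * w m z = snd p) \<and> lint 2 cm (\<lambda>z. fst p z - 1) \<le> snd p - 1"
    for m and p :: "(complex \<Rightarrow> complex) \<times> real"
  have "\<forall>m. \<exists>p. P m p"
  proof
    fix m
    obtain \<phi> c where "\<phi> \<in> hb" "1 \<le> c" "c \<le> (LINT z|cm. w m z)" "AE z in cm. (cmod (\<phi> z))\<^sup>2 * w m z = c"
      "lint 2 cm (\<lambda>z. \<phi> z - 1) \<le> c - 1"
      by (rule prediction[OF wi[of m] w1]) (rule that)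
    then have "P m (\<phi>, c)" by (simp add: P_def wI)
    then show "\<exists>p. P m p" ..
  qed
  from choice[OF this] obtain p where p: "\<And>m. P m (p m)" by blast
  define \<phi> where "\<phi> m = fst (p m)" for m
  define c where "c m = snd (p m)" for m
  have \<phi>: "\<phi> m \<in> hb" and c: "1 \<le> c m" "c m \<le> 1 + I / real (Suc m)"
    and \<phi>w: "AE z in cm. (cmod (\<phi> m z))\<^sup>2 * w m z = c m" and \<phi>1: "lint 2 cm (\<lambda>z. \<phi> m z - 1) \<le> c m - 1" for m
    using p[of m] by (auto simp: P_def \<phi>_def c_def)
  have conv: "(\<lambda>m. lint 2 cm (\<lambda>z. \<phi> m z - 1)) \<longlonglongrightarrow> 0"
  proof (rule LIMSEQ_0_le)
    show "lint 2 cm (\<lambda>z. \<phi> m z - 1) \<le> I * (1 / real (Suc m))" for m using \<phi>1[of m] c(2)[of m] by simp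
    show "(\<lambda>m. I * (1 / real (Suc m))) \<longlonglongrightarrow> 0"
      using tendsto_mult[OF tendsto_const[of I] LIMSEQ_inverse_real_of_nat[unfolded inverse_eq_divide]] by (simp only: mult_zero_right)
  qed simp
  have one: "(\<lambda>_. 1) \<in> lq 2 cm" by (rule hb_lq[OF hb_const]) simp
  obtain r :: "nat \<Rightarrow> nat" where r: "AE z in cm. (\<lambda>m. \<phi> (r m) z) \<longlonglongrightarrow> 1"
    by (rule lq_convergent_dominated_subseq[OF _ hb_lq[OF \<phi>] one conv]) auto
  \<comment> \<open>|\<phi>|^2 F^q is bounded, but the first power of F has to be compensated. With
    \<Phi> = \<phi>^s and s q >= 2 the q-th power of |\<Phi>| F has only the bounded surplus factor
    |\<phi>|^(s q - 2).\<close>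
  obtain s :: nat where s: "2 / q < real s" using reals_Archimedean2 by blast
  have sq2: "2 \<le> real s * q" using s q by (simp add: field_simps)
  define K where "K = sqrt (1 + I)"
  have K1: "1 \<le> K" using I0 by (simp add: K_def)
  have cI: "c m \<le> 1 + I" for m
  proof -
    have "I / real (Suc m) \<le> I / 1" using I0 by (intro divide_left_mono) auto
    then show ?thesis using c(2)[of m] by simp
  qed
  have xK: "x \<le> K" if "x\<^sup>2 * w m z = c m" for x m z
  proof -
    have "x\<^sup>2 \<le> 1 + I" using mult_left_mono[OF w1[of m z], of "x\<^sup>2"] that cI[of m] by simp
    then show ?thesis unfolding K_def using real_le_rsqrt by blast
  qed
  show thesis
  proof (rule that)
    show "(\<lambda>z. \<phi> (r m) z ^ s) \<in> hb" for m by (rule hb_power[OF \<phi>])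
    show "AE z in cm. cmod (\<phi> (r m) z ^ s) \<le> K ^ s" for m
      using \<phi>w[of "r m"] by eventually_elim (simp add: norm_power power_mono xK)
    show "AE z in cm. (\<lambda>m. \<phi> (r m) z ^ s) \<longlonglongrightarrow> 1"
      using r
    proof eventually_elim
      case (elim z)
      from tendsto_power[OF elim, of s] show ?case by simp
    qed
    fix m
    define k where "k = r m"
    define C where "C = D * (real (Suc k) * c k) * K powr (real s * q - 2)"
    have "AE z in cm. cmod (\<phi> k (B z) ^ s) * F z \<le> C powr (1 / q)"
      using AE_blaschke_compose[OF \<phi>w[of k]] d(2) AE_cm_circle
    proof eventually_elim
      case (elim z)
      define x where "x = cmod (\<phi> k (B z))"
      have x0: "0 \<le> x" by (simp add: x_def)
      have xw: "x\<^sup>2 * w k (B z) = c k" using elim(1) by (simp add: x_def)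
      have "F z powr q \<le> D * sq d (B z)" using D(2)[OF elim(3), of d] elim(2) f2[of z] by simp
      then have "x\<^sup>2 * F z powr q \<le> x\<^sup>2 * (D * sq d (B z))" by (intro mult_left_mono) auto
      also have "\<dots> = D * (real (Suc k) * (x\<^sup>2 * (sq d (B z) / real (Suc k))))" by simp
      also have "\<dots> \<le> D * (real (Suc k) * c k)"
      proof -
        have "x\<^sup>2 * (sq d (B z) / real (Suc k)) \<le> c k" unfolding xw[symmetric] by (intro mult_left_mono) (auto simp: w_def)
        then show ?thesis using D(1) by (intro mult_left_mono) auto
      qed
      finally have 1: "x\<^sup>2 * F z powr q \<le> D * (real (Suc k) * c k)" .
      have 2: "x powr (real s * q) \<le> x\<^sup>2 * K powr (real s * q - 2)"
      proof (cases "x = 0")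
        case False
        then have "x > 0" using x0 by simp
        have "x powr (real s * q) = x powr (2 + (real s * q - 2))" by simp
        also have "\<dots> = x powr 2 * x powr (real s * q - 2)" by (rule powr_add)
        finally have "x powr (real s * q) = x powr 2 * x powr (real s * q - 2)" .
        also have "\<dots> \<le> x\<^sup>2 * K powr (real s * q - 2)"
          using x0 xK[OF xw] sq2 \<open>x > 0\<close> by (simp add: powr_numeral mult_left_mono powr_mono2)
        finally show ?thesis .
      qed simp
      have xs: "x ^ s = x powr real s" if "x > 0" using that by (simp add: powr_realpow)
      have "(x ^ s * F z) powr q = x powr (real s * q) * F z powr q"
      proof (cases "x = 0")
        case True
        have "s \<noteq> 0" using sq2 by (cases s) auto
        then show ?thesis using True by (simp add: power_0_left)
      next
        case False
        then show ?thesis using x0 F0[of z] xs by (simp add: powr_mult powr_powr)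
      qed
      also have "\<dots> \<le> x\<^sup>2 * K powr (real s * q - 2) * F z powr q" using 2 by (intro mult_right_mono) auto
      also have "\<dots> \<le> C" using mult_right_mono[OF 1, of "K powr (real s * q - 2)"] by (simp add: C_def mult_ac)
      finally have "((x ^ s * F z) powr q) powr (1 / q) \<le> C powr (1 / q)" using q by (intro powr_mono2) auto
      then show ?case using q x0 F0[of z] by (simp add: powr_powr norm_power x_def)
    qed
    then show "\<exists>C. AE z in cm. cmod (\<phi> (r m) (B z) ^ s) * F z \<le> C" unfolding k_def by blast
  qed
qed

end

subsection \<open>Invariant subspaces and their bounded elements\<close>

context blaschke_product
begin

lemma hb_blaschke_compose:
  assumes f: "f \<in> hb"
  shows "(\<lambda>z. f (B z)) \<in> hb"
proof -
  obtain C where "AE z in cm. cmod (f z) \<le> C" using f by (auto simp: hb_def)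
  then have "AE z in cm. cmod (f (B z)) \<le> C" by (rule AE_blaschke_compose)
  then show ?thesis using H2_blaschke_compose[OF hb_H2[OF f]] by (auto simp: hb_iff)
qed

text \<open>The weight u is the indicator of the set where \<open>sq c\<close> exceeds C^2. The
  weighted isometry and the measure preservation by B show that (sq c - C^2) u, which is
  nonnegative, has integral at most 0.\<close>

lemma sq_bounded:
  assumes c: "\<And>j. j < n \<Longrightarrow> c j \<in> lq 2 cm" and C: "AE z in cm. cmod (T c z) \<le> C"
  shows "AE z in cm. sq c z \<le> C\<^sup>2"
proof -
  have cmeas: "\<And>j. j < n \<Longrightarrow> c j \<in> borel_measurable cm" using c by (auto dest: lqD)
  have si: "integrable cm (sq c)" by (rule sq_integrable(1)) (rule c)
  have [measurable]: "sq c \<in> borel_measurable cm" using si by auto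
  define u where "u z = (if sq c z > C\<^sup>2 then 1 else 0::real)" for z
  have um[measurable]: "u \<in> borel_measurable cm" unfolding u_def[abs_def] by measurable
  have ui: "integrable cm u" by (rule cm.integrable_const_bound[of _ 1]) (auto simp: u_def)
  have iu: "integrable cm (\<lambda>z. sq c z * u z)"
    by (rule Bochner_Integration.integrable_bound[OF si]) (auto simp: u_def)
  have w: "integrable cm (\<lambda>z. (cmod (T c z))\<^sup>2 * u (B z))"
    "(LINT z|cm. (cmod (T c z))\<^sup>2 * u (B z)) = (LINT z|cm. sq c z * u z)"
    by (rule T_weight[OF _ um iu], erule cmeas)+
  have uB: "integrable cm (\<lambda>z. u (B z))" "(LINT z|cm. u (B z)) = (LINT z|cm. u z)"
  proof -
    have "integrable cm (\<lambda>z. complex_of_real (u z))" using ui by simp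
    note b = integral_blaschke_compose[OF this]
    show "integrable cm (\<lambda>z. u (B z))" using integrable_Re[OF b(1)] by simp
    show "(LINT z|cm. u (B z)) = (LINT z|cm. u z)" using b(2) by (simp only: integral_complex_of_real of_real_eq_iff)
  qed
  have "(LINT z|cm. sq c z * u z) \<le> (LINT z|cm. C\<^sup>2 * u (B z))"
    unfolding w(2)[symmetric]
  proof (rule integral_mono_AE)
    show "integrable cm (\<lambda>z. (cmod (T c z))\<^sup>2 * u (B z))" by (rule w(1))
    show "integrable cm (\<lambda>z. C\<^sup>2 * u (B z))" using uB by simp
    show "AE z in cm. (cmod (T c z))\<^sup>2 * u (B z) \<le> C\<^sup>2 * u (B z)"
      using C by eventually_elim (auto simp: u_def intro!: power_mono)
  qed
  also have "\<dots> = (LINT z|cm. C\<^sup>2 * u z)" using uB by simp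
  finally have le: "(LINT z|cm. sq c z * u z - C\<^sup>2 * u z) \<le> 0" using iu ui by simp
  have nn: "AE z in cm. 0 \<le> sq c z * u z - C\<^sup>2 * u z" by (auto simp: u_def)
  have ii: "integrable cm (\<lambda>z. sq c z * u z - C\<^sup>2 * u z)" using iu ui by simp
  have "(LINT z|cm. sq c z * u z - C\<^sup>2 * u z) = 0"
    using le integral_nonneg_AE[OF nn] by linarith
  then have "AE z in cm. sq c z * u z - C\<^sup>2 * u z = 0"
    using integral_nonneg_eq_0_iff_AE[OF ii nn] by simp
  then show ?thesis by eventually_elim (auto simp: u_def split: if_splits)
qed

text \<open>The isometry with the weight \<open>u = sq c powr (q / 2 - 1)\<close> bounds the coefficients in
  \<open>L\<^sup>q\<close> for every exponent \<open>q > 0\<close>, without any interpolation.\<close>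

lemma lint_coefficients:
  assumes q: "0 < q"
  obtains A where "0 \<le> A" "\<And>c K. (\<And>j. j < n \<Longrightarrow> c j \<in> lq 2 cm) \<Longrightarrow> AE z in cm. cmod (T c z) \<le> K \<Longrightarrow>
    integrable cm (\<lambda>z. sq c z powr (q / 2)) \<and> (LINT z|cm. sq c z powr (q / 2)) \<le> A * lint q cm (T c)"
proof -
  obtain D where D: "D > 0" "\<And>c z. cmod z = 1 \<Longrightarrow> (\<forall>j<n. cmod (e0 \<alpha> j z) \<le> D) \<and> (cmod (T c z))\<^sup>2 \<le> D * sq c (B z)"
    by (rule T_bound) (rule that)
  \<comment> \<open>For q < 2 the weight has a negative exponent and is controlled by |T c|^2 <= D
    sq c (B z). For q >= 2 it is compared with powers of 2 |T c|^2 where sq c (B z) is below that;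
    the leading 2 pays for absorbing the remaining region.\<close>
  define A where "A = (if q < 2 then D powr (1 - q / 2) else 2 * 2 powr (q / 2 - 1))"
  have A0: "0 \<le> A" by (simp add: A_def)
  show thesis
  proof (rule that[OF A0])
    fix c K assume c: "\<And>j. j < n \<Longrightarrow> c j \<in> lq 2 cm" and K: "AE z in cm. cmod (T c z) \<le> K"
    have cmeas: "\<And>j. j < n \<Longrightarrow> c j \<in> borel_measurable cm" using c by (auto dest: lqD)
    have si: "integrable cm (sq c)" by (rule sq_integrable(1)) (rule c)
    have [measurable]: "sq c \<in> borel_measurable cm" using si by auto
    have Tm[measurable]: "T c \<in> borel_measurable cm" by (rule measurable_T) (rule cmeas)
    have K': "AE z in cm. cmod (T c z) \<le> \<bar>K\<bar>" using K by eventually_elim simp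
    have sK: "AE z in cm. sq c z \<le> \<bar>K\<bar>\<^sup>2" by (rule sq_bounded[OF c K'])
    have H: "integrable cm (\<lambda>z. sq c z powr (q / 2))"
    proof (rule cm.integrable_const_bound[of _ "(\<bar>K\<bar>\<^sup>2) powr (q / 2)"])
      show "AE z in cm. norm (sq c z powr (q / 2)) \<le> (\<bar>K\<bar>\<^sup>2) powr (q / 2)"
        using sK by eventually_elim (use q in \<open>auto intro!: powr_mono2 sq_nonneg\<close>)
    qed measurable
    \<comment> \<open>\<open>0 powr x\<close> is 0 for every x, so at the zeros of
      \<open>sq c\<close> the weight vanishes even for a negative exponent, and \<open>su\<close>
      holds there too.\<close>
    define u where "u z = sq c z powr (q / 2 - 1)" for z
    have um[measurable]: "u \<in> borel_measurable cm" unfolding u_def[abs_def] by measurable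
    have u0: "0 \<le> u z" for z by (simp add: u_def)
    have su: "sq c z * u z = sq c z powr (q / 2)" for z
    proof (cases "sq c z = 0")
      case False
      then have "sq c z > 0" using sq_nonneg[of c z] by simp
      then show ?thesis by (simp add: u_def powr_diff)
    qed (simp add: u_def)
    have iu: "integrable cm (\<lambda>z. sq c z * u z)" unfolding su by (rule H)
    have w: "integrable cm (\<lambda>z. (cmod (T c z))\<^sup>2 * u (B z))"
      "(LINT z|cm. (cmod (T c z))\<^sup>2 * u (B z)) = (LINT z|cm. sq c z powr (q / 2))"
      unfolding su[symmetric] by (rule T_weight[OF _ um iu], erule cmeas)+
    have TL: "T c \<in> lq q cm" by (rule lq_cm_bounded[OF Tm K q])
    have HB: "integrable cm (\<lambda>z. sq c (B z) powr (q / 2))" "(LINT z|cm. sq c (B z) powr (q / 2)) = (LINT z|cm. sq c z powr (q / 2))"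
    proof -
      have "integrable cm (\<lambda>z. complex_of_real (sq c z powr (q / 2)))" using H by simp
      note b = integral_blaschke_compose[OF this]
      show "integrable cm (\<lambda>z. sq c (B z) powr (q / 2))" using integrable_Re[OF b(1)] by simp
      show "(LINT z|cm. sq c (B z) powr (q / 2)) = (LINT z|cm. sq c z powr (q / 2))"
        using b(2) by (simp only: integral_complex_of_real of_real_eq_iff)
    qed
    have "(LINT z|cm. sq c z powr (q / 2)) \<le> A * lint q cm (T c)"
    proof (cases "q < 2")
      case True
      have "(LINT z|cm. (cmod (T c z))\<^sup>2 * u (B z)) \<le> (LINT z|cm. A * cmod (T c z) powr q)"
      proof (rule integral_mono_AE)
        show "integrable cm (\<lambda>z. (cmod (T c z))\<^sup>2 * u (B z))" by (rule w(1))
        show "integrable cm (\<lambda>z. A * cmod (T c z) powr q)" using lq_integrable[OF TL] by simp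
        show "AE z in cm. (cmod (T c z))\<^sup>2 * u (B z) \<le> A * cmod (T c z) powr q"
          using AE_cm_circle
        proof eventually_elim
          case (elim z)
          define x y where "x = cmod (T c z)" and "y = sq c (B z)"
          have x0: "0 \<le> x" and y0: "0 \<le> y" by (simp_all add: x_def y_def sq_nonneg)
          have xy: "x\<^sup>2 \<le> D * y" using D(2)[OF elim, of c] by (simp add: x_def y_def)
          have "x\<^sup>2 * y powr (q / 2 - 1) \<le> A * x powr q"
          proof (cases "x = 0")
            case False
            then have x: "x > 0" using x0 by simp
            then have "0 < D * y" using xy by (smt (verit) zero_less_power)
            then have y: "y > 0" using D(1) y0 by (simp add: zero_less_mult_iff)
            have "x\<^sup>2 = x powr 2" using x by (simp add: powr_numeral)
            also have "\<dots> = x powr q * x powr (2 - q)" by (simp add: powr_add[symmetric])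
            also have "x powr (2 - q) = (x\<^sup>2) powr (1 - q / 2)"
              using x by (simp add: powr_powr powr_numeral[symmetric] algebra_simps del: powr_numeral)
            also have "\<dots> \<le> (D * y) powr (1 - q / 2)" using xy True by (intro powr_mono2) auto
            also have "\<dots> = D powr (1 - q / 2) * y powr (1 - q / 2)" using D(1) y by (simp add: powr_mult)
            finally have "x\<^sup>2 \<le> x powr q * (D powr (1 - q / 2) * y powr (1 - q / 2))"
              by (simp add: mult_left_mono)
            then have "x\<^sup>2 * y powr (q / 2 - 1) \<le> x powr q * (D powr (1 - q / 2) * y powr (1 - q / 2)) * y powr (q / 2 - 1)"
              by (intro mult_right_mono) auto
            also have "\<dots> = x powr q * D powr (1 - q / 2) * (y powr (1 - q / 2) * y powr (q / 2 - 1))" by simp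
            also have "y powr (1 - q / 2) * y powr (q / 2 - 1) = 1" using y by (simp add: powr_add[symmetric])
            finally show ?thesis using True by (simp add: A_def mult.commute)
          qed (simp add: A0)
          then show ?case by (simp add: x_def y_def u_def)
        qed
      qed
      then show ?thesis using w(2) by (simp add: lint_def)
    next
      case False
      \<comment> \<open>One half of the integral to be bounded reappears on the right and is
        subtracted at the end; it is finite by \<open>H\<close>, which rests on the boundedness of T
        c.\<close>
      have "(LINT z|cm. (cmod (T c z))\<^sup>2 * u (B z)) \<le> (LINT z|cm. (1 / 2) * sq c (B z) powr (q / 2) + (A / 2) * cmod (T c z) powr q)"
      proof (rule integral_mono)
        show "integrable cm (\<lambda>z. (cmod (T c z))\<^sup>2 * u (B z))" by (rule w(1))
        show "integrable cm (\<lambda>z. (1 / 2) * sq c (B z) powr (q / 2) + (A / 2) * cmod (T c z) powr q)"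
          using lq_integrable[OF TL] HB by simp
        fix z
        define x y where "x = cmod (T c z)" and "y = sq c (B z)"
        have x0: "0 \<le> x" and y0: "0 \<le> y" by (simp_all add: x_def y_def sq_nonneg)
        have "x\<^sup>2 * y powr (q / 2 - 1) \<le> (1 / 2) * y powr (q / 2) + (A / 2) * x powr q"
        proof (cases "x\<^sup>2 \<le> y / 2")
          case True
          have yy: "y * y powr (q / 2 - 1) = y powr (q / 2)" using su[of "B z"] by (simp add: u_def y_def)
          have "x\<^sup>2 * y powr (q / 2 - 1) \<le> y / 2 * y powr (q / 2 - 1)" using True by (intro mult_right_mono) auto
          also have "\<dots> = (1 / 2) * y powr (q / 2)" using yy by simp
          finally show ?thesis using A0 by (simp add: add_increasing2)
        next
          case nle: False
          then have x: "x > 0" using y0 x0 by (cases "x = 0") auto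
          have "y powr (q / 2 - 1) \<le> (2 * x\<^sup>2) powr (q / 2 - 1)"
            using nle False y0 by (intro powr_mono2) auto
          also have "\<dots> = 2 powr (q / 2 - 1) * x powr (q - 2)"
            using x by (simp add: powr_mult powr_powr powr_numeral[symmetric] algebra_simps del: powr_numeral)
          finally have "x\<^sup>2 * y powr (q / 2 - 1) \<le> x\<^sup>2 * (2 powr (q / 2 - 1) * x powr (q - 2))"
            by (intro mult_left_mono) auto
          also have "\<dots> = 2 powr (q / 2 - 1) * (x powr 2 * x powr (q - 2))" using x by (simp add: powr_numeral)
          also have "x powr 2 * x powr (q - 2) = x powr q" by (simp only: powr_add[symmetric]) simp
          finally have "x\<^sup>2 * y powr (q / 2 - 1) \<le> (A / 2) * x powr q" using False by (simp add: A_def)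
          then show ?thesis by (simp add: add_increasing)
        qed
        then show "(cmod (T c z))\<^sup>2 * u (B z) \<le> (1 / 2) * sq c (B z) powr (q / 2) + (A / 2) * cmod (T c z) powr q"
          by (simp add: x_def y_def u_def)
      qed
      also have "\<dots> = (1 / 2) * (LINT z|cm. sq c z powr (q / 2)) + (A / 2) * lint q cm (T c)"
        using lq_integrable[OF TL] HB by (subst Bochner_Integration.integral_add) (simp_all add: lint_def)
      finally show ?thesis using w(2) by simp
    qed
    with H show "integrable cm (\<lambda>z. sq c z powr (q / 2)) \<and> (LINT z|cm. sq c z powr (q / 2)) \<le> A * lint q cm (T c)" ..
  qed
qed

text \<open>Bessel's inequality for the unit vectors: in the r by m matrix each column has squared
  norm at most 1 and each row exactly 1. Summing all entries in both orders compares r with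
  m.\<close>

lemma orthonormal_le:
  fixes c :: "nat \<Rightarrow> nat \<Rightarrow> complex"
  assumes o: "\<And>i k. i < r \<Longrightarrow> k < r \<Longrightarrow> (\<Sum>j<m. c i j * cnj (c k j)) = (if i = k then 1 else 0)"
  shows "r \<le> m"
proof -
  have bessel: "(\<Sum>i<r. (cmod (c i j))\<^sup>2) \<le> 1" if j: "j < m" for j
  proof -
    define s where "s = (\<Sum>i<r. (cmod (c i j))\<^sup>2)"
    \<comment> \<open>The projection of the j-th unit vector onto the span of the rows: its j-th
      entry and its squared norm are both s, so s^2 <= s.\<close>
    define v where "v l = (\<Sum>i<r. cnj (c i j) * c i l)" for l
    have vj: "v j = of_real s" unfolding v_def s_def of_real_sum
      by (intro sum.cong refl) (simp add: complex_norm_square mult.commute del: of_real_power)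
    have "complex_of_real (\<Sum>l<m. (cmod (v l))\<^sup>2) = (\<Sum>l<m. v l * cnj (v l))"
      unfolding of_real_sum by (intro sum.cong refl) (rule complex_norm_square)
    also have "\<dots> = (\<Sum>l<m. \<Sum>i<r. \<Sum>k<r. cnj (c i j) * c k j * (c i l * cnj (c k l)))"
      unfolding v_def cnj_sum sum_product by (intro sum.cong refl) (simp add: mult_ac)
    also have "\<dots> = (\<Sum>i<r. \<Sum>l<m. \<Sum>k<r. cnj (c i j) * c k j * (c i l * cnj (c k l)))"
      by (rule sum.swap)
    also have "\<dots> = (\<Sum>i<r. \<Sum>k<r. \<Sum>l<m. cnj (c i j) * c k j * (c i l * cnj (c k l)))"
      by (rule sum.cong[OF refl]) (rule sum.swap)
    also have "\<dots> = (\<Sum>i<r. \<Sum>k<r. cnj (c i j) * c k j * (if i = k then 1 else 0))"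
      unfolding sum_distrib_left[symmetric] by (intro sum.cong refl) (simp add: o)
    also have "\<dots> = (\<Sum>i<r. cnj (c i j) * c i j)" by (intro sum.cong refl) (simp add: if_distrib sum.delta cong: if_cong)
    also have "\<dots> = of_real s" using vj by (simp add: v_def)
    finally have "(\<Sum>l<m. (cmod (v l))\<^sup>2) = s" by (simp only: of_real_eq_iff)
    moreover have "(cmod (v j))\<^sup>2 \<le> (\<Sum>l<m. (cmod (v l))\<^sup>2)" by (rule member_le_sum) (use j in auto)
    ultimately have "s\<^sup>2 \<le> s" using vj by simp
    then have "s * s \<le> 1 * s" by (simp add: power2_eq_square)
    moreover have "0 \<le> s" by (simp add: s_def sum_nonneg)
    ultimately show ?thesis unfolding s_def[symmetric] by (cases "s = 0") (auto dest!: mult_right_le_imp_le)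
  qed
  have "real r = (\<Sum>i<r. \<Sum>j<m. (cmod (c i j))\<^sup>2)"
  proof -
    have "(\<Sum>j<m. (cmod (c i j))\<^sup>2) = 1" if "i < r" for i
    proof -
      have "complex_of_real (\<Sum>j<m. (cmod (c i j))\<^sup>2) = (\<Sum>j<m. c i j * cnj (c i j))"
        unfolding of_real_sum by (intro sum.cong refl) (rule complex_norm_square)
      then have "complex_of_real (\<Sum>j<m. (cmod (c i j))\<^sup>2) = of_real 1" using o[OF that that] by simp
      then show ?thesis by (simp only: of_real_eq_iff)
    qed
    then show ?thesis by simp
  qed
  also have "\<dots> = (\<Sum>j<m. \<Sum>i<r. (cmod (c i j))\<^sup>2)" by (rule sum.swap)
  also have "\<dots> \<le> (\<Sum>j<m. 1)" by (intro sum_mono bessel) auto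
  finally show ?thesis by simp
qed

end

text \<open>\<open>bdd_hb\<close> and \<open>bdd_lim\<close> concern bounded functions only. They
  hold for closed subspaces of H^p with finite p as well as for weak-star closed subspaces of
  H^\<infinity>, so the construction of J is done once for all p.\<close>

locale bounded_invariant = blaschke_product +
  fixes M :: "(complex \<Rightarrow> complex) set"
  assumes sub: "csubspace M"
    and inv: "\<And>f. f \<in> M \<Longrightarrow> (\<lambda>z. B z * f z) \<in> M"
    and bdd_hb: "\<And>f C. f \<in> M \<Longrightarrow> AE z in cm. cmod (f z) \<le> C \<Longrightarrow> f \<in> hb"
    and bdd_lim: "\<And>s f C. (\<And>k. s k \<in> M) \<Longrightarrow> (\<And>k. AE z in cm. cmod (s k z) \<le> C) \<Longrightarrow> f \<in> borel_measurable cm \<Longrightarrow>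
      AE z in cm. (\<lambda>k. s k z) \<longlonglongrightarrow> f z \<Longrightarrow> f \<in> M"
begin

definition K :: "(complex \<Rightarrow> complex) set" where "K = M \<inter> hb"

lemma K_csubspace: "csubspace K"
  unfolding csubspace_def K_def using sub
  by (auto simp: csubspace_def hb_const hb_add hb_cmult)

lemma K_lq: "K \<subseteq> lq 2 cm"
  unfolding K_def using hb_lq by auto

lemma poly_inv: "f \<in> M \<Longrightarrow> (\<lambda>z. poly p (B z) * f z) \<in> M"
proof (induction p)
  case 0
  show ?case using csubspace_0[OF sub] by simp
next
  case (pCons a p)
  have "(\<lambda>z. a * f z + B z * (poly p (B z) * f z)) \<in> M"
    by (intro csubspace_add[OF sub] csubspace_cmult[OF sub] inv pCons)
  then show ?case by (simp add: algebra_simps)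
qed

lemma M_cong_AE:
  assumes "f \<in> M" "f \<in> hb" "AE z in cm. f z = g z" "g \<in> borel_measurable cm"
  shows "g \<in> M"
proof -
  obtain C where C: "AE z in cm. cmod (f z) \<le> C" using assms(2) by (auto simp: hb_def)
  show ?thesis
  proof (rule bdd_lim[of "\<lambda>_. f"])
    show "AE z in cm. (\<lambda>k. f z) \<longlonglongrightarrow> g z" using assms(3) by eventually_elim simp
  qed (use assms C in auto)
qed

text \<open>For polynomials in B the claim is invariance. Bounded pointwise approximation of \<Phi>
  by polynomials survives composition with the measure-preserving B, and \<open>bdd_lim\<close>
  takes the limit.\<close>

lemma hb_mult_K:
  assumes \<Phi>: "\<Phi> \<in> hb" and f: "f \<in> K"
  shows "(\<lambda>z. \<Phi> (B z) * f z) \<in> K"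
proof -
  have fhb: "f \<in> hb" and fM: "f \<in> M" using f by (auto simp: K_def)
  obtain D where D: "AE z in cm. cmod (f z) \<le> D" using fhb by (auto simp: hb_def)
  have hb: "(\<lambda>z. \<Phi> (B z) * f z) \<in> hb" by (rule hb_mult[OF fhb hb_blaschke_compose[OF \<Phi>]])
  have "\<Phi> \<in> Hinf" using \<Phi> by (simp add: Hinf_eq_hb)
  then obtain q C where q: "\<And>k z. cmod z = 1 \<Longrightarrow> cmod (poly (q k) z) \<le> C" "AE z in cm. (\<lambda>k. poly (q k) z) \<longlonglongrightarrow> \<Phi> z"
    by (rule Hinf_poly_approx) (rule that)
  have "(\<lambda>z. \<Phi> (B z) * f z) \<in> M"
  proof (rule bdd_lim[of "\<lambda>k z. poly (q k) (B z) * f z"])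
    show "(\<lambda>z. poly (q k) (B z) * f z) \<in> M" for k by (rule poly_inv[OF fM])
    show "AE z in cm. cmod (poly (q k) (B z) * f z) \<le> \<bar>C\<bar> * \<bar>D\<bar>" for k
      using D AE_cm_circle
    proof eventually_elim
      case (elim z)
      have "cmod (poly (q k) (B z)) \<le> \<bar>C\<bar>" using q(1)[OF blaschke_circle[OF order_refl elim(2)], of k] by linarith
      then show ?case using elim(1) by (auto simp: norm_mult intro!: mult_mono)
    qed
    show "AE z in cm. (\<lambda>k. poly (q k) (B z) * f z) \<longlonglongrightarrow> \<Phi> (B z) * f z"
      using AE_blaschke_compose[OF q(2)] by eventually_elim (intro tendsto_intros)
  qed (use hb in \<open>rule hb_measurable\<close>)
  with hb show ?thesis by (simp add: K_def)
qed

definition M2 :: "(complex \<Rightarrow> complex) set" where "M2 = lq_closure 2 cm K"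

lemma M2_csubspace: "csubspace M2"
  unfolding M2_def by (rule lq_closure_csubspace[OF _ K_lq K_csubspace]) simp

lemma M2_lq: "f \<in> M2 \<Longrightarrow> f \<in> lq 2 cm"
  unfolding M2_def by (rule lq_closure_lq)

lemma M2_closed:
  assumes "\<And>k. s k \<in> M2" "f \<in> lq 2 cm" "(\<lambda>k. lint 2 cm (\<lambda>z. s k z - f z)) \<longlonglongrightarrow> 0"
  shows "f \<in> M2"
  unfolding M2_def by (rule lq_closure_closed[OF _ K_lq assms(2) assms(1)[unfolded M2_def] assms(3)]) simp

lemma K_M2: "K \<subseteq> M2"
  unfolding M2_def by (rule lq_closure_superset[OF K_lq])

lemma M2_H2: "f \<in> M2 \<Longrightarrow> f \<in> H2"
proof -
  assume f: "f \<in> M2"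
  obtain s where s: "\<And>k. s k \<in> K" "(\<lambda>k. lint 2 cm (\<lambda>z. s k z - f z)) \<longlonglongrightarrow> 0"
    by (rule lq_closureE[OF f[unfolded M2_def]]) (rule that)
  show ?thesis by (rule H2_closed[OF _ M2_lq[OF f] s(2)]) (use s(1) hb_H2 in \<open>auto simp: K_def\<close>)
qed

lemma M2_mult:
  assumes \<Phi>: "\<Phi> \<in> hb" and f: "f \<in> M2"
  shows "(\<lambda>z. \<Phi> (B z) * f z) \<in> M2"
proof -
  obtain s where s: "\<And>k. s k \<in> K" "(\<lambda>k. lint 2 cm (\<lambda>z. s k z - f z)) \<longlonglongrightarrow> 0"
    by (rule lq_closureE[OF f[unfolded M2_def]]) (rule that)
  obtain C where C: "AE z in cm. cmod (\<Phi> z) \<le> C" using \<Phi> by (auto simp: hb_def)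
  have CB: "AE z in cm. cmod (\<Phi> (B z)) \<le> C" by (rule AE_blaschke_compose[OF C])
  have m: "(\<lambda>z. \<Phi> (B z)) \<in> borel_measurable cm" by (rule measurable_blaschke_compose[OF hb_measurable[OF \<Phi>]])
  have d: "(\<lambda>z. s k z - f z) \<in> lq 2 cm" for k using s(1)[of k] K_lq M2_lq[OF f] by (intro lq_diff) auto
  show ?thesis
  proof (rule M2_closed[of "\<lambda>k z. \<Phi> (B z) * s k z"])
    show "(\<lambda>z. \<Phi> (B z) * s k z) \<in> M2" for k using hb_mult_K[OF \<Phi> s(1)] K_M2 by blast
    show "(\<lambda>z. \<Phi> (B z) * f z) \<in> lq 2 cm" by (rule lq_mult_bounded[OF _ M2_lq[OF f] m CB]) simp
    have "(\<lambda>k. \<bar>C\<bar> powr 2 * lint 2 cm (\<lambda>z. s k z - f z)) \<longlonglongrightarrow> \<bar>C\<bar> powr 2 * 0" by (intro tendsto_intros s)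
    then have "(\<lambda>k. \<bar>C\<bar> powr 2 * lint 2 cm (\<lambda>z. s k z - f z)) \<longlonglongrightarrow> 0" by (simp only: mult_zero_right)
    then show "(\<lambda>k. lint 2 cm (\<lambda>z. \<Phi> (B z) * s k z - \<Phi> (B z) * f z)) \<longlonglongrightarrow> 0"
    proof (rule LIMSEQ_0_le)
      show "lint 2 cm (\<lambda>z. \<Phi> (B z) * s k z - \<Phi> (B z) * f z) \<le> \<bar>C\<bar> powr 2 * lint 2 cm (\<lambda>z. s k z - f z)" for k
        using lq_mult_bounded(2)[OF _ d m CB, of k] by (simp add: right_diff_distrib)
    qed simp
  qed
qed

lemma M2_B: "f \<in> M2 \<Longrightarrow> (\<lambda>z. B z * f z) \<in> M2"
  using M2_mult[OF hb_id] by simp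

lemma M2_B_power: "f \<in> M2 \<Longrightarrow> (\<lambda>z. B z ^ k * f z) \<in> M2"
  using M2_mult[OF hb_power[OF hb_id]] by simp

text \<open>The multipliers tame the majorant F of a subsequence: for fixed m the products with the
  approximants are uniformly bounded, so their limit \<open>\<Phi> m (B z) * f z\<close> is in M;
  then m tends to infinity under the bounds of \<Phi> m and f. This brings L^2 limits back into M,
  whatever the topology of M itself.\<close>

lemma bounded_M2_in_K:
  assumes f: "f \<in> M2" and C: "AE z in cm. cmod (f z) \<le> C"
  shows "f \<in> K"
proof -
  have fhb: "f \<in> hb" using M2_H2[OF f] C by (auto simp: hb_iff)
  have fm: "f \<in> borel_measurable cm" using fhb by (rule hb_measurable)
  obtain s where s: "\<And>k. s k \<in> K" "(\<lambda>k. lint 2 cm (\<lambda>z. s k z - f z)) \<longlonglongrightarrow> 0"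
    by (rule lq_closureE[OF f[unfolded M2_def]]) (rule that)
  have sL: "s k \<in> lq 2 cm" for k using s(1) K_lq by blast
  obtain F r where F: "strict_mono (r :: nat \<Rightarrow> nat)" "F \<in> borel_measurable cm"
    "integrable cm (\<lambda>z. F z powr 2)" "\<And>z. 0 \<le> F z"
    "AE z in cm. (\<lambda>k. s (r k) z) \<longlonglongrightarrow> f z" "\<And>k. AE z in cm. cmod (s (r k) z) \<le> F z"
    by (rule lq_convergent_dominated_subseq[OF _ sL M2_lq[OF f] s(2)]) (simp, rule that)
  obtain \<Phi> A where \<Phi>: "\<And>m. \<Phi> m \<in> hb" "\<And>m. AE z in cm. cmod (\<Phi> m z) \<le> A"
    "\<And>m. \<exists>C. AE z in cm. cmod (\<Phi> m (B z)) * F z \<le> C" "AE z in cm. (\<lambda>m. \<Phi> m z) \<longlonglongrightarrow> 1"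
    by (rule multipliers[OF _ F(2,3,4)]) (simp, rule that)
  have \<Phi>f: "(\<lambda>z. \<Phi> m (B z) * f z) \<in> hb" for m by (rule hb_mult[OF fhb hb_blaschke_compose[OF \<Phi>(1)]])
  have "(\<lambda>z. \<Phi> m (B z) * f z) \<in> M" for m
  proof -
    obtain D where D: "AE z in cm. cmod (\<Phi> m (B z)) * F z \<le> D" using \<Phi>(3) by blast
    show ?thesis
    proof (rule bdd_lim[of "\<lambda>k z. \<Phi> m (B z) * s (r k) z"])
      show "(\<lambda>z. \<Phi> m (B z) * s (r k) z) \<in> M" for k using hb_mult_K[OF \<Phi>(1) s(1)] by (auto simp: K_def)
      show "AE z in cm. cmod (\<Phi> m (B z) * s (r k) z) \<le> D" for k
        using D F(6)[of k]
      proof eventually_elim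
        case (elim z)
        have "cmod (\<Phi> m (B z) * s (r k) z) \<le> cmod (\<Phi> m (B z)) * F z"
          unfolding norm_mult using elim(2) by (intro mult_left_mono) auto
        then show ?case using elim(1) by linarith
      qed
      show "AE z in cm. (\<lambda>k. \<Phi> m (B z) * s (r k) z) \<longlonglongrightarrow> \<Phi> m (B z) * f z"
        using F(5) by eventually_elim (intro tendsto_intros)
    qed (rule hb_measurable[OF \<Phi>f])
  qed
  then have "f \<in> M"
  proof (rule bdd_lim[OF _ _ fm])
    show "AE z in cm. cmod (\<Phi> m (B z) * f z) \<le> \<bar>A\<bar> * \<bar>C\<bar>" for m
      using AE_blaschke_compose[OF \<Phi>(2)[of m]] C by eventually_elim (auto simp: norm_mult intro!: mult_mono)
    show "AE z in cm. (\<lambda>m. \<Phi> m (B z) * f z) \<longlonglongrightarrow> f z"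
      using AE_blaschke_compose[OF \<Phi>(4)]
    proof eventually_elim
      case (elim z)
      from tendsto_mult[OF elim tendsto_const[of "f z"]] show ?case by simp
    qed
  qed
  with fhb show ?thesis by (simp add: K_def)
qed

end

subsection \<open>The wandering subspace\<close>

lemma integral_cnj_swap: "(LINT z|M. g z * cnj (f z)) = cnj (LINT z|M. f z * cnj (g z))"
proof -
  have "(LINT z|M. g z * cnj (f z)) = (LINT z|M. cnj (f z * cnj (g z)))" by (simp add: mult.commute)
  then show ?thesis by (simp only: Bochner_Integration.integral_cnj)
qed

lemma integral_self_cnj: "(LINT z|M. f z * cnj (f z)) = of_real (lint 2 M f)"
  unfolding lint2_eq by (subst integral_complex_of_real[symmetric]) (simp only: complex_norm_square)

context blaschke_product
begin

definition dot :: "(nat \<Rightarrow> complex \<Rightarrow> complex) \<Rightarrow> (nat \<Rightarrow> complex \<Rightarrow> complex) \<Rightarrow> complex \<Rightarrow> complex" where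
  "dot c d z = (\<Sum>j<n. c j z * cnj (d j z))"

lemma dot_self: "dot c c z = of_real (sq c z)"
  unfolding dot_def sq_def of_real_sum by (intro sum.cong refl) (rule complex_norm_square[symmetric])

lemma cmod_dot_le: "(cmod (dot c d z))\<^sup>2 \<le> sq c z * sq d z"
proof -
  have "cmod (dot c d z) \<le> (\<Sum>j<n. cmod (c j z) * cmod (d j z))"
    unfolding dot_def by (rule order_trans[OF norm_sum]) (simp add: norm_mult)
  then have "(cmod (dot c d z))\<^sup>2 \<le> (\<Sum>j<n. cmod (c j z) * cmod (d j z))\<^sup>2" by (intro power_mono) auto
  also have "\<dots> \<le> sq c z * sq d z" unfolding sq_def by (rule Cauchy_Schwarz_ineq_sum)
  finally show ?thesis .
qed

lemma measurable_dot:
  assumes "\<And>j. j < n \<Longrightarrow> c j \<in> borel_measurable cm" "\<And>j. j < n \<Longrightarrow> d j \<in> borel_measurable cm"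
  shows "dot c d \<in> borel_measurable cm"
  unfolding dot_def[abs_def]
  by (intro borel_measurable_sum borel_measurable_times measurable_cnj assms) simp_all

lemma T_inner_bounded:
  assumes c: "\<And>j. j < n \<Longrightarrow> c j \<in> lq 2 cm" and d: "\<And>j. j < n \<Longrightarrow> d j \<in> lq 2 cm"
    and \<psi>: "\<psi> \<in> borel_measurable cm" "AE z in cm. cmod (\<psi> z) \<le> C"
  shows "(LINT z|cm. T c z * cnj (T d z) * \<psi> (B z)) = (LINT z|cm. dot c d z * \<psi> z)"
    "integrable cm (\<lambda>z. dot c d z * \<psi> z)"
proof -
  have i: "integrable cm (\<lambda>z. c j z * cnj (d k z) * \<psi> z)" if "j < n" "k < n" for j k
    using lq2_cnj_mult_integrable[OF lq_mult_bounded(1)[OF _ c[OF that(1)] \<psi>] d[OF that(2)]] by (simp add: mult_ac)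
  show "(LINT z|cm. T c z * cnj (T d z) * \<psi> (B z)) = (LINT z|cm. dot c d z * \<psi> z)"
    unfolding dot_def by (rule T_inner(2)) (rule i)
  show "integrable cm (\<lambda>z. dot c d z * \<psi> z)"
    unfolding dot_def sum_distrib_right by (rule Bochner_Integration.integrable_sum) (simp add: i)
qed

end

context bounded_invariant
begin

definition W :: "(complex \<Rightarrow> complex) set" where
  "W = {f \<in> M2. \<forall>g\<in>M2. (LINT z|cm. f z * cnj (B z * g z)) = 0}"

definition onf :: "nat \<Rightarrow> (nat \<Rightarrow> complex \<Rightarrow> complex) \<Rightarrow> bool" where
  "onf r J \<longleftrightarrow> (\<forall>i<r. J i \<in> W) \<and> (\<forall>i<r. \<forall>k<r. (LINT z|cm. J i z * cnj (J k z)) = (if i = k then 1 else 0))"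

lemma W_M2: "f \<in> W \<Longrightarrow> f \<in> M2"
  by (simp add: W_def)

lemma W_D: "f \<in> W \<Longrightarrow> g \<in> M2 \<Longrightarrow> (LINT z|cm. f z * cnj (B z * g z)) = 0"
  unfolding W_def by blast

lemma W_orth: "f \<in> W \<Longrightarrow> g \<in> M2 \<Longrightarrow> (LINT z|cm. f z * cnj (B z ^ Suc k * g z)) = 0"
proof -
  assume f: "f \<in> W" and g: "g \<in> M2"
  have "(LINT z|cm. f z * cnj (B z * (B z ^ k * g z))) = 0" 
    by (rule W_D[OF f M2_B_power[OF g]])
  then show ?thesis by (simp only: power_Suc mult.assoc)
qed

lemma T_inner_cong:
  assumes c: "\<And>j. j < n \<Longrightarrow> c j \<in> lq 2 cm" "AE z in cm. f z = T c z" and d: "\<And>j. j < n \<Longrightarrow> d j \<in> lq 2 cm" "AE z in cm. g z = T d z"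
    and m: "f \<in> borel_measurable cm" "g \<in> borel_measurable cm" and \<psi>: "\<psi> \<in> borel_measurable cm" "AE z in cm. cmod (\<psi> z) \<le> C"
  shows "(LINT z|cm. f z * cnj (g z) * \<psi> (B z)) = (LINT z|cm. dot c d z * \<psi> z)"
proof -
  have [measurable]: "T c \<in> borel_measurable cm" "T d \<in> borel_measurable cm"
    using c(1) d(1) by (auto intro!: measurable_T dest: lqD)
  have [measurable]: "(\<lambda>z. \<psi> (B z)) \<in> borel_measurable cm" by (rule measurable_blaschke_compose[OF \<psi>(1)])
  note [measurable] = m
  have "(LINT z|cm. f z * cnj (g z) * \<psi> (B z)) = (LINT z|cm. T c z * cnj (T d z) * \<psi> (B z))"
  proof (rule integral_cong_AE)
    show "AE z in cm. f z * cnj (g z) * \<psi> (B z) = T c z * cnj (T d z) * \<psi> (B z)"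
      using c(2) d(2) by eventually_elim simp
  qed measurable
  also have "\<dots> = (LINT z|cm. dot c d z * \<psi> z)" by (rule T_inner_bounded(1)[OF _ _ \<psi>]) (rule c(1) d(1), assumption)+
  finally show ?thesis .
qed

text \<open>The Fourier coefficients of \<open>dot c d\<close> are the integrals of f cnj g against
  powers of B and their conjugates. For a nonzero power these are, up to conjugation, inner products
  of g with B^k f or of f with B^k g, which vanish for wandering f and g. So orthonormality in L^2
  becomes orthonormality at almost every point.\<close>

lemma W_dot_const:
  assumes f: "f \<in> W" and g: "g \<in> W"
    and c: "\<And>j. j < n \<Longrightarrow> c j \<in> lq 2 cm" "AE z in cm. f z = T c z"
    and d: "\<And>j. j < n \<Longrightarrow> d j \<in> lq 2 cm" "AE z in cm. g z = T d z"
  shows "AE z in cm. dot c d z = (LINT z|cm. f z * cnj (g z))"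
proof -
  have m: "f \<in> borel_measurable cm" "g \<in> borel_measurable cm" using f g by (auto dest!: W_M2 M2_lq lqD)
  define a where "a = (LINT z|cm. f z * cnj (g z))"
  have zm: "(\<lambda>z. z ^ k) \<in> borel_measurable cm" "(\<lambda>z. cnj (z ^ k)) \<in> borel_measurable cm" for k by measurable
  have zb: "AE z in cm. cmod (z ^ k) \<le> 1" "AE z in cm. cmod (cnj (z ^ k)) \<le> 1" for k
    using AE_cm_circle by (eventually_elim, simp add: norm_power)+
  have i: "integrable cm (\<lambda>z. dot c d z * z ^ k)" "integrable cm (\<lambda>z. dot c d z * cnj (z ^ k))" for k
    by (rule T_inner_bounded(2)[OF _ _ zm(1) zb(1)], erule c(1), erule d(1))
       (rule T_inner_bounded(2)[OF _ _ zm(2) zb(2)], erule c(1), erule d(1))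
  have e: "(LINT z|cm. dot c d z * z ^ k) = (LINT z|cm. f z * cnj (g z) * B z ^ k)" for k
    by (rule T_inner_cong[OF _ c(2) _ d(2) m zm(1) zb(1), symmetric]) (erule c(1), erule d(1))
  have e': "(LINT z|cm. dot c d z * cnj (z ^ k)) = (LINT z|cm. f z * cnj (g z) * cnj (B z ^ k))" for k
    by (rule T_inner_cong[OF _ c(2) _ d(2) m zm(2) zb(2), symmetric]) (erule c(1), erule d(1))
  have iz: "integrable cm (\<lambda>z. z ^ k)" "integrable cm (\<lambda>z. cnj (z ^ k))" for k
    using hb_integrable[OF hb_power[OF hb_id]] by (simp_all only: complex_integrable_cnj)
  have "AE z in cm. dot c d z - a = 0"
  proof (rule fourier_unique)
    show "integrable cm (\<lambda>z. dot c d z - a)" using i(1)[of 0] by simp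
    show "(LINT z|cm. (dot c d z - a) * z ^ k) = 0" for k
    proof -
      have "(LINT z|cm. (dot c d z - a) * z ^ k) = (LINT z|cm. dot c d z * z ^ k) - a * (LINT z|cm. z ^ k)"
        using i(1)[of k] iz(1)[of k] by (simp add: left_diff_distrib)
      also have "\<dots> = 0"
      proof (cases k)
        case 0
        then show ?thesis unfolding e by (simp add: a_def integral_cm_power cm.prob_space[simplified])
      next
        case (Suc l)
        have "(LINT z|cm. f z * cnj (g z) * B z ^ Suc l) = (LINT z|cm. B z ^ Suc l * f z * cnj (g z))"
          by (simp only: mult_ac)
        also have "\<dots> = cnj (LINT z|cm. g z * cnj (B z ^ Suc l * f z))" by (rule integral_cnj_swap)
        finally show ?thesis unfolding e Suc using W_orth[OF g W_M2[OF f], of l]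
          by (simp add: integral_cm_power del: power_Suc complex_cnj_mult)
      qed
      finally show ?thesis .
    qed
    show "(LINT z|cm. (dot c d z - a) * cnj (z ^ k)) = 0" for k
    proof -
      have "(LINT z|cm. (dot c d z - a) * cnj (z ^ k)) = (LINT z|cm. dot c d z * cnj (z ^ k)) - a * (LINT z|cm. cnj (z ^ k))"
        unfolding left_diff_distrib using i(2)[of k] iz(2)[of k] by (subst Bochner_Integration.integral_diff) simp_all
      also have "(LINT z|cm. cnj (z ^ k)) = cnj (LINT z|cm. z ^ k)" by (rule Bochner_Integration.integral_cnj)
      also have "(LINT z|cm. dot c d z * cnj (z ^ k)) - a * cnj (LINT z|cm. z ^ k) = 0"
      proof (cases k)
        case 0
        then show ?thesis unfolding e' by (simp add: a_def integral_cm_power cm.prob_space[simplified])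
      next
        case (Suc l)
        have "(LINT z|cm. f z * cnj (g z) * cnj (B z ^ Suc l)) = (LINT z|cm. f z * cnj (B z ^ Suc l * g z))"
          by (simp only: complex_cnj_mult mult_ac)
        then show ?thesis unfolding e' Suc using W_orth[OF f W_M2[OF g], of l]
          by (simp add: integral_cm_power del: power_Suc complex_cnj_mult)
      qed
      finally show ?thesis .
    qed
  qed
  then show ?thesis by eventually_elim (simp add: a_def)
qed

lemma M2_expansion:
  assumes "f \<in> M2"
  obtains d where "\<And>j. j < n \<Longrightarrow> d j \<in> H2" "AE z in cm. f z = T d z"
  by (rule H2_expansion[OF M2_H2[OF assms]]) (rule that)

lemma onf_coefficients:
  assumes "onf r J"
  obtains c where "\<And>i j. i < r \<Longrightarrow> j < n \<Longrightarrow> c i j \<in> H2" "\<And>i. i < r \<Longrightarrow> AE z in cm. J i z = T (c i) z"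
    "\<And>i k. i < r \<Longrightarrow> k < r \<Longrightarrow> AE z in cm. dot (c i) (c k) z = (if i = k then 1 else 0)"
proof -
  have "\<forall>i. \<exists>d. i < r \<longrightarrow> (\<forall>j<n. d j \<in> H2) \<and> (AE z in cm. J i z = T d z)"
  proof
    fix i
    show "\<exists>d. i < r \<longrightarrow> (\<forall>j<n. d j \<in> H2) \<and> (AE z in cm. J i z = T d z)"
    proof (cases "i < r")
      case True
      then have "J i \<in> M2" using assms by (simp add: onf_def W_M2)
      then obtain d where "\<And>j. j < n \<Longrightarrow> d j \<in> H2" "AE z in cm. J i z = T d z" by (rule M2_expansion) (rule that)
      then show ?thesis by blast
    qed simp
  qed
  from choice[OF this] obtain c where c: "\<And>i j. i < r \<Longrightarrow> j < n \<Longrightarrow> c i j \<in> H2" "\<And>i. i < r \<Longrightarrow> AE z in cm. J i z = T (c i) z"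
    by blast
  have "AE z in cm. dot (c i) (c k) z = (if i = k then 1 else 0)" if "i < r" "k < r" for i k
  proof -
    have "AE z in cm. dot (c i) (c k) z = (LINT z|cm. J i z * cnj (J k z))"
      by (rule W_dot_const[OF _ _ _ c(2)[OF that(1)] _ c(2)[OF that(2)]])
         (use assms that c(1) H2_lq in \<open>auto simp: onf_def\<close>)
    then show ?thesis using assms that by (simp add: onf_def)
  qed
  with c show thesis using that[of c] by blast
qed

text \<open>Almost every point carries r orthonormal vectors of length n; a single such point
  decides.\<close>

lemma onf_le: assumes "onf r J" shows "r \<le> n"
proof -
  obtain c where "\<And>i k. i < r \<Longrightarrow> k < r \<Longrightarrow> AE z in cm. dot (c i) (c k) z = (if i = k then 1 else 0)"
    by (rule onf_coefficients[OF assms]) blast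
  then have "AE z in cm. \<forall>i\<in>{..<r}. \<forall>k\<in>{..<r}. dot (c i) (c k) z = (if i = k then 1 else 0)"
    by (intro AE_finite_allI) auto
  then have "AE z in cm. r \<le> n"
  proof eventually_elim
    case (elim z)
    show ?case by (rule orthonormal_le[where r = r and m = n and c = "\<lambda>i j. c i j z"]) (use elim in \<open>simp add: dot_def\<close>)
  qed
  then show ?thesis by simp
qed

lemma onf_maximal: obtains r J where "onf r J" "\<And>J'. \<not> onf (Suc r) J'"
proof -
  define P where "P r \<longleftrightarrow> (\<exists>J. onf r J)" for r
  have 0: "P 0" by (simp add: P_def onf_def)
  have le: "\<forall>r. P r \<longrightarrow> r \<le> n" using onf_le by (auto simp: P_def)
  have "P (Greatest P)" by (rule GreatestI_nat[of P 0 n]) (use 0 le in auto)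
  moreover have "\<not> P (Suc (Greatest P))" using Greatest_le_nat[of P "Suc (Greatest P)" n] le by auto
  ultimately show thesis using that unfolding P_def by blast
qed

text \<open>As |B| = 1 on the circle, the projection g of h onto B M2, a limit of B t_k, makes t_k
  converge to h1 = cnj B * g. So h1 is in M2, and h - g is wandering.\<close>

lemma M2_decompose:
  assumes h: "h \<in> M2"
  obtains u h1 where "u \<in> W" "h1 \<in> M2" "\<And>z. h z = u z + B z * h1 z"
proof -
  define S where "S = {\<lambda>z. B z * g z | g. g \<in> M2}"
  have SM: "S \<subseteq> M2" using M2_B by (auto simp: S_def)
  then have SL: "S \<subseteq> lq 2 cm" using M2_lq by blast
  have S: "csubspace S"
    unfolding csubspace_def
  proof (intro conjI ballI allI)
    show "(\<lambda>_. 0) \<in> S" unfolding S_def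
      by (intro CollectI exI[of _ "\<lambda>_. 0"]) (simp add: csubspace_0[OF M2_csubspace])
  next
    fix f g assume "f \<in> S" "g \<in> S"
    then obtain f' g' where *: "f = (\<lambda>z. B z * f' z)" "g = (\<lambda>z. B z * g' z)" "f' \<in> M2" "g' \<in> M2" by (auto simp: S_def)
    show "(\<lambda>z. f z + g z) \<in> S" unfolding S_def *
      by (intro CollectI exI[of _ "\<lambda>z. f' z + g' z"]) (simp add: distrib_left csubspace_add[OF M2_csubspace *(3,4)])
  next
    fix a f assume "f \<in> S"
    then obtain f' where *: "f = (\<lambda>z. B z * f' z)" "f' \<in> M2" by (auto simp: S_def)
    show "(\<lambda>z. a * f z) \<in> S" unfolding S_def *
      by (intro CollectI exI[of _ "\<lambda>z. a * f' z"]) (simp add: mult.left_commute csubspace_cmult[OF M2_csubspace *(2)])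
  qed
  obtain s g where s: "\<And>k. s k \<in> S" and g: "g \<in> lq 2 cm" and conv: "(\<lambda>k. lint 2 cm (\<lambda>z. s k z - g z)) \<longlonglongrightarrow> 0"
    and o: "\<And>f. f \<in> S \<Longrightarrow> (LINT z|cm. (h z - g z) * cnj (f z)) = 0"
    by (rule lq2_projection[OF SL S M2_lq[OF h]]) (rule that)
  have "\<forall>k. \<exists>t. t \<in> M2 \<and> s k = (\<lambda>z. B z * t z)" using s by (auto simp: S_def)
  from choice[OF this] obtain t where t: "\<And>k. t k \<in> M2" "\<And>k. s k = (\<lambda>z. B z * t k z)" by blast
  define h1 where "h1 z = cnj (B z) * g z" for z
  have gm[measurable]: "g \<in> borel_measurable cm" "h \<in> borel_measurable cm" using g h by (auto dest!: M2_lq lqD)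
  have bB: "AE z in cm. cmod (cnj (B z)) \<le> 1" using AE_cm_circle by eventually_elim (simp add: blaschke_circle)
  have BB: "cnj (B z) * B z = 1" "B z * cnj (B z) = 1" if "cmod z = 1" for z
    using cnj_mult_circle[OF blaschke_circle[OF order_refl that]] by auto
  have h1L: "h1 \<in> lq 2 cm" unfolding h1_def[abs_def] by (rule lq_mult_bounded[OF _ g _ bB]) simp_all
  have h1: "h1 \<in> M2"
  proof (rule M2_closed[OF t(1) h1L])
    show "(\<lambda>k. lint 2 cm (\<lambda>z. t k z - h1 z)) \<longlonglongrightarrow> 0"
    proof (rule LIMSEQ_0_le[OF conv])
      fix k
      have d: "(\<lambda>z. s k z - g z) \<in> lq 2 cm" using s SL g by (intro lq_diff) auto
      have tm: "t k \<in> borel_measurable cm" using t(1) by (auto dest!: M2_lq lqD)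
      note [measurable] = tm
      have "lint 2 cm (\<lambda>z. t k z - h1 z) = lint 2 cm (\<lambda>z. cnj (B z) * (s k z - g z))"
      proof (rule lint_cong_AE)
        show "AE z in cm. t k z - h1 z = cnj (B z) * (s k z - g z)"
          using AE_cm_circle
        proof eventually_elim
          case (elim z)
          have "cnj (B z) * (s k z - g z) = (cnj (B z) * B z) * t k z - cnj (B z) * g z"
            unfolding t(2) by (simp add: algebra_simps)
          then show ?case unfolding BB(1)[OF elim] by (simp add: h1_def)
        qed
        show "(\<lambda>z. cnj (B z) * (s k z - g z)) \<in> borel_measurable cm" unfolding t(2) by measurable
      qed (simp add: h1_def[abs_def])
      also have "\<dots> \<le> \<bar>1\<bar> powr 2 * lint 2 cm (\<lambda>z. s k z - g z)"
        by (rule lq_mult_bounded(2)[OF _ d _ bB]) simp_all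
      finally show "lint 2 cm (\<lambda>z. t k z - h1 z) \<le> lint 2 cm (\<lambda>z. s k z - g z)" by simp
    qed simp
  qed
  define u where "u z = h z - B z * h1 z" for z
  have uM: "u \<in> M2" unfolding u_def[abs_def] by (rule csubspace_diff[OF M2_csubspace h M2_B[OF h1]])
  have [measurable]: "h1 \<in> borel_measurable cm" unfolding h1_def[abs_def] by measurable
  have uW: "u \<in> W" unfolding W_def
  proof (intro CollectI conjI ballI uM)
    fix f assume f: "f \<in> M2"
    have [measurable]: "f \<in> borel_measurable cm" using f by (auto dest!: M2_lq lqD)
    have "(LINT z|cm. u z * cnj (B z * f z)) = (LINT z|cm. (h z - g z) * cnj (B z * f z))"
    proof (rule integral_cong_AE)
      show "AE z in cm. u z * cnj (B z * f z) = (h z - g z) * cnj (B z * f z)"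
        using AE_cm_circle
      proof eventually_elim
        case (elim z)
        have "B z * h1 z = g z" unfolding h1_def mult.assoc[symmetric] BB(2)[OF elim] by simp
        then show ?case by (simp add: u_def)
      qed
    qed (simp_all add: u_def[abs_def])
    also have "\<dots> = 0" by (rule o) (use f in \<open>auto simp: S_def\<close>)
    finally show "(LINT z|cm. u z * cnj (B z * f z)) = 0" .
  qed
  show thesis by (rule that[OF uW h1]) (simp add: u_def)
qed

text \<open>Otherwise u, normalized, would extend the family J, against its maximality.\<close>

lemma onf_maximal_vanish:
  assumes J: "onf r J" "\<And>J'. \<not> onf (Suc r) J'" and u: "u \<in> W" and o: "\<And>i. i < r \<Longrightarrow> (LINT z|cm. u z * cnj (J i z)) = 0"
  shows "AE z in cm. u z = 0"
proof (rule ccontr)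
  assume ne: "\<not> (AE z in cm. u z = 0)"
  define N where "N = lint 2 cm u"
  have uL: "u \<in> lq 2 cm" by (rule M2_lq[OF W_M2[OF u]])
  have N: "N > 0" using ne lint_eq_0_iff[OF uL] lint_nonneg[of 2 cm u] by (simp add: N_def less_le)
  define a where "a = complex_of_real (1 / sqrt N)"
  define v where "v z = a * u z" for z
  have v: "v \<in> W" unfolding W_def
  proof (intro CollectI conjI ballI)
    show "v \<in> M2" unfolding v_def[abs_def] by (rule csubspace_cmult[OF M2_csubspace W_M2[OF u]])
    show "(LINT z|cm. v z * cnj (B z * g z)) = 0" if "g \<in> M2" for g
      using u that unfolding v_def W_def by (simp add: mult.assoc)
  qed
  have vu: "(LINT z|cm. v z * cnj (g z)) = a * (LINT z|cm. u z * cnj (g z))" for g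
    unfolding v_def by (simp add: mult.assoc)
  have vv: "(LINT z|cm. v z * cnj (v z)) = 1"
  proof -
    have "(LINT z|cm. v z * cnj (v z)) = (LINT z|cm. a * cnj a * (u z * cnj (u z)))"
      by (simp add: v_def mult_ac)
    also have "\<dots> = a * cnj a * of_real N"
      unfolding integral_mult_right_zero integral_self_cnj N_def ..
    also have "\<dots> = of_real (1 / sqrt N * (1 / sqrt N) * N)" unfolding a_def by (simp only: complex_cnj_complex_of_real of_real_mult)
    also have "1 / sqrt N * (1 / sqrt N) * N = 1" using N by (simp add: field_simps)
    finally show ?thesis by simp
  qed
  have vJ: "(LINT z|cm. v z * cnj (J i z)) = 0" "(LINT z|cm. J i z * cnj (v z)) = 0" if "i < r" for i
    using o[OF that] unfolding integral_cnj_swap[of _ "J i" v] vu by simp_all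
  have "onf (Suc r) (J(r := v))"
    unfolding onf_def using J(1) v vv vJ by (auto simp: onf_def less_Suc_eq)
  with J(2) show False by blast
qed

text \<open>The wandering part of h is orthogonal to J and vanishes by maximality, so h = B h1, and
  h1 satisfies the same orthogonality relations. Iterating, h is divisible by every power of
  B.\<close>

lemma M2_vanish:
  assumes J: "onf r J" "\<And>J'. \<not> onf (Suc r) J'" and h: "h \<in> M2"
    and o: "\<And>i k. i < r \<Longrightarrow> (LINT z|cm. h z * cnj (J i z) * cnj (B z ^ k)) = 0"
  shows "AE z in cm. h z = 0"
proof -
  define Q where "Q h \<longleftrightarrow> h \<in> M2 \<and> (\<forall>i<r. \<forall>k. (LINT z|cm. h z * cnj (J i z) * cnj (B z ^ k)) = 0)" for h
  have JM: "J i \<in> W" "J i \<in> M2" if "i < r" for i using J(1) that by (auto simp: onf_def W_M2)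
  have Jm: "J i \<in> borel_measurable cm" if "i < r" for i using JM(2)[OF that] by (auto dest!: M2_lq lqD)
  have step: "\<exists>g. Q g \<and> (AE z in cm. h z = B z * g z)" if h: "Q h" for h
  proof -
    have hM: "h \<in> M2" using h by (simp add: Q_def)
    obtain u h1 where u: "u \<in> W" "h1 \<in> M2" "\<And>z. h z = u z + B z * h1 z" by (rule M2_decompose[OF hM]) (rule that)
    have [measurable]: "h \<in> borel_measurable cm" "h1 \<in> borel_measurable cm" using hM u(2) by (auto dest!: M2_lq lqD)
    have "AE z in cm. u z = 0"
    proof (rule onf_maximal_vanish[OF J u(1)])
      fix i assume i: "i < r"
      have "(LINT z|cm. h z * cnj (J i z) * cnj (B z ^ 0)) = 0" using h i unfolding Q_def by blast
      then have "(LINT z|cm. h z * cnj (J i z)) = 0" by simp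
      moreover have "(LINT z|cm. B z * h1 z * cnj (J i z)) = 0"
        unfolding integral_cnj_swap[of _ "\<lambda>z. B z * h1 z" "J i"] W_D[OF JM(1)[OF i] u(2)] by simp
      moreover have "(LINT z|cm. u z * cnj (J i z)) = (LINT z|cm. (h z - B z * h1 z) * cnj (J i z))" by (simp add: u(3))
      ultimately show "(LINT z|cm. u z * cnj (J i z)) = 0"
        using lq2_integral_mult_diff[OF M2_lq[OF hM] M2_lq[OF M2_B[OF u(2)]] lq_cnj(1)[OF M2_lq[OF JM(2)[OF i]]]] by simp
    qed
    then have eq: "AE z in cm. h z = B z * h1 z" by eventually_elim (simp add: u(3))
    have "Q h1" unfolding Q_def
    proof (intro conjI allI impI u(2))
      fix i k assume i: "i < r"
      note [measurable] = Jm[OF i]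
      have "(LINT z|cm. h1 z * cnj (J i z) * cnj (B z ^ k)) = (LINT z|cm. h z * cnj (J i z) * cnj (B z ^ Suc k))"
      proof (rule integral_cong_AE)
        show "AE z in cm. h1 z * cnj (J i z) * cnj (B z ^ k) = h z * cnj (J i z) * cnj (B z ^ Suc k)"
          using eq AE_cm_circle
        proof eventually_elim
          case (elim z)
          have "h z * cnj (J i z) * cnj (B z ^ Suc k) = (B z * cnj (B z)) * (h1 z * cnj (J i z) * cnj (B z ^ k))"
            unfolding elim(1) by simp
          then show ?case unfolding cnj_mult_circle(1)[OF blaschke_circle[OF order_refl elim(2)]] by (simp only: mult_1_left)
        qed
      qed measurable
      also have "\<dots> = 0" using h i by (simp only: Q_def)
      finally show "(LINT z|cm. h1 z * cnj (J i z) * cnj (B z ^ k)) = 0" .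
    qed
    with eq show ?thesis by blast
  qed
  have iter: "\<exists>g. Q g \<and> (AE z in cm. h z = B z ^ k * g z)" for k
  proof (induction k)
    case 0
    have "Q h" using h o by (simp add: Q_def)
    then show ?case by (intro exI[of _ h]) simp
  next
    case (Suc k)
    then obtain g where g: "Q g" "AE z in cm. h z = B z ^ k * g z" by blast
    obtain g' where g': "Q g'" "AE z in cm. g z = B z * g' z" using step[OF g(1)] by blast
    have "AE z in cm. h z = B z ^ Suc k * g' z" using g(2) g'(2) by eventually_elim simp
    with g'(1) show ?case by blast
  qed
  show ?thesis
  proof (rule H2_blaschke_vanish[OF M2_H2[OF h]])
    show "\<exists>g\<in>H2. AE z in cm. h z = B z ^ k * g z" for k
      using iter[of k] M2_H2 by (auto simp: Q_def)
  qed
qed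

end

context blaschke_product
begin

lemma mult_blaschke_compose_tendsto:
  assumes q: "0 < q" and J: "J \<in> borel_measurable cm" "AE z in cm. cmod (J z) \<le> C"
    and s: "\<And>k. s k \<in> lq q cm" and g: "g \<in> lq q cm" and conv: "(\<lambda>k. lint q cm (\<lambda>z. s k z - g z)) \<longlonglongrightarrow> 0"
  shows "(\<lambda>z. J z * g (B z)) \<in> lq q cm" "(\<lambda>k. lint q cm (\<lambda>z. J z * s k (B z) - J z * g (B z))) \<longlonglongrightarrow> 0"
proof -
  show "(\<lambda>z. J z * g (B z)) \<in> lq q cm"
    by (rule lq_mult_bounded[OF q lq_blaschke_compose(1)[OF g] J])
  have d: "(\<lambda>z. s k z - g z) \<in> lq q cm" for k by (rule lq_diff[OF q s g])
  have "(\<lambda>k. \<bar>C\<bar> powr q * lint q cm (\<lambda>z. s k z - g z)) \<longlonglongrightarrow> \<bar>C\<bar> powr q * 0" by (intro tendsto_intros conv)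
  then have "(\<lambda>k. \<bar>C\<bar> powr q * lint q cm (\<lambda>z. s k z - g z)) \<longlonglongrightarrow> 0" by (simp only: mult_zero_right)
  then show "(\<lambda>k. lint q cm (\<lambda>z. J z * s k (B z) - J z * g (B z))) \<longlonglongrightarrow> 0"
  proof (rule LIMSEQ_0_le)
    show "lint q cm (\<lambda>z. J z * s k (B z) - J z * g (B z)) \<le> \<bar>C\<bar> powr q * lint q cm (\<lambda>z. s k z - g z)" for k
      using lq_mult_bounded(2)[OF q lq_blaschke_compose(1)[OF d] J, of k] lq_blaschke_compose(2)[OF d, of k]
      by (simp add: right_diff_distrib)
  qed simp
qed

end

context bounded_invariant
begin

context
  fixes r J c
  assumes J: "onf r J" and Jmax: "\<And>J'. \<not> onf (Suc r) J'"
    and c: "\<And>i j. i < r \<Longrightarrow> j < n \<Longrightarrow> c i j \<in> H2" and Jc: "\<And>i. i < r \<Longrightarrow> AE z in cm. J i z = T (c i) z"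
    and cc: "\<And>i k. i < r \<Longrightarrow> k < r \<Longrightarrow> AE z in cm. dot (c i) (c k) z = (if i = k then 1 else 0)"
begin

lemma onf_sq: "i < r \<Longrightarrow> AE z in cm. sq (c i) z = 1"
  using cc[of i i] by (simp only: dot_self simp_thms if_True of_real_eq_1_iff)

lemma onf_measurable: "i < r \<Longrightarrow> J i \<in> borel_measurable cm" "i < r \<Longrightarrow> j < n \<Longrightarrow> c i j \<in> borel_measurable cm"
proof -
  show "J i \<in> borel_measurable cm" if "i < r" using J that by (intro lqD[OF M2_lq[OF W_M2]]) (simp add: onf_def)
  show "c i j \<in> borel_measurable cm" if "i < r" "j < n" using lqD[OF H2_lq[OF c[OF that]]] .
qed

text \<open>The coefficient vector of J i has length 1 almost everywhere, so \<open>T_bound\<close>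
  bounds J i by sqrt D, and bounded elements of M2 belong to K.\<close>

lemma onf_K: assumes i: "i < r" shows "J i \<in> K"
proof -
  obtain D where D: "D > 0" "\<And>c z. cmod z = 1 \<Longrightarrow> (\<forall>j<n. cmod (e0 \<alpha> j z) \<le> D) \<and> (cmod (T c z))\<^sup>2 \<le> D * sq c (B z)"
    by (rule T_bound) (rule that)
  have "AE z in cm. cmod (J i z) \<le> sqrt D"
    using Jc[OF i] AE_blaschke_compose[OF onf_sq[OF i]] AE_cm_circle
  proof eventually_elim
    case (elim z)
    have "(cmod (J i z))\<^sup>2 \<le> D" using D(2)[OF elim(3), of "c i"] elim(1,2) by simp
    then show ?case by (rule real_le_rsqrt)
  qed
  moreover have "J i \<in> M2" using J i by (simp add: onf_def W_M2)
  ultimately show ?thesis by (rule bounded_M2_in_K[rotated])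
qed

lemma onf_coeff_bound: "i < r \<Longrightarrow> j < n \<Longrightarrow> AE z in cm. cmod (c i j z) \<le> 1"
proof -
  assume i: "i < r" and j: "j < n"
  show ?thesis using onf_sq[OF i]
  proof eventually_elim
    case (elim z)
    have "(cmod (c i j z))\<^sup>2 \<le> 1\<^sup>2" using sq_ge[OF j, of "c i" z] elim by simp
    then show ?case by (rule power2_le_imp_le) simp
  qed
qed

lemma onf_mult_M2:
  assumes i: "i < r" and g: "g \<in> H2"
  shows "(\<lambda>z. J i z * g (B z)) \<in> M2"
proof -
  have JK: "J i \<in> hb" "J i \<in> M2" using onf_K[OF i] K_M2 by (auto simp: K_def)
  obtain C where C: "AE z in cm. cmod (J i z) \<le> C" using JK(1) by (auto simp: hb_def)
  note Jm = onf_measurable(1)[OF i]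
  obtain s where s: "\<And>k. s k \<in> range poly" "(\<lambda>k. lint 2 cm (\<lambda>z. s k z - g z)) \<longlonglongrightarrow> 0"
    by (rule lq_closureE[OF g]) (rule that)
  have sl: "s k \<in> lq 2 cm" for k using s(1)[of k] range_poly_lq[of 2] by auto
  show ?thesis
  proof (rule M2_closed[of "\<lambda>k z. J i z * s k (B z)"])
    show "(\<lambda>z. J i z * s k (B z)) \<in> M2" for k
    proof -
      obtain p where p: "s k = poly p" using s(1)[of k] by auto
      show ?thesis using M2_mult[OF hb_poly JK(2), of p] by (simp add: p mult.commute)
    qed
  qed (rule mult_blaschke_compose_tendsto[OF _ Jm C sl H2_lq[OF g] s(2)]; simp)+
qed

text \<open>The i-th coordinate is the pointwise inner product of d with c i: square integrable by
  Cauchy-Schwarz, and in H^2 because B^(k+1) f is orthogonal to the wandering J i. Once all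
  coordinates are subtracted, the coefficients e are pointwise orthogonal to every c k, so the
  remainder is orthogonal to all B^k J i and \<open>M2_vanish\<close> applies.\<close>

lemma onf_representation:
  assumes f: "f \<in> M2" and d: "\<And>j. j < n \<Longrightarrow> d j \<in> H2" "AE z in cm. f z = T d z"
  shows "\<And>i. i < r \<Longrightarrow> dot d (c i) \<in> H2" "AE z in cm. f z = (\<Sum>i<r. J i z * dot d (c i) (B z))"
proof -
  have fm: "f \<in> borel_measurable cm" using lqD[OF M2_lq[OF f]] .
  have dL: "\<And>j. j < n \<Longrightarrow> d j \<in> lq 2 cm" using d(1) H2_lq by blast
  have cL: "\<And>i j. i < r \<Longrightarrow> j < n \<Longrightarrow> c i j \<in> lq 2 cm" using c H2_lq by blast
  have dm: "\<And>j. j < n \<Longrightarrow> d j \<in> borel_measurable cm" using lqD[OF dL] .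
  have zm: "(\<lambda>z. z ^ k) \<in> borel_measurable cm" "(\<lambda>z. cnj (z ^ k)) \<in> borel_measurable cm" for k by measurable
  have zb: "AE z in cm. cmod (z ^ k) \<le> 1" "AE z in cm. cmod (cnj (z ^ k)) \<le> 1" for k
    using AE_cm_circle by (eventually_elim, simp add: norm_power)+
  define g where "g i = dot d (c i)" for i
  have gm: "g i \<in> borel_measurable cm" if "i < r" for i
    unfolding g_def by (rule measurable_dot) (erule dm, erule onf_measurable(2)[OF that])
  have gL: "g i \<in> lq 2 cm" if i: "i < r" for i
  proof (rule lq_bound[OF gm[OF i]])
    show "integrable cm (sq d)" by (rule sq_integrable(1)) (erule dL)
    show "AE z in cm. cmod (g i z) powr 2 \<le> sq d z"
      using onf_sq[OF i]
    proof eventually_elim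
      case (elim z)
      show ?case using cmod_dot_le[of d "c i" z] elim by (simp add: g_def powr_numeral)
    qed
  qed
  show gH: "dot d (c i) \<in> H2" if i: "i < r" for i
  proof (rule H2I)
    show "dot d (c i) \<in> lq 2 cm" using gL[OF i] by (simp add: g_def)
    fix k
    have "(LINT z|cm. dot d (c i) z * z ^ Suc k) = (LINT z|cm. f z * cnj (J i z) * B z ^ Suc k)"
      by (rule T_inner_cong[OF _ d(2) _ Jc[OF i] fm onf_measurable(1)[OF i] zm(1) zb(1), symmetric])
         (erule dL, erule cL[OF i])
    also have "\<dots> = (LINT z|cm. B z ^ Suc k * f z * cnj (J i z))" by (simp only: mult_ac)
    also have "\<dots> = cnj (LINT z|cm. J i z * cnj (B z ^ Suc k * f z))" by (rule integral_cnj_swap)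
    also have "\<dots> = 0" using J i W_orth[OF _ f, of "J i" k] by (simp only: onf_def complex_cnj_zero)
    finally show "(LINT z|cm. dot d (c i) z * z ^ Suc k) = 0" .
  qed
  define f' where "f' z = (\<Sum>i<r. J i z * g i (B z))" for z
  have f': "f' \<in> M2" unfolding f'_def[abs_def]
    by (rule csubspace_sum[OF M2_csubspace]) (auto simp: g_def intro!: onf_mult_M2 gH)
  define h where "h z = f z - f' z" for z
  have h: "h \<in> M2" unfolding h_def[abs_def] by (rule csubspace_diff[OF M2_csubspace f f'])
  have hm: "h \<in> borel_measurable cm" using lqD[OF M2_lq[OF h]] .
  define e where "e j z = d j z - (\<Sum>i<r. g i z * c i j z)" for j z
  have eL: "e j \<in> lq 2 cm" if j: "j < n" for j
    unfolding e_def[abs_def]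
  proof (intro lq_diff lq_sum dL[OF j])
    fix i assume "i \<in> {..<r}"
    then have i: "i < r" by simp
    show "(\<lambda>z. g i z * c i j z) \<in> lq 2 cm"
      using lq_mult_bounded(1)[OF _ gL[OF i] onf_measurable(2)[OF i j] onf_coeff_bound[OF i j]] by (simp add: mult.commute)
  qed simp_all
  have Te: "T e z = T d z - (\<Sum>i<r. T (c i) z * g i (B z))" for z
  proof -
    have "T e z = T d z - (\<Sum>j<n. \<Sum>i<r. e0 \<alpha> j z * (g i (B z) * c i j (B z)))"
      by (simp add: T_def e_def right_diff_distrib sum_subtractf sum_distrib_left)
    also have "(\<Sum>j<n. \<Sum>i<r. e0 \<alpha> j z * (g i (B z) * c i j (B z))) = (\<Sum>i<r. \<Sum>j<n. e0 \<alpha> j z * (g i (B z) * c i j (B z)))"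
      by (rule sum.swap)
    also have "\<dots> = (\<Sum>i<r. T (c i) z * g i (B z))"
      by (simp add: T_def sum_distrib_left sum_distrib_right mult_ac)
    finally show ?thesis .
  qed
  have "AE z in cm. \<forall>i\<in>{..<r}. J i z = T (c i) z" by (intro AE_finite_allI) (auto intro: Jc)
  then have he: "AE z in cm. h z = T e z" using d(2)
    by eventually_elim (simp add: h_def f'_def Te)
  have "AE z in cm. \<forall>i\<in>{..<r}. \<forall>k\<in>{..<r}. dot (c i) (c k) z = (if i = k then 1 else 0)"
    by (intro AE_finite_allI finite_lessThan) (rule cc; simp)
  then have de: "AE z in cm. \<forall>k<r. dot e (c k) z = 0"
  proof eventually_elim
    case (elim z)
    show ?case
    proof (intro allI impI)
      fix k assume k: "k < r"
      have "dot e (c k) z = dot d (c k) z - (\<Sum>j<n. \<Sum>i<r. g i z * (c i j z * cnj (c k j z)))"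
        by (simp add: dot_def e_def left_diff_distrib sum_subtractf sum_distrib_right mult.assoc)
      also have "(\<Sum>j<n. \<Sum>i<r. g i z * (c i j z * cnj (c k j z))) = (\<Sum>i<r. \<Sum>j<n. g i z * (c i j z * cnj (c k j z)))"
        by (rule sum.swap)
      also have "\<dots> = (\<Sum>i<r. g i z * dot (c i) (c k) z)" by (simp add: dot_def sum_distrib_left)
      also have "\<dots> = (\<Sum>i<r. if i = k then g i z else 0)" by (rule sum.cong) (use elim k in auto)
      also have "\<dots> = g k z" using k by (simp add: sum.delta)
      finally show "dot e (c k) z = 0" by (simp add: g_def)
    qed
  qed
  have "AE z in cm. h z = 0"
  proof (rule M2_vanish[OF J Jmax h])
    fix i k assume i: "i < r"
    have "(LINT z|cm. h z * cnj (J i z) * cnj (B z ^ k)) = (LINT z|cm. dot e (c i) z * cnj (z ^ k))"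
      by (rule T_inner_cong[OF _ he _ Jc[OF i] hm onf_measurable(1)[OF i] zm(2) zb(2)])
         (erule eL, erule cL[OF i])
    also have "\<dots> = (LINT z|cm. 0)"
    proof (rule integral_cong_AE)
      show "AE z in cm. dot e (c i) z * cnj (z ^ k) = 0" using de by eventually_elim (simp add: i)
      have "dot e (c i) \<in> borel_measurable cm"
        by (rule measurable_dot) (erule lqD[OF eL], erule onf_measurable(2)[OF i])
      then show "(\<lambda>z. dot e (c i) z * cnj (z ^ k)) \<in> borel_measurable cm" using zm(2) by (rule borel_measurable_times)
    qed simp
    finally show "(LINT z|cm. h z * cnj (J i z) * cnj (B z ^ k)) = 0" by simp
  qed
  then show "AE z in cm. f z = (\<Sum>i<r. J i z * dot d (c i) (B z))"
    by eventually_elim (simp add: h_def f'_def g_def)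
qed

end

lemma inner_basis:
  obtains r J c where "r \<le> n" "\<And>i. i < r \<Longrightarrow> J i \<in> K" "\<And>i j. i < r \<Longrightarrow> j < n \<Longrightarrow> c i j \<in> H2"
    "\<And>i. i < r \<Longrightarrow> AE z in cm. J i z = T (c i) z"
    "\<And>i k. i < r \<Longrightarrow> k < r \<Longrightarrow> AE z in cm. dot (c i) (c k) z = (if i = k then 1 else 0)"
    "\<And>f d i. f \<in> K \<Longrightarrow> (\<And>j. j < n \<Longrightarrow> d j \<in> H2) \<Longrightarrow> AE z in cm. f z = T d z \<Longrightarrow> i < r \<Longrightarrow> dot d (c i) \<in> H2"
    "\<And>f d. f \<in> K \<Longrightarrow> (\<And>j. j < n \<Longrightarrow> d j \<in> H2) \<Longrightarrow> AE z in cm. f z = T d z \<Longrightarrow>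
      AE z in cm. f z = (\<Sum>i<r. J i z * dot d (c i) (B z))"
proof -
  obtain r J where J: "onf r J" "\<And>J'. \<not> onf (Suc r) J'" by (rule onf_maximal) (rule that)
  obtain c where c: "\<And>i j. i < r \<Longrightarrow> j < n \<Longrightarrow> c i j \<in> H2" "\<And>i. i < r \<Longrightarrow> AE z in cm. J i z = T (c i) z"
    "\<And>i k. i < r \<Longrightarrow> k < r \<Longrightarrow> AE z in cm. dot (c i) (c k) z = (if i = k then 1 else 0)"
    by (rule onf_coefficients[OF J(1)]) (rule that)
  show thesis
  proof (rule that[of r J c])
    show "r \<le> n" by (rule onf_le[OF J(1)])
    show "J i \<in> K" if "i < r" for i by (rule onf_K[where J=J and c=c and r=r and i=i]) (fact J c that)+
  next
    fix f d i assume "f \<in> K" and d: "\<And>j. j < n \<Longrightarrow> d j \<in> H2" "AE z in cm. f z = T d z" and i: "i < r"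
    then have f: "f \<in> M2" using K_M2 by blast
    show "dot d (c i) \<in> H2" by (rule onf_representation(1)[where J=J and c=c and r=r and d=d and f=f and i=i]) (fact J c f d i)+
  next
    fix f d assume "f \<in> K" and d: "\<And>j. j < n \<Longrightarrow> d j \<in> H2" "AE z in cm. f z = T d z"
    then have f: "f \<in> M2" using K_M2 by blast
    show "AE z in cm. f z = (\<Sum>i<r. J i z * dot d (c i) (B z))" by (rule onf_representation(2)[where J=J and c=c and r=r and d=d and f=f]) (fact J c f d)+
  qed (fact c)+
qed

end

subsection \<open>The decomposition\<close>

lemma sum_space_mult_space:
  "h \<in> sum_space r (\<lambda>i. mult_space (J i) (hardy_comp p b)) \<longleftrightarrow>
    h \<in> borel_measurable cm \<and> (\<exists>f. (\<forall>i\<in>{1..r}. f i \<in> hardy p) \<and> (AE z in cm. h z = (\<Sum>i=1..r. J i z * f i (b z))))"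
  (is "?l \<longleftrightarrow> ?r")
proof
  assume ?l
  then obtain g where h: "h \<in> borel_measurable cm" "AE z in cm. h z = (\<Sum>i=1..r. g i z)"
    and g: "\<forall>i\<in>{1..r}. \<exists>f. f \<in> hardy p \<and> g i = (\<lambda>z. J i z * f (b z))"
    by (fastforce simp: sum_space_def mult_space_def hardy_comp_def comp_def)
  from bchoice[OF g] obtain f where f: "\<forall>i\<in>{1..r}. f i \<in> hardy p \<and> g i = (\<lambda>z. J i z * f i (b z))" ..
  then have "(\<Sum>i=1..r. g i z) = (\<Sum>i=1..r. J i z * f i (b z))" for z by (intro sum.cong) simp_all
  then show ?r using h f by (intro conjI exI[of _ f]) simp_all
next
  assume ?r
  then obtain f where h: "h \<in> borel_measurable cm" "AE z in cm. h z = (\<Sum>i=1..r. J i z * f i (b z))"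
    and f: "\<forall>i\<in>{1..r}. f i \<in> hardy p" by (elim conjE exE)
  have "(\<lambda>z. J i z * f i (b z)) \<in> mult_space (J i) (hardy_comp p b)" if "i \<in> {1..r}" for i
    unfolding mult_space_def hardy_comp_def
    by (intro CollectI exI[of _ "f i \<circ> b"] conjI exI[of _ "f i"] refl) (use f that in simp_all)
  then show ?l using h unfolding sum_space_def by (intro CollectI conjI exI[of _ "\<lambda>i z. J i z * f i (b z)"]) simp_all
qed

lemma lq_sum_tendsto:
  assumes q: "0 < q" and I: "finite I" and s: "\<And>i k. i \<in> I \<Longrightarrow> s i k \<in> lq q M" and f: "\<And>i. i \<in> I \<Longrightarrow> f i \<in> lq q M"
    and conv: "\<And>i. i \<in> I \<Longrightarrow> (\<lambda>k. lint q M (\<lambda>z. s i k z - f i z)) \<longlonglongrightarrow> 0"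
  shows "(\<lambda>k. lint q M (\<lambda>z. (\<Sum>i\<in>I. s i k z) - (\<Sum>i\<in>I. f i z))) \<longlonglongrightarrow> 0"
  using I s f conv
proof (induction I rule: finite_induct)
  case empty
  then show ?case by (simp add: lint_def)
next
  case (insert i I)
  have 1: "(\<lambda>z. s i k z - f i z) \<in> lq q M" for k by (intro lq_diff[OF q] insert.prems) simp_all
  have 2: "(\<lambda>z. (\<Sum>i\<in>I. s i k z) - (\<Sum>i\<in>I. f i z)) \<in> lq q M" for k
    by (intro lq_diff[OF q] lq_sum[OF q] insert.prems) simp_all
  have IH: "(\<lambda>k. lint q M (\<lambda>z. (\<Sum>i\<in>I. s i k z) - (\<Sum>i\<in>I. f i z))) \<longlonglongrightarrow> 0"
    by (rule insert.IH) (simp_all add: insert.prems)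
  have "(\<lambda>k. 2 powr q * (lint q M (\<lambda>z. s i k z - f i z) + lint q M (\<lambda>z. (\<Sum>i\<in>I. s i k z) - (\<Sum>i\<in>I. f i z)))) \<longlonglongrightarrow> 2 powr q * (0 + 0)"
    by (intro tendsto_intros IH insert.prems) simp_all
  then have "(\<lambda>k. 2 powr q * (lint q M (\<lambda>z. s i k z - f i z) + lint q M (\<lambda>z. (\<Sum>i\<in>I. s i k z) - (\<Sum>i\<in>I. f i z)))) \<longlonglongrightarrow> 0"
    by (simp only: add_0_left mult_zero_right)
  then show ?case
  proof (rule LIMSEQ_0_le)
    show "lint q M (\<lambda>z. (\<Sum>i\<in>insert i I. s i k z) - (\<Sum>i\<in>insert i I. f i z))
      \<le> 2 powr q * (lint q M (\<lambda>z. s i k z - f i z) + lint q M (\<lambda>z. (\<Sum>i\<in>I. s i k z) - (\<Sum>i\<in>I. f i z)))" for k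
      using lq_add(2)[OF q 1 2, of k k] insert.hyps by (simp add: algebra_simps)
  qed simp
qed

lemma hb_lq_closure_poly:
  assumes q: "0 < q" and f: "f \<in> hb"
  shows "f \<in> lq_closure q cm (range poly)"
proof -
  obtain r C where r: "\<And>k z. cmod z = 1 \<Longrightarrow> cmod (poly (r k) z) \<le> C" "AE z in cm. (\<lambda>k. poly (r k) z) \<longlonglongrightarrow> f z"
    by (rule Hinf_poly_approx[of f]) (use f Hinf_eq_hb in auto)
  have "AE z in cm. cmod (poly (r k) z) \<le> C" for k using AE_cm_circle by eventually_elim (rule r)
  note c = bounded_convergence_lq[OF q hb_measurable[OF f] measurable_poly this r(2)]
  show ?thesis by (rule lq_closureI[OF c(1) _ c(3)]) simp
qed

context blaschke_product
begin

lemma B_inner_T: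
  assumes J: "J \<in> hb" and c: "\<And>j. j < n \<Longrightarrow> c j \<in> H2" and JT: "AE z in cm. J z = T c z" and sq: "AE z in cm. sq c z = 1"
  shows "B_inner \<alpha> n J"
  unfolding B_inner_def hardy_comp_def hardy_2 Hinf_eq_hb
proof (intro conjI exI[of _ "\<lambda>j. c j \<circ> B"] allI impI)
  show "c j \<circ> B \<in> {f \<circ> B |f. f \<in> H2}" if "j < n" for j using c[OF that] by blast
  show "AE z in cm. (\<Sum>j<n. (cmod ((c j \<circ> B) z))\<^sup>2) = 1"
    using AE_blaschke_compose[OF sq] by (simp add: sq_def)
qed (use J JT in \<open>simp_all add: T_def\<close>)

text \<open>The f i are only measurable, so the isometry does not apply to them directly. Dividing
  by 1 + sum |f i|, again a function evaluated at B z, makes them bounded; then T d = 0 forces d =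
  0, and the pointwise inner product with c k isolates f k.\<close>

lemma T_independent:
  fixes r :: nat
  assumes J: "\<And>i. i < r \<Longrightarrow> AE z in cm. J i z = T (c i) z" and c: "\<And>i j. i < r \<Longrightarrow> j < n \<Longrightarrow> c i j \<in> lq 2 cm"
    and cc: "\<And>i k. i < r \<Longrightarrow> k < r \<Longrightarrow> AE z in cm. dot (c i) (c k) z = (if i = k then 1 else 0)"
    and f: "\<And>i. i < r \<Longrightarrow> f i \<in> borel_measurable cm" and 0: "AE z in cm. (\<Sum>i<r. J i z * f i (B z)) = 0" and k: "k < r"
  shows "AE z in cm. f k z = 0"
proof -
  have f': "i \<in> {..<r} \<Longrightarrow> f i \<in> borel_measurable cm" for i using f by simp
  define u where "u z = complex_of_real (1 / (1 + (\<Sum>i<r. cmod (f i z))))" for z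
  have u0: "1 + (\<Sum>i<r. cmod (f i z)) > 0" for z by (intro add_pos_nonneg sum_nonneg) simp_all
  have um: "u \<in> borel_measurable cm" unfolding u_def[abs_def] using f' by measurable
  have fu: "cmod (f i z * u z) \<le> 1" if "i < r" for i z
  proof -
    have "cmod (f i z) \<le> (\<Sum>i<r. cmod (f i z))" by (intro member_le_sum) (simp_all add: that)
    then show ?thesis using u0[of z] by (simp add: u_def norm_mult norm_divide divide_le_eq flip: of_real_add of_real_sum)
  qed
  define d where "d j z = (\<Sum>i<r. (f i z * u z) * c i j z)" for j z
  have dL: "d j \<in> lq 2 cm" if j: "j < n" for j
    unfolding d_def[abs_def]
  proof (rule lq_sum)
    fix i assume "i \<in> {..<r}"
    then have i: "i < r" by simp
    show "(\<lambda>z. (f i z * u z) * c i j z) \<in> lq 2 cm"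
      by (rule lq_mult_bounded(1)[OF _ c[OF i j] borel_measurable_times[OF f[OF i] um], of 1]) (simp_all add: fu[OF i])
  qed simp
  have Td: "T d z = u (B z) * (\<Sum>i<r. T (c i) z * f i (B z))" for z
  proof -
    have "T d z = (\<Sum>j<n. \<Sum>i<r. u (B z) * (e0 \<alpha> j z * c i j (B z) * f i (B z)))"
      by (simp add: T_def d_def sum_distrib_left mult_ac)
    also have "\<dots> = (\<Sum>i<r. \<Sum>j<n. u (B z) * (e0 \<alpha> j z * c i j (B z) * f i (B z)))" by (rule sum.swap)
    finally show ?thesis by (simp add: T_def sum_distrib_left sum_distrib_right)
  qed
  have "AE z in cm. \<forall>i\<in>{..<r}. J i z = T (c i) z" by (intro AE_finite_allI finite_lessThan) (rule J; simp)
  then have "AE z in cm. T d z = 0" using 0 by eventually_elim (simp add: Td)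
  then have "lint 2 cm (T d) = 0" using lint_eq_0_iff[OF T_isometry(1)[OF dL]] by simp
  then have "(\<Sum>j<n. lint 2 cm (d j)) = 0" using T_isometry(2)[OF dL] by simp
  then have "\<forall>j\<in>{..<n}. lint 2 cm (d j) = 0" by (subst (asm) sum_nonneg_eq_0_iff) simp_all
  then have "AE z in cm. \<forall>j\<in>{..<n}. d j z = 0"
    by (intro AE_finite_allI finite_lessThan) (use lint_eq_0_iff[OF dL] in simp)
  moreover have "AE z in cm. \<forall>i\<in>{..<r}. dot (c i) (c k) z = (if i = k then 1 else 0)"
    by (intro AE_finite_allI finite_lessThan) (rule cc; use k in simp)
  ultimately show ?thesis
  proof eventually_elim
    case (elim z)
    have "dot d (c k) z = (\<Sum>j<n. \<Sum>i<r. (f i z * u z) * (c i j z * cnj (c k j z)))"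
      by (simp add: dot_def d_def sum_distrib_left mult_ac)
    also have "\<dots> = (\<Sum>i<r. \<Sum>j<n. (f i z * u z) * (c i j z * cnj (c k j z)))" by (rule sum.swap)
    also have "\<dots> = (\<Sum>i<r. (f i z * u z) * dot (c i) (c k) z)" by (simp add: dot_def sum_distrib_left)
    also have "\<dots> = (\<Sum>i<r. if i = k then f i z * u z else 0)" by (rule sum.cong) (use elim in auto)
    also have "\<dots> = f k z * u z" using k by (simp add: sum.delta)
    finally have "f k z * u z = dot d (c k) z" by (rule sym)
    also have "\<dots> = 0" using elim by (simp add: dot_def)
    finally have "f k z * u z = 0" .
    moreover have "u z \<noteq> 0" using u0[of z] by (simp add: u_def del: of_real_divide)
    ultimately show ?case by simp
  qed
qed

text \<open>The common end of the cases of finite and infinite p: \<open>repr\<close> and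
  \<open>mem\<close> provide the two inclusions between M and the sum, \<open>T_independent\<close>
  the directness.\<close>

lemma inner_sum_decomposition:
  assumes r: "r \<le> n" and J: "\<And>i. i < r \<Longrightarrow> J i \<in> hb" "\<And>i. i < r \<Longrightarrow> AE z in cm. J i z = T (c i) z"
    and c: "\<And>i j. i < r \<Longrightarrow> j < n \<Longrightarrow> c i j \<in> H2"
    and cc: "\<And>i k. i < r \<Longrightarrow> k < r \<Longrightarrow> AE z in cm. dot (c i) (c k) z = (if i = k then 1 else 0)"
    and H: "hardy p \<subseteq> borel_measurable cm" and Mm: "M \<subseteq> borel_measurable cm"
    and repr: "\<And>f. f \<in> M \<Longrightarrow> \<exists>g. (\<forall>i<r. g i \<in> hardy p) \<and> (AE z in cm. f z = (\<Sum>i<r. J i z * g i (B z)))"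
    and mem: "\<And>f g. f \<in> borel_measurable cm \<Longrightarrow> (\<And>i. i < r \<Longrightarrow> g i \<in> hardy p) \<Longrightarrow> AE z in cm. f z = (\<Sum>i<r. J i z * g i (B z)) \<Longrightarrow> f \<in> M"
  shows "\<exists>r J. r \<le> n \<and> (\<forall>i\<in>{1..r}. B_inner \<alpha> n (J i)) \<and>
    independent_spaces r (\<lambda>i. mult_space (J i) (hardy_comp p B)) \<and>
    M = sum_space r (\<lambda>i. mult_space (J i) (hardy_comp p B))"
proof (intro exI[of _ r] exI[of _ "\<lambda>i. J (i - 1)"] conjI ballI r)
  \<comment> \<open>The summand receives both i - 1 and i, because J is numbered from 0 while the
    functions taken from the sum are numbered from 1.\<close>
  have shift: "(\<Sum>i=1..r. h (i - 1) i) = (\<Sum>i<r. h i (Suc i))" for h :: "nat \<Rightarrow> nat \<Rightarrow> complex"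
    using sum.atLeast1_atMost_eq[of "\<lambda>i. h (i - 1) i" r] by simp
  show "B_inner \<alpha> n (J (i - 1))" if "i \<in> {1..r}" for i
  proof -
    have i: "i - 1 < r" using that by auto
    have "AE z in cm. sq (c (i - 1)) z = 1" using cc[OF i i] by (simp only: dot_self simp_thms if_True of_real_eq_1_iff)
    then show ?thesis by (intro B_inner_T[OF J(1)[OF i] _ J(2)[OF i]] c[OF i])
  qed
  show "independent_spaces r (\<lambda>i. mult_space (J (i - 1)) (hardy_comp p B))"
    unfolding independent_spaces_def
  proof (intro allI impI ballI, elim conjE)
    fix g i assume g: "\<forall>i\<in>{1..r}. g i \<in> mult_space (J (i - 1)) (hardy_comp p B)"
      and s: "AE z in cm. (\<Sum>i=1..r. g i z) = 0" and i: "i \<in> {1..r}"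
    have "\<forall>i\<in>{1..r}. \<exists>f. f \<in> hardy p \<and> g i = (\<lambda>z. J (i - 1) z * f (B z))"
      using g by (fastforce simp: mult_space_def hardy_comp_def comp_def)
    from bchoice[OF this] obtain f where f: "\<forall>i\<in>{1..r}. f i \<in> hardy p \<and> g i = (\<lambda>z. J (i - 1) z * f i (B z))" ..
    have "(\<Sum>i=1..r. g i z) = (\<Sum>i=1..r. J (i - 1) z * f i (B z))" for z
      by (rule sum.cong) (use f in simp_all)
    then have "(\<Sum>i=1..r. g i z) = (\<Sum>i<r. J i z * f (Suc i) (B z))" for z
      using shift[of "\<lambda>k i. J k z * f i (B z)"] by simp
    then have "AE z in cm. (\<Sum>i<r. J i z * f (Suc i) (B z)) = 0" using s by simp
    moreover have "f (Suc i) \<in> borel_measurable cm" if "i < r" for i using f H that by auto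
    moreover have "i - 1 < r" using i by auto
    ultimately have "AE z in cm. f (Suc (i - 1)) z = 0"
      using T_independent[OF J(2) H2_lq[OF c] cc, of r "\<lambda>i. f (Suc i)" "i - 1"] by blast
    moreover have "Suc (i - 1) = i" using i by simp
    ultimately have "AE z in cm. f i z = 0" by simp
    from AE_blaschke_compose[OF this] show "AE z in cm. g i z = 0"
      by eventually_elim (use f i in simp)
  qed
  show "M = sum_space r (\<lambda>i. mult_space (J (i - 1)) (hardy_comp p B))"
  proof (intro set_eqI iffI)
    fix h assume h: "h \<in> M"
    then obtain g where g: "\<forall>i<r. g i \<in> hardy p" "AE z in cm. h z = (\<Sum>i<r. J i z * g i (B z))" using repr by blast
    have "(\<Sum>i=1..r. J (i - 1) z * g (i - 1) (B z)) = (\<Sum>i<r. J i z * g i (B z))" for z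
      by (rule shift[of "\<lambda>k i. J k z * g k (B z)"])
    then show "h \<in> sum_space r (\<lambda>i. mult_space (J (i - 1)) (hardy_comp p B))"
      unfolding sum_space_mult_space using h Mm g
      by (intro conjI exI[of _ "\<lambda>i. g (i - 1)"]) auto
  next
    fix h assume "h \<in> sum_space r (\<lambda>i. mult_space (J (i - 1)) (hardy_comp p B))"
    then obtain f where h: "h \<in> borel_measurable cm" "AE z in cm. h z = (\<Sum>i=1..r. J (i - 1) z * f i (B z))"
      and f: "\<forall>i\<in>{1..r}. f i \<in> hardy p" unfolding sum_space_mult_space by (elim conjE exE)
    have "(\<Sum>i=1..r. J (i - 1) z * f i (B z)) = (\<Sum>i<r. J i z * f (Suc i) (B z))" for z
      by (rule shift[of "\<lambda>k i. J k z * f i (B z)"])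
    then show "h \<in> M" using h f by (intro mem[of h "\<lambda>i. f (Suc i)"]) auto
  qed
qed

end

text \<open>q is the real value of a finite p; membership and closedness are phrased with
  \<open>lq_closure\<close>, into which \<open>hardy p\<close> and \<open>lp_closure p\<close>
  translate uniformly.\<close>

locale hardy_invariant = blaschke_product +
  fixes q :: real and M :: "(complex \<Rightarrow> complex) set"
  assumes q: "0 < q" and subspace: "csubspace M"
    and invariant: "\<And>f. f \<in> M \<Longrightarrow> (\<lambda>z. B z * f z) \<in> M"
    and hardy: "M \<subseteq> lq_closure q cm (range poly)"
    and closed: "lq_closure q cm (range poly) \<inter> lq_closure q cm M \<subseteq> M"
begin

lemma poly_lq: "s \<in> range poly \<Longrightarrow> s \<in> lq q cm"
  using range_poly_lq[OF q] by blast

lemma M_lq: "f \<in> M \<Longrightarrow> f \<in> lq q cm"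
  using hardy by (blast dest: lq_closure_lq)

lemma M_limit:
  assumes s: "\<And>k. s k \<in> M" and f: "f \<in> lq q cm" and conv: "(\<lambda>k. lint q cm (\<lambda>z. s k z - f z)) \<longlonglongrightarrow> 0"
  shows "f \<in> M"
proof -
  have "f \<in> lq_closure q cm (range poly)"
    by (rule lq_closure_closed[OF q range_poly_lq[OF q] f _ conv]) (use s hardy in blast)
  moreover have "f \<in> lq_closure q cm M" by (rule lq_closureI[OF f s conv])
  ultimately show ?thesis using closed by blast
qed

lemma M_AE:
  assumes f: "f \<in> M" and g: "AE z in cm. f z = g z" "g \<in> borel_measurable cm"
  shows "g \<in> M"
proof (rule M_limit[of "\<lambda>_. f"])
  show gl: "g \<in> lq q cm" by (rule lq_cong_AE[OF M_lq[OF f] g])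
  have "lint q cm (\<lambda>z. f z - g z) = 0"
    unfolding lint_eq_0_iff[OF lq_diff(1)[OF q M_lq[OF f] gl]] using g(1) by eventually_elim simp
  then show "(\<lambda>k. lint q cm (\<lambda>z. f z - g z)) \<longlonglongrightarrow> 0" by simp
qed (rule f)

text \<open>A multiplier makes the polynomial approximants, dominated by F along a subsequence,
  uniformly bounded; their limit stays in \<open>hb\<close>, and then the multiplier is removed by
  letting it tend to 1. The argument is the same for q < 1 and for q >= 1.\<close>

lemma bounded_hb:
  assumes f: "f \<in> lq_closure q cm (range poly)" and C: "AE z in cm. cmod (f z) \<le> C"
  shows "f \<in> hb"
proof -
  have fl: "f \<in> lq q cm" by (rule lq_closure_lq[OF f])
  note fm = lqD[OF fl]
  obtain s where s: "\<And>k. s k \<in> range poly" "(\<lambda>k. lint q cm (\<lambda>z. s k z - f z)) \<longlonglongrightarrow> 0"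
    by (rule lq_closureE[OF f]) (rule that)
  obtain F r where F: "F \<in> borel_measurable cm" "integrable cm (\<lambda>z. F z powr q)" "\<And>z. 0 \<le> F z"
    and lim: "AE z in cm. (\<lambda>k. s (r k) z) \<longlonglongrightarrow> f z" and le: "\<And>k. AE z in cm. cmod (s (r k) z) \<le> F z"
    by (rule lq_convergent_dominated_subseq[OF q poly_lq[OF s(1)] fl s(2)]) (rule that)
  obtain \<Phi> A where \<Phi>: "\<And>m. \<Phi> m \<in> hb" "\<And>m. AE z in cm. cmod (\<Phi> m z) \<le> A"
    and \<Phi>F: "\<And>m. \<exists>C. AE z in cm. cmod (\<Phi> m (B z)) * F z \<le> C" and \<Phi>1: "AE z in cm. (\<lambda>m. \<Phi> m z) \<longlonglongrightarrow> 1"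
    by (rule multipliers[OF q F]) (rule that)
  have \<Phi>f: "(\<lambda>z. \<Phi> m (B z) * f z) \<in> hb" for m
  proof -
    obtain C' where C': "AE z in cm. cmod (\<Phi> m (B z)) * F z \<le> C'" using \<Phi>F by blast
    show ?thesis
    proof (rule hb_bounded_limit[where s="\<lambda>k z. \<Phi> m (B z) * s (r k) z" and C=C'])
      show "(\<lambda>z. \<Phi> m (B z) * s (r k) z) \<in> hb" for k
      proof -
        obtain p where "s (r k) = poly p" using s(1)[of "r k"] by blast
        then show ?thesis using hb_mult[OF hb_poly hb_blaschke_compose[OF \<Phi>(1)]] by simp
      qed
      show "AE z in cm. cmod (\<Phi> m (B z) * s (r k) z) \<le> C'" for k
        using le[of k] C'
      proof eventually_elim
        case (elim z)
        have "cmod (\<Phi> m (B z) * s (r k) z) \<le> cmod (\<Phi> m (B z)) * F z"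
          unfolding norm_mult by (rule mult_left_mono[OF elim(1)]) simp
        with elim(2) show ?case by linarith
      qed
      show "(\<lambda>z. \<Phi> m (B z) * f z) \<in> borel_measurable cm"
        by (intro borel_measurable_times fm hb_measurable[OF hb_blaschke_compose[OF \<Phi>(1)]])
      show "AE z in cm. (\<lambda>k. \<Phi> m (B z) * s (r k) z) \<longlonglongrightarrow> \<Phi> m (B z) * f z"
        using lim by eventually_elim (intro tendsto_intros)
    qed
  qed
  show ?thesis
  proof (rule hb_bounded_limit[where s="\<lambda>m z. \<Phi> m (B z) * f z" and C="A * C"])
    show "AE z in cm. cmod (\<Phi> m (B z) * f z) \<le> A * C" for m
      using AE_blaschke_compose[OF \<Phi>(2)[of m]] C
    proof eventually_elim
      case (elim z)
      show ?case unfolding norm_mult by (rule mult_mono'[OF elim]) simp_all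
    qed
    show "AE z in cm. (\<lambda>m. \<Phi> m (B z) * f z) \<longlonglongrightarrow> f z"
      using AE_blaschke_compose[OF \<Phi>1]
    proof eventually_elim
      case (elim z)
      have "(\<lambda>m. \<Phi> m (B z) * f z) \<longlonglongrightarrow> 1 * f z" by (intro tendsto_intros elim)
      then show ?case by simp
    qed
  qed (fact \<Phi>f fm)+
qed

sublocale bounded_invariant
proof unfold_locales
  show "csubspace M" by (rule subspace)
  show "(\<lambda>z. B z * f z) \<in> M" if "f \<in> M" for f by (rule invariant[OF that])
  show "f \<in> hb" if "f \<in> M" "AE z in cm. cmod (f z) \<le> C" for f C
    by (rule bounded_hb[OF subsetD[OF hardy]]) (fact that)+
  fix s f C assume s: "\<And>k. s k \<in> M" "\<And>k. AE z in cm. cmod (s k z) \<le> C" and f: "f \<in> borel_measurable cm"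
    "AE z in cm. (\<lambda>k. s k z) \<longlonglongrightarrow> f z"
  note bc = bounded_convergence_lq[OF q f(1) lqD[OF M_lq[OF s(1)]] s(2) f(2)]
  show "f \<in> M" by (rule M_limit[OF s(1) bc(1,3)])
qed

text \<open>Here f may be unbounded, so the limit is taken in L^q: the polynomial approximants of
  \<Phi> are bounded by |C|, and |C| |f| is a majorant.\<close>

lemma hb_mult_M:
  assumes \<Phi>: "\<Phi> \<in> hb" and f: "f \<in> M"
  shows "(\<lambda>z. \<Phi> (B z) * f z) \<in> M"
proof -
  obtain p C where p: "\<And>k z. cmod z = 1 \<Longrightarrow> cmod (poly (p k) z) \<le> C" "AE z in cm. (\<lambda>k. poly (p k) z) \<longlonglongrightarrow> \<Phi> z"
    by (rule Hinf_poly_approx[of \<Phi>]) (use \<Phi> Hinf_eq_hb in auto)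
  note fm = lqD[OF M_lq[OF f]]
  note cf = lq_cmult(1)[OF M_lq[OF f], of "of_real C"]
  have dom: "integrable cm (\<lambda>z. cmod (of_real C * f z) powr q)" by (rule lq_integrable[OF cf])
  have bd: "AE z in cm. cmod (poly (p k) (B z) * f z) \<le> cmod (of_real C * f z)" for k
    using AE_cm_circle
  proof eventually_elim
    case (elim z)
    have "cmod (poly (p k) (B z)) \<le> \<bar>C\<bar>"
      using p(1)[OF blaschke_circle[OF order_refl elim], of k] by linarith
    then show ?case unfolding norm_mult norm_of_real by (rule mult_right_mono) simp
  qed
  have lim: "AE z in cm. (\<lambda>k. poly (p k) (B z) * f z) \<longlonglongrightarrow> \<Phi> (B z) * f z"
    using AE_blaschke_compose[OF p(2)] by eventually_elim (intro tendsto_intros)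
  have m: "(\<lambda>z. \<Phi> (B z) * f z) \<in> borel_measurable cm" "(\<lambda>z. poly (p k) (B z) * f z) \<in> borel_measurable cm" for k
    by (intro borel_measurable_times fm hb_measurable[OF hb_blaschke_compose[OF \<Phi>]] hb_measurable[OF hb_blaschke_compose[OF hb_poly]])+
  note dc = lq_dominated_convergence[OF q m dom bd lim]
  show ?thesis by (rule M_limit[OF poly_inv[OF f] dc(1,3)])
qed

text \<open>The multipliers are built for the majorant |f| itself: the products
  \<open>\<Phi> m (B z) * f z\<close> are bounded elements of M and converge to f under the majorant
  |A| |f|.\<close>

lemma bounded_approximation:
  assumes f: "f \<in> M"
  obtains h where "\<And>m. h m \<in> K" "(\<lambda>m. lint q cm (\<lambda>z. h m z - f z)) \<longlonglongrightarrow> 0"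
proof -
  note fl = M_lq[OF f]
  note fm = lqD[OF fl]
  have nm: "(\<lambda>z. cmod (f z)) \<in> borel_measurable cm" using fm by measurable
  obtain \<Phi> A where \<Phi>: "\<And>m. \<Phi> m \<in> hb" "\<And>m. AE z in cm. cmod (\<Phi> m z) \<le> A"
    and \<Phi>f: "\<And>m. \<exists>C. AE z in cm. cmod (\<Phi> m (B z)) * cmod (f z) \<le> C" and \<Phi>1: "AE z in cm. (\<lambda>m. \<Phi> m z) \<longlonglongrightarrow> 1"
    by (rule multipliers[OF q nm lq_integrable[OF fl]]) (simp, rule that)
  define h where "h m z = \<Phi> m (B z) * f z" for m z
  have hM: "h m \<in> M" for m unfolding h_def[abs_def] by (rule hb_mult_M[OF \<Phi>(1) f])
  have "h m \<in> hb" for m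
  proof -
    obtain C where "AE z in cm. cmod (\<Phi> m (B z)) * cmod (f z) \<le> C" using \<Phi>f by blast
    then show ?thesis by (intro bdd_hb[OF hM, of _ C]) (simp add: h_def norm_mult)
  qed
  then have hK: "h m \<in> K" for m using hM by (simp add: K_def)
  have dom: "integrable cm (\<lambda>z. cmod (of_real A * f z) powr q)" by (rule lq_integrable[OF lq_cmult(1)[OF fl]])
  have bd: "AE z in cm. cmod (h m z) \<le> cmod (of_real A * f z)" for m
    using AE_blaschke_compose[OF \<Phi>(2)[of m]]
  proof eventually_elim
    case (elim z)
    then have "cmod (\<Phi> m (B z)) \<le> \<bar>A\<bar>" by linarith
    then show ?case unfolding h_def norm_mult norm_of_real by (rule mult_right_mono) simp
  qed
  have lim: "AE z in cm. (\<lambda>m. h m z) \<longlonglongrightarrow> f z"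
    using AE_blaschke_compose[OF \<Phi>1]
  proof eventually_elim
    case (elim z)
    have "(\<lambda>m. h m z) \<longlonglongrightarrow> 1 * f z" unfolding h_def by (intro tendsto_intros elim)
    then show ?case by simp
  qed
  show thesis
    by (rule that[OF hK lq_dominated_convergence(3)[OF q fm lqD[OF M_lq[OF hM]] dom bd lim]])
qed

context
  fixes r :: nat and J c
  assumes J: "\<And>i. i < r \<Longrightarrow> J i \<in> K" and c: "\<And>i j. i < r \<Longrightarrow> j < n \<Longrightarrow> c i j \<in> H2"
    and cc: "\<And>i. i < r \<Longrightarrow> AE z in cm. sq (c i) z = 1"
begin

lemma J_bounded:
  assumes "i < r"
  obtains C where "J i \<in> borel_measurable cm" "AE z in cm. cmod (J i z) \<le> C"
  using J[OF assms] that by (auto simp: K_def hb_def)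

lemma inner_sum_mem:
  assumes f: "f \<in> borel_measurable cm" and g: "\<And>i. i < r \<Longrightarrow> g i \<in> lq_closure q cm (range poly)"
    and fg: "AE z in cm. f z = (\<Sum>i<r. J i z * g i (B z))"
  shows "f \<in> M"
proof -
  have "(\<lambda>z. J i z * g i (B z)) \<in> M" if i: "i < r" for i
  proof -
    obtain C where C: "J i \<in> borel_measurable cm" "AE z in cm. cmod (J i z) \<le> C" by (rule J_bounded[OF i]) (rule that)
    obtain s where s: "\<And>k. s k \<in> range poly" "(\<lambda>k. lint q cm (\<lambda>z. s k z - g i z)) \<longlonglongrightarrow> 0"
      by (rule lq_closureE[OF g[OF i]]) (rule that)
    have "(\<lambda>z. J i z * s k (B z)) \<in> M" for k
    proof -
      obtain p where p: "s k = poly p" using s(1)[of k] by auto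
      have "J i \<in> M" using J[OF i] by (simp add: K_def)
      from poly_inv[OF this, of p] show ?thesis by (simp add: p mult.commute)
    qed
    then show ?thesis
      by (rule M_limit[OF _ mult_blaschke_compose_tendsto[OF q C poly_lq[OF s(1)] lq_closure_lq[OF g[OF i]] s(2)]])
  qed
  then have "(\<lambda>z. \<Sum>i<r. J i z * g i (B z)) \<in> M" by (intro csubspace_sum[OF sub]) simp
  then show ?thesis by (rule M_AE) (use fg f in auto)
qed

text \<open>The coordinates of the bounded approximants h m are Cauchy in L^q, because
  \<open>lint_coefficients\<close>, applied to the bounded differences T (d m) - T (d l), controls
  them by h m - h l. Their limits G i are the coordinates of f, since both sides of the
  representation of h m converge in L^q.\<close>

lemma inner_sum_representation:
  assumes gH: "\<And>f d i. f \<in> K \<Longrightarrow> (\<And>j. j < n \<Longrightarrow> d j \<in> H2) \<Longrightarrow> AE z in cm. f z = T d z \<Longrightarrow> i < r \<Longrightarrow> dot d (c i) \<in> H2"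
    and gJ: "\<And>f d. f \<in> K \<Longrightarrow> (\<And>j. j < n \<Longrightarrow> d j \<in> H2) \<Longrightarrow> AE z in cm. f z = T d z \<Longrightarrow>
      AE z in cm. f z = (\<Sum>i<r. J i z * dot d (c i) (B z))"
    and f: "f \<in> M"
  shows "\<exists>g. (\<forall>i<r. g i \<in> lq_closure q cm (range poly)) \<and> (AE z in cm. f z = (\<Sum>i<r. J i z * g i (B z)))"
proof -
  note fl = M_lq[OF f]
  obtain h where h: "\<And>m. h m \<in> K" "(\<lambda>m. lint q cm (\<lambda>z. h m z - f z)) \<longlonglongrightarrow> 0"
    by (rule bounded_approximation[OF f]) (rule that)
  have hl: "h m \<in> lq q cm" for m using h(1) M_lq by (simp add: K_def)
  have "\<exists>d. (\<forall>j<n. d j \<in> H2) \<and> (AE z in cm. h m z = T d z)" for m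
    by (rule H2_expansion[OF hb_H2[of "h m"]]) (use h(1)[of m] in \<open>auto simp: K_def\<close>)
  then obtain d where d: "\<And>m j. j < n \<Longrightarrow> d m j \<in> H2" "\<And>m. AE z in cm. h m z = T (d m) z" by metis
  have dL: "j < n \<Longrightarrow> d m j \<in> lq 2 cm" for m j using d(1) by (rule H2_lq)
  have dd: "j < n \<Longrightarrow> (\<lambda>z. d m j z - d l j z) \<in> lq 2 cm" for m l j by (rule lq_diff) (simp_all add: dL)
  obtain A where A: "0 \<le> A" "\<And>c K. (\<And>j. j < n \<Longrightarrow> c j \<in> lq 2 cm) \<Longrightarrow> AE z in cm. cmod (T c z) \<le> K \<Longrightarrow>
    integrable cm (\<lambda>z. sq c z powr (q / 2)) \<and> (LINT z|cm. sq c z powr (q / 2)) \<le> A * lint q cm (T c)"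
    by (rule lint_coefficients[OF q]) (rule that, assumption, simp)
  have hC: "\<exists>C. AE z in cm. cmod (T (d m) z) \<le> C" for m
  proof -
    obtain C where C: "AE z in cm. cmod (h m z) \<le> C" using h(1)[of m] by (auto simp: K_def hb_def)
    have "AE z in cm. cmod (T (d m) z) \<le> C" using C d(2)[of m] by eventually_elim simp
    then show ?thesis by blast
  qed
  have g: "dot (d m) (c i) \<in> hb" if i: "i < r" for i m
  proof -
    obtain C where C: "AE z in cm. cmod (T (d m) z) \<le> C" using hC by blast
    have "AE z in cm. sq (d m) z \<le> C\<^sup>2" by (rule sq_bounded[OF _ C]) (rule dL)
    then have "AE z in cm. cmod (dot (d m) (c i) z) \<le> \<bar>C\<bar>" using cc[OF i]
    proof eventually_elim
      case (elim z)
      have "(cmod (dot (d m) (c i) z))\<^sup>2 \<le> \<bar>C\<bar>\<^sup>2" using cmod_dot_le[of "d m" "c i" z] elim by simp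
      then show ?case by (rule power2_le_imp_le) simp
    qed
    moreover have "dot (d m) (c i) \<in> H2" by (rule gH[OF h(1) d(1) d(2) i])
    ultimately show ?thesis unfolding hb_iff by blast
  qed
  have gl: "dot (d m) (c i) \<in> lq q cm" if i: "i < r" for i m by (rule hb_lq[OF g[OF i] q])
  \<comment> \<open>As c i has length 1, |dot e (c i)|^2 <= sq e, so the integral of
    \<open>sq e z powr (q / 2)\<close> dominates.\<close>
  have diff: "lint q cm (\<lambda>z. dot (d m) (c i) z - dot (d l) (c i) z) \<le> A * lint q cm (\<lambda>z. h m z - h l z)" if i: "i < r" for i m l
  proof -
    define e where "e j z = d m j z - d l j z" for j z
    have Te: "T e z = T (d m) z - T (d l) z" for z unfolding e_def[abs_def] by (rule T_diff)
    obtain C C' where "AE z in cm. cmod (T (d m) z) \<le> C" "AE z in cm. cmod (T (d l) z) \<le> C'" using hC by blast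
    then have Cb: "AE z in cm. cmod (T e z) \<le> C + C'"
    proof eventually_elim
      case (elim z)
      show ?case unfolding Te using norm_triangle_ineq4[of "T (d m) z" "T (d l) z"] elim by linarith
    qed
    have eL: "j < n \<Longrightarrow> e j \<in> lq 2 cm" for j unfolding e_def[abs_def] by (rule dd)
    have e: "integrable cm (\<lambda>z. sq e z powr (q / 2))" "(LINT z|cm. sq e z powr (q / 2)) \<le> A * lint q cm (T e)"
      using A(2)[OF eL Cb] by simp_all
    have "dot (d m) (c i) z - dot (d l) (c i) z = dot e (c i) z" for z
      by (simp add: dot_def e_def left_diff_distrib sum_subtractf)
    then have "lint q cm (\<lambda>z. dot (d m) (c i) z - dot (d l) (c i) z) = lint q cm (dot e (c i))" by simp
    also have "\<dots> \<le> (LINT z|cm. sq e z powr (q / 2))"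
      unfolding lint_def
    proof (rule integral_mono_AE)
      have "dot e (c i) = (\<lambda>z. dot (d m) (c i) z - dot (d l) (c i) z)"
        by (simp add: dot_def e_def left_diff_distrib sum_subtractf fun_eq_iff)
      then show "integrable cm (\<lambda>z. cmod (dot e (c i) z) powr q)"
        using lq_integrable[OF lq_diff(1)[OF q gl[OF i] gl[OF i]], of m l] by simp
      show "AE z in cm. cmod (dot e (c i) z) powr q \<le> sq e z powr (q / 2)"
        using cc[OF i]
      proof eventually_elim
        case (elim z)
        have "cmod (dot e (c i) z) powr q = ((cmod (dot e (c i) z))\<^sup>2) powr (q / 2)"
          by (simp add: powr_powr flip: powr_numeral)
        also have "\<dots> \<le> sq e z powr (q / 2)"
          by (rule powr_mono2) (use q cmod_dot_le[of e "c i" z] elim in simp_all)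
        finally show ?case .
      qed
    qed (rule e)
    also have "\<dots> \<le> A * lint q cm (T e)" by (rule e)
    also have "lint q cm (T e) = lint q cm (\<lambda>z. h m z - h l z)"
    proof (rule lint_cong_AE)
      show "AE z in cm. T e z = h m z - h l z" using d(2)[of m] d(2)[of l] by eventually_elim (simp add: Te)
      show "T e \<in> borel_measurable cm" by (rule measurable_T) (rule lqD[OF eL])
      show "(\<lambda>z. h m z - h l z) \<in> borel_measurable cm" by (intro borel_measurable_diff lqD[OF hl])
    qed
    finally show ?thesis .
  qed
  have ex: "\<exists>g. g \<in> lq q cm \<and> (\<lambda>m. lint q cm (\<lambda>z. dot (d m) (c i) z - g z)) \<longlonglongrightarrow> 0" if i: "i < r" for i
  proof (rule lq_Cauchy_dominated_subseq[OF q gl[OF i]])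
    fix e :: real assume e: "e > 0"
    obtain N where N: "\<forall>k\<ge>N. \<forall>l\<ge>N. lint q cm (\<lambda>z. h k z - h l z) < e / (A + 1)"
      using lq_convergent_Cauchy[OF q hl fl h(2), of "e / (A + 1)"] e A(1) by auto
    have "lint q cm (\<lambda>z. dot (d k) (c i) z - dot (d l) (c i) z) < e" if "k \<ge> N" "l \<ge> N" for k l
    proof -
      have "lint q cm (\<lambda>z. dot (d k) (c i) z - dot (d l) (c i) z) \<le> A * lint q cm (\<lambda>z. h k z - h l z)" by (rule diff[OF i])
      also have "\<dots> \<le> (A + 1) * lint q cm (\<lambda>z. h k z - h l z)" by (rule mult_right_mono) simp_all
      also have "\<dots> < e" using N that A(1) by (simp add: less_divide_eq mult.commute)
      finally show ?thesis .
    qed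
    then show "\<exists>N. \<forall>k\<ge>N. \<forall>l\<ge>N. lint q cm (\<lambda>z. dot (d k) (c i) z - dot (d l) (c i) z) < e" by blast
  qed blast
  have "\<forall>i. \<exists>g. i < r \<longrightarrow> g \<in> lq q cm \<and> (\<lambda>m. lint q cm (\<lambda>z. dot (d m) (c i) z - g z)) \<longlonglongrightarrow> 0"
  proof
    show "\<exists>g. i < r \<longrightarrow> g \<in> lq q cm \<and> (\<lambda>m. lint q cm (\<lambda>z. dot (d m) (c i) z - g z)) \<longlonglongrightarrow> 0" for i
      using ex[of i] by (cases "i < r") simp_all
  qed
  from choice[OF this] obtain G where G':
    "\<forall>i. i < r \<longrightarrow> G i \<in> lq q cm \<and> (\<lambda>m. lint q cm (\<lambda>z. dot (d m) (c i) z - G i z)) \<longlonglongrightarrow> 0" ..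
  have G: "G i \<in> lq q cm" "(\<lambda>m. lint q cm (\<lambda>z. dot (d m) (c i) z - G i z)) \<longlonglongrightarrow> 0" if "i < r" for i
    using G' that by simp_all
  \<comment> \<open>The coordinates of h m are in \<open>hb\<close>, hence L^q limits of
    polynomials, and so is their own limit.\<close>
  have GH: "G i \<in> lq_closure q cm (range poly)" if i: "i < r" for i
    by (rule lq_closure_closed[OF q range_poly_lq[OF q] G(1)[OF i] hb_lq_closure_poly[OF q g[OF i]] G(2)[OF i]])
  have prod: "(\<lambda>z. J i z * G i (B z)) \<in> lq q cm"
    "(\<lambda>m. lint q cm (\<lambda>z. J i z * dot (d m) (c i) (B z) - J i z * G i (B z))) \<longlonglongrightarrow> 0"
    "(\<lambda>z. J i z * dot (d m) (c i) (B z)) \<in> lq q cm" if i: "i < r" for i m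
  proof -
    obtain C where C: "J i \<in> borel_measurable cm" "AE z in cm. cmod (J i z) \<le> C" by (rule J_bounded[OF i]) (rule that)
    note m = mult_blaschke_compose_tendsto[OF q C gl[OF i] G(1)[OF i] G(2)[OF i]]
    show "(\<lambda>z. J i z * G i (B z)) \<in> lq q cm"
      "(\<lambda>m. lint q cm (\<lambda>z. J i z * dot (d m) (c i) (B z) - J i z * G i (B z))) \<longlonglongrightarrow> 0" by (fact m)+
    show "(\<lambda>z. J i z * dot (d m) (c i) (B z)) \<in> lq q cm"
      by (rule lq_mult_bounded(1)[OF q lq_blaschke_compose(1)[OF gl[OF i]] C])
  qed
  define S where "S m z = (\<Sum>i<r. J i z * dot (d m) (c i) (B z))" for m z
  define S' where "S' z = (\<Sum>i<r. J i z * G i (B z))" for z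
  have Sl: "S m \<in> lq q cm" for m unfolding S_def[abs_def] by (rule lq_sum[OF q]) (simp add: prod)
  have S'l: "S' \<in> lq q cm" unfolding S'_def[abs_def] by (rule lq_sum[OF q]) (simp add: prod)
  have SS': "(\<lambda>m. lint q cm (\<lambda>z. S m z - S' z)) \<longlonglongrightarrow> 0"
    unfolding S_def[abs_def] S'_def[abs_def] by (rule lq_sum_tendsto[OF q]) (simp_all add: prod)
  have "lint q cm (\<lambda>z. S m z - f z) = lint q cm (\<lambda>z. h m z - f z)" for m
  proof (rule lint_cong_AE)
    have "AE z in cm. h m z = S m z" unfolding S_def by (rule gJ[OF h(1) d(1) d(2)])
    then show "AE z in cm. S m z - f z = h m z - f z" by eventually_elim simp
  qed (intro borel_measurable_diff lqD[OF Sl] lqD[OF fl] lqD[OF hl])+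
  then have "(\<lambda>m. lint q cm (\<lambda>z. S m z - f z)) \<longlonglongrightarrow> 0" using h(2) by simp
  from lq_limit_unique[OF q Sl fl S'l this SS'] show ?thesis
    unfolding S'_def using GH by (intro exI[of _ G]) simp
qed

end

end

lemma (in hardy_invariant) decomposition:
  assumes H: "hardy p = lq_closure q cm (range poly)"
  shows "\<exists>r J. r \<le> n \<and> (\<forall>i\<in>{1..r}. B_inner \<alpha> n (J i)) \<and>
    independent_spaces r (\<lambda>i. mult_space (J i) (hardy_comp p B)) \<and>
    M = sum_space r (\<lambda>i. mult_space (J i) (hardy_comp p B))"
proof (rule inner_basis)
  fix r J c
  assume r: "r \<le> n" and J: "\<And>i. i < r \<Longrightarrow> J i \<in> K" and c: "\<And>i j. i < r \<Longrightarrow> j < n \<Longrightarrow> c i j \<in> H2"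
    and Jc: "\<And>i. i < r \<Longrightarrow> AE z in cm. J i z = T (c i) z"
    and cc: "\<And>i k. i < r \<Longrightarrow> k < r \<Longrightarrow> AE z in cm. dot (c i) (c k) z = (if i = k then 1 else 0)"
    and gH: "\<And>f d i. f \<in> K \<Longrightarrow> (\<And>j. j < n \<Longrightarrow> d j \<in> H2) \<Longrightarrow> AE z in cm. f z = T d z \<Longrightarrow> i < r \<Longrightarrow> dot d (c i) \<in> H2"
    and gJ: "\<And>f d. f \<in> K \<Longrightarrow> (\<And>j. j < n \<Longrightarrow> d j \<in> H2) \<Longrightarrow> AE z in cm. f z = T d z \<Longrightarrow>
      AE z in cm. f z = (\<Sum>i<r. J i z * dot d (c i) (B z))"
  have sq: "AE z in cm. sq (c i) z = 1" if "i < r" for i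
    using cc[OF that that] by (simp only: dot_self simp_thms if_True of_real_eq_1_iff)
  show ?thesis
  proof (rule inner_sum_decomposition[where r=r and J=J and c=c])
    show "J i \<in> hb" if "i < r" for i using J[OF that] by (simp add: K_def)
    show "hardy p \<subseteq> borel_measurable cm" unfolding H by (blast dest: lq_closure_lq lqD)
    show "M \<subseteq> borel_measurable cm" by (blast dest: M_lq lqD)
    show "\<exists>g. (\<forall>i<r. g i \<in> hardy p) \<and> (AE z in cm. f z = (\<Sum>i<r. J i z * g i (B z)))" if "f \<in> M" for f
      unfolding H by (rule inner_sum_representation[where c=c]) (fact J c sq gH gJ that)+
    show "f \<in> M" if "f \<in> borel_measurable cm" "\<And>i. i < r \<Longrightarrow> g i \<in> hardy p" "AE z in cm. f z = (\<Sum>i<r. J i z * g i (B z))" for f g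
      by (rule inner_sum_mem[where r=r and J=J and c=c and g=g]) (fact J c sq that that[unfolded H])+
  qed (fact r c Jc cc)+
qed

text \<open>With M inside \<open>hb\<close> one has K = M, so the representation of K applies as it
  stands; its coordinates are bounded because \<open>sq_bounded\<close> bounds the coefficient
  vector.\<close>

lemma (in bounded_invariant) bounded_decomposition:
  assumes M: "M \<subseteq> hb"
  shows "\<exists>r J. r \<le> n \<and> (\<forall>i\<in>{1..r}. B_inner \<alpha> n (J i)) \<and>
    independent_spaces r (\<lambda>i. mult_space (J i) (hardy_comp \<infinity> B)) \<and>
    M = sum_space r (\<lambda>i. mult_space (J i) (hardy_comp \<infinity> B))"
proof (rule inner_basis)
  have H: "hardy \<infinity> = hb" by (simp add: hardy_def Hinf_eq_hb)
  have MK: "K = M" using M by (auto simp: K_def)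
  fix r J c
  assume r: "r \<le> n" and J: "\<And>i. i < r \<Longrightarrow> J i \<in> K" and c: "\<And>i j. i < r \<Longrightarrow> j < n \<Longrightarrow> c i j \<in> H2"
    and Jc: "\<And>i. i < r \<Longrightarrow> AE z in cm. J i z = T (c i) z"
    and cc: "\<And>i k. i < r \<Longrightarrow> k < r \<Longrightarrow> AE z in cm. dot (c i) (c k) z = (if i = k then 1 else 0)"
    and gH: "\<And>f d i. f \<in> K \<Longrightarrow> (\<And>j. j < n \<Longrightarrow> d j \<in> H2) \<Longrightarrow> AE z in cm. f z = T d z \<Longrightarrow> i < r \<Longrightarrow> dot d (c i) \<in> H2"
    and gJ: "\<And>f d. f \<in> K \<Longrightarrow> (\<And>j. j < n \<Longrightarrow> d j \<in> H2) \<Longrightarrow> AE z in cm. f z = T d z \<Longrightarrow>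
      AE z in cm. f z = (\<Sum>i<r. J i z * dot d (c i) (B z))"
  have sq: "AE z in cm. sq (c i) z = 1" if "i < r" for i
    using cc[OF that that] by (simp only: dot_self simp_thms if_True of_real_eq_1_iff)
  show ?thesis
  proof (rule inner_sum_decomposition[where r=r and J=J and c=c])
    show "J i \<in> hb" if "i < r" for i using J[OF that] by (simp add: K_def)
    show "hardy \<infinity> \<subseteq> borel_measurable cm" unfolding H by (auto simp: hb_def)
    show "M \<subseteq> borel_measurable cm" using M by (auto simp: hb_def)
  next
    fix f assume "f \<in> M"
    then have f: "f \<in> K" and fb: "f \<in> hb" using M by (auto simp: MK)
    obtain d where d: "\<And>j. j < n \<Longrightarrow> d j \<in> H2" "AE z in cm. f z = T d z"
      by (rule H2_expansion[OF hb_H2[OF fb]]) (rule that)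
    obtain C where C: "AE z in cm. cmod (f z) \<le> C" using fb by (auto simp: hb_def)
    have "AE z in cm. cmod (T d z) \<le> C" using C d(2) by eventually_elim simp
    from sq_bounded[OF H2_lq[OF d(1)] this] have sd: "AE z in cm. sq d z \<le> C\<^sup>2" by simp
    have "dot d (c i) \<in> hb" if i: "i < r" for i
    proof -
      have "AE z in cm. cmod (dot d (c i) z) \<le> \<bar>C\<bar>" using sd sq[OF i]
      proof eventually_elim
        case (elim z)
        have "(cmod (dot d (c i) z))\<^sup>2 \<le> \<bar>C\<bar>\<^sup>2" using cmod_dot_le[of d "c i" z] elim by simp
        then show ?case by (rule power2_le_imp_le) simp
      qed
      moreover have "dot d (c i) \<in> H2" by (rule gH[OF f d(1) d(2) i])
      ultimately show ?thesis unfolding hb_iff by blast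
    qed
    moreover have "AE z in cm. f z = (\<Sum>i<r. J i z * dot d (c i) (B z))" by (rule gJ[OF f d(1) d(2)])
    ultimately show "\<exists>g. (\<forall>i<r. g i \<in> hardy \<infinity>) \<and> (AE z in cm. f z = (\<Sum>i<r. J i z * g i (B z)))"
      unfolding H by (intro exI[of _ "\<lambda>i. dot d (c i)"]) simp
  next
    fix f g assume f: "f \<in> borel_measurable cm" and g: "\<And>i. i < r \<Longrightarrow> g i \<in> hardy \<infinity>"
      and fg: "AE z in cm. f z = (\<Sum>i<r. J i z * g i (B z))"
    have "(\<lambda>z. J i z * g i (B z)) \<in> K" if i: "i < r" for i
      using hb_mult_K[OF g[OF i, unfolded H] J[OF i]] by (simp add: mult.commute)
    then have "(\<lambda>z. \<Sum>i<r. J i z * g i (B z)) \<in> K" by (intro csubspace_sum[OF K_csubspace]) simp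
    then have S: "(\<lambda>z. \<Sum>i<r. J i z * g i (B z)) \<in> M" "(\<lambda>z. \<Sum>i<r. J i z * g i (B z)) \<in> hb" by (simp_all only: K_def Int_iff)
    have "AE z in cm. (\<Sum>i<r. J i z * g i (B z)) = f z" using fg by eventually_elim (rule sym)
    from M_cong_AE[OF S this f] show "f \<in> M" .
  qed (fact r c Jc cc)+
qed

text \<open>Dominated convergence against each of the finitely many test functions in L^1, with
  majorant 2 C |g|. It is the link between weak-star closedness and \<open>bdd_lim\<close>.\<close>

lemma weak_star_closure_bounded_limit:
  assumes s: "\<And>k. s k \<in> S" "\<And>k. s k \<in> borel_measurable cm" "\<And>k. AE z in cm. cmod (s k z) \<le> C"
    and f: "f \<in> borel_measurable cm" and lim: "AE z in cm. (\<lambda>k. s k z) \<longlonglongrightarrow> f z"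
  shows "f \<in> weak_star_closure S"
  unfolding weak_star_closure_def
proof (intro CollectI conjI allI impI, goal_cases)
  have C: "AE z in cm. cmod (f z) \<le> C" by (rule bounded_convergence_lq(4)[OF _ f s(2,3) lim, of 1]) simp
  {
    case 1
    show ?case using f C by (auto simp: Lp_def)
  next
    case (2 G e)
    then have e: "e > 0" and fin: "finite G" and G: "G \<subseteq> Lp 1" by auto
    have "\<forall>\<^sub>F k in sequentially. cmod (LINT z|cm. (f z - s k z) * g z) < e" if g: "g \<in> G" for g
    proof -
      have gm: "g \<in> borel_measurable cm" and gi: "integrable cm (\<lambda>z. cmod (g z))"
        using g G by (auto simp: Lp_def powr_one')
      note [measurable] = s(2) f gm
      have "(\<lambda>k. LINT z|cm. (f z - s k z) * g z) \<longlonglongrightarrow> (LINT z|cm. 0)"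
      proof (rule integral_dominated_convergence[where w="\<lambda>z. (2 * C) * cmod (g z)"])
        show "integrable cm (\<lambda>z. (2 * C) * cmod (g z))" using gi by (rule integrable_mult_right)
        show "AE z in cm. (\<lambda>k. (f z - s k z) * g z) \<longlonglongrightarrow> 0" using lim
        proof eventually_elim
          case (elim z)
          have "(\<lambda>k. (f z - s k z) * g z) \<longlonglongrightarrow> (f z - f z) * g z" by (intro tendsto_intros elim)
          then show ?case by simp
        qed
        show "AE z in cm. cmod ((f z - s k z) * g z) \<le> (2 * C) * cmod (g z)" for k
          using C s(3)[of k]
        proof eventually_elim
          case (elim z)
          have "cmod (f z - s k z) \<le> 2 * C" using norm_triangle_ineq4[of "f z" "s k z"] elim by linarith
          then show ?case unfolding norm_mult by (rule mult_right_mono) simp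
        qed
      qed measurable
      then have "(\<lambda>k. cmod (LINT z|cm. (f z - s k z) * g z)) \<longlonglongrightarrow> 0" by (simp add: tendsto_norm_zero)
      from order_tendstoD(2)[OF this e] show ?thesis .
    qed
    then have "\<forall>\<^sub>F k in sequentially. \<forall>g\<in>G. cmod (LINT z|cm. (f z - s k z) * g z) < e"
      by (intro eventually_ball_finite fin) blast
    then obtain k where "\<forall>g\<in>G. cmod (LINT z|cm. (f z - s k z) * g z) < e" by (auto simp: eventually_sequentially)
    then show ?case using s(1) by blast
  }
qed

theorem theorem4:
  fixes p :: ennreal and n :: nat and \<alpha> :: "nat \<Rightarrow> complex"
    and M :: "(complex \<Rightarrow> complex) set"
  assumes "0 < p" and "p \<noteq> 2"
    and "1 \<le> n" and "\<forall>j\<in>{1..n}. \<alpha> j \<in> ball 0 1" and "\<alpha> 1 = 0"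
    and "M \<subseteq> hardy p" and "csubspace M" and "closed_in_hardy p M"
    and "invariant_under (banach_algebra_gen (blaschke \<alpha> n)) M"
  shows "\<exists>r J. r \<le> n \<and> (\<forall>i\<in>{1..r}. B_inner \<alpha> n (J i)) \<and>
    independent_spaces r (\<lambda>i. mult_space (J i) (hardy_comp p (blaschke \<alpha> n))) \<and>
    (let S = sum_space r (\<lambda>i. mult_space (J i) (hardy_comp p (blaschke \<alpha> n)))
     in if p < 1 then M = hardy p \<inter> lp_closure p S else M = S)"
proof -
  let ?B = "blaschke \<alpha> n"
  interpret blaschke_product \<alpha> n by unfold_locales (use assms in auto)
  have "?B \<in> banach_algebra_gen ?B"
    using hull_subset[of "{?B}" closed_subalgebra] by (simp add: banach_algebra_gen_def)
  then have inv: "\<And>f. f \<in> M \<Longrightarrow> (\<lambda>z. ?B z * f z) \<in> M" using assms(9) by (simp add: invariant_under_def)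
  have main: "\<exists>r J. r \<le> n \<and> (\<forall>i\<in>{1..r}. B_inner \<alpha> n (J i)) \<and>
    independent_spaces r (\<lambda>i. mult_space (J i) (hardy_comp p ?B)) \<and>
    M = sum_space r (\<lambda>i. mult_space (J i) (hardy_comp p ?B))"
  proof (cases "p = \<infinity>")
    case True
    have M: "M \<subseteq> hb" using assms(6) True by (simp add: hardy_def Hinf_eq_hb)
    have closed: "hb \<inter> weak_star_closure M \<subseteq> M"
      using assms(8) True by (simp add: closed_in_hardy_def hardy_def Hinf_eq_hb)
    interpret bounded_invariant \<alpha> n M
    proof unfold_locales
      fix s f C assume s: "\<And>k. s k \<in> M" "\<And>k. AE z in cm. cmod (s k z) \<le> C"
        and f: "f \<in> borel_measurable cm" "AE z in cm. (\<lambda>k. s k z) \<longlonglongrightarrow> f z"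
      have hb: "\<And>k. s k \<in> hb" using s(1) M by blast
      have "f \<in> hb" by (rule hb_bounded_limit[OF hb s(2) f])
      moreover have "f \<in> weak_star_closure M"
        by (rule weak_star_closure_bounded_limit[OF s(1) hb_measurable[OF hb] s(2) f])
      ultimately show "f \<in> M" using closed by blast
    qed (use assms(7) inv M in auto)
    show ?thesis using bounded_decomposition[OF M] True by simp
  next
    case False
    define q where "q = enn2real p"
    have H: "hardy p = lq_closure q cm (range poly)" unfolding q_def by (rule hardy_eq[OF assms(1) False])
    have closed: "lq_closure q cm (range poly) \<inter> lq_closure q cm M \<subseteq> M"
      using assms(8) False by (simp add: closed_in_hardy_def H lp_closure_eq[OF assms(1) False] flip: q_def)
    interpret hardy_invariant \<alpha> n q M
    proof unfold_locales
      show "0 < q" unfolding q_def by (rule enn2real_pos_finite[OF assms(1) False])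
    qed (use assms(6,7) inv closed H in auto)
    show ?thesis by (rule decomposition[OF H])
  qed
  then obtain r J where rJ: "r \<le> n" "\<forall>i\<in>{1..r}. B_inner \<alpha> n (J i)"
    "independent_spaces r (\<lambda>i. mult_space (J i) (hardy_comp p ?B))"
    and M: "M = sum_space r (\<lambda>i. mult_space (J i) (hardy_comp p ?B))" by (elim exE conjE)
  \<comment> \<open>A closed M coincides with its closure inside \<open>hardy p\<close>; with M
    equal to the sum, this is the form that the statement takes for p < 1.\<close>
  have "M = hardy p \<inter> lp_closure p M" if "p < 1"
  proof -
    have fin: "p \<noteq> \<infinity>" using that by auto
    have "M \<subseteq> lp_closure p M"
      unfolding lp_closure_eq[OF assms(1) fin]
      by (rule lq_closure_superset)
        (use assms(6) in \<open>auto simp: hardy_eq[OF assms(1) fin] dest: lq_closure_lq\<close>)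
    then show ?thesis using assms(6,8) fin by (auto simp: closed_in_hardy_def)
  qed
  with rJ M show ?thesis by (intro exI[of _ r] exI[of _ J]) (simp add: Let_def)
qed

end
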